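(* Let $t>0$ and $\beta>0$. For $N\ge1$ and $a\in\mathbb{R}$ let $$\mathcal{I}_{N,\beta}(a)=\int_{]-\infty,a]^N}\prod_{i<j}|\lambda_i-\lambda_j|^{2\beta}\,\prod_{i=1}^N e^{-\frac{N\beta}{2t}\lambda_i^2}\,d\lambda_1\cdots d\lambda_N ,\qquad \mathcal{P}_N(a)=\frac{\mathcal{I}_{N,\beta}(a)}{\mathcal{I}_{N,\beta}(\infty)},$$ so that $\mathcal{P}_N(a)$ is the probability that the largest eigenvalue of the Gaussian $\beta$-ensemble is at most $a$. Assume that $\ln\mathcal{I}_{N,\beta}(a)$ has a $1/N$ expansion for $a<2\sqrt t$, and that the double scaling limit $N\to\infty$, $a\to 2\sqrt t$ may be taken in it (both assumptions are spelled out in the context). Then the limit $$\mathcal{P}^*_\beta(\eta)=\lim_{N\to\infty}\mathcal{P}_N\big(2\sqrt t\,(1-N^{-2/3}\eta)\big)$$ exists and, writing $\xi=-2\eta$, as $\xi\to-\infty$ (that is, $\eta\to+\infty$), $$\mathcal{P}^*_\beta(\eta)=\tau_\beta\exp\Big[-\frac{\beta|\xi|^3}{12}+\frac{\sqrt2(\beta-1)}{3}|\xi|^{3/2}+\frac{\beta+\beta^{-1}-3}{8}\ln|\xi|+O(|\xi|^{-3/2})\Big],$$ where the constant $\tau_\beta$ is given by $$\ln\tau_\beta=\Big(\frac{17}{8}-\frac{25}{24}(\beta+\beta^{-1})\Big)\ln2-\frac{\ln(2\pi)}2-\frac{\ln\beta}2+\kappa_\beta ,$$ and $\kappa_\beta$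 is the finite part (the constant term) in the large-$N$ asymptotic expansion of $\sum_{j=1}^N\ln\Gamma(1+j\beta)$, namely $$\kappa_\beta=\frac{\ln(2\pi)}4+\beta\Big(\frac1{12}-\zeta'(-1)\Big)+\frac{\gamma_E}{12\beta}+\int_0^\infty\frac{d\sigma}{\sigma^2}\,\frac{1}{e^{\beta\sigma}-1}\Big(\frac{\sigma}{e^\sigma-1}-1+\frac\sigma2-\frac{\sigma^2}{12}\Big).$$
   Context: $\zeta$ is the Riemann zeta function, $\Gamma$ the Gamma function and $\gamma_E$ the Euler–Mascheroni constant. The normalization of $\beta$ is such that $\beta=1/2,1,2$ are the Gaussian orthogonal, unitary and symplectic ensembles. Assumption 1 (existence of the $1/N$ expansion). For $a<2\sqrt t$ (where the limiting eigenvalue support is a single interval $[b,a]$), as $N\to\infty$, $$\ln\mathcal{I}_{N,\beta}(a)=D_{N,\beta}+\sum_{g,k\ge0}\Big(\frac{N\sqrt\beta}{t}\Big)^{2-2g-k}\Big(\sqrt\beta-\frac1{\sqrt\beta}\Big)^kF^{g,k}(a)$$ as an asymptotic expansion, where $D_{N,\beta}$ depends only on $N$ and $\beta$, and the coefficients $F^{g,k}(a)$ depend on $a$ and $t$ but not on $N$ or $\beta$. Assumption 2 (double scaling limit). One may set $a=2\sqrt t\,(1-N^{-2/3}\eta)$ in the resulting expansion of $\ln\mathcal{P}_N(a)$ and take the limit $N\to\infty$ at fixed $\eta$ term by term, the series so obtained being the asymptotic expansion, as $\eta\to+\infty$, of the logarithm of the limit of $\mathcal{P}_N$. *)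

theory Defs
  imports "HOL-Complex_Analysis.Complex_Analysis" "HOL-Library.Landau_Symbols"
begin

(* I_{N,beta}(a), with upper limit a in ]-oo, oo]; a = \<infinity> gives the full partition function. *)
definition partition_fn :: "real \<Rightarrow> real \<Rightarrow> nat \<Rightarrow> ereal \<Rightarrow> real" where
  "partition_fn t \<beta> N a =
     (LINT x : (\<Pi>\<^sub>E i\<in>{..<N}. {y. ereal y \<le> a}) | (\<Pi>\<^sub>M i\<in>{..<N}. lborel).
        (\<Prod>(i, j)\<in>{(i, j). i < j \<and> j < N}. \<bar>x i - x j\<bar> powr (2 * \<beta>)) *
        (\<Prod>i<N. exp (- (real N * \<beta> / (2 * t)) * (x i)\<^sup>2)))"

definition max_eigenvalue_cdf :: "real \<Rightarrow> real \<Rightarrow> nat \<Rightarrow> real \<Rightarrow> real" where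
  "max_eigenvalue_cdf t \<beta> N a = partition_fn t \<beta> N (ereal a) / partition_fn t \<beta> N \<infinity>"

definition edge_scaled :: "real \<Rightarrow> nat \<Rightarrow> real \<Rightarrow> real" where
  "edge_scaled t N \<eta> = 2 * sqrt t * (1 - real N powr (-2/3) * \<eta>)"

(* Poincare's notion: T n is the n-th term and \<phi> n its nominal order of magnitude. A term may be
   o(\<phi> n), in particular zero, which is why the scale is kept apart from the terms. *)
definition asymp_expansion ::
    "'a filter \<Rightarrow> ('a \<Rightarrow> real) \<Rightarrow> (nat \<Rightarrow> 'a \<Rightarrow> real) \<Rightarrow> (nat \<Rightarrow> 'a \<Rightarrow> real) \<Rightarrow> bool" where
  "asymp_expansion F f T \<phi> \<longleftrightarrow> (\<forall>M. (\<lambda>x. f x - (\<Sum>n\<le>M. T n x)) \<in> o[F](\<phi> M))"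

(* The double series over (g,k), collected by powers N^(2-n), n = 2 g + k. *)
definition expansion_term ::
    "(nat \<Rightarrow> nat \<Rightarrow> real \<Rightarrow> real \<Rightarrow> real) \<Rightarrow> real \<Rightarrow> real \<Rightarrow> nat \<Rightarrow> nat \<Rightarrow> real \<Rightarrow> real" where
  "expansion_term F t \<beta> n N a =
     (\<Sum>(g, k)\<in>{(g, k). 2 * g + k = n}.
        (real N * sqrt \<beta> / t) powi (2 - 2 * int g - int k) *
        (sqrt \<beta> - 1 / sqrt \<beta>) ^ k * F g k t a)"

(* That D depends on N and \<beta> only, and F on t and a only, is expressed by one choice
   of D and F serving all t, \<beta> and a. *)
definition has_one_over_N_expansion ::
    "(nat \<Rightarrow> real \<Rightarrow> real) \<Rightarrow> (nat \<Rightarrow> nat \<Rightarrow> real \<Rightarrow> real \<Rightarrow> real) \<Rightarrow> bool" where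
  "has_one_over_N_expansion D F \<longleftrightarrow>
     (\<forall>t>0. \<forall>\<beta>>0. \<forall>a<2 * sqrt t.
        asymp_expansion sequentially
          (\<lambda>N. ln (partition_fn t \<beta> N (ereal a)) - D N \<beta>)
          (\<lambda>n N. expansion_term F t \<beta> n N a)
          (\<lambda>n N. real N powi (2 - int n)))"

(* The limit N -> oo at fixed \<eta> is taken term by term in the expansion of ln P_N(a).
   ln P_N(a) = (D N \<beta> - ln I_N(\<infinity>)) + (ln I_N(a) - D N \<beta>): the second part is expanded by
   has_one_over_N_expansion; the first, free of a, has an expansion whose terms may carry a factor
   ln N. The term of order n of ln P_N(a) is the sum of the two terms of that order. The ln N cannot
   be dropped: for n = 2 it cancels the logarithmic divergence of F g k t a at a = 2 sqrt t.
   F is only specified for a < 2 sqrt t, that is \<eta> > 0. The scale \<eta>^(3(2-n)/2) is N^(2-n)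
   transported by 1 - a / (2 sqrt t) = N^(-2/3) \<eta>. *)
definition double_scaling_limit ::
    "(nat \<Rightarrow> real \<Rightarrow> real) \<Rightarrow> (nat \<Rightarrow> nat \<Rightarrow> real \<Rightarrow> real \<Rightarrow> real) \<Rightarrow> real \<Rightarrow> real \<Rightarrow> bool" where
  "double_scaling_limit D F t \<beta> \<longleftrightarrow>
     (\<exists>(p :: nat \<Rightarrow> real) (q :: nat \<Rightarrow> real) (P :: real \<Rightarrow> real) (T :: nat \<Rightarrow> real \<Rightarrow> real).
        asymp_expansion sequentially
          (\<lambda>N. D N \<beta> - ln (partition_fn t \<beta> N \<infinity>))
          (\<lambda>n N. real N powi (2 - int n) * (p n + q n * ln (real N)))
          (\<lambda>n N. real N powi (2 - int n)) \<and>
        (\<forall>\<eta>>0. \<forall>n.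
           (\<lambda>N. expansion_term F t \<beta> n N (edge_scaled t N \<eta>) +
                 real N powi (2 - int n) * (p n + q n * ln (real N))) \<longlonglongrightarrow> T n \<eta>) \<and>
        (\<forall>\<eta>. (\<lambda>N. max_eigenvalue_cdf t \<beta> N (edge_scaled t N \<eta>)) \<longlonglongrightarrow> P \<eta>) \<and>
        asymp_expansion at_top (\<lambda>\<eta>. ln (P \<eta>)) T (\<lambda>n \<eta>. \<eta> powr (3 * (2 - real n) / 2)))"

(* The analytic continuation of the Dirichlet series; the value at the pole is fixed to 0 only to
   make the function unique. *)
definition riemann_zeta :: "complex \<Rightarrow> complex" where
  "riemann_zeta = (THE f. f holomorphic_on (- {1}) \<and> f 1 = 0 \<and>
     (\<forall>s. Re s > 1 \<longrightarrow> (\<lambda>n. 1 / of_nat (Suc n) powr s) sums f s))"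

(* \<kappa> is the constant term of the large-N expansion of s in the functions N^i (ln N)^j. Those with
   (i,j) \<noteq> (0,0) diverge and have distinct orders, so \<kappa> is unique. *)
definition has_finite_part :: "(nat \<Rightarrow> real) \<Rightarrow> real \<Rightarrow> bool" where
  "has_finite_part s \<kappa> \<longleftrightarrow>
     (\<exists>(m :: nat) (c :: nat \<Rightarrow> nat \<Rightarrow> real).
        (\<lambda>N. s N - (\<Sum>(i, j)\<in>{..m} \<times> {..m} - {(0, 0)}. c i j * real N ^ i * ln (real N) ^ j))
          \<longlonglongrightarrow> \<kappa>)"

definition kappa_integrand :: "real \<Rightarrow> real \<Rightarrow> real" where
  "kappa_integrand \<beta> \<sigma> = 1 / \<sigma>\<^sup>2 * (1 / (exp (\<beta> * \<sigma>) - 1)) *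
     (\<sigma> / (exp \<sigma> - 1) - 1 + \<sigma> / 2 - \<sigma>\<^sup>2 / 12)"

definition kappa :: "real \<Rightarrow> real" where
  "kappa \<beta> = ln (2 * pi) / 4 + \<beta> * (1 / 12 - Re (deriv riemann_zeta (-1)))
     + euler_mascheroni / (12 * \<beta>)
     + (LINT \<sigma> : {0<..} | lborel. kappa_integrand \<beta> \<sigma>)"

definition tau :: "real \<Rightarrow> real" where
  "tau \<beta> = exp ((17 / 8 - 25 / 24 * (\<beta> + 1 / \<beta>)) * ln 2
     - ln (2 * pi) / 2 - ln \<beta> / 2 + kappa \<beta>)"

end

theory Submission
  imports Defs "HOL-Probability.Sinc_Integral" "HOL-Real_Asymp.Real_Asymp"
begin

text \<open>After reflection at the cut-off, \<open>I_{N,\<beta>}(a)\<close> is an integral of \<open>\<Prod>|x_i - x_j|^{2 \<beta>}\<close> over the positive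
  orthant against \<open>exp (- l y - c y^2 / 2)\<close> in each variable. Its moments of \<open>x_0 \<cdots> x_{p-1}\<close>, \<open>0 \<le> p \<le> N\<close>, satisfy by
  Aomoto's integration by parts a tridiagonal linear system of differential equations in \<open>l\<close> with nonnegative
  off-diagonal coefficients. A WKB ansatz in \<open>p / N\<close> solves the system up to \<open>O(1 / N)\<close>, and a maximum principle turns
  this residual into an \<open>O(1 / N)\<close> bound for the logarithm of the moments. For \<open>l \<rightarrow> \<infinity>\<close> they are Laguerre integrals, of
  which the full Gaussian integral is a limit; the quotient is a product of \<open>\<Gamma>(1 + j \<beta>)\<close>, and Binet's formula together
  with \<open>\<zeta>'(-1)\<close> gives its asymptotics. This computes \<open>ln P_N(a)\<close> up to \<open>o(1)\<close>, hence, by uniqueness of asymptotic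
  expansions, the terms of orders \<open>N^2\<close>, \<open>N\<close>, \<open>1\<close> of the assumed expansion and their limits at the edge. The term
  \<open>T_3\<close> of order \<open>1 / N\<close> is not computed: passing from \<open>N\<close> to \<open>k N\<close> shows \<open>T_3(k^{2/3} \<eta>) = T_3(\<eta>) / k\<close>, and since
  the limit distribution is monotone this forces \<open>T_3(\<eta>) = O(\<eta>^{-3/2})\<close>.\<close>

section \<open>Integrals over products of rapidly decreasing weights\<close>

text \<open>The assumptions provide coefficients without formulas, so these have to be identified.
  At a fixed cut-off, uniqueness determines \<open>exp_coeff F t \<beta> n a + p n\<close> for n
  \<le> 2 exactly, for every a below the edge; the N-dependent cut-off is then inserted into closed
  formulas, and no estimate uniform up to the edge is required. Only the moment p = 0 is wanted, but
  the system closes only on all p from 0 to N together, so the ansatz must be accurate uniformly in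
  p / N. Its coefficients are of size N^2; a residual O(1 / N) therefore needs ratios of
  neighbouring moments up to O(1 / N^3). This forces a term \<open>sig\<close> of size 1 / N into
  the ansatz, although it does not survive the limit. All integrations in m start at m = 1, where
  every moment is explicit, so that no constant of integration is left free. Truncating the assumed
  expansion after its constant order leaves a remainder o(1) only. The claimed O(|\<xi>|^(-3/2))
  therefore needs a bound on the next term, which this ansatz does not supply.\<close>

abbreviation Leb :: "nat \<Rightarrow> (nat \<Rightarrow> real) measure" where
  "Leb N \<equiv> \<Pi>\<^sub>M i\<in>{..<N}. (lborel :: real measure)"

interpretation Leb: product_sigma_finite "\<lambda>_::nat. lborel :: real measure"
  by (simp add: product_sigma_finite_def sigma_finite_lborel)

text \<open>Decay faster than every power is all that the integrability and domination arguments
  use. It survives multiplication by \<open>polyb\<close> factors and covers Gaussian, Laguerre and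
  two-sided exponential weights alike.\<close>

definition rapid :: "(real \<Rightarrow> real) \<Rightarrow> bool" where
  "rapid f \<longleftrightarrow> f \<in> borel_measurable borel \<and> (\<forall>k::nat. \<exists>C. \<forall>y. \<bar>f y\<bar> * (1 + \<bar>y\<bar>) ^ k \<le> C)"

lemma rapid_measurable [measurable_dest]: "rapid f \<Longrightarrow> f \<in> borel_measurable borel"
  by (simp add: rapid_def)

lemma rapid_mult_power:
  assumes "rapid f"
  shows "rapid (\<lambda>y. (1 + \<bar>y\<bar>) ^ k * f y)"
  unfolding rapid_def
proof (intro conjI allI)
  show "(\<lambda>y. (1 + \<bar>y\<bar>) ^ k * f y) \<in> borel_measurable borel"
    using assms by (auto simp: rapid_def)
  fix j :: nat
  obtain C where "\<forall>y. \<bar>f y\<bar> * (1 + \<bar>y\<bar>) ^ (k + j) \<le> C"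
    using assms unfolding rapid_def by blast
  then show "\<exists>C. \<forall>y. \<bar>(1 + \<bar>y\<bar>) ^ k * f y\<bar> * (1 + \<bar>y\<bar>) ^ j \<le> C"
    by (intro exI[of _ C]) (auto simp: abs_mult power_add mult_ac)
qed

lemma rapid_integrable:
  assumes "rapid f"
  shows "integrable lborel f"
proof -
  obtain C where C: "\<And>y. \<bar>f y\<bar> * (1 + \<bar>y\<bar>) ^ 2 \<le> C"
    using assms unfolding rapid_def by blast
  have i: "integrable lborel (\<lambda>y::real. C * inverse (1 + y^2))"
    using integrable_inverse_1_plus_square
    by (intro integrable_mult_right) (simp add: set_integrable_def einterval_eq_UNIV)
  show ?thesis
  proof (rule Bochner_Integration.integrable_bound[OF i])
    show "f \<in> borel_measurable lborel" using assms by (simp add: rapid_def)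
    have "\<bar>f y\<bar> \<le> \<bar>C * inverse (1 + y^2)\<bar>" for y
    proof -
      have "\<bar>f y\<bar> * (1 + y^2) \<le> \<bar>f y\<bar> * (1 + \<bar>y\<bar>) ^ 2"
        by (intro mult_left_mono) (auto simp: power2_eq_square algebra_simps)
      also note C
      finally have "\<bar>f y\<bar> * (1 + y^2) \<le> C" .
      then have "\<bar>f y\<bar> \<le> C * inverse (1 + y^2)"
        by (simp add: field_simps add_pos_nonneg)
      then show ?thesis by linarith
    qed
    then show "AE y in lborel. norm (f y) \<le> norm (C * inverse (1 + y^2))" by simp
  qed
qed

lemma power_exp_bound:
  fixes s :: real
  assumes "s > 0"
  shows "\<exists>C\<ge>0. \<forall>y\<ge>0. (1 + y) ^ k * exp (- s * y) \<le> C"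
proof -
  have "(1 + y) ^ k * exp (- s * y) \<le> (fact k / s ^ k) * exp s" if "y \<ge> 0" for y
  proof -
    have "(s * (1 + y)) ^ k / fact k \<le> exp (s * (1 + y))"
    proof -
      have "(\<Sum>n<Suc k. (s * (1 + y)) ^ n / fact n) \<le> exp (s * (1 + y))"
        using sum_le_suminf[OF summable_exp_generic[of "s * (1 + y)"], of "{..<Suc k}"] assms that
        by (auto simp: exp_def divide_inverse mult_ac)
      moreover have "(s * (1 + y)) ^ k / fact k \<le> (\<Sum>n<Suc k. (s * (1 + y)) ^ n / fact n)"
        using assms that by (auto intro!: sum_nonneg divide_nonneg_pos)
      ultimately show ?thesis by linarith
    qed
    then have "(1 + y) ^ k \<le> (fact k / s ^ k) * exp s * exp (s * y)"
      using assms by (simp add: field_simps power_mult_distrib[symmetric] exp_add ring_distribs)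
    then have "(1 + y) ^ k * exp (- s * y) \<le> (fact k / s ^ k) * exp s * exp (s * y) * exp (- s * y)"
      by (intro mult_right_mono) auto
    then show ?thesis by (simp add: mult.assoc mult_exp_exp)
  qed
  moreover have "(fact k / s ^ k) * exp s \<ge> 0" using assms by simp
  ultimately show ?thesis by blast
qed

lemma rapid_exp_bound:
  assumes "f \<in> borel_measurable borel" "s > 0" "\<And>y. \<bar>f y\<bar> \<le> C * (1 + \<bar>y\<bar>) ^ j * exp (- s * \<bar>y\<bar>)"
  shows "rapid f"
  unfolding rapid_def
proof (intro conjI allI assms(1))
  fix k :: nat
  obtain D where D: "D \<ge> 0" "\<And>y. y \<ge> 0 \<Longrightarrow> (1 + y) ^ (j + k) * exp (- s * y) \<le> D"
    using power_exp_bound[OF assms(2)] by meson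
  have "\<bar>f y\<bar> * (1 + \<bar>y\<bar>) ^ k \<le> \<bar>C\<bar> * D" for y
  proof -
    have "\<bar>f y\<bar> * (1 + \<bar>y\<bar>) ^ k \<le> (C * (1 + \<bar>y\<bar>) ^ j * exp (- s * \<bar>y\<bar>)) * (1 + \<bar>y\<bar>) ^ k"
      by (intro mult_right_mono assms(3)) auto
    also have "\<dots> = C * ((1 + \<bar>y\<bar>) ^ (j + k) * exp (- s * \<bar>y\<bar>))"
      by (simp add: power_add)
    also have "\<dots> \<le> \<bar>C\<bar> * ((1 + \<bar>y\<bar>) ^ (j + k) * exp (- s * \<bar>y\<bar>))"
      by (intro mult_right_mono) auto
    also have "\<dots> \<le> \<bar>C\<bar> * D"
      by (intro mult_left_mono D) auto
    finally show ?thesis .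
  qed
  then show "\<exists>C. \<forall>y. \<bar>f y\<bar> * (1 + \<bar>y\<bar>) ^ k \<le> C" by blast
qed

text \<open>The bound is a power of a product over the coordinates, not of a norm, because it then
  factorises: \<open>rapid_prod_integrable\<close> becomes a product of one-dimensional
  integrals.\<close>

definition polyb :: "nat \<Rightarrow> ((nat \<Rightarrow> real) \<Rightarrow> real) \<Rightarrow> bool" where
  "polyb N g \<longleftrightarrow> g \<in> borel_measurable (Leb N) \<and> (\<exists>C\<ge>0. \<exists>K. \<forall>x. \<bar>g x\<bar> \<le> C * (\<Prod>i<N. (1 + \<bar>x i\<bar>)) ^ K)"

lemma polyb_measurable: "polyb N g \<Longrightarrow> g \<in> borel_measurable (Leb N)"
  by (simp add: polyb_def)

lemma prod_ge1: "1 \<le> (\<Prod>i<N. (1 + \<bar>x i :: real\<bar>))"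
  by (rule prod_ge_1) auto

lemma prod_ge_component:
  fixes x :: "nat \<Rightarrow> real"
  assumes "j < N"
  shows "1 + \<bar>x j\<bar> \<le> (\<Prod>i<N. (1 + \<bar>x i\<bar>))"
proof -
  have "(1 + \<bar>x j\<bar>) * 1 \<le> (1 + \<bar>x j\<bar>) * (\<Prod>i\<in>{..<N} - {j}. 1 + \<bar>x i\<bar>)"
    by (intro mult_left_mono prod_ge_1) auto
  also have "\<dots> = (\<Prod>i<N. (1 + \<bar>x i\<bar>))"
    using assms by (subst prod.remove[of "{..<N}" j]) auto
  finally show ?thesis by simp
qed

lemma polyb_const: "polyb N (\<lambda>_. c)"
  unfolding polyb_def by (intro conjI exI[of _ "\<bar>c\<bar>"] exI[of _ 0]) auto

lemma polyb_component:
  assumes "j < N" shows "polyb N (\<lambda>x. x j)"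
  unfolding polyb_def
proof (intro conjI exI[of _ 1] exI[of _ 1] allI)
  show "(\<lambda>x. x j) \<in> borel_measurable (Leb N)" using assms by auto
  show "\<bar>x j\<bar> \<le> 1 * (\<Prod>i<N. 1 + \<bar>x i\<bar>) ^ 1" for x :: "nat \<Rightarrow> real"
    using prod_ge_component[OF assms, of x] by auto
qed auto

lemma polyb_mult:
  assumes "polyb N f" "polyb N g" shows "polyb N (\<lambda>x. f x * g x)"
proof -
  from assms obtain C K D J where *: "C \<ge> 0" "\<And>x. \<bar>f x\<bar> \<le> C * (\<Prod>i<N. (1 + \<bar>x i\<bar>)) ^ K"
    "D \<ge> 0" "\<And>x. \<bar>g x\<bar> \<le> D * (\<Prod>i<N. (1 + \<bar>x i\<bar>)) ^ J"
    unfolding polyb_def by metis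
  have "\<bar>f x * g x\<bar> \<le> (C * D) * (\<Prod>i<N. (1 + \<bar>x i\<bar>)) ^ (K + J)" for x
  proof -
    have "\<bar>f x * g x\<bar> \<le> (C * (\<Prod>i<N. (1 + \<bar>x i\<bar>)) ^ K) * (D * (\<Prod>i<N. (1 + \<bar>x i\<bar>)) ^ J)"
      unfolding abs_mult using * by (intro mult_mono) (auto intro!: mult_nonneg_nonneg zero_le_power prod_nonneg)
    then show ?thesis by (simp add: power_add mult_ac)
  qed
  then show ?thesis using assms *(1,3) unfolding polyb_def
    by (intro conjI exI[of _ "C * D"] exI[of _ "K + J"]) auto
qed

lemma polyb_add:
  assumes "polyb N f" "polyb N g" shows "polyb N (\<lambda>x. f x + g x)"
proof -
  from assms obtain C K D J where *: "C \<ge> 0" "\<And>x. \<bar>f x\<bar> \<le> C * (\<Prod>i<N. (1 + \<bar>x i\<bar>)) ^ K"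
    "D \<ge> 0" "\<And>x. \<bar>g x\<bar> \<le> D * (\<Prod>i<N. (1 + \<bar>x i\<bar>)) ^ J"
    unfolding polyb_def by metis
  have "\<bar>f x + g x\<bar> \<le> (C + D) * (\<Prod>i<N. (1 + \<bar>x i\<bar>)) ^ (K + J)" for x
  proof -
    have "\<bar>f x + g x\<bar> \<le> C * (\<Prod>i<N. (1 + \<bar>x i\<bar>)) ^ K + D * (\<Prod>i<N. (1 + \<bar>x i\<bar>)) ^ J"
      using *(2)[of x] *(4)[of x] by linarith
    also have "\<dots> \<le> C * (\<Prod>i<N. (1 + \<bar>x i\<bar>)) ^ (K + J) + D * (\<Prod>i<N. (1 + \<bar>x i\<bar>)) ^ (K + J)"
      using * by (intro add_mono mult_left_mono power_increasing prod_ge1) auto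
    finally show ?thesis by (simp add: algebra_simps)
  qed
  then show ?thesis using assms *(1,3) unfolding polyb_def
    by (intro conjI exI[of _ "C + D"] exI[of _ "K + J"]) auto
qed

lemma polyb_diff: "polyb N f \<Longrightarrow> polyb N g \<Longrightarrow> polyb N (\<lambda>x. f x - g x)"
  using polyb_add[of N f "\<lambda>x. (-1) * g x"] polyb_mult[OF polyb_const[of N "-1"], of g] by simp

lemma polyb_sum: "(\<And>i. i \<in> I \<Longrightarrow> polyb N (f i)) \<Longrightarrow> polyb N (\<lambda>x. \<Sum>i\<in>I. f i x)"
  by (induction I rule: infinite_finite_induct) (auto intro: polyb_const polyb_add)

lemma polyb_prod: "(\<And>i. i \<in> I \<Longrightarrow> polyb N (f i)) \<Longrightarrow> polyb N (\<lambda>x. \<Prod>i\<in>I. f i x)"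
  by (induction I rule: infinite_finite_induct) (auto intro: polyb_const polyb_mult)

lemma polyb_le:
  assumes "polyb N g" "f \<in> borel_measurable (Leb N)" "\<And>x. \<bar>f x\<bar> \<le> \<bar>g x\<bar>"
  shows "polyb N f"
  using assms unfolding polyb_def by (meson order_trans)

lemma polyb_powr:
  assumes "polyb N f" "\<And>x. f x \<ge> 0" "b \<ge> 0"
  shows "polyb N (\<lambda>x. f x powr b)"
proof -
  define k where "k = nat \<lceil>b\<rceil>"
  have k: "b \<le> real k" unfolding k_def by linarith
  have 1: "polyb N (\<lambda>x. \<Prod>i<k. (1 + f x))"
    by (intro polyb_prod polyb_add polyb_const assms)
  show ?thesis
  proof (rule polyb_le[OF 1])
    show "(\<lambda>x. f x powr b) \<in> borel_measurable (Leb N)"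
      using assms(1) by (auto simp: polyb_def)
    fix x
    have "f x powr b \<le> (1 + f x) powr b" using assms by (intro powr_mono2) auto
    also have "\<dots> \<le> (1 + f x) powr real k" using assms(2)[of x] k by (intro powr_mono) auto
    also have "\<dots> = (1 + f x) ^ k" using assms(2)[of x] by (simp add: powr_realpow add_pos_nonneg)
    finally show "\<bar>f x powr b\<bar> \<le> \<bar>\<Prod>i<k. (1 + f x)\<bar>" using assms(2)[of x] by simp
  qed
qed

lemma rapid_prod_integrable:
  assumes "polyb N g" "rapid f"
  shows "integrable (Leb N) (\<lambda>x. g x * (\<Prod>i<N. f (x i)))"
proof -
  from assms(1) obtain C K where C: "C \<ge> 0" "\<And>x. \<bar>g x\<bar> \<le> C * (\<Prod>i<N. (1 + \<bar>x i\<bar>)) ^ K"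
    unfolding polyb_def by metis
  have 1: "integrable (Leb N) (\<lambda>x. C * (\<Prod>i<N. (1 + \<bar>x i\<bar>) ^ K * f (x i)))"
    by (intro integrable_mult_right Leb.product_integrable_prod)
       (auto intro: rapid_integrable rapid_mult_power assms)
  show ?thesis
  proof (rule Bochner_Integration.integrable_bound[OF 1])
    show "(\<lambda>x. g x * (\<Prod>i<N. f (x i))) \<in> borel_measurable (Leb N)"
      using polyb_measurable[OF assms(1)] rapid_measurable[OF assms(2)] by measurable
    have "\<bar>g x * (\<Prod>i<N. f (x i))\<bar> \<le> \<bar>C * (\<Prod>i<N. (1 + \<bar>x i\<bar>) ^ K * f (x i))\<bar>" for x
    proof -
      have "\<bar>g x\<bar> * \<bar>\<Prod>i<N. f (x i)\<bar> \<le> (C * (\<Prod>i<N. (1 + \<bar>x i\<bar>)) ^ K) * \<bar>\<Prod>i<N. f (x i)\<bar>"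
        by (intro mult_right_mono C) auto
      then show ?thesis
        using C(1) by (simp add: abs_mult prod.distrib prod_power_distrib abs_prod power_abs)
    qed
    then show "AE x in Leb N. norm (g x * (\<Prod>i<N. f (x i))) \<le> norm (C * (\<Prod>i<N. (1 + \<bar>x i\<bar>) ^ K * f (x i)))"
      by simp
  qed
qed

section \<open>Changes of variables\<close>

lemma Leb_permute:
  assumes p: "p permutes {..<N}"
  shows "distr (Leb N) (Leb N) (\<lambda>x. \<lambda>i\<in>{..<N}. x (p i)) = Leb N"
proof (rule Leb.PiM_eqI)
  have [measurable]: "(\<lambda>x. \<lambda>i\<in>{..<N}. x (p i)) \<in> measurable (Leb N) (Leb N)"
    using permutes_in_image[OF p] by (intro measurable_restrict) auto
  fix A :: "nat \<Rightarrow> real set" assume A: "\<And>i. i \<in> {..<N} \<Longrightarrow> A i \<in> sets lborel"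
  let ?q = "inv p"
  have q: "?q permutes {..<N}" using p by (rule permutes_inv)
  have pq: "p (?q i) = i" "?q (p i) = i" for i
    using p by (auto simp: permutes_inverses)
  have 1: "(\<lambda>x. \<lambda>i\<in>{..<N}. x (p i)) -` Pi\<^sub>E {..<N} A \<inter> space (Leb N) = Pi\<^sub>E {..<N} (\<lambda>i. A (?q i))"
  proof (intro set_eqI iffI)
    fix x assume x: "x \<in> (\<lambda>x. \<lambda>i\<in>{..<N}. x (p i)) -` Pi\<^sub>E {..<N} A \<inter> space (Leb N)"
    then show "x \<in> Pi\<^sub>E {..<N} (\<lambda>i. A (?q i))"
    proof (intro PiE_I)
      fix i assume "i \<in> {..<N}"
      then have "?q i \<in> {..<N}" using permutes_in_image[OF q] by auto
      with x have "x (p (?q i)) \<in> A (?q i)" by (auto simp: PiE_iff)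
      then show "x i \<in> A (?q i)" by (simp add: pq)
    qed (auto simp: space_PiM PiE_iff extensional_def)
  next
    fix x assume x: "x \<in> Pi\<^sub>E {..<N} (\<lambda>i. A (?q i))"
    have "x (p i) \<in> A i" if "i < N" for i
      using x that permutes_in_image[OF p, of i] by (auto simp: PiE_iff pq dest!: bspec[of _ _ "p i"])
    then show "x \<in> (\<lambda>x. \<lambda>i\<in>{..<N}. x (p i)) -` Pi\<^sub>E {..<N} A \<inter> space (Leb N)"
      using x by (auto simp: space_PiM PiE_iff)
  qed
  have "emeasure (distr (Leb N) (Leb N) (\<lambda>x. \<lambda>i\<in>{..<N}. x (p i))) (Pi\<^sub>E {..<N} A)
      = emeasure (Leb N) (Pi\<^sub>E {..<N} (\<lambda>i. A (?q i)))"
    using A by (subst emeasure_distr) (auto simp: 1)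
  also have "\<dots> = (\<Prod>i<N. emeasure lborel (A (?q i)))"
    using A permutes_in_image[OF q] by (intro Leb.emeasure_PiM) auto
  also have "\<dots> = (\<Prod>i<N. emeasure lborel (A i))"
    by (rule prod.permute[OF q, symmetric, unfolded comp_def])
  finally show "emeasure (distr (Leb N) (Leb N) (\<lambda>x. \<lambda>i\<in>{..<N}. x (p i))) (Pi\<^sub>E {..<N} A)
      = (\<Prod>i\<in>{..<N}. emeasure lborel (A i))" .
qed auto

lemma Leb_integral_swap:
  fixes f :: "(nat \<Rightarrow> real) \<Rightarrow> real"
  assumes "j < N" "k < N" "f \<in> borel_measurable (Leb N)"
  shows "(\<integral>x. f x \<partial>Leb N) = (\<integral>x. f (\<lambda>i\<in>{..<N}. x (Transposition.transpose j k i)) \<partial>Leb N)"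
proof -
  have p: "Transposition.transpose j k permutes {..<N}"
    using assms by (intro permutes_swap_id) auto
  have [measurable]: "(\<lambda>x. \<lambda>i\<in>{..<N}. x (Transposition.transpose j k i)) \<in> measurable (Leb N) (Leb N)"
    using permutes_in_image[OF p] by (intro measurable_restrict) auto
  show ?thesis
    by (subst Leb_permute[OF p, symmetric], subst integral_distr) (use assms(3) in auto)
qed

lemma Leb_affine:
  assumes c: "c \<noteq> (0::real)"
  shows "Leb N = density (distr (Leb N) (Leb N) (\<lambda>x. \<lambda>i\<in>{..<N}. t + c * x i)) (\<lambda>_. ennreal (\<bar>c\<bar> ^ N))"
    (is "_ = ?R")
proof (rule Leb.PiM_eqI[symmetric])
  have m [measurable]: "(\<lambda>x. \<lambda>i\<in>{..<N}. t + c * x i) \<in> measurable (Leb N) (Leb N)"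
    by (intro measurable_restrict) auto
  fix A :: "nat \<Rightarrow> real set" assume A: "\<And>i. i \<in> {..<N} \<Longrightarrow> A i \<in> sets lborel"
  have [measurable]: "i < N \<Longrightarrow> A i \<in> sets borel" for i using A by auto
  have 1: "(\<lambda>x. \<lambda>i\<in>{..<N}. t + c * x i) -` Pi\<^sub>E {..<N} A \<inter> space (Leb N)
      = Pi\<^sub>E {..<N} (\<lambda>i. (\<lambda>y. t + c * y) -` A i)"
    by (auto simp: space_PiM PiE_iff)
  have 2: "emeasure lborel (A i) = ennreal \<bar>c\<bar> * emeasure lborel ((\<lambda>y. t + c * y) -` A i)" if "i < N" for i
    using that by (subst lborel_real_affine[OF c, of t])
      (auto simp: emeasure_density nn_integral_cmult emeasure_distr nn_integral_distr)
  have "emeasure ?R (Pi\<^sub>E {..<N} A) = ennreal (\<bar>c\<bar> ^ N) * emeasure (Leb N) (Pi\<^sub>E {..<N} (\<lambda>i. (\<lambda>y. t + c * y) -` A i))"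
    using A by (subst emeasure_density) (auto simp: nn_integral_cmult emeasure_distr 1)
  also have "emeasure (Leb N) (Pi\<^sub>E {..<N} (\<lambda>i. (\<lambda>y. t + c * y) -` A i))
      = (\<Prod>i<N. emeasure lborel ((\<lambda>y. t + c * y) -` A i))"
    by (intro Leb.emeasure_PiM) (auto intro!: measurable_sets_borel[of _ borel])
  also have "ennreal (\<bar>c\<bar> ^ N) * \<dots> = (\<Prod>i<N. emeasure lborel (A i))"
    by (simp add: 2 prod.distrib ennreal_power)
  finally show "emeasure ?R (Pi\<^sub>E {..<N} A) = (\<Prod>i\<in>{..<N}. emeasure lborel (A i))" .
qed auto

lemma Leb_integral_affine:
  fixes f :: "(nat \<Rightarrow> real) \<Rightarrow> real"
  assumes c: "c \<noteq> 0" and f: "f \<in> borel_measurable (Leb N)"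
  shows "(\<integral>x. f x \<partial>Leb N) = \<bar>c\<bar> ^ N * (\<integral>x. f (\<lambda>i\<in>{..<N}. t + c * x i) \<partial>Leb N)"
proof -
  have m [measurable]: "(\<lambda>x. \<lambda>i\<in>{..<N}. t + c * x i) \<in> measurable (Leb N) (Leb N)"
    by (intro measurable_restrict) auto
  note f [measurable]
  show ?thesis
    by (subst Leb_affine[OF c, of N t]) (simp add: integral_density integral_distr)
qed

section \<open>Differentiation under the integral sign\<close>

text \<open>The mean value theorem bounds the difference quotients by \<open>w\<close>, so dominated
  convergence applies along any sequence tending to \<open>t0\<close>. The shift by
  \<open>n0\<close> discards the members outside the interval where \<open>f\<close> is
  controlled.\<close>

lemma has_real_derivative_integral:
  fixes f f' :: "real \<Rightarrow> 'a \<Rightarrow> real"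
  assumes d: "d > 0"
    and int: "\<And>t. \<bar>t - t0\<bar> < d \<Longrightarrow> integrable M (f t)"
    and meas: "f' t0 \<in> borel_measurable M"
    and deriv: "\<And>t x. \<bar>t - t0\<bar> < d \<Longrightarrow> x \<in> space M \<Longrightarrow> ((\<lambda>t. f t x) has_real_derivative f' t x) (at t)"
    and bound: "\<And>t x. \<bar>t - t0\<bar> < d \<Longrightarrow> x \<in> space M \<Longrightarrow> \<bar>f' t x\<bar> \<le> w x"
    and w: "integrable M w"
  shows "((\<lambda>t. \<integral>x. f t x \<partial>M) has_real_derivative (\<integral>x. f' t0 x \<partial>M)) (at t0)"
  unfolding has_field_derivative_iff tendsto_at_iff_sequentially
proof (intro allI impI)
  fix X :: "nat \<Rightarrow> real" assume X: "\<forall>i. X i \<in> UNIV - {t0}" "X \<longlonglongrightarrow> t0"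
  from X(2) d have "eventually (\<lambda>n. \<bar>X n - t0\<bar> < d) sequentially"
    by (auto dest!: tendstoD[of X t0 sequentially d] simp: dist_real_def)
  then obtain n0 where n0: "\<And>n. n \<ge> n0 \<Longrightarrow> \<bar>X n - t0\<bar> < d"
    by (auto simp: eventually_sequentially)
  let ?g = "\<lambda>n x. (f (X n) x - f t0 x) / (X n - t0)"
  have Xn: "X n \<noteq> t0" for n using X(1) by auto
  have "(\<lambda>n. \<integral>x. ?g (n + n0) x \<partial>M) \<longlonglongrightarrow> (\<integral>x. f' t0 x \<partial>M)"
  proof (rule integral_dominated_convergence[where w = w])
    show "?g (n + n0) \<in> borel_measurable M" for n
      using int[of "X (n + n0)"] int[of t0] n0[of "n + n0"] d by (intro borel_measurable_divide borel_measurable_diff) auto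
    show "AE x in M. (\<lambda>n. ?g (n + n0) x) \<longlonglongrightarrow> f' t0 x"
    proof (rule AE_I2)
      fix x assume x: "x \<in> space M"
      have "((\<lambda>t. (f t x - f t0 x) / (t - t0)) \<longlongrightarrow> f' t0 x) (at t0)"
        using deriv[of t0 x] d x unfolding has_field_derivative_iff by simp
      then have "(\<lambda>n. ?g n x) \<longlonglongrightarrow> f' t0 x"
        using X unfolding tendsto_at_iff_sequentially comp_def by auto
      then show "(\<lambda>n. ?g (n + n0) x) \<longlonglongrightarrow> f' t0 x" by (rule LIMSEQ_ignore_initial_segment)
    qed
    show "AE x in M. norm (?g (n + n0) x) \<le> w x" for n
    proof (rule AE_I2)
      fix x assume x: "x \<in> space M"
      let ?t = "X (n + n0)"
      have t: "\<bar>?t - t0\<bar> < d" by (rule n0) simp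
      have "norm (f ?t x - f t0 x) \<le> w x * norm (?t - t0)"
      proof (rule field_differentiable_bound[of "{t0 - \<bar>?t - t0\<bar>..t0 + \<bar>?t - t0\<bar>}" "\<lambda>t. f t x" "\<lambda>t. f' t x"])
        fix s assume s: "s \<in> {t0 - \<bar>?t - t0\<bar>..t0 + \<bar>?t - t0\<bar>}"
        then have s': "\<bar>s - t0\<bar> < d" using t by auto
        show "((\<lambda>t. f t x) has_field_derivative f' s x) (at s within {t0 - \<bar>?t - t0\<bar>..t0 + \<bar>?t - t0\<bar>})"
          using deriv[OF s' x] by (rule has_field_derivative_at_within)
        show "norm (f' s x) \<le> w x" using bound[OF s' x] by simp
      qed auto
      then show "norm (?g (n + n0) x) \<le> w x"
        using Xn[of "n + n0"] by (simp add: divide_le_eq)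
    qed
  qed (use meas w in auto)
  then have "(\<lambda>n. \<integral>x. ?g n x \<partial>M) \<longlonglongrightarrow> (\<integral>x. f' t0 x \<partial>M)"
    by (rule LIMSEQ_offset)
  moreover have "eventually (\<lambda>n. (\<integral>x. ?g n x \<partial>M) = ((\<integral>x. f (X n) x \<partial>M) - (\<integral>x. f t0 x \<partial>M)) / (X n - t0)) sequentially"
    unfolding eventually_sequentially
    by (intro exI[of _ n0] allI impI) (use int n0 d in \<open>simp add: Bochner_Integration.integral_diff\<close>)
  ultimately show "((\<lambda>y. ((\<integral>x. f y x \<partial>M) - (\<integral>x. f t0 x \<partial>M)) / (y - t0)) \<circ> X) \<longlonglongrightarrow> (\<integral>x. f' t0 x \<partial>M)"
    unfolding comp_def by (rule Lim_transform_eventually)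
qed

section \<open>The Aomoto recursion\<close>

definition pairs :: "nat \<Rightarrow> (nat \<times> nat) set" where
  "pairs N = {(i, j). i < j \<and> j < N}"

lemma finite_pairs [simp]: "finite (pairs N)"
  by (rule finite_subset[of _ "{..<N} \<times> {..<N}"]) (auto simp: pairs_def)

text \<open>The regularisation \<open>e > 0\<close> makes the Vandermonde factor smooth for every \<open>\<beta>\<close>; the
  logarithmic derivatives then only enter through \<open>d^2 / (d^2 + e) \<le> 1\<close>, which survives \<open>e \<rightarrow> 0\<close>.\<close>

definition vand :: "real \<Rightarrow> real \<Rightarrow> nat \<Rightarrow> (nat \<Rightarrow> real) \<Rightarrow> real" where
  "vand \<beta> e N x = (\<Prod>(i, j)\<in>pairs N. ((x i - x j)^2 + e) powr \<beta>)"

text \<open>For c > 0 this is a Gaussian seen from the cut-off, for c = 0 and l = 1 the Laguerre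
  weight. The exponent \<open>m\<close> is unrelated to the real parameter \<open>m\<close> of the
  WKB part.\<close>

definition weight :: "nat \<Rightarrow> real \<Rightarrow> real \<Rightarrow> real \<Rightarrow> real" where
  "weight m l c y = (if y \<ge> 0 then y ^ m * exp (- l * y - c * y^2 / 2) else 0)"

lemma weight_nonneg: "weight m l c y \<ge> 0"
  by (simp add: weight_def)

lemma rapid_weight:
  assumes "c > 0 \<or> (c = 0 \<and> l > 0)"
  shows "rapid (weight m l c)"
proof -
  obtain s K where s: "s > 0" "\<And>y. y \<ge> 0 \<Longrightarrow> - l * y - c * y^2 / 2 \<le> K - s * y"
  proof (cases "c > 0")
    case True
    have "- l * y - c * y^2 / 2 \<le> (l - 1)^2 / (2 * c) - 1 * y" for y
    proof -
      have "0 \<le> (c * y + (l - 1))^2 / (2 * c)" using True by simp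
      also have "\<dots> = c * y^2 / 2 + (l - 1) * y + (l - 1)^2 / (2 * c)"
        using True by (simp add: power2_eq_square field_simps)
      finally show ?thesis by (simp add: algebra_simps)
    qed
    then show ?thesis by (intro that[of 1]) auto
  next
    case False
    then show ?thesis using assms by (intro that[of l 0]) auto
  qed
  show ?thesis
  proof (rule rapid_exp_bound[of _ s "exp K" m])
    have "(\<lambda>y. if y \<ge> 0 then y ^ m * exp (- l * y - c * y^2 / 2) else 0) \<in> borel_measurable borel"
      by measurable
    then show "weight m l c \<in> borel_measurable borel" by (simp add: weight_def[abs_def])
    fix y
    show "\<bar>weight m l c y\<bar> \<le> exp K * (1 + \<bar>y\<bar>) ^ m * exp (- s * \<bar>y\<bar>)"
    proof (cases "y \<ge> 0")
      case True
      have "y ^ m * exp (- l * y - c * y^2 / 2) \<le> (1 + y) ^ m * exp (K - s * y)"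
        using True s(2)[of y] by (intro mult_mono power_mono) auto
      then show ?thesis using True by (simp add: weight_def mult_ac exp_diff exp_minus field_simps)
    qed (auto simp: weight_def)
  qed (rule s)
qed

text \<open>The integrand is the derivative of y^(m+1) exp(- l y - c y^2 / 2) G(y). The additional
  factor y makes the boundary term at 0 vanish even for m = 0, where the weight itself
  jumps.\<close>

lemma weight_ibp_1d:
  fixes G G' :: "real \<Rightarrow> real"
  assumes w: "rapid (weight m l c)"
    and G: "\<And>y. (G has_real_derivative G' y) (at y)" and G': "continuous_on UNIV G'"
    and bG: "\<And>y. \<bar>G y\<bar> \<le> C * (1 + \<bar>y\<bar>) ^ K" and bG': "\<And>y. \<bar>G' y\<bar> \<le> C * (1 + \<bar>y\<bar>) ^ K"
  shows "(LINT y|lborel. ((1 + real m) * G y + y * G' y - (l * y + c * y^2) * G y) * weight m l c y) = 0"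
proof -
  let ?F = "\<lambda>y. (1 + real m) * G y + y * G' y - (l * y + c * y^2) * G y" and ?e = "\<lambda>y. exp (- l * y - c * y^2 / 2)"
  define h where "h y = ?F y * (y ^ m * ?e y)" for y
  define H where "H y = y ^ Suc m * ?e y * G y" for y
  have contG: "continuous_on UNIV G"
    using G by (intro DERIV_continuous_on[of _ G]) (auto intro: DERIV_subset)
  have C: "C \<ge> 0" using bG[of 0] by auto
  have [measurable]: "G \<in> borel_measurable borel" "G' \<in> borel_measurable borel"
    using contG G' by (auto intro: borel_measurable_continuous_onI)
  have hw: "indicator {0<..} y *\<^sub>R h y = ?F y * weight m l c y" if "y \<noteq> 0" for y
    using that by (auto simp: h_def weight_def)
  have nz: "AE y in lborel. y \<noteq> (0::real)" by (rule AE_lborel_singleton)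
  have E: "einterval 0 \<infinity> = {0<..}" by (auto simp: einterval_def)
  have int: "integrable lborel (\<lambda>y. ?F y * weight m l c y)"
  proof (rule Bochner_Integration.integrable_bound)
    show "integrable lborel (\<lambda>y. (C * (2 + real m + \<bar>l\<bar> + \<bar>c\<bar>)) * ((1 + \<bar>y\<bar>) ^ (K + 2) * weight m l c y))"
      by (intro integrable_mult_right rapid_integrable rapid_mult_power w)
    have "\<bar>?F y * weight m l c y\<bar>
       \<le> (C * (2 + real m + \<bar>l\<bar> + \<bar>c\<bar>)) * ((1 + \<bar>y\<bar>) ^ (K + 2) * weight m l c y)" for y
    proof -
      let ?B = "C * (1 + \<bar>y\<bar>) ^ K" and ?Y = "1 + \<bar>y\<bar>"
      have B0: "?B \<ge> 0" using C by simp
      have y2: "\<bar>y\<bar> \<le> ?Y^2" "1 \<le> ?Y^2" "y^2 \<le> ?Y^2"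
        by (auto simp: power2_eq_square algebra_simps)
      have "\<bar>(1 + real m) * G y + y * G' y - (l * y + c * y^2) * G y\<bar>
         \<le> (1 + real m) * \<bar>G y\<bar> + \<bar>y\<bar> * \<bar>G' y\<bar> + (\<bar>l\<bar> * \<bar>y\<bar> + \<bar>c\<bar> * y^2) * \<bar>G y\<bar>"
      proof -
        have "\<bar>(l * y + c * y^2) * G y\<bar> \<le> (\<bar>l\<bar> * \<bar>y\<bar> + \<bar>c\<bar> * y^2) * \<bar>G y\<bar>"
          unfolding abs_mult by (intro mult_right_mono order_trans[OF abs_triangle_ineq]) (auto simp: abs_mult)
        moreover have "\<bar>(1 + real m) * G y\<bar> = (1 + real m) * \<bar>G y\<bar>" "\<bar>y * G' y\<bar> = \<bar>y\<bar> * \<bar>G' y\<bar>"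
          by (auto simp: abs_mult)
        ultimately show ?thesis by linarith
      qed
      also have "\<dots> \<le> (1 + real m) * (?Y^2 * ?B) + ?Y^2 * ?B + ((\<bar>l\<bar> + \<bar>c\<bar>) * ?Y^2) * ?B"
      proof (intro add_mono)
        have "\<bar>G y\<bar> \<le> 1 * ?B" using bG[of y] by simp
        also have "\<dots> \<le> ?Y^2 * ?B" by (intro mult_right_mono y2 B0)
        finally show "(1 + real m) * \<bar>G y\<bar> \<le> (1 + real m) * (?Y^2 * ?B)" by (intro mult_left_mono) auto
        show "\<bar>y\<bar> * \<bar>G' y\<bar> \<le> ?Y^2 * ?B" by (intro mult_mono y2 bG') auto
        show "(\<bar>l\<bar> * \<bar>y\<bar> + \<bar>c\<bar> * y^2) * \<bar>G y\<bar> \<le> ((\<bar>l\<bar> + \<bar>c\<bar>) * ?Y^2) * ?B"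
          unfolding distrib_right[of "\<bar>l\<bar>"] using y2
          by (intro mult_mono add_mono mult_left_mono bG) auto
      qed
      also have "\<dots> = (C * (2 + real m + \<bar>l\<bar> + \<bar>c\<bar>)) * ?Y ^ (K + 2)"
        unfolding power_add by (simp add: algebra_simps)
      finally have "\<bar>(1 + real m) * G y + y * G' y - (l * y + c * y^2) * G y\<bar> * weight m l c y
         \<le> (C * (2 + real m + \<bar>l\<bar> + \<bar>c\<bar>)) * ?Y ^ (K + 2) * weight m l c y"
        by (intro mult_right_mono weight_nonneg)
      then show ?thesis using weight_nonneg[of m l c y] by (simp add: abs_mult mult_ac)
    qed
    then show "AE y in lborel. norm (?F y * weight m l c y)
       \<le> norm ((C * (2 + real m + \<bar>l\<bar> + \<bar>c\<bar>)) * ((1 + \<bar>y\<bar>) ^ (K + 2) * weight m l c y))"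
      unfolding real_norm_def by (intro AE_I2 order_trans[OF _ abs_ge_self])
  qed (use rapid_measurable[OF w] in measurable)
  obtain D where D: "\<And>y. \<bar>weight m l c y\<bar> * (1 + \<bar>y\<bar>) ^ (K + 2) \<le> D"
    using w unfolding rapid_def by blast
  have D0: "D \<ge> 0" using order_trans[OF _ D[of 0]] by auto
  \<comment> \<open>One bound serves both ends, since y / (1 + y)^2 tends to 0 at 0 and at infinity;
    for this the decay of the weight is tested with the power K + 2.\<close>
  have Hb: "\<bar>H y\<bar> \<le> C * D * (y / (1 + y)^2)" if y: "y > 0" for y
  proof -
    have "\<bar>H y\<bar> = y * (\<bar>weight m l c y\<bar> * \<bar>G y\<bar>)"
      using y by (simp add: H_def weight_def abs_mult)
    also have "\<dots> \<le> y * (\<bar>weight m l c y\<bar> * (C * (1 + \<bar>y\<bar>) ^ K))"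
      using y by (intro mult_left_mono bG) auto
    also have "\<dots> = y * C / (1 + y)^2 * (\<bar>weight m l c y\<bar> * (1 + \<bar>y\<bar>) ^ (K + 2))"
      using y unfolding power_add by (simp add: field_simps)
    also have "\<dots> \<le> y * C / (1 + y)^2 * D"
      using y C by (intro mult_left_mono D) auto
    finally show ?thesis by (simp add: mult_ac)
  qed
  have lim0: "((\<lambda>y. C * D * (y / (1 + y)^2)) \<longlongrightarrow> 0) (at_right 0)"
    by (auto intro!: tendsto_eq_intros)
  have liminf: "((\<lambda>y::real. C * D * (y / (1 + y)^2)) \<longlongrightarrow> 0) at_top"
    by (rule tendsto_mult_right_zero) real_asymp
  have H0: "(H \<longlongrightarrow> 0) (at_right 0)"
    by (rule Lim_null_comparison[OF _ lim0]) (use Hb in \<open>auto simp: eventually_at_filter\<close>)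
  have Hinf: "(H \<longlongrightarrow> 0) at_top"
    by (rule Lim_null_comparison[OF _ liminf]) (use Hb in \<open>auto intro!: eventually_at_top_linorderI[of 1]\<close>)
  have "(LBINT y=0..\<infinity>. h y) = 0 - 0"
  proof (rule interval_integral_FTC_integrable[where F = H])
    fix y :: real
    show "(H has_vector_derivative h y) (at y)"
    proof -
      have 1: "((\<lambda>y. y ^ Suc m) has_real_derivative (1 + real m) * y ^ m) (at y)"
        using DERIV_pow[of "Suc m" y] by simp
      have 2: "((\<lambda>y. ?e y) has_real_derivative ?e y * (- l - c * y)) (at y)"
        by (auto intro!: derivative_eq_intros)
      have "(H has_real_derivative ((1 + real m) * y ^ m * ?e y +
          ?e y * (- l - c * y) * y ^ Suc m) * G y +
          G' y * (y ^ Suc m * ?e y)) (at y)"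
        unfolding H_def by (intro DERIV_mult 1 2 G)
      moreover have "((1 + real m) * y ^ m * ?e y +
          ?e y * (- l - c * y) * y ^ Suc m) * G y +
          G' y * (y ^ Suc m * ?e y) = h y"
        unfolding h_def power2_eq_square power_Suc by algebra
      ultimately show ?thesis by (simp add: has_real_derivative_iff_has_vector_derivative)
    qed
    show "isCont h y"
    proof -
      have "continuous_on UNIV h" unfolding h_def by (intro continuous_intros contG G') auto
      then show ?thesis by (simp add: continuous_on_eq_continuous_at)
    qed
  next
    show "set_integrable lborel (einterval 0 \<infinity>) h"
      unfolding set_integrable_def E
    proof (rule integrable_cong_AE_imp[OF int])
      show "(\<lambda>y. indicator {0<..} y *\<^sub>R h y) \<in> borel_measurable lborel" unfolding h_def by measurable
      show "AE y in lborel. ?F y * weight m l c y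
          = indicator {0<..} y *\<^sub>R h y"
        using nz by eventually_elim (rule hw[symmetric])
    qed
    show "((H \<circ> real_of_ereal) \<longlongrightarrow> 0) (at_right 0)"
      using H0 by (simp add: zero_ereal_def ereal_tendsto_simps)
    show "((H \<circ> real_of_ereal) \<longlongrightarrow> 0) (at_left \<infinity>)"
      using Hinf by (simp add: ereal_tendsto_simps)
  qed auto
  moreover have "(LINT y|lborel. indicator {0<..} y *\<^sub>R h y) =
      (LINT y|lborel. ?F y * weight m l c y)"
  proof (rule integral_cong_AE)
    show "AE y in lborel. indicator {0<..} y *\<^sub>R h y =
        ?F y * weight m l c y"
      using nz by eventually_elim (rule hw)
    show "(\<lambda>y. indicator {0<..} y *\<^sub>R h y) \<in> borel_measurable lborel" unfolding h_def by measurable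
  qed (use int in auto)
  ultimately show ?thesis
    unfolding interval_lebesgue_integral_def set_lebesgue_integral_def E by simp
qed

text \<open>Fubini isolates the coordinate k. The other coordinates enter the one-dimensional
  identity only through the constants P^K1 and P^K2 in the growth bounds.\<close>

lemma weight_ibp:
  assumes k: "k < N" and w: "rapid (weight m l c)"
    and g: "polyb N g" and g': "polyb N g'"
    and deriv: "\<And>x y. ((\<lambda>y. g (x(k := y))) has_real_derivative g' (x(k := y))) (at y)"
    and cont: "\<And>x. continuous_on UNIV (\<lambda>y. g' (x(k := y)))"
  shows "(LINT x|Leb N. ((1 + real m) * g x + x k * g' x - (l * x k + c * (x k)^2) * g x) *
            (\<Prod>i<N. weight m l c (x i))) = 0"
proof -
  let ?I = "{..<N} - {k}"
  let ?f = "\<lambda>x. ((1 + real m) * g x + x k * g' x - (l * x k + c * (x k)^2) * g x)"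
  have ins: "insert k ?I = {..<N}" using k by auto
  have pf: "polyb N ?f"
    using k by (simp only: power2_eq_square) (intro polyb_add polyb_diff polyb_mult polyb_const polyb_component g g')
  have int: "integrable (Leb N) (\<lambda>x. ?f x * (\<Prod>i<N. weight m l c (x i)))"
    by (rule rapid_prod_integrable[OF pf w])
  from g obtain C1 K1 where C1: "C1 \<ge> 0" "\<And>x. \<bar>g x\<bar> \<le> C1 * (\<Prod>i<N. (1 + \<bar>x i\<bar>)) ^ K1"
    unfolding polyb_def by metis
  from g' obtain C2 K2 where C2: "C2 \<ge> 0" "\<And>x. \<bar>g' x\<bar> \<le> C2 * (\<Prod>i<N. (1 + \<bar>x i\<bar>)) ^ K2"
    unfolding polyb_def by metis
  have "(LINT x|Leb N. ?f x * (\<Prod>i<N. weight m l c (x i)))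
      = (LINT x|(\<Pi>\<^sub>M i\<in>?I. lborel :: real measure). LINT y|lborel. ?f (x(k := y)) * (\<Prod>i<N. weight m l c ((x(k := y)) i)))"
    using Leb.product_integral_insert[of ?I k, unfolded ins, OF _ _ int] by simp
  also have "\<dots> = (LINT x|(\<Pi>\<^sub>M i\<in>?I. lborel :: real measure). (0::real))"
  proof (rule Bochner_Integration.integral_cong[OF refl])
    fix x :: "nat \<Rightarrow> real"
    define P where "P = (\<Prod>i\<in>?I. (1 + \<bar>x i\<bar>))"
    have P1: "P \<ge> 1" unfolding P_def by (intro prod_ge_1) auto
    have prodk: "(\<Prod>i<N. (1 + \<bar>(x(k := y)) i\<bar>)) = (1 + \<bar>y\<bar>) * P" for y
      unfolding P_def using k by (subst prod.remove[of "{..<N}" k]) (auto intro!: prod.cong)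
    have wk: "(\<Prod>i<N. weight m l c ((x(k := y)) i)) = weight m l c y * (\<Prod>i\<in>?I. weight m l c (x i))" for y
      using k by (subst prod.remove[of "{..<N}" k]) (auto intro!: prod.cong)
    let ?C = "C1 * P ^ K1 + C2 * P ^ K2"
    have le: "C * ((1 + \<bar>y\<bar>) * P) ^ K \<le> ?C * (1 + \<bar>y\<bar>) ^ (K1 + K2)"
      if "C = C1 \<and> K = K1 \<or> C = C2 \<and> K = K2" for C K y
    proof -
      have "C * ((1 + \<bar>y\<bar>) * P) ^ K = (C * P ^ K) * (1 + \<bar>y\<bar>) ^ K" by (simp add: power_mult_distrib)
      also have "\<dots> \<le> ?C * (1 + \<bar>y\<bar>) ^ (K1 + K2)"
        using that C1(1) C2(1) P1 by (intro mult_mono power_increasing) auto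
      finally show ?thesis .
    qed
    have "(LINT y|lborel. ((1 + real m) * g (x(k := y)) + y * g' (x(k := y))
        - (l * y + c * y^2) * g (x(k := y))) * weight m l c y) = 0"
    proof (rule weight_ibp_1d[OF w deriv cont])
      show "\<bar>g (x(k := y))\<bar> \<le> ?C * (1 + \<bar>y\<bar>) ^ (K1 + K2)" for y
        using C1(2)[of "x(k := y)"] unfolding prodk using le[of C1 K1 y] by linarith
      show "\<bar>g' (x(k := y))\<bar> \<le> ?C * (1 + \<bar>y\<bar>) ^ (K1 + K2)" for y
        using C2(2)[of "x(k := y)"] unfolding prodk using le[of C2 K2 y] by linarith
    qed
    then show "(LINT y|lborel. ?f (x(k := y)) * (\<Prod>i<N. weight m l c ((x(k := y)) i))) = 0"
      unfolding wk by (simp add: mult.assoc[symmetric])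
  qed
  finally show ?thesis by simp
qed

lemma polyb_vand:
  assumes "\<beta> \<ge> 0" "e \<ge> 0"
  shows "polyb N (vand \<beta> e N)"
proof -
  have "polyb N (\<lambda>x. \<Prod>p\<in>pairs N. ((x (fst p) - x (snd p))^2 + e) powr \<beta>)"
    using assms by (intro polyb_prod polyb_powr polyb_add polyb_const)
      (auto simp: power2_eq_square pairs_def intro!: polyb_mult polyb_diff polyb_component)
  then show ?thesis by (simp add: vand_def[abs_def] case_prod_beta)
qed

lemma vand_nonneg: "vand \<beta> e N x \<ge> 0"
  unfolding vand_def by (intro prod_nonneg) auto

lemma vand_mono:
  assumes "\<beta> \<ge> 0" "0 \<le> e" "e \<le> e'"
  shows "vand \<beta> e N x \<le> vand \<beta> e' N x"
  unfolding vand_def using assms by (intro prod_mono) (auto intro!: powr_mono2)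

lemma vand_tendsto:
  assumes "\<beta> > 0" "e \<longlonglongrightarrow> 0" "\<And>n. e n \<ge> 0"
  shows "(\<lambda>n::nat. vand \<beta> (e n) N x) \<longlonglongrightarrow> vand \<beta> 0 N x"
proof -
  have "(\<lambda>n. ((x i - x j)^2 + e n) powr \<beta>) \<longlonglongrightarrow> ((x i - x j)^2 + 0) powr \<beta>" for i j
    using assms by (intro tendsto_powr2 tendsto_intros) (auto intro!: always_eventually)
  then show ?thesis unfolding vand_def case_prod_beta by (intro tendsto_prod) auto
qed

lemma vand_transpose:
  assumes "j < N" "k < N"
  shows "vand \<beta> e N (\<lambda>i\<in>{..<N}. x (Transposition.transpose j k i)) = vand \<beta> e N x"
proof -
  let ?t = "Transposition.transpose j k"
  \<comment> \<open>A transposition may reverse the order of a pair; sorting the image by min and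
    max gives an involution of \<open>pairs N\<close>, and the squared differences do not notice the
    sorting.\<close>
  let ?s = "\<lambda>(a, b). (min (?t a) (?t b), max (?t a) (?t b))"
  have t: "?t i < N \<longleftrightarrow> i < N" for i using assms by (auto simp: Transposition.transpose_def)
  have inj: "?t a = ?t b \<longleftrightarrow> a = b" for a b by (metis transpose_involutory)
  have s: "?s p \<in> pairs N" "?s (?s p) = p" if "p \<in> pairs N" for p
  proof -
    from that obtain a b where p: "p = (a, b)" "a < b" "b < N" by (auto simp: pairs_def)
    have "?t a \<noteq> ?t b" using p inj by auto
    then consider "?t a < ?t b" | "?t b < ?t a" by linarith
    then show "?s p \<in> pairs N" "?s (?s p) = p"
      by (cases; use p t[of a] t[of b] in \<open>auto simp: pairs_def min_def max_def\<close>)+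
  qed
  show ?thesis unfolding vand_def
  proof (rule prod.reindex_bij_witness[of _ ?s ?s])
    fix p assume p: "p \<in> pairs N"
    then obtain a b where ab: "p = (a, b)" "a < b" "b < N" by (auto simp: pairs_def)
    show "(case ?s p of (i, j) \<Rightarrow> ((x i - x j)^2 + e) powr \<beta>) = (case p of (i, j) \<Rightarrow>
       (((\<lambda>i\<in>{..<N}. x (?t i)) i - (\<lambda>i\<in>{..<N}. x (?t i)) j)^2 + e) powr \<beta>)"
      using ab by (auto simp: min_def max_def power2_commute)
  qed (use s in auto)
qed

lemma prod_transpose:
  assumes "j < N" "k < N"
  shows "(\<Prod>i<N. f ((\<lambda>i\<in>{..<N}. x (Transposition.transpose j k i)) i)) = (\<Prod>i<N. (f (x i) :: real))"
proof -
  have "(\<Prod>i<N. f ((\<lambda>i\<in>{..<N}. x (Transposition.transpose j k i)) i)) = (\<Prod>i<N. f (x (Transposition.transpose j k i)))"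
    by (intro prod.cong) auto
  also have "\<dots> = (\<Prod>i<N. f (x i))"
    using prod.permute[OF permutes_swap_id[of j "{..<N}" k], of "\<lambda>i. f (x i)"] assms by (simp add: comp_def)
  finally show ?thesis .
qed

text \<open>Not divided by the total mass: an unnormalised integral, so that different weights can
  be compared directly.\<close>

definition avg :: "real \<Rightarrow> real \<Rightarrow> nat \<Rightarrow> (real \<Rightarrow> real) \<Rightarrow> ((nat \<Rightarrow> real) \<Rightarrow> real) \<Rightarrow> real" where
  "avg \<beta> e N w g = (LINT x|Leb N. g x * vand \<beta> e N x * (\<Prod>i<N. w (x i)))"

lemma avg_integrable:
  assumes "\<beta> \<ge> 0" "e \<ge> 0" "rapid w" "polyb N g"
  shows "integrable (Leb N) (\<lambda>x. g x * vand \<beta> e N x * (\<Prod>i<N. w (x i)))"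
  by (intro rapid_prod_integrable polyb_mult polyb_vand assms)

lemma avg_add:
  assumes "\<beta> \<ge> 0" "e \<ge> 0" "rapid w" "polyb N f" "polyb N g"
  shows "avg \<beta> e N w (\<lambda>x. f x + g x) = avg \<beta> e N w f + avg \<beta> e N w g"
  unfolding avg_def distrib_right
  by (intro Bochner_Integration.integral_add avg_integrable assms)

lemma avg_cmult: "avg \<beta> e N w (\<lambda>x. c * f x) = c * avg \<beta> e N w f"
  unfolding avg_def by (simp add: mult.assoc)

lemma avg_diff:
  assumes "\<beta> \<ge> 0" "e \<ge> 0" "rapid w" "polyb N f" "polyb N g"
  shows "avg \<beta> e N w (\<lambda>x. f x - g x) = avg \<beta> e N w f - avg \<beta> e N w g"
  using avg_add[OF assms(1-4) polyb_mult[OF polyb_const[of N "-1"] assms(5)]]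
    avg_cmult[of \<beta> e N w "-1" g] by simp

lemma avg_sum:
  assumes "\<beta> \<ge> 0" "e \<ge> 0" "rapid w" "\<And>i. i \<in> I \<Longrightarrow> polyb N (f i)"
  shows "avg \<beta> e N w (\<lambda>x. \<Sum>i\<in>I. f i x) = (\<Sum>i\<in>I. avg \<beta> e N w (f i))"
  using assms(4)
proof (induction I rule: infinite_finite_induct)
  case (insert i I)
  then show ?case by (simp add: avg_add[OF assms(1-3)] polyb_sum)
qed (auto simp: avg_def)

lemma avg_transpose:
  assumes "\<beta> \<ge> 0" "e \<ge> 0" "rapid w" "polyb N g" "j < N" "k < N"
  shows "avg \<beta> e N w g = avg \<beta> e N w (\<lambda>x. g (\<lambda>i\<in>{..<N}. x (Transposition.transpose j k i)))"
proof -
  have "(\<lambda>x. g x * vand \<beta> e N x * (\<Prod>i<N. w (x i))) \<in> borel_measurable (Leb N)"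
    by (intro borel_measurable_integrable avg_integrable assms)
  from Leb_integral_swap[OF assms(5,6) this] show ?thesis
    unfolding avg_def vand_transpose[OF assms(5,6)] prod_transpose[OF assms(5,6)] .
qed

lemma avg_cong:
  assumes "\<And>x. x \<in> space (Leb N) \<Longrightarrow> f x = g x"
  shows "avg \<beta> e N w f = avg \<beta> e N w g"
  unfolding avg_def by (intro Bochner_Integration.integral_cong) (auto simp: assms)

lemma vand_deriv:
  assumes k: "k < N" and e: "e > 0"
  shows "((\<lambda>y. vand \<beta> e N (x(k := y))) has_real_derivative
     vand \<beta> e N (x(k := y)) * (\<Sum>j\<in>{..<N} - {k}. 2 * \<beta> * (y - x j) / ((y - x j)^2 + e))) (at y)"
proof -
  have pos: "(a::real)^2 + e > 0" for a using e by (simp add: add_nonneg_pos)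
  let ?f = "\<lambda>j. 2 * \<beta> * (y - x j) / ((y - x j)^2 + e)"
  let ?L = "\<lambda>y. \<Sum>p\<in>pairs N. \<beta> * ln (((x(k := y)) (fst p) - (x(k := y)) (snd p))^2 + e)"
  let ?D = "\<lambda>p. if fst p = k then ?f (snd p) else if snd p = k then ?f (fst p) else 0"
  have v: "vand \<beta> e N z = exp (\<Sum>p\<in>pairs N. \<beta> * ln ((z (fst p) - z (snd p))^2 + e))" for z
    unfolding vand_def by (subst exp_sum) (auto simp: powr_def pos less_imp_neq[symmetric] case_prod_beta)
  have 1: "(?L has_real_derivative (\<Sum>p\<in>pairs N. ?D p)) (at y)"
  proof (rule DERIV_sum)
    fix p assume p: "p \<in> pairs N"
    then have ne: "fst p \<noteq> snd p" by (auto simp: pairs_def)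
    note q = pos[of "y - x (snd p)"] pos[of "x (fst p) - y"]
    consider "fst p = k" | "fst p \<noteq> k" "snd p = k" | "fst p \<noteq> k" "snd p \<noteq> k" by blast
    then show "((\<lambda>y. \<beta> * ln (((x(k := y)) (fst p) - (x(k := y)) (snd p))^2 + e)) has_real_derivative ?D p) (at y)"
    proof cases
      case 1
      then show ?thesis using ne q(1)
        by (auto intro!: derivative_eq_intros)
    next
      case 2
      have "2 * (x (fst p) - y) * (- 1) * \<beta> / ((x (fst p) - y)^2 + e) = ?f (fst p)"
        by (simp add: power2_commute[of y] algebra_simps)
      with 2 show ?thesis using ne q(2)
        by (auto intro!: derivative_eq_intros simp: power2_commute[of y] algebra_simps)
    qed auto
  qed
  have 2: "(\<Sum>p\<in>pairs N. ?D p) = (\<Sum>j\<in>{..<N} - {k}. ?f j)"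
  proof -
    have "(\<Sum>p\<in>pairs N. ?D p) = (\<Sum>p\<in>{p\<in>pairs N. fst p = k \<or> snd p = k}. ?D p)"
      by (rule sum.mono_neutral_right) auto
    also have "\<dots> = (\<Sum>j\<in>{..<N} - {k}. ?f j)"
      by (rule sum.reindex_bij_witness[of _ "\<lambda>j. (min j k, max j k)" "\<lambda>p. if fst p = k then snd p else fst p"])
         (use k in \<open>auto simp: pairs_def min_def max_def\<close>)
    finally show ?thesis .
  qed
  show ?thesis
    unfolding v using DERIV_chain2[OF DERIV_exp 1] unfolding 2 by simp
qed

lemma polyb_frac:
  assumes "j < N" "k < N" "e > 0"
  shows "polyb N (\<lambda>x. (x k - x j) / ((x k - x j)^2 + e))"
    and "polyb N (\<lambda>x. (x k - x j)\<^sup>2 / ((x k - x j)^2 + e))"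
proof -
  have pos: "(a::real)^2 + e > 0" for a using assms by (simp add: add_nonneg_pos)
  have meas: "(\<lambda>x. x k - x j) \<in> borel_measurable (Leb N)" using assms by auto
  show "polyb N (\<lambda>x. (x k - x j) / ((x k - x j)^2 + e))"
  proof (rule polyb_le[of N "\<lambda>x. (1 / e) * (x k - x j)"])
    show "polyb N (\<lambda>x. (1 / e) * (x k - x j))"
      using assms by (intro polyb_mult polyb_diff polyb_const polyb_component)
    show "\<bar>(x k - x j) / ((x k - x j)^2 + e)\<bar> \<le> \<bar>(1 / e) * (x k - x j)\<bar>" for x
      using assms pos[of "x k - x j"]
      by (simp add: abs_mult abs_divide) (intro divide_left_mono mult_pos_pos; simp)
  qed (use meas in measurable)
  show "polyb N (\<lambda>x. (x k - x j)\<^sup>2 / ((x k - x j)^2 + e))"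
  proof (rule polyb_le[of N "\<lambda>x. 1", OF polyb_const])
    show "\<bar>(x k - x j)\<^sup>2 / ((x k - x j)^2 + e)\<bar> \<le> \<bar>1\<bar>" for x
      using assms pos[of "x k - x j"] by (simp add: divide_le_eq)
  qed (use meas in measurable)
qed

context
  fixes \<beta> :: real and N m :: nat and l c :: real
  assumes \<beta>: "\<beta> > 0" and lc: "c > 0 \<or> (c = 0 \<and> l > 0)"
begin

abbreviation "W \<equiv> weight m l c"

lemma rapid_W: "rapid W" by (rule rapid_weight[OF lc])

text \<open>For j < k the polynomial factor is the product over all i \<le> k, which is invariant
  under exchanging j and k, while the quotient changes sign.\<close>

lemma avg_antisym:
  assumes e: "e > 0" and k: "k < N" and j: "j < k"
  shows "avg \<beta> e N W (\<lambda>x. x k * (\<Prod>i<k. x i) * ((x k - x j) / ((x k - x j)^2 + e))) = 0"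
    (is "?A = 0")
proof -
  have q: "x k * (\<Prod>i<k. x i) = (\<Prod>i<Suc k. x i)" for x :: "nat \<Rightarrow> real" by (simp add: mult_ac)
  have jN: "j < N" using k j by simp
  have pb: "polyb N (\<lambda>x. x k * (\<Prod>i<k. x i) * ((x k - x j) / ((x k - x j)^2 + e)))"
    using k jN e by (intro polyb_mult polyb_prod polyb_component polyb_frac) auto
  have "?A = avg \<beta> e N W (\<lambda>x. (-1) * (x k * (\<Prod>i<k. x i) * ((x k - x j) / ((x k - x j)^2 + e))))"
  proof (subst avg_transpose[OF _ _ rapid_W pb jN k], goal_cases)
    case 3
    show ?case
    proof (rule avg_cong)
      fix x :: "nat \<Rightarrow> real"
      let ?y = "\<lambda>i\<in>{..<N}. x (Transposition.transpose j k i)"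
      have "(\<Prod>i<Suc k. ?y i) = (\<Prod>i<Suc k. x (Transposition.transpose j k i))"
        using k by (intro prod.cong) auto
      also have "\<dots> = (\<Prod>i<Suc k. x i)"
        using prod.permute[OF permutes_swap_id[of j "{..<Suc k}" k], of x] j by (simp add: comp_def)
      finally have p: "?y k * (\<Prod>i<k. ?y i) = x k * (\<Prod>i<k. x i)" unfolding q .
      have y: "?y k = x j" "?y j = x k" using k jN by auto
      have s: "(x j - x k) / ((x j - x k)^2 + e) = - ((x k - x j) / ((x k - x j)^2 + e))"
        by (simp add: power2_commute minus_divide_left)
      show "?y k * (\<Prod>i<k. ?y i) * ((?y k - ?y j) / ((?y k - ?y j)^2 + e)) =
         - 1 * (x k * (\<Prod>i<k. x i) * ((x k - x j) / ((x k - x j)^2 + e)))"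
        unfolding p unfolding y s by simp
    qed
  qed (use \<beta> e in auto)
  then show ?thesis unfolding avg_cmult by simp
qed

text \<open>For j > k the exchange turns x_k in front of the product into x_j and flips the sign of
  the quotient. Averaging both forms puts x_k - x_j into the numerator, which tames the pole of the
  logarithmic derivative as e tends to 0.\<close>

lemma avg_symmetrise:
  assumes e: "e > 0" and j: "j < N" and k: "k < j"
  shows "avg \<beta> e N W (\<lambda>x. x k * (\<Prod>i<k. x i) * ((x k - x j) / ((x k - x j)^2 + e)))
     = (1 / 2) * avg \<beta> e N W (\<lambda>x. (\<Prod>i<k. x i) * ((x k - x j)^2 / ((x k - x j)^2 + e)))"
    (is "?A = _ * ?B")
proof -
  have kN: "k < N" using k j by simp
  have pb: "polyb N (\<lambda>x. x k * (\<Prod>i<k. x i) * ((x k - x j) / ((x k - x j)^2 + e)))"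
    and pb': "polyb N (\<lambda>x. x j * (\<Prod>i<k. x i) * ((x k - x j) / ((x k - x j)^2 + e)))"
    using kN j e by (intro polyb_mult polyb_prod polyb_component polyb_frac; auto)+
  have "?A = avg \<beta> e N W (\<lambda>x. (-1) * (x j * (\<Prod>i<k. x i) * ((x k - x j) / ((x k - x j)^2 + e))))"
  proof (subst avg_transpose[OF _ _ rapid_W pb j kN], goal_cases)
    case 3
    show ?case
    proof (rule avg_cong)
      fix x :: "nat \<Rightarrow> real"
      let ?y = "\<lambda>i\<in>{..<N}. x (Transposition.transpose j k i)"
      have p: "(\<Prod>i<k. ?y i) = (\<Prod>i<k. x i)"
        using k kN by (intro prod.cong) (auto simp: Transposition.transpose_def)
      have y: "?y k = x j" "?y j = x k" using kN j by auto
      have s: "(x j - x k) / ((x j - x k)^2 + e) = - ((x k - x j) / ((x k - x j)^2 + e))"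
        by (simp add: power2_commute minus_divide_left)
      show "?y k * (\<Prod>i<k. ?y i) * ((?y k - ?y j) / ((?y k - ?y j)^2 + e)) =
         - 1 * (x j * (\<Prod>i<k. x i) * ((x k - x j) / ((x k - x j)^2 + e)))"
        unfolding p unfolding y s by simp
    qed
  qed (use \<beta> e in auto)
  also have "\<dots> = - avg \<beta> e N W (\<lambda>x. x j * (\<Prod>i<k. x i) * ((x k - x j) / ((x k - x j)^2 + e)))"
    unfolding avg_cmult by simp
  finally have 1: "?A = \<dots>" .
  have "?A - avg \<beta> e N W (\<lambda>x. x j * (\<Prod>i<k. x i) * ((x k - x j) / ((x k - x j)^2 + e))) = ?B"
  proof (subst avg_diff[OF _ _ rapid_W pb pb', symmetric], goal_cases)
    case 3
    show ?case
      by (rule avg_cong, unfold power2_eq_square times_divide_eq_right diff_divide_distrib[symmetric])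
         (simp add: algebra_simps)
  qed (use \<beta> e in auto)
  with 1 show ?thesis by simp
qed

text \<open>Integration by parts in the coordinate k, which does not occur in the product over i <
  k. Of the interaction terms, those with j < k vanish by antisymmetry, and those with j > k keep
  the factor 2 \<beta> * (1 / 2) = \<beta>.\<close>

lemma aomoto_regularised:
  assumes e: "e > 0" and k: "k < N"
  shows "(1 + real m) * avg \<beta> e N W (\<lambda>x. \<Prod>i<k. x i)
     + \<beta> * (\<Sum>j\<in>{k<..<N}. avg \<beta> e N W (\<lambda>x. (\<Prod>i<k. x i) * ((x k - x j)^2 / ((x k - x j)^2 + e))))
     - l * avg \<beta> e N W (\<lambda>x. \<Prod>i<Suc k. x i) - c * avg \<beta> e N W (\<lambda>x. (\<Prod>i<k. x i) * (x k * x k)) = 0"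
proof -
  let ?q = "\<lambda>x. \<Prod>i<k. x i :: real"
  let ?F = "\<lambda>j x. (x k - x j) / ((x k - x j)^2 + e)"
  let ?g = "\<lambda>x. ?q x * vand \<beta> e N x"
  let ?g' = "\<lambda>x. ?q x * vand \<beta> e N x * (\<Sum>j\<in>{..<N} - {k}. 2 * \<beta> * ?F j x)"
  have b: "\<beta> \<ge> 0" "e \<ge> 0" using \<beta> e by auto
  have pq: "polyb N ?q" using k by (intro polyb_prod polyb_component) auto
  have pg: "polyb N ?g" by (intro polyb_mult pq polyb_vand b)
  have pF: "polyb N (?F j)" if "j < N" for j using that k e by (intro polyb_frac) auto
  have pg': "polyb N ?g'"
    by (intro polyb_mult pq polyb_vand b polyb_sum polyb_const pF) auto
  have qk: "?q (x(k := y)) = ?q x" for x y by (intro prod.cong) auto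
  have d: "((\<lambda>y. ?g (x(k := y))) has_real_derivative ?g' (x(k := y))) (at y)" for x y
  proof -
    have "(\<Sum>j\<in>{..<N} - {k}. 2 * \<beta> * ?F j (x(k := y))) = (\<Sum>j\<in>{..<N} - {k}. 2 * \<beta> * (y - x j) / ((y - x j)^2 + e))"
      by (intro sum.cong) auto
    then show ?thesis unfolding qk
      using DERIV_cmult[OF vand_deriv[OF k e, of \<beta> x y], of "?q x"] by (simp only: mult.assoc)
  qed
  have pos: "(a::real)^2 + e \<noteq> 0" for a using e by (smt (verit) zero_le_power2)
  have contv: "continuous_on UNIV (\<lambda>y. vand \<beta> e N (x(k := y)))" for x
    by (rule DERIV_continuous_on[OF DERIV_subset[OF vand_deriv[OF k e]]]) auto
  have cont: "continuous_on UNIV (\<lambda>y. ?g' (x(k := y)))" for x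
  proof -
    have "(\<Sum>j\<in>{..<N} - {k}. 2 * \<beta> * ?F j (x(k := y))) = (\<Sum>j\<in>{..<N} - {k}. 2 * \<beta> * ((y - x j) / ((y - x j)^2 + e)))" for y
      by (intro sum.cong) auto
    then show ?thesis unfolding qk
      by (simp only:) (intro continuous_intros contv, auto simp: pos)
  qed
  have "(LINT x|Leb N. ((1 + real m) * ?g x + x k * ?g' x - (l * x k + c * (x k)^2) * ?g x) *
            (\<Prod>i<N. weight m l c (x i))) = 0"
    by (rule weight_ibp[OF k rapid_W pg pg' d cont])
  also have "(LINT x|Leb N. ((1 + real m) * ?g x + x k * ?g' x - (l * x k + c * (x k)^2) * ?g x) *
            (\<Prod>i<N. weight m l c (x i)))
     = avg \<beta> e N W (\<lambda>x. (1 + real m) * ?q x + 2 * \<beta> * (\<Sum>j\<in>{..<N} - {k}. x k * ?q x * ?F j x)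
          - l * (\<Prod>i<Suc k. x i) - c * (?q x * (x k * x k)))"
    unfolding avg_def
    by (intro Bochner_Integration.integral_cong refl)
       (simp add: algebra_simps power2_eq_square sum_distrib_left sum_distrib_right)
  also have "\<dots> = (1 + real m) * avg \<beta> e N W ?q + 2 * \<beta> * (\<Sum>j\<in>{..<N} - {k}. avg \<beta> e N W (\<lambda>x. x k * ?q x * ?F j x))
       - l * avg \<beta> e N W (\<lambda>x. \<Prod>i<Suc k. x i) - c * avg \<beta> e N W (\<lambda>x. ?q x * (x k * x k))"
  proof -
    have p1: "polyb N (\<lambda>x. \<Sum>j\<in>{..<N} - {k}. x k * ?q x * ?F j x)"
      using k by (intro polyb_sum polyb_mult polyb_component pq pF) auto
    have p2: "polyb N (\<lambda>x. \<Prod>i<Suc k. x i)" using k by (intro polyb_prod polyb_component) auto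
    have p3: "polyb N (\<lambda>x. ?q x * (x k * x k))" using k by (intro polyb_mult polyb_component pq) auto
    have s: "avg \<beta> e N W (\<lambda>x. \<Sum>j\<in>{..<N} - {k}. x k * ?q x * ?F j x) = (\<Sum>j\<in>{..<N} - {k}. avg \<beta> e N W (\<lambda>x. x k * ?q x * ?F j x))"
      using k by (intro avg_sum b rapid_W polyb_mult polyb_component pq pF) auto
    show ?thesis
      by (subst avg_diff avg_add, rule b, rule b, rule rapid_W,
          (intro polyb_add polyb_diff polyb_mult polyb_const pq p1 p2 p3)+)+
         (simp only: avg_cmult s)
  qed
  also have "(\<Sum>j\<in>{..<N} - {k}. avg \<beta> e N W (\<lambda>x. x k * ?q x * ?F j x))
      = (\<Sum>j\<in>{k<..<N}. avg \<beta> e N W (\<lambda>x. x k * ?q x * ?F j x))"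
  proof (rule sum.mono_neutral_right)
    show "\<forall>j\<in>{..<N} - {k} - {k<..<N}. avg \<beta> e N W (\<lambda>x. x k * ?q x * ?F j x) = 0"
      by (intro ballI avg_antisym[OF e k]) auto
  qed auto
  also have "\<dots> = (\<Sum>j\<in>{k<..<N}. (1 / 2) * avg \<beta> e N W (\<lambda>x. ?q x * ((x k - x j)^2 / ((x k - x j)^2 + e))))"
    by (intro sum.cong refl avg_symmetrise e) auto
  finally show ?thesis unfolding sum_distrib_left[symmetric] by simp
qed

text \<open>Domination comes from monotonicity in the regularisation: the Vandermonde factor at 1 /
  (n + 1) is at most its value at e = 1.\<close>

lemma avg_limit:
  assumes g: "\<And>n. polyb N (g n)" and G: "polyb N G" and h: "polyb N h"
    and bound: "\<And>n x. \<bar>g n x\<bar> \<le> \<bar>h x\<bar>"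
    and lim: "\<And>x. (\<lambda>n. g n x * vand \<beta> (1 / Suc n) N x) \<longlonglongrightarrow> G x * vand \<beta> 0 N x"
  shows "(\<lambda>n. avg \<beta> (1 / Suc n) N W (g n)) \<longlonglongrightarrow> avg \<beta> 0 N W G"
  unfolding avg_def
proof (rule integral_dominated_convergence[where w = "\<lambda>x. \<bar>h x * vand \<beta> 1 N x * (\<Prod>i<N. W (x i))\<bar>"])
  show "integrable (Leb N) (\<lambda>x. \<bar>h x * vand \<beta> 1 N x * (\<Prod>i<N. W (x i))\<bar>)"
    using \<beta> by (intro integrable_abs avg_integrable rapid_W h) auto
  show "(\<lambda>x. G x * vand \<beta> 0 N x * (\<Prod>i<N. W (x i))) \<in> borel_measurable (Leb N)"
    using \<beta> by (intro borel_measurable_integrable avg_integrable rapid_W G) auto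
  show "(\<lambda>x. g n x * vand \<beta> (1 / Suc n) N x * (\<Prod>i<N. W (x i))) \<in> borel_measurable (Leb N)" for n
    using \<beta> by (intro borel_measurable_integrable avg_integrable rapid_W g) auto
  show "AE x in Leb N. (\<lambda>n. g n x * vand \<beta> (1 / Suc n) N x * (\<Prod>i<N. W (x i)))
      \<longlonglongrightarrow> G x * vand \<beta> 0 N x * (\<Prod>i<N. W (x i))"
    by (intro AE_I2 tendsto_mult lim tendsto_const)
  show "AE x in Leb N. norm (g n x * vand \<beta> (1 / Suc n) N x * (\<Prod>i<N. W (x i)))
      \<le> \<bar>h x * vand \<beta> 1 N x * (\<Prod>i<N. W (x i))\<bar>" for n
    unfolding real_norm_def abs_mult
    using \<beta> vand_mono[of \<beta> "1 / Suc n" 1 N] vand_nonneg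
    by (intro AE_I2 mult_right_mono mult_mono bound) auto
qed

text \<open>For c = 0 this is a two-term recursion and evaluates Laguerre moments. For c > 0 it
  expresses the integral with a squared coordinate by the moments with k and k + 1 factors, which is
  what closes the system in \<open>mom_deriv\<close>.\<close>

lemma aomoto:
  assumes k: "k < N"
  shows "(1 + real m + \<beta> * real (N - 1 - k)) * avg \<beta> 0 N W (\<lambda>x. \<Prod>i<k. x i)
     = l * avg \<beta> 0 N W (\<lambda>x. \<Prod>i<Suc k. x i) + c * avg \<beta> 0 N W (\<lambda>x. (\<Prod>i<k. x i) * (x k * x k))"
proof -
  let ?q = "\<lambda>x. \<Prod>i<k. x i :: real"
  have pq: "polyb N ?q" using k by (intro polyb_prod polyb_component) auto
  have p2: "polyb N (\<lambda>x. \<Prod>i<Suc k. x i)" using k by (intro polyb_prod polyb_component) auto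
  have p3: "polyb N (\<lambda>x. ?q x * (x k * x k))" using k by (intro polyb_mult polyb_component pq) auto
  have vl: "(\<lambda>n. vand \<beta> (1 / Suc n) N x) \<longlonglongrightarrow> vand \<beta> 0 N x" for x
    by (intro vand_tendsto \<beta> lim_inverse_n'[THEN LIMSEQ_Suc]) auto
  have L: "(\<lambda>n. avg \<beta> (1 / Suc n) N W g) \<longlonglongrightarrow> avg \<beta> 0 N W g" if "polyb N g" for g
    by (rule avg_limit[OF that that that]) (simp, intro tendsto_mult tendsto_const vl)
  have F: "(\<lambda>n. avg \<beta> (1 / Suc n) N W (\<lambda>x. ?q x * ((x k - x j)^2 / ((x k - x j)^2 + 1 / Suc n))))
      \<longlonglongrightarrow> avg \<beta> 0 N W ?q" if j: "j \<in> {k<..<N}" for j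
  proof (rule avg_limit[where h = ?q])
    show "polyb N (\<lambda>x. ?q x * ((x k - x j)^2 / ((x k - x j)^2 + 1 / Suc n)))" for n
      using j k by (intro polyb_mult pq polyb_frac) auto
    show "\<bar>?q x * ((x k - x j)^2 / ((x k - x j)^2 + 1 / Suc n))\<bar> \<le> \<bar>?q x\<bar>" for n x
    proof -
      have "\<bar>(x k - x j)\<^sup>2 / ((x k - x j)^2 + 1 / Suc n)\<bar> \<le> 1"
        by (auto simp: abs_divide divide_le_eq add_nonneg_pos)
      then show ?thesis unfolding abs_mult by (rule mult_left_le) simp
    qed
    show "(\<lambda>n. ?q x * ((x k - x j)^2 / ((x k - x j)^2 + 1 / Suc n)) * vand \<beta> (1 / Suc n) N x)
        \<longlonglongrightarrow> ?q x * vand \<beta> 0 N x" for x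
    \<comment> \<open>On the diagonal the quotient is 0 for all n and does not tend to 1, but there
      the limiting Vandermonde factor vanishes, so the pointwise limit holds everywhere.\<close>
    proof (cases "x k = x j")
      case True
      have "(k, j) \<in> pairs N" using j by (auto simp: pairs_def)
      then have "vand \<beta> 0 N x = 0" unfolding vand_def using True
        by (intro prod_zero) (auto intro!: bexI[of _ "(k, j)"])
      then show ?thesis using True by simp
    next
      case False
      then have "(\<lambda>n. (x k - x j)\<^sup>2 / ((x k - x j)^2 + 1 / Suc n)) \<longlonglongrightarrow> (x k - x j)\<^sup>2 / ((x k - x j)^2 + 0)"
        by (intro tendsto_intros lim_inverse_n'[THEN LIMSEQ_Suc]) auto
      then have "(\<lambda>n. (x k - x j)\<^sup>2 / ((x k - x j)^2 + 1 / Suc n)) \<longlonglongrightarrow> 1"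
        using False by simp
      from tendsto_mult[OF tendsto_mult[OF tendsto_const this] vl] show ?thesis by simp
    qed
  qed (use pq in auto)
  have "(\<lambda>n. (1 + real m) * avg \<beta> (1 / Suc n) N W ?q
     + \<beta> * (\<Sum>j\<in>{k<..<N}. avg \<beta> (1 / Suc n) N W (\<lambda>x. ?q x * ((x k - x j)^2 / ((x k - x j)^2 + 1 / Suc n))))
     - l * avg \<beta> (1 / Suc n) N W (\<lambda>x. \<Prod>i<Suc k. x i) - c * avg \<beta> (1 / Suc n) N W (\<lambda>x. ?q x * (x k * x k)))
     \<longlonglongrightarrow> (1 + real m) * avg \<beta> 0 N W ?q + \<beta> * (\<Sum>j\<in>{k<..<N}. avg \<beta> 0 N W ?q)
     - l * avg \<beta> 0 N W (\<lambda>x. \<Prod>i<Suc k. x i) - c * avg \<beta> 0 N W (\<lambda>x. ?q x * (x k * x k))"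
    by (intro tendsto_intros L pq p2 p3 F)
  moreover have "(1 + real m) * avg \<beta> (1 / Suc n) N W ?q
     + \<beta> * (\<Sum>j\<in>{k<..<N}. avg \<beta> (1 / Suc n) N W (\<lambda>x. ?q x * ((x k - x j)^2 / ((x k - x j)^2 + 1 / Suc n))))
     - l * avg \<beta> (1 / Suc n) N W (\<lambda>x. \<Prod>i<Suc k. x i) - c * avg \<beta> (1 / Suc n) N W (\<lambda>x. ?q x * (x k * x k)) = 0" for n
    by (rule aomoto_regularised) (use k in auto)
  ultimately have "(1 + real m) * avg \<beta> 0 N W ?q + \<beta> * (\<Sum>j\<in>{k<..<N}. avg \<beta> 0 N W ?q)
     - l * avg \<beta> 0 N W (\<lambda>x. \<Prod>i<Suc k. x i) - c * avg \<beta> 0 N W (\<lambda>x. ?q x * (x k * x k)) = 0"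
    by (simp add: LIMSEQ_const_iff)
  moreover have "card {k<..<N} = N - 1 - k" by simp
  ultimately show ?thesis by (simp add: algebra_simps)
qed

end

section \<open>The moments and their differential equation\<close>

definition mom :: "real \<Rightarrow> nat \<Rightarrow> real \<Rightarrow> real \<Rightarrow> nat \<Rightarrow> real" where
  "mom \<beta> N c l p = avg \<beta> 0 N (weight 0 l c) (\<lambda>x. \<Prod>i<p. x i)"

lemma vand_scale:
  assumes "s > 0"
  shows "vand \<beta> 0 N (\<lambda>i\<in>{..<N}. t + s * x i) = (s powr (2 * \<beta>)) ^ card (pairs N) * vand \<beta> 0 N x"
proof -
  have "vand \<beta> 0 N (\<lambda>i\<in>{..<N}. t + s * x i) = (\<Prod>p\<in>pairs N. s powr (2 * \<beta>) * ((x (fst p) - x (snd p))^2 + 0) powr \<beta>)"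
    unfolding vand_def case_prod_beta
  proof (rule prod.cong[OF refl])
    fix p assume "p \<in> pairs N"
    then have "fst p < N" "snd p < N" by (auto simp: pairs_def)
    then have "((\<lambda>i\<in>{..<N}. t + s * x i) (fst p) - (\<lambda>i\<in>{..<N}. t + s * x i) (snd p))^2 = s^2 * (x (fst p) - x (snd p))^2"
      by (simp add: power_mult_distrib[symmetric] algebra_simps)
    moreover have "s\<^sup>2 powr \<beta> = s powr (2 * \<beta>)"
      using assms by (simp add: powr_powr[symmetric])
    ultimately show "(((\<lambda>i\<in>{..<N}. t + s * x i) (fst p) - (\<lambda>i\<in>{..<N}. t + s * x i) (snd p))^2 + 0) powr \<beta>
        = s powr (2 * \<beta>) * ((x (fst p) - x (snd p))^2 + 0) powr \<beta>"
      by (simp add: powr_mult)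
  qed
  then show ?thesis by (simp add: prod.distrib vand_def case_prod_beta)
qed

lemma card_pairs: "real (card (pairs N)) = real N * (real N - 1) / 2"
proof -
  have "pairs N = (\<Union>j<N. (\<lambda>i. (i, j)) ` {..<j})" by (auto simp: pairs_def)
  also have "card \<dots> = (\<Sum>j<N. card ((\<lambda>i. (i, j)) ` {..<j}))"
    by (intro card_UN_disjoint) auto
  also have "\<dots> = (\<Sum>j<N. j)" by (intro sum.cong refl) (auto simp: card_image inj_on_def)
  also have "real \<dots> = real N * (real N - 1) / 2"
    by (induction N) (auto simp: field_simps)
  finally show ?thesis .
qed

lemma weight_exp: "weight m l c y = weight m l' c y * exp ((l' - l) * y)"
  by (simp add: weight_def exp_add[symmetric] algebra_simps)

lemma prod_weight_exp:
  fixes N :: nat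
  shows "(\<Prod>i<N. weight m l c (x i)) = (\<Prod>i<N. weight m l' c (x i)) * exp ((l' - l) * (\<Sum>i<N. x i))"
proof -
  have "(\<Prod>i<N. weight m l c (x i)) = (\<Prod>i<N. weight m l' c (x i) * exp ((l' - l) * x i))"
    by (intro prod.cong refl weight_exp)
  moreover have "exp ((l' - l) * (\<Sum>i<N. x i)) = (\<Prod>i<N. exp ((l' - l) * x i))"
    by (subst sum_distrib_left, rule exp_sum) simp
  ultimately show ?thesis by (simp only: prod.distrib)
qed

lemma prod_weight_pos:
  fixes N :: nat
  shows "(\<Prod>i<N. weight m l c (x i)) = 0 \<or> (\<forall>i<N. x i \<ge> 0)"
  by (auto simp: weight_def split: if_splits)

text \<open>On the support of the weight all coordinates are nonnegative, so the exponential factor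
  decreases in l, and the integrand at l - 1 dominates those at all t with |t - l| < 1.\<close>

lemma mom_deriv_avg:
  assumes \<beta>: "\<beta> > 0" and c: "c > 0" and p: "p \<le> N"
  shows "((\<lambda>l. mom \<beta> N c l p) has_real_derivative
      - avg \<beta> 0 N (weight 0 l c) (\<lambda>x. (\<Sum>i<N. x i) * (\<Prod>i<p. x i))) (at l)"
proof -
  let ?q = "\<lambda>x. \<Prod>i<p. x i :: real" and ?s = "\<lambda>x. \<Sum>i<N. x i :: real"
  let ?f = "\<lambda>l x. ?q x * vand \<beta> 0 N x * (\<Prod>i<N. weight 0 l c (x i))"
  let ?f' = "\<lambda>l x. - (?s x * ?q x * vand \<beta> 0 N x * (\<Prod>i<N. weight 0 l c (x i)))"
  have pq: "polyb N ?q" using p by (intro polyb_prod polyb_component) auto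
  have ps: "polyb N ?s" by (intro polyb_sum polyb_component) auto
  have r: "rapid (weight 0 l c)" for l using c by (intro rapid_weight) auto
  have "((\<lambda>l. LINT x|Leb N. ?f l x) has_real_derivative (LINT x|Leb N. ?f' l x)) (at l)"
  proof (rule has_real_derivative_integral[where d = 1 and w = "\<lambda>x. \<bar>?f' (l - 1) x\<bar>"])
    show "integrable (Leb N) (?f t)" for t
      using \<beta> by (intro avg_integrable r pq) auto
    have i: "integrable (Leb N) (?f' t)" for t
      using \<beta> by (intro integrable_minus avg_integrable r polyb_mult pq ps) auto
    show "?f' l \<in> borel_measurable (Leb N)" using i by auto
    show "integrable (Leb N) (\<lambda>x. \<bar>?f' (l - 1) x\<bar>)" using i by (intro integrable_abs)
    show "((\<lambda>t. ?f t x) has_real_derivative ?f' t x) (at t)" for t x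
    proof -
      have "((\<lambda>t. exp ((0 - t) * ?s x)) has_real_derivative exp ((0 - t) * ?s x) * (- ?s x)) (at t)"
        by (auto intro!: derivative_eq_intros)
      note DERIV_cmult[OF this, of "?q x * vand \<beta> 0 N x * (\<Prod>i<N. weight 0 0 c (x i))"]
      moreover have "?f t x = ?q x * vand \<beta> 0 N x * (\<Prod>i<N. weight 0 0 c (x i)) * exp ((0 - t) * ?s x)" for t
        by (subst prod_weight_exp[of 0 t c x N 0]) (simp only: mult_ac)
      ultimately show ?thesis by (simp only: mult_ac mult_minus_left mult_minus_right)
    qed
    show "\<bar>?f' t x\<bar> \<le> \<bar>?f' (l - 1) x\<bar>" if t: "\<bar>t - l\<bar> < 1" for t x
    proof (cases "(\<Prod>i<N. weight 0 (l - 1) c (x i)) = 0")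
      case True
      show ?thesis unfolding prod_weight_exp[of 0 t c x N "l - 1"] True
        by (simp only: mult_zero_left mult_zero_right minus_zero abs_zero order_refl)
    next
      case False
      then have "\<forall>i<N. x i \<ge> 0" using prod_weight_pos by blast
      then have "?s x \<ge> 0" by (intro sum_nonneg) auto
      then have "exp ((l - 1 - t) * ?s x) \<le> 1" using t by (auto simp: mult_le_0_iff)
      then show ?thesis unfolding prod_weight_exp[of 0 t c x N "l - 1"]
        by (auto simp: abs_mult intro!: mult_left_mono mult_left_le)
    qed
  qed auto
  then show ?thesis unfolding mom_def avg_def by simp
qed

text \<open>By symmetry the sum of the coordinates contributes p equal terms with a squared
  coordinate and N - p equal terms with one factor more. The squares are eliminated by
  \<open>aomoto\<close> with k = p - 1, which leaves the neighbours p - 1, p and p + 1. At p = 0 and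
  p = N the out-of-range neighbour has the coefficient 0.\<close>

lemma mom_deriv:
  assumes \<beta>: "\<beta> > 0" and c: "c > 0" and p: "p \<le> N"
  shows "((\<lambda>l. mom \<beta> N c l p) has_real_derivative
     (- (real p * (1 + \<beta> * real (N - p)) * mom \<beta> N c l (p - 1)) + real p * l * mom \<beta> N c l p
       - c * real (N - p) * mom \<beta> N c l (Suc p)) / c) (at l)"
proof -
  let ?q = "\<lambda>p x. \<Prod>i<p. x i :: real"
  let ?A = "avg \<beta> 0 N (weight 0 l c)"
  have r: "rapid (weight 0 l c)" using c by (intro rapid_weight) auto
  have pq: "polyb N (?q p)" if "p \<le> N" for p using that by (intro polyb_prod polyb_component) auto
  have pi: "polyb N (\<lambda>x. x i * ?q p x)" if "i < N" for i
    using that p by (intro polyb_mult pq polyb_component) auto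
  have "?A (\<lambda>x. (\<Sum>i<N. x i) * ?q p x) = (\<Sum>i<N. ?A (\<lambda>x. x i * ?q p x))"
    unfolding sum_distrib_right using \<beta> by (intro avg_sum r pi) auto
  also have "\<dots> = (\<Sum>i<p. ?A (\<lambda>x. x i * ?q p x)) + (\<Sum>i\<in>{p..<N}. ?A (\<lambda>x. x i * ?q p x))"
    using p by (subst sum.union_disjoint[symmetric]) (auto intro!: sum.cong)
  also have "(\<Sum>i\<in>{p..<N}. ?A (\<lambda>x. x i * ?q p x)) = (\<Sum>i\<in>{p..<N}. ?A (?q (Suc p)))"
  proof (rule sum.cong[OF refl])
    fix i assume i: "i \<in> {p..<N}"
    then have iN: "i < N" "p < N" by auto
    show "?A (\<lambda>x. x i * ?q p x) = ?A (?q (Suc p))"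
    proof (subst avg_transpose[OF _ _ r pi[OF iN(1)] iN], goal_cases)
      case 3
      show ?case
      proof (rule avg_cong)
        fix x :: "nat \<Rightarrow> real"
        let ?y = "\<lambda>j\<in>{..<N}. x (Transposition.transpose i p j)"
        have "?q p ?y = ?q p x"
          using i by (intro prod.cong) (auto simp: Transposition.transpose_def)
        moreover have "?y i = x p" using i by auto
        ultimately show "?y i * ?q p ?y = ?q (Suc p) x" by simp
      qed
    qed (use \<beta> in auto)
  qed
  also have "\<dots> = real (N - p) * ?A (?q (Suc p))" by simp
  also have "(\<Sum>i<p. ?A (\<lambda>x. x i * ?q p x)) = (\<Sum>i<p. ?A (\<lambda>x. ?q (p - 1) x * (x (p - 1) * x (p - 1))))"
  proof (rule sum.cong[OF refl])
    fix i assume i: "i \<in> {..<p}"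
    then obtain k where k: "p = Suc k" by (cases p) auto
    have iN: "i < N" "k < N" using i p k by auto
    show "?A (\<lambda>x. x i * ?q p x) = ?A (\<lambda>x. ?q (p - 1) x * (x (p - 1) * x (p - 1)))"
    proof (subst avg_transpose[OF _ _ r pi[OF iN(1)] iN], goal_cases)
      case 3
      show ?case
      proof (rule avg_cong)
        fix x :: "nat \<Rightarrow> real"
        let ?y = "\<lambda>j\<in>{..<N}. x (Transposition.transpose i k j)"
        have "?q p ?y = (\<Prod>j<p. x (Transposition.transpose i k j))"
          using p by (intro prod.cong) auto
        also have "\<dots> = ?q p x"
          using prod.permute[OF permutes_swap_id[of i "{..<p}" k], of x] i k by (simp add: comp_def)
        finally have "?q p ?y = ?q p x" .
        moreover have "?y i = x k" using iN by auto
        ultimately show "?y i * ?q p ?y = ?q (p - 1) x * (x (p - 1) * x (p - 1))" by (simp add: k)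
      qed
    qed (use \<beta> in auto)
  qed
  finally have s: "?A (\<lambda>x. (\<Sum>i<N. x i) * ?q p x)
      = real p * ?A (\<lambda>x. ?q (p - 1) x * (x (p - 1) * x (p - 1))) + real (N - p) * ?A (?q (Suc p))"
    by simp
  have a: "real p * (1 + \<beta> * real (N - p)) * mom \<beta> N c l (p - 1) =
     real p * l * mom \<beta> N c l p + c * (real p * ?A (\<lambda>x. ?q (p - 1) x * (x (p - 1) * x (p - 1))))"
  proof (cases p)
    case (Suc k)
    then have "k < N" using p by simp
    from aomoto[OF \<beta> _ this, of c l 0] c Suc
    have "(1 + \<beta> * real (N - p)) * mom \<beta> N c l k = l * mom \<beta> N c l p + c * ?A (\<lambda>x. ?q k x * (x k * x k))"
      by (simp add: mom_def)
    from arg_cong[OF this, of "\<lambda>z. real p * z"] show ?thesis using Suc by (simp add: algebra_simps)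
  qed simp
  have "- ?A (\<lambda>x. (\<Sum>i<N. x i) * ?q p x) = (- (real p * (1 + \<beta> * real (N - p)) * mom \<beta> N c l (p - 1)) + real p * l * mom \<beta> N c l p
       - c * real (N - p) * mom \<beta> N c l (Suc p)) / c"
    unfolding a s using c by (simp add: mom_def field_simps)
  with mom_deriv_avg[OF \<beta> c p, of l] show ?thesis by simp
qed

lemma avg_pos:
  assumes "\<beta> > 0" "rapid w" "\<And>y. w y \<ge> 0" "\<And>y. y > 0 \<Longrightarrow> w y > 0" "polyb N g"
    "\<And>x. (\<forall>i<N. w (x i) \<noteq> 0) \<Longrightarrow> g x \<ge> 0" "\<And>x. \<forall>i<N. x i > 0 \<Longrightarrow> g x > 0"
  shows "avg \<beta> 0 N w g > 0"
proof -
  let ?f = "\<lambda>x. g x * vand \<beta> 0 N x * (\<Prod>i<N. w (x i))"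
  have int: "integrable (Leb N) ?f" using assms by (intro avg_integrable) auto
  have nn: "?f x \<ge> 0" for x
  proof (cases "\<forall>i<N. w (x i) \<noteq> 0")
    case True
    then show ?thesis using assms vand_nonneg by (intro mult_nonneg_nonneg prod_nonneg) auto
  next
    case False
    then have "(\<Prod>i<N. w (x i)) = 0" by (intro prod_zero) auto
    then show ?thesis by (simp only: mult_zero_right order_refl)
  qed
  \<comment> \<open>A box of positive measure in which the coordinates are positive and increasing:
    the intervals of length 1/2 are disjoint, so no difference x_i - x_j vanishes.\<close>
  let ?B = "Pi\<^sub>E {..<N} (\<lambda>i. {real i + 1..real i + 3 / 2})"
  have B: "?B \<in> sets (Leb N)" by (intro sets_PiM_I_finite) auto
  have Bp: "?f x > 0" if x: "x \<in> ?B" for x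
  proof -
    have xi: "real i + 1 \<le> x i" "x i \<le> real i + 3 / 2" if "i < N" for i
      using PiE_mem[OF x, of i] that by auto
    have "vand \<beta> 0 N x > 0"
      unfolding vand_def
    proof (intro prod_pos ballI)
      fix p assume "p \<in> pairs N"
      then obtain i j where p: "p = (i, j)" "i < j" "j < N" by (auto simp: pairs_def)
      have "x i < x j" using xi[of i] xi[of j] p by linarith
      then show "0 < (case p of (i, j) \<Rightarrow> ((x i - x j)^2 + 0) powr \<beta>)" using p by simp
    qed
    moreover have x0: "\<forall>i<N. x i > 0"
    proof (intro allI impI)
      fix i assume "i < N"
      from xi(1)[OF this] show "x i > 0" using of_nat_0_le_iff[of i, where ?'a = real] by linarith
    qed
    moreover have "(\<Prod>i<N. w (x i)) > 0" using x0 assms(4) by (intro prod_pos) auto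
    ultimately show ?thesis using assms(7)[of x] by simp
  qed
  have "avg \<beta> 0 N w g \<noteq> 0"
  proof
    assume "avg \<beta> 0 N w g = 0"
    then have "AE x in Leb N. ?f x = 0"
      unfolding avg_def using integral_nonneg_eq_0_iff_AE[OF int] nn by auto
    then have ae: "AE x in Leb N. x \<notin> ?B" by (rule AE_mp) (intro AE_I2 impI notI, metis Bp less_irrefl)
    have eq: "{x \<in> space (Leb N). \<not> x \<notin> ?B} = ?B" using sets.sets_into_space[OF B] by blast
    have "emeasure (Leb N) ?B = 0" by (rule AE_iff_measurable[OF B eq, THEN iffD1, OF ae])
    moreover have "emeasure (Leb N) ?B = (\<Prod>i<N. ennreal (1 / 2))"
      by (subst Leb.emeasure_PiM) auto
    ultimately show False by (simp add: prod_ennreal)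
  qed
  moreover have "avg \<beta> 0 N w g \<ge> 0" unfolding avg_def by (intro integral_nonneg_AE AE_I2 nn)
  ultimately show ?thesis by linarith
qed

lemma mom_pos:
  assumes "\<beta> > 0" "c > 0 \<or> c = 0 \<and> l > 0" "p \<le> N"
  shows "mom \<beta> N c l p > 0"
  unfolding mom_def
proof (rule avg_pos)
  show "polyb N (\<lambda>x. \<Prod>i<p. x i)" using assms by (intro polyb_prod polyb_component) auto
  show "(\<Prod>i<p. x i) \<ge> 0" if "\<forall>i<N. weight 0 l c (x i) \<noteq> 0" for x
  proof (intro prod_nonneg ballI)
    fix i assume "i \<in> {..<p}"
    then show "x i \<ge> 0" using that assms by (auto simp: weight_def split: if_splits)
  qed
  show "(\<Prod>i<p. x i) > 0" if "\<forall>i<N. x i > 0" for x :: "nat \<Rightarrow> real"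
    by (rule prod_pos) (use that assms in auto)
  show "rapid (weight 0 l c)" using assms by (intro rapid_weight) auto
qed (use assms in \<open>auto simp: weight_def\<close>)

lemma laguerre_mom:
  assumes \<beta>: "\<beta> > 0" and p: "p \<le> N"
  shows "mom \<beta> N 0 1 p = (\<Prod>j<p. 1 + \<beta> * real (N - 1 - j)) * mom \<beta> N 0 1 0"
  using p
proof (induction p)
  case (Suc p)
  then show ?case using aomoto[OF \<beta>, of 0 1 p N 0] by (simp add: mom_def mult_ac)
qed simp

text \<open>Substituting x / l for x turns the weight into exp(- y - c y^2 / (2 l^2)), whose
  quadratic part disappears as l grows. The power of l collects the Jacobian, the p factors and the
  homogeneity of the Vandermonde factor.\<close>

lemma mom_laguerre_limit:
  assumes \<beta>: "\<beta> > 0" and c: "c > 0" and p: "p \<le> N"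
  shows "((\<lambda>l. mom \<beta> N c l p * (l ^ (N + p) * (l powr (2 * \<beta>)) ^ card (pairs N))) \<longlongrightarrow> mom \<beta> N 0 1 p) at_top"
proof -
  let ?q = "\<lambda>x. \<Prod>i<p. x i :: real"
  let ?w = "\<lambda>l y. if y \<ge> 0 then exp (- y - c * y^2 / (2 * l^2)) else 0 :: real"
  let ?s = "\<lambda>l x. ?q x * vand \<beta> 0 N x * (\<Prod>i<N. ?w l (x i))"
  have pq: "polyb N ?q" using p by (intro polyb_prod polyb_component) auto
  have r: "rapid (weight 0 1 0)" by (rule rapid_weight) auto
  have mw: "?w l \<in> borel_measurable borel" for l by measurable
  have pv: "vand \<beta> 0 N \<in> borel_measurable (Leb N)" using polyb_measurable[OF polyb_vand] \<beta> by auto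
  have ms: "?s l \<in> borel_measurable (Leb N)" for l
    using polyb_measurable[OF pq] pv mw[of l] by measurable
  have "((\<lambda>l. LINT x|Leb N. ?s l x) \<longlongrightarrow> (LINT x|Leb N. ?q x * vand \<beta> 0 N x * (\<Prod>i<N. weight 0 1 0 (x i)))) at_top"
  proof (rule integral_dominated_convergence_at_top[where w = "\<lambda>x. \<bar>?q x * vand \<beta> 0 N x * (\<Prod>i<N. weight 0 1 0 (x i))\<bar>"])
    have i: "integrable (Leb N) (\<lambda>x. ?q x * vand \<beta> 0 N x * (\<Prod>i<N. weight 0 1 0 (x i)))"
      using \<beta> by (intro avg_integrable r pq) auto
    show "integrable (Leb N) (\<lambda>x. \<bar>?q x * vand \<beta> 0 N x * (\<Prod>i<N. weight 0 1 0 (x i))\<bar>)"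
      by (rule integrable_abs[OF i])
    show "(\<lambda>x. ?q x * vand \<beta> 0 N x * (\<Prod>i<N. weight 0 1 0 (x i))) \<in> borel_measurable (Leb N)"
      using i by auto
    show "AE x in Leb N. ((\<lambda>l. ?s l x) \<longlongrightarrow> ?q x * vand \<beta> 0 N x * (\<Prod>i<N. weight 0 1 0 (x i))) at_top"
    proof (intro AE_I2 tendsto_mult tendsto_const tendsto_prod)
      fix x :: "nat \<Rightarrow> real" and i
      have "((\<lambda>l. c * (x i)^2 / (2 * l^2)) \<longlongrightarrow> 0) at_top"
        by (intro real_tendsto_divide_at_top[OF tendsto_const] filterlim_tendsto_pos_mult_at_top[OF tendsto_const]
              filterlim_pow_at_top filterlim_ident) auto
      from tendsto_diff[OF tendsto_const this, of "- x i"]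
      have "((\<lambda>l. exp (- x i - c * (x i)^2 / (2 * l^2))) \<longlongrightarrow> exp (- x i - 0)) at_top"
        by (rule tendsto_exp)
      then show "((\<lambda>l. ?w l (x i)) \<longlongrightarrow> weight 0 1 0 (x i)) at_top"
        by (auto simp: weight_def)
    qed
    show "\<forall>\<^sub>F l in at_top. AE x in Leb N. norm (?s l x) \<le> \<bar>?q x * vand \<beta> 0 N x * (\<Prod>i<N. weight 0 1 0 (x i))\<bar>"
    proof (intro always_eventually allI AE_I2)
      fix l and x :: "nat \<Rightarrow> real"
      have wle: "0 \<le> ?w l y" "?w l y \<le> weight 0 1 0 y" for y
        using c by (auto simp: weight_def)
      have "0 \<le> (\<Prod>i<N. ?w l (x i))" "(\<Prod>i<N. ?w l (x i)) \<le> (\<Prod>i<N. weight 0 1 0 (x i))"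
        by (rule prod_nonneg, rule wle) (rule prod_mono, rule conjI[OF wle])
      then have "\<bar>\<Prod>i<N. ?w l (x i)\<bar> \<le> \<bar>\<Prod>i<N. weight 0 1 0 (x i)\<bar>" by linarith
      then show "norm (?s l x) \<le> \<bar>?q x * vand \<beta> 0 N x * (\<Prod>i<N. weight 0 1 0 (x i))\<bar>"
        unfolding real_norm_def abs_mult by (intro mult_left_mono) auto
    qed
  qed (rule ms)
  then have L: "((\<lambda>l. LINT x|Leb N. ?s l x) \<longlongrightarrow> mom \<beta> N 0 1 p) at_top"
    by (simp add: mom_def avg_def)
  show ?thesis
  proof (rule Lim_transform_eventually[OF L])
    show "\<forall>\<^sub>F l in at_top. (LINT x|Leb N. ?s l x) = mom \<beta> N c l p * (l ^ (N + p) * (l powr (2 * \<beta>)) ^ card (pairs N))"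
      using eventually_gt_at_top[of 0]
    proof eventually_elim
      fix l :: real assume l: "l > 0"
      have key: "?s l (\<lambda>i\<in>{..<N}. 0 + l * x i) = (l ^ p * (l powr (2 * \<beta>)) ^ card (pairs N)) *
          (?q x * vand \<beta> 0 N x * (\<Prod>i<N. weight 0 l c (x i)))" for x :: "nat \<Rightarrow> real"
      proof -
        have "?q (\<lambda>i\<in>{..<N}. 0 + l * x i) = (\<Prod>i<p. l * x i)" using p by (intro prod.cong) auto
        also have "\<dots> = l ^ p * ?q x" by (simp add: prod.distrib)
        finally have 1: "?q (\<lambda>i\<in>{..<N}. 0 + l * x i) = l ^ p * ?q x" .
        have 2: "(\<Prod>i<N. ?w l ((\<lambda>i\<in>{..<N}. 0 + l * x i) i)) = (\<Prod>i<N. weight 0 l c (x i))"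
          using l by (intro prod.cong) (auto simp: weight_def power_mult_distrib zero_le_mult_iff)
        show ?thesis unfolding vand_scale[OF l] 1 2 by (simp only: mult_ac)
      qed
      have "(LINT x|Leb N. ?s l x) = \<bar>l\<bar> ^ N * (LINT x|Leb N. ?s l (\<lambda>i\<in>{..<N}. 0 + l * x i))"
        using l by (intro Leb_integral_affine ms) auto
      also have "\<dots> = l ^ N * (l ^ p * (l powr (2 * \<beta>)) ^ card (pairs N) * mom \<beta> N c l p)"
        unfolding key mom_def avg_def using l by simp
      finally show "(LINT x|Leb N. ?s l x) = mom \<beta> N c l p * (l ^ (N + p) * (l powr (2 * \<beta>)) ^ card (pairs N))"
        by (simp add: power_add mult_ac)
    qed
  qed
qed

section \<open>The full Gaussian integral as a limit of Laguerre integrals\<close>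

text \<open>Mehta's integral. Only its quotient by \<open>laguerre \<beta> N 0\<close> is needed,
  since the moments are normalised by the same Laguerre integral, whose own value cancels in the
  end.\<close>

definition mehta :: "real \<Rightarrow> nat \<Rightarrow> real" where
  "mehta \<beta> N = avg \<beta> 0 N (\<lambda>x. exp (- x\<^sup>2 / 2)) (\<lambda>_. 1)"

definition laguerre :: "real \<Rightarrow> nat \<Rightarrow> nat \<Rightarrow> real" where
  "laguerre \<beta> N m = avg \<beta> 0 N (weight m 1 0) (\<lambda>_. 1)"

text \<open>Raising the exponent by one inserts the product of all coordinates, i.e. the moment with
  p = N, and \<open>aomoto\<close> with c = 0 removes its factors one at a time.\<close>

lemma laguerre_Suc:
  assumes \<beta>: "\<beta> > 0"
  shows "laguerre \<beta> N (Suc m) = (\<Prod>j<N. 1 + real m + \<beta> * real j) * laguerre \<beta> N m"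
proof -
  have *: "avg \<beta> 0 N (weight m 1 0) (\<lambda>x. \<Prod>i<p. x i) = (\<Prod>k<p. 1 + real m + \<beta> * real (N - 1 - k)) * laguerre \<beta> N m"
    if "p \<le> N" for p
    using that
  proof (induction p)
    case (Suc p)
    then show ?case using aomoto[OF \<beta>, of 0 1 p N m] by (simp add: mult_ac)
  qed (simp add: laguerre_def)
  have "laguerre \<beta> N (Suc m) = avg \<beta> 0 N (weight m 1 0) (\<lambda>x. \<Prod>i<N. x i)"
    unfolding laguerre_def avg_def
  proof (intro Bochner_Integration.integral_cong refl)
    fix x :: "nat \<Rightarrow> real"
    have "(\<Prod>i<N. weight (Suc m) 1 0 (x i)) = (\<Prod>i<N. x i * weight m 1 0 (x i))"
      by (intro prod.cong) (auto simp: weight_def)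
    then show "1 * vand \<beta> 0 N x * (\<Prod>i<N. weight (Suc m) 1 0 (x i))
       = (\<Prod>i<N. x i) * vand \<beta> 0 N x * (\<Prod>i<N. weight m 1 0 (x i))"
      by (simp add: prod.distrib)
  qed
  also have "\<dots> = (\<Prod>k<N. 1 + real m + \<beta> * real (N - 1 - k)) * laguerre \<beta> N m" by (rule *) simp
  also have "(\<Prod>k<N. 1 + real m + \<beta> * real (N - 1 - k)) = (\<Prod>j<N. 1 + real m + \<beta> * real j)"
    by (rule prod.reindex_bij_witness[of _ "\<lambda>j. N - 1 - j" "\<lambda>j. N - 1 - j"]) auto
  finally show ?thesis .
qed

section \<open>Laplace's method for Laguerre weights of large exponent\<close>

lemma ln_one_plus_quadratic_bound:
  fixes s :: real
  assumes "s > - 1"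
  shows "ln (1 + s) \<le> s - s^2 / (2 * (1 + \<bar>s\<bar>))"
proof (cases "s \<ge> 0")
  case True
  let ?f = "\<lambda>s. s - s^2 / (2 * (1 + s)) - ln (1 + s :: real)"
  have "?f 0 \<le> ?f s"
  proof (rule DERIV_nonneg_imp_nondecreasing[OF True])
    fix x :: real assume x: "0 \<le> x" "x \<le> s"
    have "(?f has_real_derivative (1 - (2 * x * (2 * (1 + x)) - x^2 * 2) / (2 * (1 + x))^2 - 1 / (1 + x))) (at x)"
      using x by (auto intro!: derivative_eq_intros simp: power2_eq_square)
    moreover have "1 - (2 * x * (2 * (1 + x)) - x^2 * 2) / (2 * (1 + x))^2 - 1 / (1 + x) = x^2 / (2 * (1 + x)^2)"
      using x by (simp add: divide_simps power2_eq_square) (simp add: algebra_simps)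
    ultimately show "\<exists>y. (?f has_real_derivative y) (at x) \<and> 0 \<le> y" using x by auto
  qed
  then show ?thesis using True by simp
next
  case False
  let ?f = "\<lambda>s. s - s^2 / 2 - ln (1 + s :: real)"
  have "?f 0 \<le> ?f s"
  proof (rule DERIV_nonpos_imp_nonincreasing[of s 0 ?f])
    fix x :: real assume x: "s \<le> x" "x \<le> 0"
    have "(?f has_real_derivative (1 - x - 1 / (1 + x))) (at x)"
      using x assms by (auto intro!: derivative_eq_intros)
    moreover have "1 - x - 1 / (1 + x) = - x\<^sup>2 / (1 + x)"
      using x assms by (simp add: divide_simps power2_eq_square) (simp add: algebra_simps)
    ultimately show "\<exists>y. (?f has_real_derivative y) (at x) \<and> y \<le> 0" using x assms
      by (auto simp: divide_nonpos_pos)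
  qed (use False in auto)
  moreover have "s^2 / (2 * (1 + \<bar>s\<bar>)) \<le> s^2 / 2" by (intro divide_left_mono) auto
  ultimately show ?thesis by simp
qed

lemma laplace_pointwise:
  "(\<lambda>m. real m * ln (1 + x / sqrt (real m)) - sqrt (real m) * x) \<longlonglongrightarrow> - x\<^sup>2 / 2"
proof (cases x "0 :: real" rule: linorder_cases)
  case less
  then have "(\<lambda>m. real m * ln (1 + x / sqrt (real m)) - sqrt (real m) * x) \<longlonglongrightarrow> - (x * x / 2)"
    by real_asymp
  then show ?thesis by (simp add: power2_eq_square)
next
  case greater
  then have "(\<lambda>m. real m * ln (1 + x / sqrt (real m)) - sqrt (real m) * x) \<longlonglongrightarrow> - (x * x / 2)"
    by real_asymp
  then show ?thesis by (simp add: power2_eq_square)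
qed auto

text \<open>The weight y^m exp(- y) recentred at its maximum y = m, measured in units of its width
  sqrt m, and divided by its maximal value.\<close>

definition shifted_weight :: "nat \<Rightarrow> real \<Rightarrow> real" where
  "shifted_weight m x = (if x \<ge> - sqrt m then (1 + x / sqrt m) ^ m * exp (- sqrt m * x) else 0)"

lemma shifted_weight_eq:
  assumes "m > 0" "x > - sqrt m"
  shows "shifted_weight m x = exp (real m * ln (1 + x / sqrt m) - sqrt m * x)"
proof -
  have "1 + x / sqrt m > 0" using assms by (simp add: field_simps)
  then have "(1 + x / sqrt m) ^ m = exp (real m * ln (1 + x / sqrt m))"
    by (metis exp_ln exp_of_nat_mult)
  then show ?thesis using assms by (simp add: shifted_weight_def exp_diff exp_minus divide_inverse)
qed

text \<open>The quadratic bound for the logarithm gives the exponent - x^2 / (2 (1 + |x / sqrt m|)).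
  As |x / sqrt m| \<le> |x|, it can be replaced by an expression free of m, and x^2 \<ge> (|x| - 1)
  (1 + |x|) yields the constants 1/2.\<close>

lemma shifted_weight_bound:
  assumes "m > 0"
  shows "0 \<le> shifted_weight m x" "shifted_weight m x \<le> exp (1 / 2) * exp (- (1 / 2) * \<bar>x\<bar>)"
proof -
  have "0 \<le> shifted_weight m x \<and> shifted_weight m x \<le> exp (1 / 2) * exp (- (1 / 2) * \<bar>x\<bar>)"
  proof (cases "x > - sqrt m")
    case True
    let ?s = "x / sqrt m"
    have m: "sqrt m \<ge> 1" using assms by simp
    have s: "?s > - 1" using True m by (simp add: field_simps)
    have "\<bar>x\<bar> / sqrt m \<le> \<bar>x\<bar> / 1" using m by (intro divide_left_mono) auto
    then have sx: "\<bar>?s\<bar> \<le> \<bar>x\<bar>" by (simp add: abs_divide)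
    have "real m * ln (1 + ?s) \<le> real m * (?s - ?s^2 / (2 * (1 + \<bar>?s\<bar>)))"
      by (intro mult_left_mono ln_one_plus_quadratic_bound s) auto
    also have "\<dots> = sqrt m * x - x^2 / (2 * (1 + \<bar>?s\<bar>))"
    proof -
      have "real m * ?s = sqrt m * x" using m by (simp add: field_simps)
      moreover have "real m * ?s^2 = x^2" using assms by (simp add: power_divide)
      ultimately show ?thesis by (simp add: right_diff_distrib)
    qed
    also have "\<dots> \<le> sqrt m * x - x^2 / (2 * (1 + \<bar>x\<bar>))"
      using sx by (intro diff_left_mono divide_left_mono) (auto intro!: mult_pos_pos add_pos_nonneg)
    finally have "real m * ln (1 + ?s) - sqrt m * x \<le> - (x^2 / (2 * (1 + \<bar>x\<bar>)))" by linarith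
    also have "\<dots> \<le> 1 / 2 + (- (1 / 2) * \<bar>x\<bar>)"
    proof -
      have "(\<bar>x\<bar> - 1) * (1 + \<bar>x\<bar>) \<le> x^2" by (simp add: algebra_simps power2_eq_square)
      define q where "q = x^2 / (1 + \<bar>x\<bar>)"
      have "\<bar>x\<bar> - 1 \<le> q" unfolding q_def using \<open>(\<bar>x\<bar> - 1) * (1 + \<bar>x\<bar>) \<le> x^2\<close> by (subst pos_le_divide_eq) auto
      moreover have "x^2 / (2 * (1 + \<bar>x\<bar>)) = q / 2" unfolding q_def by simp
      ultimately show ?thesis by simp
    qed
    finally show ?thesis unfolding shifted_weight_eq[OF assms True] exp_add[symmetric] by simp
  next
    case False
    then have "shifted_weight m x = 0"
      using assms by (cases "x = - sqrt m") (auto simp: shifted_weight_def power_0_left)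
    then show ?thesis by simp
  qed
  then show "0 \<le> shifted_weight m x" "shifted_weight m x \<le> exp (1 / 2) * exp (- (1 / 2) * \<bar>x\<bar>)" by auto
qed

lemma rapid_gauss: "rapid (\<lambda>x::real. exp (- x\<^sup>2 / 2))"
proof (rule rapid_exp_bound[of _ 1 "exp (1 / 2)" 0])
  show "\<bar>exp (- x\<^sup>2 / 2)\<bar> \<le> exp (1 / 2) * (1 + \<bar>x\<bar>) ^ 0 * exp (- 1 * \<bar>x\<bar>)" for x :: real
  proof -
    have "(\<bar>x\<bar> - 1)^2 \<ge> 0" by simp
    then have "- x\<^sup>2 / 2 \<le> 1 / 2 - \<bar>x\<bar>" by (simp add: power2_eq_square algebra_simps)
    then show ?thesis by (simp add: exp_add[symmetric] mult_exp_exp)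
  qed
qed auto

lemma rapid_exp_half: "rapid (\<lambda>x::real. exp (1 / 2) * exp (- (1 / 2) * \<bar>x\<bar>))"
  by (rule rapid_exp_bound[of _ "1 / 2" "exp (1 / 2)" 0]) auto

text \<open>Height m^m exp(- m) of the peak times its width sqrt m.\<close>

definition laplace_scale :: "nat \<Rightarrow> real" where
  "laplace_scale m = real m ^ m * exp (- real m) * sqrt (real m)"

text \<open>Around its maximum the weight becomes Gaussian in every coordinate. The Vandermonde
  factor is translation invariant and homogeneous, so the rescaling costs only a power of sqrt m for
  each pair.\<close>

lemma laguerre_tendsto_mehta:
  assumes \<beta>: "\<beta> > 0"
  shows "(\<lambda>m. laguerre \<beta> N m / (laplace_scale m ^ N * (sqrt (real m) powr (2 * \<beta>)) ^ card (pairs N))) \<longlonglongrightarrow> mehta \<beta> N"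
proof -
  have pv: "vand \<beta> 0 N \<in> borel_measurable (Leb N)" using polyb_measurable[OF polyb_vand] \<beta> by auto
  let ?s = "\<lambda>m x. 1 * vand \<beta> 0 N x * (\<Prod>i<N. shifted_weight m (x i))"
  have mw: "shifted_weight m \<in> borel_measurable borel" for m
    unfolding shifted_weight_def[abs_def] by measurable
  \<comment> \<open>The index is shifted by one because the dominating bound requires a positive
    exponent.\<close>
  have L: "(\<lambda>m. LINT x|Leb N. ?s (Suc m) x) \<longlonglongrightarrow> mehta \<beta> N"
    unfolding mehta_def avg_def
  proof (rule integral_dominated_convergence[where w = "\<lambda>x. 1 * vand \<beta> 0 N x * (\<Prod>i<N. exp (1 / 2) * exp (- (1 / 2) * \<bar>x i\<bar>))"])
    show "integrable (Leb N) (\<lambda>x. 1 * vand \<beta> 0 N x * (\<Prod>i<N. exp (1 / 2) * exp (- (1 / 2) * \<bar>x i\<bar>)))"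
      using \<beta> by (intro avg_integrable rapid_exp_half polyb_const) auto
    show "(\<lambda>x. 1 * vand \<beta> 0 N x * (\<Prod>i<N. exp (- (x i)\<^sup>2 / 2))) \<in> borel_measurable (Leb N)"
      using \<beta> by (intro borel_measurable_integrable avg_integrable rapid_gauss polyb_const) auto
    show "?s (Suc m) \<in> borel_measurable (Leb N)" for m
      using pv mw[of "Suc m"] by measurable
    show "AE x in Leb N. (\<lambda>m. ?s (Suc m) x) \<longlonglongrightarrow> 1 * vand \<beta> 0 N x * (\<Prod>i<N. exp (- (x i)\<^sup>2 / 2))"
    proof (intro AE_I2 tendsto_mult tendsto_const tendsto_prod)
      fix x :: "nat \<Rightarrow> real" and i
      have "(\<lambda>m. shifted_weight m (x i)) \<longlonglongrightarrow> exp (- (x i)\<^sup>2 / 2)"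
      proof (rule Lim_transform_eventually[OF tendsto_exp[OF laplace_pointwise]])
        have "filterlim (\<lambda>m. sqrt (real m)) at_top sequentially" by real_asymp
        then have "eventually (\<lambda>m. sqrt (real m) > - x i) sequentially"
          by (simp add: filterlim_at_top_dense)
        then show "\<forall>\<^sub>F m in sequentially. exp (real m * ln (1 + x i / sqrt (real m)) - sqrt (real m) * x i) = shifted_weight m (x i)"
          using eventually_gt_at_top[of 0] by eventually_elim (subst shifted_weight_eq; simp)
      qed
      then show "(\<lambda>m. shifted_weight (Suc m) (x i)) \<longlonglongrightarrow> exp (- (x i)\<^sup>2 / 2)" by (rule LIMSEQ_Suc)
    qed
    show "AE x in Leb N. norm (?s (Suc m) x) \<le> 1 * vand \<beta> 0 N x * (\<Prod>i<N. exp (1 / 2) * exp (- (1 / 2) * \<bar>x i\<bar>))" for m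
    proof (intro AE_I2)
      fix x :: "nat \<Rightarrow> real"
      have "0 \<le> (\<Prod>i<N. shifted_weight (Suc m) (x i))"
        "(\<Prod>i<N. shifted_weight (Suc m) (x i)) \<le> (\<Prod>i<N. exp (1 / 2) * exp (- (1 / 2) * \<bar>x i\<bar>))"
        by (rule prod_nonneg, rule shifted_weight_bound, simp)
           (rule prod_mono, rule conjI, (rule shifted_weight_bound, simp)+)
      then show "norm (?s (Suc m) x) \<le> 1 * vand \<beta> 0 N x * (\<Prod>i<N. exp (1 / 2) * exp (- (1 / 2) * \<bar>x i\<bar>))"
        using vand_nonneg[of \<beta> 0 N x] by (simp add: abs_mult mult_left_mono)
    qed
  qed
  have eq: "laguerre \<beta> N m = (laplace_scale m ^ N * (sqrt (real m) powr (2 * \<beta>)) ^ card (pairs N)) * (LINT x|Leb N. ?s m x)"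
    if m: "m > 0" for m
  proof -
    let ?g = "\<lambda>x. 1 * vand \<beta> 0 N x * (\<Prod>i<N. weight m 1 0 (x i))"
    have sm: "sqrt m > 0" using m by simp
    have gm: "?g \<in> borel_measurable (Leb N)"
      using \<beta> by (intro borel_measurable_integrable avg_integrable rapid_weight polyb_const) auto
    have w: "weight m 1 0 (real m + sqrt m * y) = (real m ^ m * exp (- real m)) * shifted_weight m y" for y
    proof -
      have mm: "real m = sqrt m * sqrt m" by simp
      have e: "real m + sqrt m * y = real m * (1 + y / sqrt m)"
        using sm by (subst (1 2) mm) (simp add: field_simps)
      have c: "0 \<le> real m + sqrt m * y \<longleftrightarrow> - sqrt m \<le> y"
      proof -
        have "0 \<le> real m + sqrt m * y \<longleftrightarrow> 0 \<le> 1 + y / sqrt m" unfolding e using m by (simp add: zero_le_mult_iff)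
        also have "\<dots> \<longleftrightarrow> - 1 \<le> y / sqrt m" by linarith
        also have "\<dots> \<longleftrightarrow> - sqrt m \<le> y" using sm by (simp add: pos_le_divide_eq)
        finally show ?thesis .
      qed
      have "(real m + sqrt m * y) ^ m * exp (- (real m + sqrt m * y))
         = (real m ^ m * exp (- real m)) * ((1 + y / sqrt m) ^ m * exp (- sqrt m * y))"
        unfolding e power_mult_distrib unfolding e[symmetric] by (simp add: exp_add exp_minus exp_diff divide_inverse)
      then show ?thesis unfolding weight_def shifted_weight_def c by simp
    qed
    have key: "?g (\<lambda>i\<in>{..<N}. real m + sqrt m * x i)
        = (real m ^ m * exp (- real m)) ^ N * (sqrt (real m) powr (2 * \<beta>)) ^ card (pairs N) * ?s m x" for x :: "nat \<Rightarrow> real"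
    proof -
      have "(\<Prod>i<N. weight m 1 0 ((\<lambda>i\<in>{..<N}. real m + sqrt m * x i) i)) = (\<Prod>i<N. (real m ^ m * exp (- real m)) * shifted_weight m (x i))"
        by (intro prod.cong refl) (simp add: w)
      also have "\<dots> = (real m ^ m * exp (- real m)) ^ N * (\<Prod>i<N. shifted_weight m (x i))"
        by (simp add: prod.distrib)
      finally show ?thesis unfolding vand_scale[OF sm] by (simp only: mult_ac)
    qed
    have "laguerre \<beta> N m = \<bar>sqrt m\<bar> ^ N * (LINT x|Leb N. ?g (\<lambda>i\<in>{..<N}. real m + sqrt m * x i))"
      unfolding laguerre_def avg_def using sm by (intro Leb_integral_affine gm) auto
    also have "\<dots> = (laplace_scale m ^ N * (sqrt (real m) powr (2 * \<beta>)) ^ card (pairs N)) * (LINT x|Leb N. ?s m x)"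
      unfolding key laplace_scale_def by (simp add: power_mult_distrib)
    finally show ?thesis .
  qed
  have "laguerre \<beta> N (Suc m) / (laplace_scale (Suc m) ^ N * (sqrt (real (Suc m)) powr (2 * \<beta>)) ^ card (pairs N)) = (LINT x|Leb N. ?s (Suc m) x)" for m
    by (subst eq) (auto simp: laplace_scale_def)
  with L have "(\<lambda>m. laguerre \<beta> N (Suc m) / (laplace_scale (Suc m) ^ N * (sqrt (real (Suc m)) powr (2 * \<beta>)) ^ card (pairs N))) \<longlonglongrightarrow> mehta \<beta> N"
    by simp
  then show ?thesis by (rule LIMSEQ_imp_Suc)
qed

lemma mehta_pos: "\<beta> > 0 \<Longrightarrow> mehta \<beta> N > 0"
  unfolding mehta_def by (rule avg_pos[OF _ rapid_gauss]) (auto intro: polyb_const)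

lemma laguerre_pos: "\<beta> > 0 \<Longrightarrow> laguerre \<beta> N m > 0"
  unfolding laguerre_def by (rule avg_pos) (auto intro: rapid_weight polyb_const simp: weight_nonneg, simp add: weight_def)

text \<open>Gauss's product for the Gamma function. \<open>Gamma_series (1 + z)\<close> contains one
  factor 1 + z + m more and one power of m more, and their quotient tends to 1.\<close>

lemma Gamma_ratio_tendsto:
  assumes z: "z \<ge> (0::real)"
  shows "(\<lambda>m. (\<Prod>k<m. 1 + real k + z) / (fact m * real m powr z)) \<longlonglongrightarrow> 1 / Gamma (1 + z)"
proof -
  have G: "Gamma_series (1 + z) \<longlonglongrightarrow> Gamma (1 + z)" by (rule Gamma_series_LIMSEQ)
  have Gp: "Gamma (1 + z) > 0" using z by (intro Gamma_real_pos) auto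
  have "(\<lambda>m. real m / (1 + z + real m)) \<longlonglongrightarrow> 1" by real_asymp
  from tendsto_divide[OF this G] have "(\<lambda>m. real m / (1 + z + real m) / Gamma_series (1 + z) m) \<longlonglongrightarrow> 1 / Gamma (1 + z)"
    using Gp by auto
  then show ?thesis
  proof (rule Lim_transform_eventually)
    show "\<forall>\<^sub>F m in sequentially. real m / (1 + z + real m) / Gamma_series (1 + z) m = (\<Prod>k<m. 1 + real k + z) / (fact m * real m powr z)"
      using eventually_gt_at_top[of 0]
    proof eventually_elim
      fix m :: nat assume m: "m > 0"
      have p: "pochhammer (1 + z) (m + 1) = (\<Prod>k<m. 1 + real k + z) * (1 + z + real m)"
        unfolding pochhammer_prod by (simp add: atLeast0LessThan add_ac)
      have e: "exp ((1 + z) * ln (real m)) = real m * real m powr z"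
        using m by (simp add: powr_def ring_distribs exp_add)
      show "real m / (1 + z + real m) / Gamma_series (1 + z) m = (\<Prod>k<m. 1 + real k + z) / (fact m * real m powr z)"
      proof -
        have a: "a / D / (f * (a * q) / (P * D)) = P / (f * q)" if "a \<noteq> 0" "D \<noteq> 0" "f \<noteq> 0" "q \<noteq> 0" for a D f q P :: real
          using that by (cases "P = 0") (auto simp: field_simps)
        show ?thesis unfolding Gamma_series_def p using m z by (simp only: e scaleR_conv_of_real of_real_eq_id id_apply) (rule a; simp)
      qed
    qed
  qed
qed

lemma laguerre_prod:
  assumes "\<beta> > 0"
  shows "laguerre \<beta> N m = (\<Prod>j<N. \<Prod>k<m. 1 + real k + \<beta> * real j) * laguerre \<beta> N 0"
  by (induction m) (simp_all add: laguerre_Suc[OF assms] prod.distrib mult_ac)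

text \<open>The N limits of Gauss type carry the powers m^(\<beta> j). Their exponents add up to
  \<beta> N (N - 1) / 2, which is exactly the power of m coming from the rescaled Vandermonde
  factor.\<close>

lemma laguerre_ratio_tendsto:
  assumes \<beta>: "\<beta> > 0"
  shows "(\<lambda>m. laguerre \<beta> N m / (fact m ^ N * (sqrt (real m) powr (2 * \<beta>)) ^ card (pairs N)))
     \<longlonglongrightarrow> laguerre \<beta> N 0 / (\<Prod>j<N. Gamma (1 + \<beta> * real j))"
proof -
  have "(\<lambda>m. (\<Prod>j<N. (\<Prod>k<m. 1 + real k + \<beta> * real j) / (fact m * real m powr (\<beta> * real j))) * laguerre \<beta> N 0)
     \<longlonglongrightarrow> (\<Prod>j<N. 1 / Gamma (1 + \<beta> * real j)) * laguerre \<beta> N 0"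
    using \<beta> by (intro tendsto_intros Gamma_ratio_tendsto) auto
  then have "(\<lambda>m. (\<Prod>j<N. (\<Prod>k<m. 1 + real k + \<beta> * real j) / (fact m * real m powr (\<beta> * real j))) * laguerre \<beta> N 0)
     \<longlonglongrightarrow> laguerre \<beta> N 0 / (\<Prod>j<N. Gamma (1 + \<beta> * real j))"
    by (simp add: prod_dividef)
  then show ?thesis
  proof (rule Lim_transform_eventually)
    show "\<forall>\<^sub>F m in sequentially. (\<Prod>j<N. (\<Prod>k<m. 1 + real k + \<beta> * real j) / (fact m * real m powr (\<beta> * real j))) * laguerre \<beta> N 0
      = laguerre \<beta> N m / (fact m ^ N * (sqrt (real m) powr (2 * \<beta>)) ^ card (pairs N))"
      using eventually_gt_at_top[of 0]
    proof eventually_elim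
      fix m :: nat assume m: "m > 0"
      have "(\<Prod>j<N. real m powr (\<beta> * real j)) = real m powr (\<beta> * real (card (pairs N)))"
      proof -
        have "(\<Prod>j<N. real m powr (\<beta> * real j)) = real m powr (\<Sum>j<N. \<beta> * real j)"
          using m by (subst powr_sum) auto
        also have "(\<Sum>j<N. \<beta> * real j) = \<beta> * (real N * (real N - 1) / 2)"
          by (induction N) (auto simp: field_simps)
        finally show ?thesis unfolding card_pairs .
      qed
      also have "\<dots> = (sqrt (real m) powr (2 * \<beta>)) ^ card (pairs N)"
        using m by (simp add: powr_half_sqrt[symmetric] powr_powr powr_realpow[symmetric])
      finally show "(\<Prod>j<N. (\<Prod>k<m. 1 + real k + \<beta> * real j) / (fact m * real m powr (\<beta> * real j))) * laguerre \<beta> N 0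
        = laguerre \<beta> N m / (fact m ^ N * (sqrt (real m) powr (2 * \<beta>)) ^ card (pairs N))"
        by (simp add: laguerre_prod[OF \<beta>, of N m] prod_dividef prod.distrib)
    qed
  qed
qed

lemma avg_single:
  assumes "rapid w"
  shows "avg \<beta> e 1 w (\<lambda>_. 1) = (LINT y|lborel. w y)"
proof -
  have p: "pairs 1 = {}" by (auto simp: pairs_def)
  have "avg \<beta> e 1 w (\<lambda>_. 1) = (LINT x|Leb 1. (\<Prod>i\<in>{..<1}. w (x i)))"
    unfolding avg_def vand_def p by simp
  also have "\<dots> = (\<Prod>i\<in>{..<1::nat}. (LINT y|lborel. w y))"
    by (intro Leb.product_integral_prod rapid_integrable assms) auto
  finally show ?thesis by simp
qed

lemma mehta_1: "mehta \<beta> 1 = sqrt (2 * pi)"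
proof -
  have "(LINT x|lborel. std_normal_density x) = 1" by simp
  then have "(LINT x|lborel. (1 / sqrt (2 * pi)) * exp (- x\<^sup>2 / 2)) = 1"
    unfolding std_normal_density_def .
  then have "(1 / sqrt (2 * pi)) * (LINT x|lborel. exp (- x\<^sup>2 / 2)) = 1"
    by (simp only: integral_mult_right_zero)
  then show ?thesis unfolding mehta_def avg_single[OF rapid_gauss] by (simp add: field_simps)
qed

lemma laguerre_1_0: "laguerre \<beta> 1 0 = 1"
proof -
  interpret prob_space "density lborel (exponential_density 1)"
    by (rule prob_space_exponential_density) simp
  have e: "weight 0 1 0 y = exponential_density 1 y" for y
    by (simp add: weight_def exponential_density_def)
  have "(\<integral>\<^sup>+y. ennreal (weight 0 1 0 y) \<partial>lborel) = 1"
    using emeasure_space_1 unfolding e by (simp add: emeasure_density)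
  then have "(LINT y|lborel. weight 0 1 0 y) = 1"
    by (subst integral_eq_nn_integral) (auto simp: weight_nonneg intro: rapid_measurable[OF rapid_weight])
  then show ?thesis unfolding laguerre_def by (subst avg_single) (auto intro: rapid_weight)
qed

text \<open>The case N = 1 of the preceding limit: there the Laguerre integral is m! and the
  Gaussian one is sqrt (2 pi).\<close>

lemma stirling: "(\<lambda>m. fact m / laplace_scale m) \<longlonglongrightarrow> sqrt (2 * pi)"
proof -
  have c: "card (pairs (Suc 0)) = 0" using card_pairs[of 1] by simp
  have l: "laguerre 1 1 m = fact m" for m
    using laguerre_1_0[of 1] by (induction m) (simp_all add: laguerre_Suc)
  show ?thesis using laguerre_tendsto_mehta[of 1 1] by (simp add: c l[unfolded One_nat_def] mehta_1[unfolded One_nat_def])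
qed

text \<open>The same limit of large exponent is evaluated twice, once by Laplace's method and once
  by the product formula; \<open>stirling\<close> matches the two normalisations.\<close>

theorem mehta_eq:
  assumes \<beta>: "\<beta> > 0"
  shows "mehta \<beta> N = sqrt (2 * pi) ^ N * (laguerre \<beta> N 0 / (\<Prod>j<N. Gamma (1 + \<beta> * real j)))"
proof (rule LIMSEQ_unique)
  show "(\<lambda>m. laguerre \<beta> N m / (laplace_scale m ^ N * (sqrt (real m) powr (2 * \<beta>)) ^ card (pairs N))) \<longlonglongrightarrow> mehta \<beta> N"
    by (rule laguerre_tendsto_mehta[OF \<beta>])
  have "(\<lambda>m. (fact m / laplace_scale m) ^ N * (laguerre \<beta> N m / (fact m ^ N * (sqrt (real m) powr (2 * \<beta>)) ^ card (pairs N))))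
     \<longlonglongrightarrow> sqrt (2 * pi) ^ N * (laguerre \<beta> N 0 / (\<Prod>j<N. Gamma (1 + \<beta> * real j)))"
    by (intro tendsto_intros stirling laguerre_ratio_tendsto \<beta>)
  then show "(\<lambda>m. laguerre \<beta> N m / (laplace_scale m ^ N * (sqrt (real m) powr (2 * \<beta>)) ^ card (pairs N)))
     \<longlonglongrightarrow> sqrt (2 * pi) ^ N * (laguerre \<beta> N 0 / (\<Prod>j<N. Gamma (1 + \<beta> * real j)))"
    by (simp add: power_divide)
qed

section \<open>The partition function\<close>

lemma powr_square: "\<bar>x :: real\<bar> powr (2 * \<beta>) = (x^2 + 0) powr \<beta>"
proof -
  have "x^2 = \<bar>x\<bar> powr 2" by (cases "x = 0") (auto simp: powr_numeral)
  then show ?thesis by (simp only: powr_powr add_0_right)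
qed

lemma partition_fn_alt:
  "partition_fn t \<beta> N a = (LINT x|Leb N. indicator (\<Pi>\<^sub>E i\<in>{..<N}. {y. ereal y \<le> a}) x * vand \<beta> 0 N x *
      (\<Prod>i<N. exp (- (real N * \<beta> / (2 * t)) * (x i)^2)))"
proof -
  have "(\<Prod>(i, j)\<in>{(i, j). i < j \<and> j < N}. \<bar>x i - x j\<bar> powr (2 * \<beta>)) = vand \<beta> 0 N x" for x :: "nat \<Rightarrow> real"
    unfolding vand_def pairs_def by (simp only: powr_square)
  then show ?thesis unfolding partition_fn_def set_lebesgue_integral_def by (simp add: mult.assoc)
qed

lemma vand_affine_neg:
  assumes "s > 0"
  shows "vand \<beta> 0 N (\<lambda>i\<in>{..<N}. t + (- s) * x i) = (s powr (2 * \<beta>)) ^ card (pairs N) * vand \<beta> 0 N x"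
proof -
  have "vand \<beta> 0 N (\<lambda>i\<in>{..<N}. t + (- s) * x i) = vand \<beta> 0 N (\<lambda>i\<in>{..<N}. - t + s * x i)"
    unfolding vand_def
    by (intro prod.cong refl) (auto simp: pairs_def power2_commute)
  then show ?thesis by (simp only: vand_scale[OF assms])
qed

lemma partition_fn_infinity:
  assumes t: "t > 0" and \<beta>: "\<beta> > 0" and N: "N > 0"
  defines "s \<equiv> sqrt (t / (real N * \<beta>))"
  shows "partition_fn t \<beta> N \<infinity> = s ^ N * (s powr (2 * \<beta>)) ^ card (pairs N) * mehta \<beta> N"
proof -
  have s: "s > 0" unfolding s_def using assms by simp
  have s2: "s^2 = t / (real N * \<beta>)" unfolding s_def using assms by simp
  let ?f = "\<lambda>x. 1 * vand \<beta> 0 N x * (\<Prod>i<N. exp (- (real N * \<beta> / (2 * t)) * (x i)^2))"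
  have pv: "vand \<beta> 0 N \<in> borel_measurable (Leb N)" using polyb_measurable[OF polyb_vand] \<beta> by auto
  have key: "?f (\<lambda>i\<in>{..<N}. 0 + s * x i) = (s powr (2 * \<beta>)) ^ card (pairs N) * (1 * vand \<beta> 0 N x * (\<Prod>i<N. exp (- (x i)\<^sup>2 / 2)))"
    for x :: "nat \<Rightarrow> real"
  proof -
    have 1: "(\<Prod>i<N. exp (- (real N * \<beta> / (2 * t)) * ((\<lambda>i\<in>{..<N}. 0 + s * x i) i)^2)) = (\<Prod>i<N. exp (- (x i)\<^sup>2 / 2))"
      using assms(1-3) by (intro prod.cong refl) (simp add: power_mult_distrib s2)
    show ?thesis unfolding vand_scale[OF s] 1 by (simp only: mult_ac)
  qed
  have m: "?f \<in> borel_measurable (Leb N)" using pv by measurable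
  have "partition_fn t \<beta> N \<infinity> = (LINT x|Leb N. ?f x)"
    unfolding partition_fn_alt
    by (intro Bochner_Integration.integral_cong refl) (auto simp: space_PiM PiE_iff indicator_def)
  also have "\<dots> = \<bar>s\<bar> ^ N * (LINT x|Leb N. ?f (\<lambda>i\<in>{..<N}. 0 + s * x i))"
    using s by (intro Leb_integral_affine m) auto
  also have "\<dots> = s ^ N * (s powr (2 * \<beta>)) ^ card (pairs N) * mehta \<beta> N"
    unfolding key mehta_def avg_def using s by simp
  finally show ?thesis .
qed

text \<open>The substitution \<lambda> = sqrt t (a - x) reflects at the cut-off. Expanding - c (a -
  x)^2 / 2 gives the constant - c a^2 / 2 and the linear coefficient l = - c a.\<close>

lemma partition_fn_finite:
  assumes t: "t > 0" and \<beta>: "\<beta> > 0" and N: "N > 0"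
  defines "c \<equiv> real N * \<beta>"
  shows "partition_fn t \<beta> N (ereal (sqrt t * a)) =
     sqrt t ^ N * (sqrt t powr (2 * \<beta>)) ^ card (pairs N) * exp (- (real N * c * a^2 / 2)) * mom \<beta> N c (- c * a) 0"
proof -
  define s where "s = sqrt t"
  have s: "s > 0" "s^2 = t" unfolding s_def using t by auto
  let ?f = "\<lambda>x. indicator (\<Pi>\<^sub>E i\<in>{..<N}. {y. ereal y \<le> ereal (s * a)}) x * vand \<beta> 0 N x * (\<Prod>i<N. exp (- (real N * \<beta> / (2 * t)) * (x i)^2))"
  have pv: "vand \<beta> 0 N \<in> borel_measurable (Leb N)" using polyb_measurable[OF polyb_vand] \<beta> by auto
  have "(\<Pi>\<^sub>E i\<in>{..<N}. {y. ereal y \<le> ereal (s * a)}) \<in> sets (Leb N)" by (intro sets_PiM_I_finite) auto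
  then have m: "?f \<in> borel_measurable (Leb N)" using pv by measurable
  have key: "?f (\<lambda>i\<in>{..<N}. s * a + (- s) * x i) = ((s powr (2 * \<beta>)) ^ card (pairs N) * exp (- (real N * c * a^2 / 2))) *
       (1 * vand \<beta> 0 N x * (\<Prod>i<N. weight 0 (- c * a) c (x i)))"
    if x: "x \<in> space (Leb N)" for x
  proof -
    let ?y = "\<lambda>i\<in>{..<N}. s * a + (- s) * x i"
    have i: "indicator (\<Pi>\<^sub>E i\<in>{..<N}. {y. ereal y \<le> ereal (s * a)}) ?y = (\<Prod>i<N. indicator {0..} (x i) :: real)"
    proof (cases "\<forall>i<N. x i \<ge> 0")
      case True
      then have "?y \<in> (\<Pi>\<^sub>E i\<in>{..<N}. {y. ereal y \<le> ereal (s * a)})" using s by (auto simp: PiE_iff)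
      moreover have "(\<Prod>i<N. indicator {0..} (x i) :: real) = 1" using True by (intro prod.neutral) auto
      ultimately show ?thesis by simp
    next
      case False
      then obtain j where j: "j < N" "x j < 0" by force
      have "s * x j < 0" using s(1) j(2) by (rule mult_pos_neg)
      have "?y \<notin> (\<Pi>\<^sub>E i\<in>{..<N}. {y. ereal y \<le> ereal (s * a)})"
      proof
        assume "?y \<in> (\<Pi>\<^sub>E i\<in>{..<N}. {y. ereal y \<le> ereal (s * a)})"
        from PiE_mem[OF this, of j] j(1) have "s * a + (- s) * x j \<le> s * a" by simp
        with \<open>s * x j < 0\<close> show False by simp
      qed
      moreover have "(\<Prod>i<N. indicator {0..} (x i) :: real) = 0" using j by (intro prod_zero) (auto intro!: bexI[of _ j])
      ultimately show ?thesis by simp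
    qed
    have "indicator {0..} (x i) * exp (- (real N * \<beta> / (2 * t)) * (?y i)^2) = exp (- (c * a^2 / 2)) * weight 0 (- c * a) c (x i)"
      if "i < N" for i
    proof -
      have "- (real N * \<beta> / (2 * t)) * (?y i)^2 = - (c / 2) * (a - x i)^2"
      proof -
        have "(?y i)^2 = t * (a - x i)^2" using that s(2) by (simp add: power_mult_distrib[symmetric] algebra_simps flip: s(2))
        then show ?thesis using t by (simp add: c_def)
      qed
      also have "\<dots> = - (c * a^2 / 2) + (- (- c * a) * x i - c * (x i)^2 / 2)"
        by (simp add: power2_eq_square algebra_simps)
      finally show ?thesis by (simp add: weight_def exp_add[symmetric] indicator_def)
    qed
    then have "(\<Prod>i<N. indicator {0..} (x i) * exp (- (real N * \<beta> / (2 * t)) * (?y i)^2)) = (\<Prod>i<N. exp (- (c * a^2 / 2)) * weight 0 (- c * a) c (x i))"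
      by (intro prod.cong refl) auto
    also have "\<dots> = exp (- (real N * c * a^2 / 2)) * (\<Prod>i<N. weight 0 (- c * a) c (x i))"
      by (simp add: prod.distrib exp_of_nat_mult[symmetric] mult_ac)
    finally have "(\<Prod>i<N. indicator {0..} (x i)) * (\<Prod>i<N. exp (- (real N * \<beta> / (2 * t)) * (?y i)^2)) = \<dots>"
      by (simp only: prod.distrib)
    note h = this
    have gen: "A * (K * V) * B = (K * C) * (1 * V * D)" if "A * B = C * D" for A B C D K V :: real
      using that by algebra
    show ?thesis unfolding vand_affine_neg[OF s(1)] i by (rule gen[OF h])
  qed
  have "partition_fn t \<beta> N (ereal (sqrt t * a)) = (LINT x|Leb N. ?f x)"
    unfolding partition_fn_alt s_def ..
  also have "\<dots> = \<bar>- s\<bar> ^ N * (LINT x|Leb N. ?f (\<lambda>i\<in>{..<N}. s * a + (- s) * x i))"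
    using s by (intro Leb_integral_affine m) auto
  also have "(LINT x|Leb N. ?f (\<lambda>i\<in>{..<N}. s * a + (- s) * x i)) = (LINT x|Leb N. ((s powr (2 * \<beta>)) ^ card (pairs N) * exp (- (real N * c * a^2 / 2))) *
       (1 * vand \<beta> 0 N x * (\<Prod>i<N. weight 0 (- c * a) c (x i))))"
    by (rule Bochner_Integration.integral_cong[OF refl key])
  also have "\<dots> = (s powr (2 * \<beta>)) ^ card (pairs N) * exp (- (real N * c * a^2 / 2)) * mom \<beta> N c (- c * a) 0"
    unfolding mom_def avg_def by simp
  finally show ?thesis using s(1) unfolding s_def[symmetric] by (simp add: mult.assoc)
qed

section \<open>The three leading orders of the WKB expansion\<close>

text \<open>The equation of order N^0 multiplied by its common denominator. The relation r^2 = 2 m -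
  1 is parametrised by k with integer coefficients, so that a plain polynomial identity in n, k and
  b remains.\<close>

lemma wkb_polynomial_identity:
  fixes n r b k m M d e g F1 F2 B S X C3 C2 E2 V Y Pp Qq W q :: real
  assumes defs: "m = 2 * k^2 + 2 * k + 1" "r = 2 * k + 1" "M = 2 * m" "d = n + m" "e = n + 1" "g = n + r"
   "F1 = e - 2 * d" "F2 = n * (2 * d^2 - e^2) - F1 * d * e"
   "B = n * e * g + 2 * (1 + b) * n * d * g + 2 * b * n * d * e - d * e * g"
   "S = d^2 * e^2 * g^2 - n^2 * e^2 * g^2 - 2 * (1 + b) * n^2 * d^2 * g^2 - 2 * b * n^2 * d^2 * e^2 - B * d * e * g"
   "X = 2 * S + n^2 * F1^2 * g^2 + B^2"
   "C3 = (b + 1) * r^3 + b * r^2 + (b + 2) * r + b"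
   "C2 = (12 * b^2 + 24 * b + 11) * r^6 + 24 * (b^2 + b) * r^5 + (36 * b^2 + 72 * b + 45) * r^4 + (48 * b^2 + 72 * b) * r^3
        + (36 * b^2 + 48 * b + 45) * r^2 + (24 * b^2 + 48 * b) * r + 12 * b^2 + 3"
   "E2 = (3 * b^2 + b) * r^4 - 4 * b^2 * r^3 - 2 * (b^2 + b) * r^2 + (4 * b^2 + 8 * b) * r + 7 * b^2 + b"
   "V = - 15 * M^2 * r^2 * d^2 * e^2 * g^3 + 24 * r * M * C3 * n * d^2 * e^2 * g^3 - C2 * n^2 * d^2 * e^2 * g^3
      + 8 * r^4 * M * (3 * b^2 + 3 * b + 1) * n^4 * d^2 * g^3 + 6 * r * M * (r^2 - 1)^2 * (b - b^2) * n^4 * d^2 * e^2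
      - 3 * M * E2 * n^4 * d^2 * e^2 * g - 8 * r^4 * n^4 * e^2 * g^3"
   "Y = 8 * r^4 * M * n^2 * g^3 * F2 + 12 * r^4 * M * n^2 * g^2 * F1 * B - V"
   "Pp = (m - n) * e^2" "Qq = (n - 1)^2 * d" "W = n^5 * d^2 * e^2 * g^3" "q = m^2 - 1"
  shows "(Pp + Qq) * (6 * r^4 * M * n * g * X) + (Qq - Pp) * Y - b * (n - 1) * (n * g * F1 + B) * 48 * r^4 * M * n^3 * d^2 * g^2
   = 48 * (1 + b) * r^2 * M * n^3 * d * e * g^2 * B * m * (n^2 - 1) - 48 * (1 + b) * (r^2 - 1) * r^2 * M * W
     + 48 * (1 + b) * q * r^2 * M * n^5 * d * e^2 * g^3
     + b * (1 + b) * (- 48 * (r^2 - 1) * r^2 * M * W + 96 * q * r * M * n^5 * d^2 * e^2 * g^2 - 48 * (r - 1) * (r^2 + 3) * r * M * W)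
     + (1 + b) * (8 * (r^2 - 1) * r^2 * M * W - 8 * q * M * W)
     + b^2 * (24 * (r - 1) * (r^2 + 3) * r * M * W - 88 * q * M * W - 8 * (r^2 - 1) * r^2 * M * W)"
  unfolding defs by algebra

text \<open>Here \<open>n = sqrt z\<close> and \<open>q\<^sub>a = 1 / (n + a)\<close>; \<open>f\<close>, \<open>s\<close>, \<open>v\<close> are the \<open>z\<close>-derivatives of the
  zeroth, first and second WKB coefficients.\<close>

lemma wkb_order2:
  fixes n r b m q0 q1 qm qr f1 f2 s1 s2 v1 :: real
  assumes n: "n \<ge> 1" and r: "r > 1" and b: "1 + b > 0" and m: "m = (r^2 + 1) / 2"
    and q: "q0 = 1 / n" "q1 = 1 / (n + 1)" "qm = 1 / (n + m)" "qr = 1 / (n + r)"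
    and f1: "f1 = q0 * (qm - 2 * q1) / 2"
    and f2: "f2 = - (q0 ^ 3 * (qm - 2 * q1) / 4) - q0^2 * (qm^2 - 2 * q1^2) / 4"
    and s1: "s1 = q0 * (- q0 / 2 + qm / 2 + (1 + b) * q1 + b * qr) / 2"
    and s2: "s2 = - (q0 ^ 3 * (- q0 / 2 + qm / 2 + (1 + b) * q1 + b * qr) / 4)
       - q0\<^sup>2 * (- q0\<^sup>2 / 2 + qm^2 / 2 + (1 + b) * q1^2 + b * qr^2) / 4"
    and C3: "C3 = (b + 1) * r ^ 3 + b * r^2 + (b + 2) * r + b"
    and C2: "C2 = (12 * b^2 + 24 * b + 11) * r ^ 6 + 24 * (b^2 + b) * r ^ 5 + (36 * b^2 + 72 * b + 45) * r ^ 4 + (48 * b^2 + 72 * b) * r ^ 3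
        + (36 * b^2 + 48 * b + 45) * r^2 + (24 * b^2 + 48 * b) * r + 12 * b^2 + 3"
    and E2: "E2 = (3 * b^2 + b) * r ^ 4 - 4 * b^2 * r ^ 3 - 2 * (b^2 + b) * r^2 + (4 * b^2 + 8 * b) * r + 7 * b^2 + b"
    and v1: "v1 = q0 * (- (5 * m / (16 * r^2)) * q0 ^ 4 + C3 / (4 * r ^ 3) * q0 ^ 3 - C2 / (192 * r ^ 4 * m) * q0^2
        + (3 * b^2 + 3 * b + 1) / 12 * q1^2 + (r^2 - 1)^2 * (b - b^2) / (16 * r ^ 3) * qr ^ 3 - E2 / (32 * r ^ 4) * qr^2
        - 1 / (24 * m) * qm^2) / 2"
  shows "(2 * r^2 / ((1 + b) * (m - 1))) * (((m - n) * (n + 1)^2 / (m + 1) + (n - 1)^2 * (n + m) / (m + 1)) * (s2 / 2 + (f1^2 / 4 + s1^2) / 2)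
      + ((n - 1)^2 * (n + m) / (m + 1) - (m - n) * (n + 1)^2 / (m + 1)) * (f2 / 6 - v1 + f1 * s1 / 2)
      + b * (n - 1) * (n + m) / ((m + 1) * (n + 1)) * (- f1 / 2 - s1))
     = s1 * (2 * m * (n^2 - 1)) / (m^2 - 1) + (- 1 / (m + 1) + 1 / (2 * (n + m)))
       + b * (- 1 / (m + 1) + 1 / (r * (n + r)) - 2 / (r * (r + 1)))
       + (1 / (3 * (r^2 + 3)) - 1 / (12 * r^2) + b^2 / (1 + b) * (1 / (r * (r + 1)) - 11 / (12 * r^2) - 1 / (3 * (r^2 + 3))))"
    (is "?L = ?R")
proof -
  define k where "k = (r - 1) / 2"
  define M where "M = 2 * m"
  define d where "d = n + m"
  define e where "e = n + 1"
  define g where "g = n + r"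
  \<comment> \<open>\<open>?E\<close> is the common denominator of \<open>f1 / 2\<close> and
    \<open>s1\<close>, \<open>?H\<close> that of their squares and \<open>s2\<close>,
    \<open>?K\<close> that of \<open>v1\<close>, \<open>f2\<close> and \<open>f1 * s1\<close>. The
    capital letters below are the corresponding numerators.\<close>
  let ?K = "192 * r^4 * M * n^5 * d^2 * e^2 * g^3" and ?H = "32 * n^4 * d^2 * e^2 * g^2" and ?E = "4 * n^2 * d * e * g"
  define F1 where "F1 = e - 2 * d"
  define F2 where "F2 = n * (2 * d^2 - e^2) - F1 * d * e"
  define B where "B = n * e * g + 2 * (1 + b) * n * d * g + 2 * b * n * d * e - d * e * g"
  define S where "S = d^2 * e^2 * g^2 - n^2 * e^2 * g^2 - 2 * (1 + b) * n^2 * d^2 * g^2 - 2 * b * n^2 * d^2 * e^2 - B * d * e * g"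
  define X where "X = 2 * S + n^2 * F1^2 * g^2 + B^2"
  define V where "V = - 15 * M^2 * r^2 * d^2 * e^2 * g^3 + 24 * r * M * C3 * n * d^2 * e^2 * g^3 - C2 * n^2 * d^2 * e^2 * g^3
      + 8 * r^4 * M * (3 * b^2 + 3 * b + 1) * n^4 * d^2 * g^3 + 6 * r * M * (r^2 - 1)^2 * (b - b^2) * n^4 * d^2 * e^2
      - 3 * M * E2 * n^4 * d^2 * e^2 * g - 8 * r^4 * n^4 * e^2 * g^3"
  define Y where "Y = 8 * r^4 * M * n^2 * g^3 * F2 + 12 * r^4 * M * n^2 * g^2 * F1 * B - V"
  define Pp where "Pp = (m - n) * e^2"
  define Qq where "Qq = (n - 1)^2 * d"
  define W where "W = n^5 * d^2 * e^2 * g^3"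
  define q where "q = m^2 - 1"
  define T where "T = b * (n - 1) * (n * g * F1 + B) * 48 * r^4 * M * n^3 * d^2 * g^2"
  have mk: "m = 2 * k^2 + 2 * k + 1" "r = 2 * k + 1"
    unfolding m k_def by (simp_all add: field_simps power2_eq_square)
  have r2: "r^2 > 1" using r by (simp add: one_less_power)
  have m1: "m > 1" unfolding m using r2 by simp
  have r3: "r^2 + 3 \<noteq> 0" using r2 by linarith
  have nz: "n \<noteq> 0" "r \<noteq> 0" "d \<noteq> 0" "e \<noteq> 0" "g \<noteq> 0" "1 + b \<noteq> 0" "m + 1 \<noteq> 0" "m - 1 \<noteq> 0" "m \<noteq> 0" "M \<noteq> 0" "q \<noteq> 0"
    "r^2 + 3 \<noteq> 0" "r + 1 \<noteq> 0"
    using n r b m1 r3 unfolding d_def e_def g_def M_def q_def by (auto simp: power2_eq_1_iff)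
  have qs: "q0 = 1 / n" "q1 = 1 / e" "qm = 1 / d" "qr = 1 / g" using q by (simp_all add: d_def e_def g_def)
  have f1': "f1 = F1 / (2 * n * d * e)" unfolding f1 qs F1_def using nz by (simp add: divide_simps)
  have f2': "f2 = F2 / (4 * n^3 * d^2 * e^2)"
  proof -
    let ?E = "4 * n^3 * d^2 * e^2"
    have 1: "q0 ^ 3 * qm / 4 = d * e^2 / ?E" "q0 ^ 3 * q1 / 2 = 2 * d^2 * e / ?E"
      "q0^2 * qm^2 / 4 = n * e^2 / ?E" "q0^2 * q1^2 / 2 = 2 * n * d^2 / ?E"
      unfolding qs using nz by (simp_all add: divide_simps power_numeral_reduce)
    have "f2 = - (q0 ^ 3 * qm / 4) + q0 ^ 3 * q1 / 2 - q0^2 * qm^2 / 4 + q0^2 * q1^2 / 2"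
      unfolding f2 by (simp add: field_simps)
    also have "\<dots> = (- (d * e^2) + 2 * d^2 * e - n * e^2 + 2 * n * d^2) / ?E"
      unfolding 1 by (simp only: add_divide_distrib diff_divide_distrib minus_divide_left)
    also have "- (d * e^2) + 2 * d^2 * e - n * e^2 + 2 * n * d^2 = F2"
      unfolding F2_def F1_def by (simp add: algebra_simps power2_eq_square)
    finally show ?thesis .
  qed
  have s1': "s1 = B / (?E)"
  proof -
    let ?E = "?E"
    have 1: "q0^2 / 4 = d * e * g / ?E" "q0 * qm / 4 = n * e * g / ?E" "q0 * q1 / 2 = 2 * n * d * g / ?E" "q0 * qr / 2 = 2 * n * d * e / ?E"
      unfolding qs using nz by (simp_all add: divide_simps power_numeral_reduce)
    have "s1 = - (q0^2 / 4) + q0 * qm / 4 + (1 + b) * (q0 * q1 / 2) + b * (q0 * qr / 2)"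
      unfolding s1 by (simp add: field_simps power2_eq_square)
    also have "\<dots> = B / ?E" unfolding 1 B_def by (simp add: add_divide_distrib diff_divide_distrib algebra_simps)
    finally show ?thesis .
  qed
  have s2': "s2 = S / (8 * n^4 * d^2 * e^2 * g^2)"
  proof -
    let ?E = "8 * n^4 * d^2 * e^2 * g^2"
    have s: "s2 = (q0 ^ 4 - q0^2 * qm^2) / 8 - (1 + b) * (q0^2 * q1^2) / 4 - b * (q0^2 * qr^2) / 4 - q0^2 * s1 / 2"
      unfolding s2 s1 by (simp add: field_simps power_numeral_reduce)
    have 1: "q0 ^ 4 / 8 = d^2 * e^2 * g^2 / ?E" "q0^2 * qm^2 / 8 = n^2 * e^2 * g^2 / ?E" "q0^2 * q1^2 / 4 = 2 * n^2 * d^2 * g^2 / ?E"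
      "q0^2 * qr^2 / 4 = 2 * n^2 * d^2 * e^2 / ?E" "q0^2 * s1 / 2 = B * d * e * g / ?E"
      unfolding qs s1' using nz by (simp_all add: divide_simps power_numeral_reduce)
    have "s2 = q0 ^ 4 / 8 - q0^2 * qm^2 / 8 - (1 + b) * (q0^2 * q1^2 / 4) - b * (q0^2 * qr^2 / 4) - q0^2 * s1 / 2"
      unfolding s by (simp add: diff_divide_distrib)
    also have "\<dots> = S / ?E" unfolding 1 S_def by (simp add: diff_divide_distrib algebra_simps add_divide_distrib)
    finally show ?thesis .
  qed
  have v1': "v1 = V / (?K)"
  proof -
    have 1: "q0 * (5 * m / (16 * r^2) * q0 ^ 4) / 2 = 15 * M^2 * r^2 * d^2 * e^2 * g^3 / (?K)"
      "q0 * (C3 / (4 * r ^ 3) * q0 ^ 3) / 2 = 24 * r * M * C3 * n * d^2 * e^2 * g^3 / (?K)"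
      "q0 * (C2 / (192 * r ^ 4 * m) * q0^2) / 2 = C2 * n^2 * d^2 * e^2 * g^3 / (?K)"
      "q0 * ((3 * b^2 + 3 * b + 1) / 12 * q1^2) / 2 = 8 * r^4 * M * (3 * b^2 + 3 * b + 1) * n^4 * d^2 * g^3 / (?K)"
      "q0 * ((r^2 - 1)^2 * (b - b^2) / (16 * r ^ 3) * qr ^ 3) / 2 = 6 * r * M * (r^2 - 1)^2 * (b - b^2) * n^4 * d^2 * e^2 / (?K)"
      "q0 * (E2 / (32 * r ^ 4) * qr^2) / 2 = 3 * M * E2 * n^4 * d^2 * e^2 * g / (?K)"
      "q0 * (1 / (24 * m) * qm^2) / 2 = 8 * r^4 * n^4 * e^2 * g^3 / (?K)"
      unfolding qs M_def using nz by (simp_all add: divide_simps power_numeral_reduce)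
    have "v1 = - (q0 * (5 * m / (16 * r^2) * q0 ^ 4) / 2) + q0 * (C3 / (4 * r ^ 3) * q0 ^ 3) / 2 - q0 * (C2 / (192 * r ^ 4 * m) * q0^2) / 2
       + q0 * ((3 * b^2 + 3 * b + 1) / 12 * q1^2) / 2 + q0 * ((r^2 - 1)^2 * (b - b^2) / (16 * r ^ 3) * qr ^ 3) / 2
       - q0 * (E2 / (32 * r ^ 4) * qr^2) / 2 - q0 * (1 / (24 * m) * qm^2) / 2"
      unfolding v1 by (simp add: algebra_simps add_divide_distrib diff_divide_distrib)
    also have "\<dots> = V / (?K)"
      unfolding 1 V_def by (simp only: add_divide_distrib diff_divide_distrib minus_divide_left)
    finally show ?thesis .
  qed
  have X': "s2 / 2 + (f1^2 / 4 + s1^2) / 2 = X / (?H)"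
  proof -
    have 1: "s2 / 2 = 2 * S / (?H)" "f1^2 / 8 = n^2 * F1^2 * g^2 / (?H)"
      "s1^2 / 2 = B^2 / (?H)"
      unfolding s2' f1' s1' using nz by (simp_all add: divide_simps power_numeral_reduce power2_eq_square)
    have "s2 / 2 + (f1^2 / 4 + s1^2) / 2 = s2 / 2 + f1^2 / 8 + s1^2 / 2" by (simp add: add_divide_distrib)
    then show ?thesis unfolding 1 X_def by (simp only: add_divide_distrib)
  qed
  have Y': "f2 / 6 - v1 + f1 * s1 / 2 = Y / (?K)"
  proof -
    have 1: "f2 / 6 = 8 * r^4 * M * n^2 * g^3 * F2 / (?K)"
      "f1 * s1 / 2 = 12 * r^4 * M * n^2 * g^2 * F1 * B / (?K)"
      unfolding f2' f1' s1' using nz by (simp_all add: divide_simps power_numeral_reduce)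
    show ?thesis unfolding 1 v1' Y_def by (simp only: add_divide_distrib diff_divide_distrib)
  qed
  have T': "- f1 / 2 - s1 = - (n * g * F1 + B) / (?E)"
  proof -
    have 1: "f1 / 2 = n * g * F1 / (?E)" unfolding f1' using nz by (simp add: divide_simps power_numeral_reduce)
    have "- f1 / 2 - s1 = - (f1 / 2 + s1)" by simp
    then show ?thesis unfolding 1 s1' by (simp only: add_divide_distrib[symmetric] minus_divide_left)
  qed
  \<comment> \<open>The prefactor 2 r^2 / ((1 + b) (m - 1)), divided by m + 1 and by 192 r^4 M W,
    the common denominator of the three summands, is exactly 1 / D.\<close>
  define D where "D = 96 * r^2 * M * W * (1 + b) * q"
  have D0: "D \<noteq> 0" unfolding D_def W_def using nz by simp
  have "?L = ((Pp + Qq) * (6 * r^4 * M * n * g * X) + (Qq - Pp) * Y - T) / D"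
  proof -
    have Z: "Z / (m + 1) * (X / (?H)) = Z * (6 * r^4 * M * n * g * X) / ((m + 1) * (192 * r^4 * M * W))"
      "Z / (m + 1) * (Y / (?K)) = Z * Y / ((m + 1) * (192 * r^4 * M * W))"
      "b * (n - 1) * d / ((m + 1) * e) * (- Z / (?E)) = - (b * (n - 1) * Z * 48 * r^4 * M * n^3 * d^2 * g^2) / ((m + 1) * (192 * r^4 * M * W))"
      for Z
      unfolding W_def using nz by (simp_all add: divide_simps power_numeral_reduce)
    have 1: "(Pp / (m + 1) + Qq / (m + 1)) * (X / (?H)) = (Pp + Qq) * (6 * r^4 * M * n * g * X) / ((m + 1) * (192 * r^4 * M * W))"
      "(Qq / (m + 1) - Pp / (m + 1)) * (Y / (?K)) = (Qq - Pp) * Y / ((m + 1) * (192 * r^4 * M * W))"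
      "b * (n - 1) * d / ((m + 1) * e) * (- (n * g * F1 + B) / (?E)) = - T / ((m + 1) * (192 * r^4 * M * W))"
      unfolding add_divide_distrib[symmetric] diff_divide_distrib[symmetric] Z T_def by (rule refl)+
    have 2: "2 * r^2 / ((1 + b) * (m - 1)) * (Z / ((m + 1) * (192 * r^4 * M * W))) = Z / D" for Z
    proof -
      have "q = (m - 1) * (m + 1)" unfolding q_def by (simp add: power2_eq_square algebra_simps)
      then show ?thesis unfolding D_def using nz by (simp add: power_numeral_reduce)
    qed
    show ?thesis
      unfolding X' Y' T' Pp_def[symmetric] Qq_def[symmetric] d_def[symmetric] e_def[symmetric] 1
      unfolding add_divide_distrib[symmetric] 2 by simp
  qed
  also have "(Pp + Qq) * (6 * r^4 * M * n * g * X) + (Qq - Pp) * Y - T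
   = 48 * (1 + b) * r^2 * M * n^3 * d * e * g^2 * B * m * (n^2 - 1) - 48 * (1 + b) * (r^2 - 1) * r^2 * M * W
     + 48 * (1 + b) * q * r^2 * M * n^5 * d * e^2 * g^3
     + b * (1 + b) * (- 48 * (r^2 - 1) * r^2 * M * W + 96 * q * r * M * n^5 * d^2 * e^2 * g^2 - 48 * (r - 1) * (r^2 + 3) * r * M * W)
     + (1 + b) * (8 * (r^2 - 1) * r^2 * M * W - 8 * q * M * W)
     + b^2 * (24 * (r - 1) * (r^2 + 3) * r * M * W - 88 * q * M * W - 8 * (r^2 - 1) * r^2 * M * W)"
    (is "_ = ?P")
    unfolding T_def
    by (rule wkb_polynomial_identity[OF mk M_def d_def e_def g_def F1_def F2_def B_def S_def X_def C3 C2 E2 V_def Y_def Pp_def Qq_def W_def q_def])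
  also have "?P / D = ?R"
  proof -
    have qr: "q = (r^2 - 1) * (r^2 + 3) / 4" "m + 1 = (r^2 + 3) / 2" unfolding q_def m by (simp_all add: power2_eq_square field_simps)
    have rm: "r^2 - 1 = (r - 1) * (r + 1)" by (simp add: power2_eq_square algebra_simps)
    have nz': "r - 1 \<noteq> 0" using r by simp
    \<comment> \<open>From here on each monomial of \<open>?P\<close> over D is reduced to one
      elementary fraction of the right-hand side; \<open>cb\<close> keeps 1 + b as an atom while
      denominators are cleared.\<close>
    define cb where "cb = 1 + b"
    have D': "D = 96 * r^2 * M * W * cb * q" unfolding D_def cb_def ..
    have cb0: "cb \<noteq> 0" using nz unfolding cb_def by simp
    note nz = nz cb0
    have o1: "48 * cb * r^2 * M * n^3 * d * e * g^2 * B * m * (n^2 - 1) / D = s1 * (2 * m * (n^2 - 1)) / (m^2 - 1)"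
      unfolding s1' q_def[symmetric] D' W_def using nz by (simp add: divide_simps power_numeral_reduce)
    have o2: "(r^2 - 1) * r^2 * M * W / D = (1 / (m + 1)) / (48 * cb)"
      unfolding D' qr using nz nz' r2 unfolding W_def by (simp add: divide_simps)
    have o3: "q * r^2 * M * n^5 * d * e^2 * g^3 / D = (1 / d) / (96 * cb)"
      unfolding D' W_def using nz by (simp add: divide_simps power_numeral_reduce)
    have o4: "q * r * M * n^5 * d^2 * e^2 * g^2 / D = (1 / (r * g)) / (96 * cb)"
      unfolding D' W_def using nz by (simp add: divide_simps power_numeral_reduce)
    have o5: "(r - 1) * (r^2 + 3) * r * M * W / D = (1 / (r * (r + 1))) / (24 * cb)"
      unfolding D' qr(1) rm using nz nz' unfolding W_def by (simp add: divide_simps power_numeral_reduce)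
    have o6: "q * M * W / D = (1 / r^2) / (96 * cb)"
      unfolding D' using nz unfolding W_def by (simp add: divide_simps power_numeral_reduce)
    note 1 = o1[unfolded cb_def] and 2 = o2[unfolded cb_def] and 3 = o3[unfolded cb_def] and 4 = o4[unfolded cb_def]
      and 5 = o5[unfolded cb_def] and 6 = o6[unfolded cb_def]
    have "?P / D = 48 * (1 + b) * r^2 * M * n^3 * d * e * g^2 * B * m * (n^2 - 1) / D
      - 48 * (1 + b) * ((r^2 - 1) * r^2 * M * W / D) + 48 * (1 + b) * (q * r^2 * M * n^5 * d * e^2 * g^3 / D)
      + b * (1 + b) * (- 48 * ((r^2 - 1) * r^2 * M * W / D) + 96 * (q * r * M * n^5 * d^2 * e^2 * g^2 / D) - 48 * ((r - 1) * (r^2 + 3) * r * M * W / D))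
      + (1 + b) * (8 * ((r^2 - 1) * r^2 * M * W / D) - 8 * (q * M * W / D))
      + b^2 * (24 * ((r - 1) * (r^2 + 3) * r * M * W / D) - 88 * (q * M * W / D) - 8 * ((r^2 - 1) * r^2 * M * W / D))"
      using D0 by (simp add: divide_simps) algebra
    also have "\<dots> = ?R"
      unfolding 1 2 3 4 5 6 d_def[symmetric] g_def[symmetric]
    proof -
      define A1 A2 A3 A4 A5 where A: "A1 = 1 / (m + 1)" "A2 = 1 / d" "A3 = 1 / (r * g)" "A4 = 1 / (r * (r + 1))" "A5 = 1 / r^2"
      have e2: "1 / (3 * (r^2 + 3)) = A1 / 6" "- 1 / (m + 1) = - A1" "1 / (2 * d) = A2 / 2" "2 / (r * (r + 1)) = 2 * A4"
        "1 / (12 * r^2) = A5 / 12" "11 / (12 * r^2) = 11 * A5 / 12"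
      proof -
        have "1 / (3 * x) = 1 / (x / 2) / 6" for x :: real by simp
        then show "1 / (3 * (r^2 + 3)) = A1 / 6" unfolding A qr(2) .
      qed (simp_all add: A)
      define u where "u = 1 / (1 + b)"
      have u: "x / (k * (1 + b)) = x * u / k" "y / (1 + b) = y * u" for x y k by (simp_all add: u_def)
      have cu: "(1 + b) * u = 1" using nz by (simp add: u_def)
      show "s1 * (2 * m * (n^2 - 1)) / (m^2 - 1) - 48 * (1 + b) * (1 / (m + 1) / (48 * (1 + b))) + 48 * (1 + b) * (1 / d / (96 * (1 + b)))
         + b * (1 + b) * (- 48 * (1 / (m + 1) / (48 * (1 + b))) + 96 * (1 / (r * g) / (96 * (1 + b))) - 48 * (1 / (r * (r + 1)) / (24 * (1 + b))))
         + (1 + b) * (8 * (1 / (m + 1) / (48 * (1 + b))) - 8 * (1 / r^2 / (96 * (1 + b))))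
         + b^2 * (24 * (1 / (r * (r + 1)) / (24 * (1 + b))) - 88 * (1 / r^2 / (96 * (1 + b))) - 8 * (1 / (m + 1) / (48 * (1 + b))))
         = s1 * (2 * m * (n^2 - 1)) / (m^2 - 1) + (- 1 / (m + 1) + 1 / (2 * d)) + b * (- 1 / (m + 1) + 1 / (r * g) - 2 / (r * (r + 1)))
         + (1 / (3 * (r^2 + 3)) - 1 / (12 * r^2) + b^2 / (1 + b) * (1 / (r * (r + 1)) - 11 / (12 * r^2) - 1 / (3 * (r^2 + 3))))"
        unfolding e2 A[symmetric] u using cu by (simp add: field_simps) algebra
    qed
    finally show ?thesis .
  qed
  finally show ?thesis .
qed

section \<open>Bounds and Taylor expansions uniform in m and z\<close>

definition wdom :: "real \<Rightarrow> real \<Rightarrow> real \<Rightarrow> bool" where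
  "wdom m1 m z \<longleftrightarrow> 1 \<le> m \<and> m \<le> m1 \<and> 1 \<le> z \<and> z \<le> m^2"

text \<open>For 0 \<le> p \<le> N the variable z = \<open>zz (p / N) m\<close> runs through
  [1, m^2]. The bound is uniform down to m = 1, where this interval shrinks to a point; it has to
  be, because the comparison with the true moments starts there.\<close>

definition UB :: "real \<Rightarrow> (real \<Rightarrow> real \<Rightarrow> real) \<Rightarrow> bool" where
  "UB m1 f \<longleftrightarrow> (\<exists>C\<ge>0. \<forall>m z. wdom m1 m z \<longrightarrow> \<bar>f m z\<bar> \<le> C)"

lemma UBE:
  assumes "UB m1 f"
  obtains C where "C \<ge> 0" "\<And>m z. wdom m1 m z \<Longrightarrow> \<bar>f m z\<bar> \<le> C"
  using assms unfolding UB_def by blast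

lemma UB_I: "(\<And>m z. wdom m1 m z \<Longrightarrow> \<bar>f m z\<bar> \<le> C) \<Longrightarrow> UB m1 f"
  unfolding UB_def by (intro exI[of _ "\<bar>C\<bar>"]) (auto intro: order_trans[OF _ abs_ge_self])

lemma UB_const [intro]: "UB m1 (\<lambda>_ _. c)"
  by (rule UB_I[of _ _ "\<bar>c\<bar>"]) auto

lemma UB_continuous:
  assumes "continuous_on {1..m1} f"
  shows "UB m1 (\<lambda>m _. f m)"
proof -
  have "bounded (f ` {1..m1})" by (intro compact_imp_bounded compact_continuous_image assms) auto
  then obtain C where "\<forall>m\<in>{1..m1}. \<bar>f m\<bar> \<le> C" by (auto simp: bounded_iff)
  then show ?thesis by (intro UB_I[of _ _ C]) (auto simp: wdom_def)
qed

lemma UB_add [intro]: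
  assumes "UB m1 f" "UB m1 g" shows "UB m1 (\<lambda>m z. f m z + g m z)"
proof -
  from assms obtain C D where CD: "\<forall>m z. wdom m1 m z \<longrightarrow> \<bar>f m z\<bar> \<le> C" "\<forall>m z. wdom m1 m z \<longrightarrow> \<bar>g m z\<bar> \<le> D"
    unfolding UB_def by auto
  show ?thesis
  proof (rule UB_I[of _ _ "C + D"])
    fix m z assume "wdom m1 m z"
    with CD have "\<bar>f m z\<bar> \<le> C" "\<bar>g m z\<bar> \<le> D" by auto
    then show "\<bar>f m z + g m z\<bar> \<le> C + D" by linarith
  qed
qed

lemma UB_mult [intro]:
  assumes "UB m1 f" "UB m1 g" shows "UB m1 (\<lambda>m z. f m z * g m z)"
proof -
  from assms obtain C D where CD: "C \<ge> 0" "D \<ge> 0"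
    "\<forall>m z. wdom m1 m z \<longrightarrow> \<bar>f m z\<bar> \<le> C" "\<forall>m z. wdom m1 m z \<longrightarrow> \<bar>g m z\<bar> \<le> D"
    unfolding UB_def by auto
  show ?thesis
  proof (rule UB_I[of _ _ "C * D"])
    fix m z assume "wdom m1 m z"
    with CD have "\<bar>f m z\<bar> \<le> C" "\<bar>g m z\<bar> \<le> D" by auto
    then show "\<bar>f m z * g m z\<bar> \<le> C * D" unfolding abs_mult using CD by (intro mult_mono) auto
  qed
qed

lemma UB_minus [intro]: "UB m1 f \<Longrightarrow> UB m1 (\<lambda>m z. - f m z)"
  unfolding UB_def by simp

lemma UB_diff [intro]: "UB m1 f \<Longrightarrow> UB m1 g \<Longrightarrow> UB m1 (\<lambda>m z. f m z - g m z)"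
  using UB_add[of m1 f "\<lambda>m z. - g m z"] by auto

lemma UB_power [intro]: "UB m1 f \<Longrightarrow> UB m1 (\<lambda>m z. f m z ^ k)"
  by (induction k) auto

lemma UB_divide_const [intro]: "UB m1 f \<Longrightarrow> UB m1 (\<lambda>m z. f m z / c)"
  using UB_mult[OF _ UB_const, of m1 f "1 / c"] by simp

definition Qf :: "real \<Rightarrow> real \<Rightarrow> real" where
  "Qf a z = 1 / (sqrt z + a)"

lemma UB_Qf [intro]: "(\<And>m. 1 \<le> m \<Longrightarrow> m \<le> m1 \<Longrightarrow> a m \<ge> 0) \<Longrightarrow> UB m1 (\<lambda>m z. Qf (a m) z)"
proof (rule UB_I[of _ _ 1])
  fix m z assume a: "\<And>m. 1 \<le> m \<Longrightarrow> m \<le> m1 \<Longrightarrow> a m \<ge> 0" and d: "wdom m1 m z"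
  then have "sqrt z \<ge> 1" "a m \<ge> 0" by (auto simp: wdom_def)
  then have "1 \<le> sqrt z + a m" by linarith
  then show "\<bar>Qf (a m) z\<bar> \<le> 1" by (simp add: Qf_def divide_le_eq)
qed

lemma DERIV_Qf:
  assumes "z > 0" "a \<ge> 0"
  shows "(Qf a has_real_derivative (- (Qf 0 z * (Qf a z)^2 / 2))) (at z)"
proof -
  have s: "sqrt z > 0" using assms by simp
  then have sa: "sqrt z + a > 0" using assms by linarith
  have "((\<lambda>z. 1 / (sqrt z + a)) has_real_derivative (0 * (sqrt z + a) - 1 * (inverse (sqrt z) / 2 + 0)) / ((sqrt z + a) * (sqrt z + a))) (at z)"
    using assms s sa by (intro DERIV_divide DERIV_add DERIV_const DERIV_real_sqrt) auto
  moreover have "(0 * (sqrt z + a) - 1 * (inverse (sqrt z) / 2 + 0)) / ((sqrt z + a) * (sqrt z + a)) = - (Qf 0 z * (Qf a z)^2 / 2)"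
    using s sa by (simp add: Qf_def field_simps power2_eq_square)
  ultimately show ?thesis unfolding Qf_def[abs_def] by simp
qed

lemma DERIV_Qf_power:
  assumes "z > 0" "a \<ge> 0"
  shows "((\<lambda>z. Qf a z ^ k) has_real_derivative (- (real k / 2 * Qf 0 z * Qf a z ^ Suc k))) (at z)"
proof (cases k)
  case (Suc j)
  have "((\<lambda>z. Qf a z ^ k) has_real_derivative (real k * (Qf a z ^ (k - 1) * - (Qf 0 z * (Qf a z)^2 / 2)))) (at z)"
    using DERIV_power[OF DERIV_Qf[OF assms], of k] by (simp add: mult_ac)
  moreover have "real k * (Qf a z ^ (k - 1) * - (Qf 0 z * (Qf a z)^2 / 2)) = - (real k / 2 * Qf 0 z * Qf a z ^ Suc k)"
    using Suc by (simp add: power2_eq_square)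
  ultimately show ?thesis by (simp only:)
qed simp

lemma DERIV_ln_sqrt:
  assumes "z > 0" "a \<ge> 0"
  shows "((\<lambda>z. ln (sqrt z + a)) has_real_derivative (Qf 0 z * Qf a z / 2)) (at z)"
proof -
  have s: "sqrt z > 0" using assms by simp
  then have sa: "sqrt z + a > 0" using assms by linarith
  have "((\<lambda>z. ln (sqrt z + a)) has_real_derivative (1 / (sqrt z + a) * (inverse (sqrt z) / 2 + 0))) (at z)"
    using assms s sa by (intro DERIV_chain2[OF DERIV_ln_divide] DERIV_add DERIV_const DERIV_real_sqrt) auto
  then show ?thesis by (rule DERIV_cong) (simp add: Qf_def inverse_eq_divide)
qed

text \<open>The four coefficients in \<open>c\<close> belong to \<open>a = 0, m, 1, r\<close>, in this order.\<close>

definition qsum :: "real \<times> real \<times> real \<times> real \<Rightarrow> nat \<Rightarrow> real \<Rightarrow> real \<Rightarrow> real \<Rightarrow> real" where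
  "qsum c k m r z = (case c of (c0, cm, c1, cr) \<Rightarrow> c0 * Qf 0 z ^ k + cm * Qf m z ^ k + c1 * Qf 1 z ^ k + cr * Qf r z ^ k)"

definition logsum :: "real \<times> real \<times> real \<times> real \<Rightarrow> real \<Rightarrow> real \<Rightarrow> real \<Rightarrow> real" where
  "logsum c m r z = (case c of (c0, cm, c1, cr) \<Rightarrow> c0 * ln (sqrt z + 0) + cm * ln (sqrt z + m) + c1 * ln (sqrt z + 1) + cr * ln (sqrt z + r))"

text \<open>\<open>ld1\<close>, \<open>ld2\<close> and \<open>ld3\<close> are the first three
  z-derivatives of \<open>logsum\<close>. They are written as polynomials in the functions
  \<open>Qf\<close>, so that their boundedness is immediate.\<close>

definition ld1 :: "real \<times> real \<times> real \<times> real \<Rightarrow> real \<Rightarrow> real \<Rightarrow> real \<Rightarrow> real" where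
  "ld1 c m r z = Qf 0 z * qsum c 1 m r z / 2"

definition ld2 :: "real \<times> real \<times> real \<times> real \<Rightarrow> real \<Rightarrow> real \<Rightarrow> real \<Rightarrow> real" where
  "ld2 c m r z = - (Qf 0 z ^ 3 * qsum c 1 m r z / 4) - (Qf 0 z)^2 * qsum c 2 m r z / 4"

definition ld3 :: "real \<times> real \<times> real \<times> real \<Rightarrow> real \<Rightarrow> real \<Rightarrow> real \<Rightarrow> real" where
  "ld3 c m r z = 3 / 8 * Qf 0 z ^ 5 * qsum c 1 m r z + 3 / 8 * Qf 0 z ^ 4 * qsum c 2 m r z + 1 / 4 * Qf 0 z ^ 3 * qsum c 3 m r z"

lemma DERIV_qsum:
  assumes "z > 0" "m \<ge> 0" "r \<ge> 0"
  shows "(qsum c k m r has_real_derivative (- (real k / 2 * Qf 0 z * qsum c (Suc k) m r z))) (at z)"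
proof -
  obtain c0 cm c1 cr where c: "c = (c0, cm, c1, cr)" by (cases c)
  have "((\<lambda>z. c0 * Qf 0 z ^ k + cm * Qf m z ^ k + c1 * Qf 1 z ^ k + cr * Qf r z ^ k) has_real_derivative
     (c0 * (- (real k / 2 * Qf 0 z * Qf 0 z ^ Suc k)) + cm * (- (real k / 2 * Qf 0 z * Qf m z ^ Suc k))
     + c1 * (- (real k / 2 * Qf 0 z * Qf 1 z ^ Suc k)) + cr * (- (real k / 2 * Qf 0 z * Qf r z ^ Suc k)))) (at z)"
    using assms by (intro DERIV_add DERIV_cmult DERIV_Qf_power) auto
  then show ?thesis unfolding qsum_def[abs_def] c by (simp add: algebra_simps)
qed

lemma DERIV_logsum:
  assumes "z > 0" "m \<ge> 0" "r \<ge> 0"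
  shows "(logsum c m r has_real_derivative ld1 c m r z) (at z)"
proof -
  obtain c0 cm c1 cr where c: "c = (c0, cm, c1, cr)" by (cases c)
  have "((\<lambda>z. c0 * ln (sqrt z + 0) + cm * ln (sqrt z + m) + c1 * ln (sqrt z + 1) + cr * ln (sqrt z + r)) has_real_derivative
     (c0 * (Qf 0 z * Qf 0 z / 2) + cm * (Qf 0 z * Qf m z / 2) + c1 * (Qf 0 z * Qf 1 z / 2) + cr * (Qf 0 z * Qf r z / 2))) (at z)"
    using assms by (intro DERIV_add DERIV_cmult DERIV_ln_sqrt) auto
  then show ?thesis unfolding logsum_def[abs_def] ld1_def qsum_def c by (simp add: algebra_simps add_divide_distrib)
qed

lemma DERIV_ld1:
  assumes "z > 0" "m \<ge> 0" "r \<ge> 0"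
  shows "(ld1 c m r has_real_derivative ld2 c m r z) (at z)"
proof -
  have "((\<lambda>z. Qf 0 z * qsum c 1 m r z / 2) has_real_derivative
     ((- (Qf 0 z * (Qf 0 z)^2 / 2)) * qsum c 1 m r z + (- (real 1 / 2 * Qf 0 z * qsum c (Suc 1) m r z)) * Qf 0 z) / 2) (at z)"
    using assms by (intro DERIV_cdivide DERIV_mult DERIV_Qf DERIV_qsum) auto
  moreover have "Suc 1 = 2" by auto
  ultimately have "((\<lambda>z. Qf 0 z * qsum c 1 m r z / 2) has_real_derivative
     ((- (Qf 0 z * (Qf 0 z)^2 / 2)) * qsum c 1 m r z + (- (real 1 / 2 * Qf 0 z * qsum c 2 m r z)) * Qf 0 z) / 2) (at z)"
    by metis
  then show ?thesis unfolding ld1_def[abs_def] ld2_def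
    by (rule DERIV_cong) (simp add: field_simps power_numeral_reduce)
qed

lemma DERIV_ld2:
  assumes "z > 0" "m \<ge> 0" "r \<ge> 0"
  shows "(ld2 c m r has_real_derivative ld3 c m r z) (at z)"
proof -
  have "((\<lambda>z. - (Qf 0 z ^ 3 * qsum c 1 m r z / 4) - (Qf 0 z)^2 * qsum c 2 m r z / 4) has_real_derivative
     - (((- (real 3 / 2 * Qf 0 z * Qf 0 z ^ Suc 3)) * qsum c 1 m r z + (- (real 1 / 2 * Qf 0 z * qsum c (Suc 1) m r z)) * Qf 0 z ^ 3) / 4)
     - ((- (real 2 / 2 * Qf 0 z * Qf 0 z ^ Suc 2)) * qsum c 2 m r z + (- (real 2 / 2 * Qf 0 z * qsum c (Suc 2) m r z)) * (Qf 0 z)^2) / 4) (at z)"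
    using assms by (intro DERIV_diff DERIV_minus DERIV_cdivide DERIV_mult DERIV_Qf_power DERIV_qsum) auto
  moreover have "Suc 1 = 2" "Suc 2 = 3" "Suc 3 = 4" by auto
  ultimately have "((\<lambda>z. - (Qf 0 z ^ 3 * qsum c 1 m r z / 4) - (Qf 0 z)^2 * qsum c 2 m r z / 4) has_real_derivative
     - (((- (real 3 / 2 * Qf 0 z * Qf 0 z ^ 4)) * qsum c 1 m r z + (- (real 1 / 2 * Qf 0 z * qsum c 2 m r z)) * Qf 0 z ^ 3) / 4)
     - ((- (real 2 / 2 * Qf 0 z * Qf 0 z ^ 3)) * qsum c 2 m r z + (- (real 2 / 2 * Qf 0 z * qsum c 3 m r z)) * (Qf 0 z)^2) / 4) (at z)"
    by metis
  then show ?thesis unfolding ld2_def[abs_def] ld3_def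
    by (rule DERIV_cong) (simp add: field_simps power_numeral_reduce)
qed

lemma UB_qsum [intro]:
  assumes "\<And>m. 1 \<le> m \<Longrightarrow> m \<le> m1 \<Longrightarrow> r m \<ge> 0"
  shows "UB m1 (\<lambda>m z. qsum c k m (r m) z)"
proof -
  obtain c0 cm c1 cr where c: "c = (c0, cm, c1, cr)" by (cases c)
  show ?thesis unfolding qsum_def c using assms
    by (auto intro!: UB_add UB_mult UB_const UB_power UB_Qf)
qed

lemma UB_ld:
  assumes "\<And>m. 1 \<le> m \<Longrightarrow> m \<le> m1 \<Longrightarrow> r m \<ge> 0"
  shows "UB m1 (\<lambda>m z. ld1 c m (r m) z)" "UB m1 (\<lambda>m z. ld2 c m (r m) z)" "UB m1 (\<lambda>m z. ld3 c m (r m) z)"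
  unfolding ld1_def ld2_def ld3_def using assms
  by (auto intro!: UB_add UB_diff UB_minus UB_mult UB_const UB_power UB_Qf UB_divide_const UB_qsum)

text \<open>Both end points lie in [1, m^2], hence so does the intermediate point of the Lagrange
  remainder, and the bound of the last derivative applies there uniformly in m.\<close>

lemma taylor_UB:
  fixes diff :: "nat \<Rightarrow> real \<Rightarrow> real \<Rightarrow> real"
  assumes n: "n > 0"
    and D: "\<And>i m z. i < n \<Longrightarrow> m \<ge> 1 \<Longrightarrow> z > 0 \<Longrightarrow> (diff i m has_real_derivative diff (Suc i) m z) (at z)"
    and B: "UB m1 (diff n)"
  shows "\<exists>C\<ge>0. \<forall>m z k. wdom m1 m z \<longrightarrow> wdom m1 m (z + k) \<longrightarrow>
     \<bar>diff 0 m (z + k) - (\<Sum>i<n. diff i m z / fact i * k ^ i)\<bar> \<le> C * \<bar>k\<bar> ^ n"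
proof -
  obtain C where C: "C \<ge> 0" "\<And>m z. wdom m1 m z \<Longrightarrow> \<bar>diff n m z\<bar> \<le> C" using UBE[OF B] by metis
  have "\<bar>diff 0 m (z + k) - (\<Sum>i<n. diff i m z / fact i * k ^ i)\<bar> \<le> C * \<bar>k\<bar> ^ n"
    if d: "wdom m1 m z" "wdom m1 m (z + k)" for m z k
  proof (cases "k = 0")
    case True
    have "(\<Sum>i<n. diff i m z / fact i * k ^ i) = diff 0 m z"
      using n True by (subst sum.remove[of _ 0]) (auto intro!: sum.neutral)
    then show ?thesis using True C(1) n by simp
  next
    case False
    have "\<exists>t. (if z + k < z then z + k < t \<and> t < z else z < t \<and> t < z + k) \<and>
      diff 0 m (z + k) = (\<Sum>i<n. diff i m z / fact i * (z + k - z) ^ i) + diff n m t / fact n * (z + k - z) ^ n"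
      using d False by (intro Taylor[OF n refl, where a = 1 and b = "m^2"]) (auto simp: wdom_def intro!: D)
    then obtain t where t: "if z + k < z then z + k < t \<and> t < z else z < t \<and> t < z + k"
      "diff 0 m (z + k) = (\<Sum>i<n. diff i m z / fact i * k ^ i) + diff n m t / fact n * k ^ n" by auto
    have "wdom m1 m t" using t(1) d by (auto simp: wdom_def split: if_splits)
    then have "\<bar>diff n m t\<bar> \<le> C" by (rule C)
    then have "\<bar>diff n m t / fact n * k ^ n\<bar> \<le> C * \<bar>k\<bar> ^ n"
      unfolding abs_mult power_abs abs_divide
      by (intro mult_right_mono) (auto intro: order_trans[OF divide_left_mono[of 1]] simp: fact_ge_1)
    then show ?thesis using t(2) by simp
  qed
  with C(1) show ?thesis by blast
qed

lemma exp_taylor2: "\<bar>exp y - 1 - y - y^2 / 2\<bar> \<le> \<bar>y\<bar> ^ 3 * exp \<bar>y\<bar>" for y :: real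
proof -
  obtain t where t: "\<bar>t\<bar> \<le> \<bar>y\<bar>" "exp y = (\<Sum>i<3. y ^ i / fact i) + (exp t / fact 3) * y ^ 3"
    using Maclaurin_exp_le[of y 3] by blast
  have "(\<Sum>i<3. y ^ i / fact i) = 1 + y + y^2 / 2" by (simp add: eval_nat_numeral)
  then have "exp y - 1 - y - y^2 / 2 = (exp t / fact 3) * y ^ 3" using t(2) by simp
  then have "\<bar>exp y - 1 - y - y^2 / 2\<bar> = (exp t / 6) * \<bar>y\<bar> ^ 3"
    by (simp only: abs_mult power_abs) (simp add: fact_numeral)
  also have "\<dots> \<le> exp \<bar>y\<bar> * \<bar>y\<bar> ^ 3"
  proof (intro mult_right_mono)
    have "exp t \<le> exp \<bar>y\<bar>" "exp t > 0" using t(1) by auto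
    then show "exp t / 6 \<le> exp \<bar>y\<bar>" by linarith
  qed auto
  finally show ?thesis by (simp add: mult.commute)
qed

text \<open>Converts an expansion of the logarithm of a ratio into one of the ratio, with a constant
  depending only on the bounds A, C and H. This is where the square \<alpha>^2 / 2 enters the second
  order.\<close>

lemma exp_expansion:
  fixes A C H :: real
  assumes "A \<ge> 0" "C \<ge> 0" "H \<ge> 0"
  shows "\<exists>C'\<ge>0. \<forall>h y \<alpha> \<gamma> :: real. 0 < h \<and> h \<le> H \<and> \<bar>\<alpha>\<bar> \<le> A \<and> \<bar>\<gamma>\<bar> \<le> A \<and> \<bar>y - h * \<alpha> - h\<^sup>2 * \<gamma>\<bar> \<le> C * h ^ 3 \<longrightarrow>
     \<bar>exp y - (1 + h * \<alpha> + h^2 * (\<gamma> + \<alpha>^2 / 2))\<bar> \<le> C' * h ^ 3"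
proof -
  \<comment> \<open>\<open>Y\<close> bounds |y| / h; it combines the bounds of \<alpha>, h \<gamma>
    and the cubic error for h \<le> H.\<close>
  define Y where "Y = A + H * A + C * H^2"
  define C' where "C' = Y ^ 3 * exp (H * Y) + C + (A + C * H) * (Y + A) / 2"
  have Y0: "Y \<ge> 0" unfolding Y_def using assms by (intro add_nonneg_nonneg mult_nonneg_nonneg) auto
  have "\<bar>exp y - (1 + h * \<alpha> + h^2 * (\<gamma> + \<alpha>^2 / 2))\<bar> \<le> C' * h ^ 3"
    if h: "0 < h" "h \<le> H" and \<alpha>: "\<bar>\<alpha>\<bar> \<le> A" and \<gamma>: "\<bar>\<gamma>\<bar> \<le> A" and y: "\<bar>y - h * \<alpha> - h\<^sup>2 * \<gamma>\<bar> \<le> C * h ^ 3" for h y \<alpha> \<gamma> :: real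
  proof -
    have a1: "\<bar>y - h * \<alpha>\<bar> \<le> h^2 * (A + C * H)"
    proof -
      have "\<bar>h\<^sup>2 * \<gamma>\<bar> \<le> h^2 * A" using \<gamma> by (simp add: abs_mult mult_left_mono)
      moreover have "C * h ^ 3 \<le> h^2 * (C * H)"
      proof -
        have "C * h ^ 3 = h^2 * (C * h)" by (simp add: power_numeral_reduce)
        also have "\<dots> \<le> h^2 * (C * H)" using h assms by (intro mult_left_mono) auto
        finally show ?thesis .
      qed
      moreover have "\<bar>y - h * \<alpha>\<bar> \<le> \<bar>y - h * \<alpha> - h\<^sup>2 * \<gamma>\<bar> + \<bar>h\<^sup>2 * \<gamma>\<bar>" by linarith
      ultimately show ?thesis using y by (simp add: distrib_left)
    qed
    have hA: "\<bar>h * \<alpha>\<bar> \<le> h * A" using h \<alpha> by (simp add: abs_mult)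
    have a2: "\<bar>y\<bar> \<le> h * Y"
    proof -
      have "h^2 * (A + C * H) \<le> h * (H * (A + C * H))"
        using h assms by (simp add: power2_eq_square mult.assoc mult_left_mono mult_right_mono)
      also have "\<dots> = h * (Y - A)" unfolding Y_def by (simp add: algebra_simps power2_eq_square)
      finally have "h^2 * (A + C * H) \<le> h * Y - h * A" by (simp add: right_diff_distrib)
      then show ?thesis using a1 hA by linarith
    qed
    have e1: "\<bar>exp y - 1 - y - y^2 / 2\<bar> \<le> (Y ^ 3 * exp (H * Y)) * h ^ 3"
    proof -
      have "\<bar>y\<bar> ^ 3 * exp \<bar>y\<bar> \<le> (h * Y) ^ 3 * exp (H * Y)"
        using a2 h Y0 by (intro mult_mono power_mono) (auto intro: order_trans[OF a2] mult_right_mono)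
      then show ?thesis using exp_taylor2[of y] by (simp add: power_mult_distrib mult_ac)
    qed
    have e2: "\<bar>y\<^sup>2 / 2 - h^2 * \<alpha>^2 / 2\<bar> \<le> ((A + C * H) * (Y + A) / 2) * h ^ 3"
    proof -
      have "\<bar>y\<^sup>2 / 2 - h^2 * \<alpha>^2 / 2\<bar> = \<bar>y - h * \<alpha>\<bar> * \<bar>y + h * \<alpha>\<bar> / 2"
        unfolding abs_mult[symmetric] by (simp add: power2_eq_square algebra_simps flip: diff_divide_distrib)
      also have "\<dots> \<le> (h^2 * (A + C * H)) * (h * Y + h * A) / 2"
        using a1 a2 hA by (intro divide_right_mono mult_mono) auto
      also have "\<dots> = ((A + C * H) * (Y + A) / 2) * h ^ 3" by (simp add: algebra_simps power_numeral_reduce)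
      finally show ?thesis .
    qed
    have eq: "exp y - (1 + h * \<alpha> + h^2 * (\<gamma> + \<alpha>^2 / 2)) = (exp y - 1 - y - y^2 / 2) + (y - h * \<alpha> - h\<^sup>2 * \<gamma>) + (y^2 / 2 - h^2 * \<alpha>^2 / 2)"
      by (simp add: algebra_simps)
    have "C' * h ^ 3 = (Y ^ 3 * exp (H * Y)) * h ^ 3 + C * h ^ 3 + ((A + C * H) * (Y + A) / 2) * h ^ 3"
      unfolding C'_def by (simp only: distrib_right)
    then show ?thesis unfolding eq using e1 e2 y by linarith
  qed
  moreover have "C' \<ge> 0" unfolding C'_def using assms Y0
    by (intro add_nonneg_nonneg mult_nonneg_nonneg divide_nonneg_nonneg zero_le_power) auto
  ultimately show ?thesis by blast
qed

section \<open>WKB coefficients and the ratios of neighbouring values\<close>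

definition rho :: "real \<Rightarrow> real" where "rho m = sqrt (2 * m - 1)"

definition cphi :: "real \<times> real \<times> real \<times> real" where "cphi = (0, 1, - 2, 0)"
text \<open>All coefficients attached to the pole \<open>- rho m\<close>, here the last entry and
  below \<open>e3\<close> and \<open>e2\<close>, vanish for b = 0. Since b will be 1 / \<beta> - 1,
  this is the case \<beta> = 1.\<close>

definition cs :: "real \<Rightarrow> real \<times> real \<times> real \<times> real" where "cs b = (- 1 / 2, 1 / 2, 1 + b, b)"

definition phi :: "real \<Rightarrow> real \<Rightarrow> real" where
  "phi m z = logsum cphi m (rho m) z + ln (m + 1)"

text \<open>The primitive of \<open>- phi m\<close> in z that vanishes at z = m^2, i.e. at p = 0.
  The function \<open>phi\<close> is chosen such that its exponential, the leading ratio of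
  neighbouring moments, is rational in sqrt z.\<close>

definition Psi :: "real \<Rightarrow> real \<Rightarrow> real" where
  "Psi m z = (m^2 - z) * (ln (sqrt z + m) + ln (m + 1) + 1 / 2) + (m - 2) * (m - sqrt z)
     + 2 * (z - 1) * ln (sqrt z + 1) - 2 * (m^2 - 1) * ln (m + 1)"

text \<open>The \<open>z\<close>-derivative of the second WKB coefficient \<open>sig\<close> is rational in \<open>sqrt z\<close>, with poles at \<open>0\<close>, \<open>- 1\<close>,
  \<open>- rho m\<close> and \<open>- m\<close>; the following are its partial fraction coefficients.\<close>

definition k4 :: "real \<Rightarrow> real \<Rightarrow> real" where "k4 b m = - (5 * m / (16 * (rho m)^2))"
definition k3 :: "real \<Rightarrow> real \<Rightarrow> real" where
  "k3 b m = ((b + 1) * rho m ^ 3 + b * (rho m)^2 + (b + 2) * rho m + b) / (4 * rho m ^ 3)"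
definition k2 :: "real \<Rightarrow> real \<Rightarrow> real" where
  "k2 b m = ((12 * b^2 + 24 * b + 11) * rho m ^ 6 + 24 * (b^2 + b) * rho m ^ 5 + (36 * b^2 + 72 * b + 45) * rho m ^ 4
     + (48 * b^2 + 72 * b) * rho m ^ 3 + (36 * b^2 + 48 * b + 45) * (rho m)^2 + (24 * b^2 + 48 * b) * rho m + 12 * b^2 + 3)
     / (192 * rho m ^ 4 * m)"
definition d2 :: "real \<Rightarrow> real \<Rightarrow> real" where "d2 b m = (3 * b^2 + 3 * b + 1) / 12"
definition e3 :: "real \<Rightarrow> real \<Rightarrow> real" where "e3 b m = ((rho m)^2 - 1)^2 * (b - b^2) / (16 * rho m ^ 3)"
definition e2 :: "real \<Rightarrow> real \<Rightarrow> real" where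
  "e2 b m = ((3 * b^2 + b) * rho m ^ 4 - 4 * b^2 * rho m ^ 3 - 2 * (b^2 + b) * (rho m)^2 + (4 * b^2 + 8 * b) * rho m + 7 * b^2 + b)
     / (32 * rho m ^ 4)"
definition g2 :: "real \<Rightarrow> real \<Rightarrow> real" where "g2 b m = 1 / (24 * m)"

text \<open>No integration constant is fitted: at the accuracy needed only differences of
  \<open>sig\<close> in z matter, and its m-derivative is absorbed into the error O(1 / N).\<close>

definition sig :: "real \<Rightarrow> real \<Rightarrow> real \<Rightarrow> real" where
  "sig b m z = - (k4 b m / 3 * Qf 0 z ^ 3 + k3 b m / 2 * (Qf 0 z)^2 - k2 b m * Qf 0 z ^ 1 + d2 b m * Qf 1 z ^ 1
     + e3 b m / 2 * (Qf (rho m) z)^2 - e2 b m * Qf (rho m) z ^ 1 - g2 b m * Qf m z ^ 1)"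

definition sig1 :: "real \<Rightarrow> real \<Rightarrow> real \<Rightarrow> real" where
  "sig1 b m z = Qf 0 z * (k4 b m * Qf 0 z ^ 4 + k3 b m * Qf 0 z ^ 3 - k2 b m * (Qf 0 z)^2 + d2 b m * (Qf 1 z)^2
     + e3 b m * Qf (rho m) z ^ 3 - e2 b m * (Qf (rho m) z)^2 - g2 b m * (Qf m z)^2) / 2"

definition sig2 :: "real \<Rightarrow> real \<Rightarrow> real \<Rightarrow> real" where
  "sig2 b m z = (- (1 / 2 * Qf 0 z * (Qf 0 z)^2)) * (k4 b m * Qf 0 z ^ 4 + k3 b m * Qf 0 z ^ 3 - k2 b m * (Qf 0 z)^2 + d2 b m * (Qf 1 z)^2
     + e3 b m * Qf (rho m) z ^ 3 - e2 b m * (Qf (rho m) z)^2 - g2 b m * (Qf m z)^2) / 2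
   + Qf 0 z * (k4 b m * (- (4 / 2 * Qf 0 z * Qf 0 z ^ 5)) + k3 b m * (- (3 / 2 * Qf 0 z * Qf 0 z ^ 4)) - k2 b m * (- (2 / 2 * Qf 0 z * Qf 0 z ^ 3))
     + d2 b m * (- (2 / 2 * Qf 0 z * Qf 1 z ^ 3)) + e3 b m * (- (3 / 2 * Qf 0 z * Qf (rho m) z ^ 4))
     - e2 b m * (- (2 / 2 * Qf 0 z * Qf (rho m) z ^ 3)) - g2 b m * (- (2 / 2 * Qf 0 z * Qf m z ^ 3))) / 2"

lemma rho_ge1: "m \<ge> 1 \<Longrightarrow> rho m \<ge> 1" by (simp add: rho_def)

lemma rho_gt1: "m > 1 \<Longrightarrow> rho m > 1" by (simp add: rho_def)

lemma DERIV_Qf_power':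
  assumes "z > 0" "a \<ge> 0" "j = Suc k"
  shows "((\<lambda>z. Qf a z ^ k) has_real_derivative (- (real k / 2 * Qf 0 z * Qf a z ^ j))) (at z)"
  using DERIV_Qf_power[OF assms(1,2), of k] assms(3) by simp

lemma DERIV_sig:
  assumes "z > 0" "m \<ge> 1"
  shows "(sig b m has_real_derivative sig1 b m z) (at z)"
proof -
  have "(sig b m has_real_derivative - (k4 b m / 3 * (- (real 3 / 2 * Qf 0 z * Qf 0 z ^ 4)) + k3 b m / 2 * (- (real 2 / 2 * Qf 0 z * Qf 0 z ^ 3))
     - k2 b m * (- (real 1 / 2 * Qf 0 z * Qf 0 z ^ 2)) + d2 b m * (- (real 1 / 2 * Qf 0 z * Qf 1 z ^ 2))
     + e3 b m / 2 * (- (real 2 / 2 * Qf 0 z * Qf (rho m) z ^ 3)) - e2 b m * (- (real 1 / 2 * Qf 0 z * Qf (rho m) z ^ 2))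
     - g2 b m * (- (real 1 / 2 * Qf 0 z * Qf m z ^ 2)))) (at z)"
    unfolding sig_def[abs_def] using assms rho_ge1[OF assms(2)]
    by (intro DERIV_minus DERIV_add DERIV_diff DERIV_cmult DERIV_Qf_power') auto
  then show ?thesis
    by (rule DERIV_cong) (simp add: sig1_def field_simps power_numeral_reduce)
qed

lemma DERIV_sig1:
  assumes "z > 0" "m \<ge> 1"
  shows "(sig1 b m has_real_derivative sig2 b m z) (at z)"
proof -
  let ?U = "\<lambda>z. k4 b m * Qf 0 z ^ 4 + k3 b m * Qf 0 z ^ 3 - k2 b m * (Qf 0 z)^2 + d2 b m * (Qf 1 z)^2
     + e3 b m * Qf (rho m) z ^ 3 - e2 b m * (Qf (rho m) z)^2 - g2 b m * (Qf m z)^2"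
  let ?U' = "k4 b m * (- (real 4 / 2 * Qf 0 z * Qf 0 z ^ 5)) + k3 b m * (- (real 3 / 2 * Qf 0 z * Qf 0 z ^ 4)) - k2 b m * (- (real 2 / 2 * Qf 0 z * Qf 0 z ^ 3))
     + d2 b m * (- (real 2 / 2 * Qf 0 z * Qf 1 z ^ 3)) + e3 b m * (- (real 3 / 2 * Qf 0 z * Qf (rho m) z ^ 4))
     - e2 b m * (- (real 2 / 2 * Qf 0 z * Qf (rho m) z ^ 3)) - g2 b m * (- (real 2 / 2 * Qf 0 z * Qf m z ^ 3))"
  have U: "(?U has_real_derivative ?U') (at z)"
    using assms rho_ge1[OF assms(2)]
    by (intro DERIV_add DERIV_diff DERIV_cmult DERIV_Qf_power') auto
  have "((\<lambda>z. Qf 0 z * ?U z / 2) has_real_derivative (- (Qf 0 z * (Qf 0 z)^2 / 2) * ?U z + ?U' * Qf 0 z) / 2) (at z)"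
    using assms by (intro DERIV_cdivide DERIV_mult DERIV_Qf U) auto
  then show ?thesis unfolding sig1_def[abs_def]
  proof (rule DERIV_cong)
    have gen: "(- (q * q2 / 2) * u + u' * q) / 2 = - (1 / 2 * q * q2) * u / 2 + q * u' / 2" for q q2 u u' :: real
      by (simp add: field_simps)
    show "(- (Qf 0 z * (Qf 0 z)^2 / 2) * ?U z + ?U' * Qf 0 z) / 2 = sig2 b m z"
      unfolding sig2_def of_nat_numeral by (rule gen)
  qed
qed

lemma UB_coeffs:
  "UB m1 (\<lambda>m z. k4 b m)" "UB m1 (\<lambda>m z. k3 b m)" "UB m1 (\<lambda>m z. k2 b m)" "UB m1 (\<lambda>m z. d2 b m)"
  "UB m1 (\<lambda>m z. e3 b m)" "UB m1 (\<lambda>m z. e2 b m)" "UB m1 (\<lambda>m z. g2 b m)"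
proof -
  have r: "rho m \<noteq> 0" if "m \<in> {1..m1}" for m using rho_ge1[of m] that by auto
  have c: "continuous_on {1..m1} rho" unfolding rho_def[abs_def] by (intro continuous_intros)
  show "UB m1 (\<lambda>m z. k4 b m)" "UB m1 (\<lambda>m z. k3 b m)" "UB m1 (\<lambda>m z. k2 b m)" "UB m1 (\<lambda>m z. d2 b m)"
    "UB m1 (\<lambda>m z. e3 b m)" "UB m1 (\<lambda>m z. e2 b m)" "UB m1 (\<lambda>m z. g2 b m)"
    unfolding k4_def k3_def k2_def d2_def e3_def e2_def g2_def
    by (intro UB_continuous continuous_intros c; use r in auto)+
qed

lemma UB_Qrho: "UB m1 (\<lambda>m z. Qf (rho m) z)" "UB m1 (\<lambda>m z. Qf m z)" "UB m1 (\<lambda>m z. Qf 0 z)" "UB m1 (\<lambda>m z. Qf 1 z)"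
proof -
  have r: "rho m \<ge> 0" if "1 \<le> m" for m using rho_ge1[OF that] by auto
  show "UB m1 (\<lambda>m z. Qf (rho m) z)" by (rule UB_Qf) (rule r)
  show "UB m1 (\<lambda>m z. Qf m z)" by (rule UB_Qf) auto
  show "UB m1 (\<lambda>m z. Qf 0 z)" by (rule UB_Qf[of m1 "\<lambda>_. 0"]) auto
  show "UB m1 (\<lambda>m z. Qf 1 z)" by (rule UB_Qf[of m1 "\<lambda>_. 1"]) auto
qed

lemmas UB_intros = UB_coeffs UB_Qrho UB_add UB_diff UB_minus UB_mult UB_const UB_power UB_divide_const

lemma UB_sig: "UB m1 (sig b)" "UB m1 (sig1 b)" "UB m1 (sig2 b)"
  unfolding sig_def[abs_def] sig1_def[abs_def] sig2_def[abs_def] by (intro UB_intros)+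

lemma DERIV_Psi:
  assumes "z > 0" "m \<ge> 1"
  shows "(Psi m has_real_derivative (- phi m z)) (at z)"
proof -
  define n where "n = sqrt z"
  have n: "n > 0" "z = n^2" unfolding n_def using assms by auto
  have nm: "n + m > 0" "n + 1 > 0" using n assms by auto
  have Q: "Qf 0 z = 1 / n" "Qf m z = 1 / (n + m)" "Qf 1 z = 1 / (n + 1)" by (simp_all add: Qf_def n_def)
  have "((\<lambda>z. (m^2 - z) * (ln (sqrt z + m) + ln (m + 1) + 1 / 2) + (m - 2) * (m - sqrt z)
     + 2 * (z - 1) * ln (sqrt z + 1) - 2 * (m^2 - 1) * ln (m + 1)) has_real_derivative
     ((0 - 1) * (ln (sqrt z + m) + ln (m + 1) + 1 / 2) + (Qf 0 z * Qf m z / 2 + 0 + 0) * (m^2 - z)) + (m - 2) * (0 - inverse (sqrt z) / 2)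
     + (2 * (1 - 0) * ln (sqrt z + 1) + (Qf 0 z * Qf 1 z / 2) * (2 * (z - 1))) - 0) (at z)"
    using assms by (intro DERIV_add DERIV_diff DERIV_mult DERIV_cmult DERIV_const DERIV_ident DERIV_ln_sqrt DERIV_real_sqrt) auto
  moreover have "((0 - 1) * (ln (sqrt z + m) + ln (m + 1) + 1 / 2) + (Qf 0 z * Qf m z / 2 + 0 + 0) * (m^2 - z)) + (m - 2) * (0 - inverse (sqrt z) / 2)
     + (2 * (1 - 0) * ln (sqrt z + 1) + (Qf 0 z * Qf 1 z / 2) * (2 * (z - 1))) - 0 = - phi m z"
  proof -
    have "(Qf 0 z * Qf m z / 2) * (m^2 - z) = (m - n) / (2 * n)"
    proof -
      have "m^2 - z = (m - n) * (n + m)" unfolding n(2) by (simp add: power2_eq_square algebra_simps)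
      then show ?thesis unfolding Q using n(1) nm by (simp add: divide_simps)
    qed
    moreover have "(Qf 0 z * Qf 1 z / 2) * (2 * (z - 1)) = (n - 1) / n"
    proof -
      have "z - 1 = (n - 1) * (n + 1)" unfolding n(2) by (simp add: power2_eq_square algebra_simps)
      then show ?thesis unfolding Q using n(1) nm by (simp add: divide_simps)
    qed
    moreover have "(m - n) / (2 * n) - (m - 2) / (2 * n) + (n - 1) / n = 1 / 2"
      using n(1) by (simp add: field_simps)
    moreover have "(m - 2) * (0 - inverse (sqrt z) / 2) = - ((m - 2) / (2 * n))"
      unfolding n_def[symmetric] by (simp add: inverse_eq_divide)
    ultimately show ?thesis unfolding phi_def logsum_def cphi_def by simp
  qed
  ultimately show ?thesis unfolding Psi_def[abs_def] by simp
qed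

lemma DERIV_phi:
  assumes "z > 0" "m \<ge> 1"
  shows "(phi m has_real_derivative ld1 cphi m (rho m) z) (at z)"
  using DERIV_add[OF DERIV_logsum[of z m "rho m" cphi] DERIV_const[of "ln (m + 1)"]] assms rho_ge1[OF assms(2)]
  unfolding phi_def[abs_def] by simp

text \<open>\<open>sg = 1\<close> is the step from p to p + 1, which lowers z by h. The three parts
  carry the factors 1 / h, 1 and h, so they are expanded to remainders of order 4, 3 and 2, and each
  leaves h^3.\<close>

lemma log_ratio_expansion:
  "\<exists>C\<ge>0. \<forall>m z h sg. 0 < h \<and> (sg = 1 \<or> sg = -1) \<and> wdom m1 m z \<and> wdom m1 m (z - sg * h) \<longrightarrow>
    \<bar>(Psi m (z - sg * h) - Psi m z) / h + (logsum (cs b) m (rho m) (z - sg * h) - logsum (cs b) m (rho m) z)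
      + h * (sig b m (z - sg * h) - sig b m z)
      - (sg * phi m z + h * (- ld1 cphi m (rho m) z / 2 - sg * ld1 (cs b) m (rho m) z)
         + h^2 * (sg * ld2 cphi m (rho m) z / 6 + ld2 (cs b) m (rho m) z / 2 - sg * sig1 b m z))\<bar> \<le> C * h ^ 3"
proof -
  have r: "rho m \<ge> 0" if "1 \<le> m" for m using rho_ge1[OF that] by auto
  let ?P = "\<lambda>i m z. [Psi m z, - phi m z, - ld1 cphi m (rho m) z, - ld2 cphi m (rho m) z, - ld3 cphi m (rho m) z] ! i"
  let ?S = "\<lambda>i m z. [logsum (cs b) m (rho m) z, ld1 (cs b) m (rho m) z, ld2 (cs b) m (rho m) z, ld3 (cs b) m (rho m) z] ! i"
  let ?V = "\<lambda>i m z. [sig b m z, sig1 b m z, sig2 b m z] ! i"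
  have "\<exists>C\<ge>0. \<forall>m z k. wdom m1 m z \<longrightarrow> wdom m1 m (z + k) \<longrightarrow>
     \<bar>?P 0 m (z + k) - (\<Sum>i<4. ?P i m z / fact i * k ^ i)\<bar> \<le> C * \<bar>k\<bar> ^ 4"
  proof (rule taylor_UB)
    fix i :: nat and m z :: real assume i: "i < 4" and m: "1 \<le> m" and z: "0 < z"
    have m0: "0 \<le> m" using m by simp
    have f: "((\<lambda>z. Psi m z) has_real_derivative - phi m z) (at z)"
      "((\<lambda>z. - phi m z) has_real_derivative - ld1 cphi m (rho m) z) (at z)"
      "((\<lambda>z. - ld1 cphi m (rho m) z) has_real_derivative - ld2 cphi m (rho m) z) (at z)"
      "((\<lambda>z. - ld2 cphi m (rho m) z) has_real_derivative - ld3 cphi m (rho m) z) (at z)"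
      by (rule DERIV_Psi[OF z m] DERIV_minus DERIV_phi[OF z m] DERIV_ld1[OF z m0 r[OF m]] DERIV_ld2[OF z m0 r[OF m]])+
    from i consider "i = 0" | "i = 1" | "i = 2" | "i = 3" by linarith
    then show "((\<lambda>z. ?P i m z) has_real_derivative ?P (Suc i) m z) (at z)"
      by cases (simp_all add: f)
  next
    show "UB m1 (\<lambda>m z. ?P 4 m z)" using UB_minus[OF UB_ld(3)[of m1 rho cphi, OF r]] by simp
  qed simp
  then obtain C1 where C1: "C1 \<ge> 0" "\<And>m z k. wdom m1 m z \<Longrightarrow> wdom m1 m (z + k) \<Longrightarrow>
     \<bar>?P 0 m (z + k) - (\<Sum>i<4. ?P i m z / fact i * k ^ i)\<bar> \<le> C1 * \<bar>k\<bar> ^ 4" by blast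
  have "\<exists>C\<ge>0. \<forall>m z k. wdom m1 m z \<longrightarrow> wdom m1 m (z + k) \<longrightarrow>
     \<bar>?S 0 m (z + k) - (\<Sum>i<3. ?S i m z / fact i * k ^ i)\<bar> \<le> C * \<bar>k\<bar> ^ 3"
  proof (rule taylor_UB)
    fix i :: nat and m z :: real assume i: "i < 3" and m: "1 \<le> m" and z: "0 < z"
    have m0: "0 \<le> m" using m by simp
    note f = DERIV_logsum[OF z m0 r[OF m]] DERIV_ld1[OF z m0 r[OF m]] DERIV_ld2[OF z m0 r[OF m]]
    from i consider "i = 0" | "i = 1" | "i = 2" by linarith
    then show "((\<lambda>z. ?S i m z) has_real_derivative ?S (Suc i) m z) (at z)"
      by cases (simp_all add: f)
  next
    show "UB m1 (\<lambda>m z. ?S 3 m z)" using UB_ld(3)[of m1 rho "cs b", OF r] by simp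
  qed simp
  then obtain C2 where C2: "C2 \<ge> 0" "\<And>m z k. wdom m1 m z \<Longrightarrow> wdom m1 m (z + k) \<Longrightarrow>
     \<bar>?S 0 m (z + k) - (\<Sum>i<3. ?S i m z / fact i * k ^ i)\<bar> \<le> C2 * \<bar>k\<bar> ^ 3" by blast
  have "\<exists>C\<ge>0. \<forall>m z k. wdom m1 m z \<longrightarrow> wdom m1 m (z + k) \<longrightarrow>
     \<bar>?V 0 m (z + k) - (\<Sum>i<2. ?V i m z / fact i * k ^ i)\<bar> \<le> C * \<bar>k\<bar> ^ 2"
  proof (rule taylor_UB)
    fix i :: nat and m z :: real assume i: "i < 2" and m: "1 \<le> m" and z: "0 < z"
    from i consider "i = 0" | "i = 1" by linarith
    then show "((\<lambda>z. ?V i m z) has_real_derivative ?V (Suc i) m z) (at z)"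
      by cases (simp_all add: DERIV_sig[OF z m] DERIV_sig1[OF z m])
  next
    show "UB m1 (\<lambda>m z. ?V 2 m z)" using UB_sig(3)[of m1 b] by simp
  qed simp
  then obtain C3 where C3: "C3 \<ge> 0" "\<And>m z k. wdom m1 m z \<Longrightarrow> wdom m1 m (z + k) \<Longrightarrow>
     \<bar>?V 0 m (z + k) - (\<Sum>i<2. ?V i m z / fact i * k ^ i)\<bar> \<le> C3 * \<bar>k\<bar> ^ 2" by blast
  show ?thesis
  proof (intro exI[of _ "C1 + C2 + C3"] conjI allI impI)
    show "0 \<le> C1 + C2 + C3" using C1 C2 C3 by simp
    fix m z h sg :: real
    assume A: "0 < h \<and> (sg = 1 \<or> sg = -1) \<and> wdom m1 m z \<and> wdom m1 m (z - sg * h)"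
    define k where "k = - sg * h"
    have k: "\<bar>k\<bar> = h" "k^2 = h^2" "k ^ 3 = - sg * h ^ 3" "z - sg * h = z + k" "k / h = - sg" using A by (auto simp: k_def)
    have h: "h > 0" and d: "wdom m1 m z" "wdom m1 m (z + k)" using A k(4) by auto
    define x1 where "x1 = Psi m (z + k) - (Psi m z - phi m z * k - ld1 cphi m (rho m) z / 2 * k^2 - ld2 cphi m (rho m) z / 6 * k ^ 3)"
    define x2 where "x2 = logsum (cs b) m (rho m) (z + k) - (logsum (cs b) m (rho m) z + ld1 (cs b) m (rho m) z * k + ld2 (cs b) m (rho m) z / 2 * k^2)"
    define x3 where "x3 = sig b m (z + k) - (sig b m z + sig1 b m z * k)"
    have x1: "\<bar>x1\<bar> \<le> C1 * h ^ 4"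
      using C1(2)[OF d] unfolding x1_def k(1) by (simp add: eval_nat_numeral algebra_simps)
    have x2: "\<bar>x2\<bar> \<le> C2 * h ^ 3"
      using C2(2)[OF d] unfolding x2_def k(1) by (simp add: eval_nat_numeral algebra_simps)
    have x3: "\<bar>x3\<bar> \<le> C3 * h ^ 2"
      using C3(2)[OF d] unfolding x3_def k(1) by (simp add: eval_nat_numeral algebra_simps)
    have P: "(Psi m (z + k) - Psi m z) / h = sg * phi m z - ld1 cphi m (rho m) z / 2 * h + sg * ld2 cphi m (rho m) z / 6 * h^2 + x1 / h"
    proof -
      have "Psi m (z + k) - Psi m z = (sg * phi m z) * h - ld1 cphi m (rho m) z / 2 * h^2 + sg * ld2 cphi m (rho m) z / 6 * h ^ 3 + x1"
        unfolding x1_def k(2,3) by (simp add: k_def)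
      then show ?thesis using h by (simp add: divide_simps power_numeral_reduce) (simp add: algebra_simps)
    qed
    have eq: "(Psi m (z - sg * h) - Psi m z) / h + (logsum (cs b) m (rho m) (z - sg * h) - logsum (cs b) m (rho m) z)
      + h * (sig b m (z - sg * h) - sig b m z)
      - (sg * phi m z + h * (- ld1 cphi m (rho m) z / 2 - sg * ld1 (cs b) m (rho m) z)
         + h^2 * (sg * ld2 cphi m (rho m) z / 6 + ld2 (cs b) m (rho m) z / 2 - sg * sig1 b m z)) = x1 / h + x2 + h * x3"
      unfolding k(4) P unfolding x2_def x3_def k(2) by (simp add: k_def algebra_simps power2_eq_square)
    have "\<bar>x1 / h\<bar> \<le> C1 * h ^ 3"
      using x1 h by (simp add: abs_divide divide_le_eq power_numeral_reduce mult_ac)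
    moreover have "\<bar>h * x3\<bar> \<le> C3 * h ^ 3"
    proof -
      have "\<bar>h * x3\<bar> = h * \<bar>x3\<bar>" using h by (simp add: abs_mult)
      also have "\<dots> \<le> h * (C3 * h ^ 2)" using x3 h by (intro mult_left_mono) auto
      finally show ?thesis by (simp add: power_numeral_reduce mult_ac)
    qed
    ultimately have "\<bar>x1 / h + x2 + h * x3\<bar> \<le> C1 * h ^ 3 + C2 * h ^ 3 + C3 * h ^ 3" using x2 by linarith
    then show "\<bar>(Psi m (z - sg * h) - Psi m z) / h + (logsum (cs b) m (rho m) (z - sg * h) - logsum (cs b) m (rho m) z)
      + h * (sig b m (z - sg * h) - sig b m z)
      - (sg * phi m z + h * (- ld1 cphi m (rho m) z / 2 - sg * ld1 (cs b) m (rho m) z)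
         + h^2 * (sg * ld2 cphi m (rho m) z / 6 + ld2 (cs b) m (rho m) z / 2 - sg * sig1 b m z))\<bar> \<le> (C1 + C2 + C3) * h ^ 3"
      unfolding eq by (simp add: distrib_right)
  qed
qed

text \<open>The equation of order N. With b / (1 + b) = 1 - \<beta> the right-hand side splits into
  the parts that match the m-derivatives of \<open>wg1 (rho m)\<close> and of \<open>Psi\<close> /
  (m^2 - 1), and into p / N, which stems from the normalisation of the moments.\<close>

lemma wkb_order1:
  fixes n r b m q0 q1 qm qr f1 s1 :: real
  assumes n: "n \<ge> 1" and r: "r > 1" and b: "1 + b > 0" and m: "m = (r^2 + 1) / 2"
    and q: "q0 = 1 / n" "q1 = 1 / (n + 1)" "qm = 1 / (n + m)" "qr = 1 / (n + r)"
    and f1: "f1 = q0 * (qm - 2 * q1) / 2"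
    and s1: "s1 = q0 * (- q0 / 2 + qm / 2 + (1 + b) * q1 + b * qr) / 2"
  shows "(2 * r^2 / ((1 + b) * (m - 1))) * ((m - n) * (n + 1)^2 / (m + 1) * (- f1 / 2 + s1)
      + (n - 1)^2 * (n + m) / (m + 1) * (- f1 / 2 - s1) + b * (n - 1) * (n + m) / ((m + 1) * (n + 1)))
     = b / (1 + b) * ((m^2 - 1) * ((- 4 * r^2 + 24 * r + 12) / ((r + 1)^2 * (r^2 + 3)^2)) + 1)
       + (m - n) * (3 * m - 2 - n) / (m^2 - 1) + (m^2 - n^2) / (m^2 - 1)"
    (is "?L = ?R")
proof -
  define k where "k = (r - 1) / 2"
  define d where "d = n + m"
  define e where "e = n + 1"
  define g where "g = n + r"
  define F1 where "F1 = e - 2 * d"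
  define B where "B = n * e * g + 2 * (1 + b) * n * d * g + 2 * b * n * d * e - d * e * g"
  define Pp where "Pp = (m - n) * e^2"
  define Qq where "Qq = (n - 1)^2 * d"
  define q where "q = m^2 - 1"
  have mk: "m = 2 * k^2 + 2 * k + 1" "r = 2 * k + 1"
    unfolding m k_def by (simp_all add: field_simps power2_eq_square)
  have r2: "r^2 > 1" using r by (simp add: one_less_power)
  have m1: "m > 1" unfolding m using r2 by simp
  have r3: "r^2 + 3 \<noteq> 0" using r2 by linarith
  have nz: "n \<noteq> 0" "r \<noteq> 0" "d \<noteq> 0" "e \<noteq> 0" "g \<noteq> 0" "1 + b \<noteq> 0" "m + 1 \<noteq> 0" "m - 1 \<noteq> 0" "q \<noteq> 0" "r + 1 \<noteq> 0"
    using n r b m1 unfolding d_def e_def g_def q_def by (auto simp: power2_eq_1_iff)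
  have qs: "q0 = 1 / n" "q1 = 1 / e" "qm = 1 / d" "qr = 1 / g" using q by (simp_all add: d_def e_def g_def)
  let ?E = "4 * n^2 * d * e * g"
  have f1': "f1 / 2 = n * g * F1 / ?E" unfolding f1 qs F1_def using nz by (simp add: divide_simps power_numeral_reduce)
  have s1': "s1 = B / ?E"
  proof -
    have 1: "q0^2 / 4 = d * e * g / ?E" "q0 * qm / 4 = n * e * g / ?E" "q0 * q1 / 2 = 2 * n * d * g / ?E" "q0 * qr / 2 = 2 * n * d * e / ?E"
      unfolding qs using nz by (simp_all add: divide_simps power_numeral_reduce)
    have "s1 = - (q0^2 / 4) + q0 * qm / 4 + (1 + b) * (q0 * q1 / 2) + b * (q0 * qr / 2)"
      unfolding s1 by (simp add: field_simps power2_eq_square)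
    also have "\<dots> = B / ?E" unfolding 1 B_def by (simp add: add_divide_distrib diff_divide_distrib algebra_simps)
    finally show ?thesis .
  qed
  define N where "N = Pp * (B - n * g * F1) - Qq * (B + n * g * F1) + b * (n - 1) * 4 * n^2 * d^2 * g"
  have N: "N = ?E * ((1 + b) * (m - n) + b * (r - 1))"
    unfolding N_def Pp_def Qq_def B_def F1_def d_def e_def g_def mk by algebra
  have q': "q = (m - 1) * (m + 1)" unfolding q_def by (simp add: power2_eq_square algebra_simps)
  have "?L = (2 * r^2 / ((1 + b) * q)) * (N / ?E)"
  proof -
    have t: "b * (n - 1) * d / ((m + 1) * e) = (b * (n - 1) * 4 * n^2 * d^2 * g / ?E) / (m + 1)"
      using nz by (simp add: divide_simps power_numeral_reduce)
    have a: "- f1 / 2 + s1 = (B - n * g * F1) / ?E" "- f1 / 2 - s1 = - ((B + n * g * F1) / ?E)"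
    proof -
      have "- f1 / 2 + s1 = s1 - f1 / 2" "- f1 / 2 - s1 = - (s1 + f1 / 2)" by simp_all
      then show "- f1 / 2 + s1 = (B - n * g * F1) / ?E" "- f1 / 2 - s1 = - ((B + n * g * F1) / ?E)"
        unfolding f1' s1' by (simp_all only: add_divide_distrib diff_divide_distrib)
    qed
    have c: "Pp / (m + 1) * ((B - n * g * F1) / ?E) + Qq / (m + 1) * (- ((B + n * g * F1) / ?E))
        + (b * (n - 1) * 4 * n^2 * d^2 * g / ?E) / (m + 1) = (N / ?E) / (m + 1)"
    proof -
      have "x / y * (u / E) + v / y * (- (w / E)) + t / E / y = ((x * u - v * w + t) / E) / y" for x y u v w t E :: real
        by (simp add: add_divide_distrib diff_divide_distrib mult_ac)
      then show ?thesis unfolding N_def .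
    qed
    have "2 * r^2 / ((1 + b) * (m - 1)) * (Z / (m + 1)) = 2 * r^2 / ((1 + b) * q) * Z" for Z
      unfolding q' by simp
    note k = this
    show ?thesis
      unfolding d_def[symmetric] e_def[symmetric] Pp_def[symmetric] Qq_def[symmetric] t a c by (rule k)
  qed
  also have "\<dots> = (2 * r^2 / ((1 + b) * q)) * ((1 + b) * (m - n) + b * (r - 1))"
    unfolding N using nz by simp
  also have "\<dots> = (m - n) * (2 * r^2) / q + b / (1 + b) * (2 * r^2 * (r - 1) / q)"
  proof -
    have "A / (cb * q) * (cb * X + b * Y) = X * A / q + b / cb * (A * Y / q)" if "cb \<noteq> 0" for A cb X Y
      using that nz by (simp add: field_simps)
    then show ?thesis using nz by blast
  qed
  also have "2 * r^2 * (r - 1) / q = q * ((- 4 * r^2 + 24 * r + 12) / ((r + 1)^2 * (r^2 + 3)^2)) + 1"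
  proof -
    have qr: "q = (r - 1) * (r + 1) * (r^2 + 3) / 4" unfolding q_def m by (simp add: power2_eq_square field_simps)
    have r1: "r - 1 \<noteq> 0" using r by simp
    define s where "s = r^2 + 3"
    have s0: "s \<noteq> 0" unfolding s_def by (rule r3)
    have "2 * r^2 * (r - 1) / q = 8 * r^2 / ((r + 1) * s)"
      unfolding qr s_def[symmetric] using r1 nz s0 by (simp add: divide_simps)
    moreover have "q * ((- 4 * r^2 + 24 * r + 12) / ((r + 1)^2 * s^2)) + 1 = ((r - 1) * (- r\<^sup>2 + 6 * r + 3) + (r + 1) * s) / ((r + 1) * s)"
      unfolding qr s_def[symmetric] using r1 nz s0 by (simp add: divide_simps power2_eq_square)
    moreover have "(r - 1) * (- r\<^sup>2 + 6 * r + 3) + (r + 1) * s = 8 * r^2"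
      unfolding s_def by (simp add: power2_eq_square algebra_simps)
    ultimately show ?thesis unfolding s_def by simp
  qed
  also have "(m - n) * (2 * r^2) / q = (m - n) * (3 * m - 2 - n) / q + (m^2 - n^2) / q"
  proof -
    have rr: "r^2 = 2 * m - 1" unfolding m by (simp add: field_simps)
    have "(m - n) * (2 * r^2) = (m - n) * (3 * m - 2 - n) + (m^2 - n^2)"
      unfolding rr by (simp add: power2_eq_square algebra_simps)
    then show ?thesis by (simp only: add_divide_distrib)
  qed
  finally show ?thesis unfolding q_def[symmetric] by simp
qed

text \<open>The equation of order N^2. Its right-hand side does not contain n, so the leading
  coefficient of the ansatz can be the same for all p.\<close>

lemma wkb_order0:
  fixes n m :: real
  assumes "m > 1"
  shows "(m - n) * (n + 1)^2 / (m + 1) + (n - 1)^2 * (n + m) / (m + 1) - (m^2 - n^2) * (4 - 2 * m) / (m + 1)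
    = 2 * m * (m - 1)^2 / (m + 1)"
proof -
  have "(m - n) * (n + 1)^2 + (n - 1)^2 * (n + m) - (m^2 - n^2) * (4 - 2 * m) = 2 * m * (m - 1)^2"
    by (simp add: power2_eq_square algebra_simps)
  then show ?thesis by (simp only: add_divide_distrib[symmetric] diff_divide_distrib[symmetric])
qed

text \<open>The logarithm of the quotient of neighbouring values of the ansatz, see
  \<open>lnk_shift\<close>; its leading part is \<open>sg * phi m z\<close>, and \<open>lr1\<close>
  and \<open>lr2\<close> are its coefficients of h and h^2.\<close>

definition lratio :: "real \<Rightarrow> real \<Rightarrow> real \<Rightarrow> real \<Rightarrow> real \<Rightarrow> real" where
  "lratio b sg m z h = (Psi m (z - sg * h) - Psi m z) / h + (logsum (cs b) m (rho m) (z - sg * h) - logsum (cs b) m (rho m) z)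
      + h * (sig b m (z - sg * h) - sig b m z)"

definition lr1 :: "real \<Rightarrow> real \<Rightarrow> real \<Rightarrow> real \<Rightarrow> real" where
  "lr1 b sg m z = - ld1 cphi m (rho m) z / 2 - sg * ld1 (cs b) m (rho m) z"

definition lr2 :: "real \<Rightarrow> real \<Rightarrow> real \<Rightarrow> real \<Rightarrow> real" where
  "lr2 b sg m z = sg * ld2 cphi m (rho m) z / 6 + ld2 (cs b) m (rho m) z / 2 - sg * sig1 b m z"

lemma UB_lr: "UB m1 (lr1 b sg)" "UB m1 (lr2 b sg)"
proof -
  have r: "rho m \<ge> 0" if "1 \<le> m" for m using rho_ge1[OF that] by auto
  note l = UB_ld[of m1 rho, OF r]
  show "UB m1 (lr1 b sg)"
    unfolding lr1_def[abs_def] by (intro UB_intros l)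
  show "UB m1 (lr2 b sg)"
    unfolding lr2_def[abs_def]
    by (rule UB_diff[OF UB_add[OF UB_divide_const[OF UB_mult[OF UB_const l(2)]] UB_divide_const[OF l(2)]] UB_mult[OF UB_const UB_sig(2)]])
qed

lemma ratio_expansion:
  "\<exists>C\<ge>0. \<forall>m z h sg. 0 < h \<and> (sg = 1 \<or> sg = -1) \<and> wdom m1 m z \<and> wdom m1 m (z - sg * h) \<longrightarrow>
    \<bar>exp (lratio b sg m z h - sg * phi m z) - (1 + h * lr1 b sg m z + h^2 * (lr2 b sg m z + (lr1 b sg m z)^2 / 2))\<bar> \<le> C * h ^ 3"
proof -
  obtain C1 where C1: "C1 \<ge> 0" "\<And>m z h sg. 0 < h \<and> (sg = 1 \<or> sg = -1) \<and> wdom m1 m z \<and> wdom m1 m (z - sg * h) \<Longrightarrow>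
    \<bar>lratio b sg m z h - (sg * phi m z + h * lr1 b sg m z + h^2 * lr2 b sg m z)\<bar> \<le> C1 * h ^ 3"
    using log_ratio_expansion[of m1 b] unfolding lratio_def[symmetric] lr1_def[symmetric] lr2_def[symmetric] by blast
  have "\<exists>A\<ge>0. \<forall>m z. wdom m1 m z \<longrightarrow> \<bar>f m z\<bar> \<le> A" if "UB m1 f" for f using that unfolding UB_def .
  from this[OF UB_lr(1)[of m1 b 1]] this[OF UB_lr(1)[of m1 b "-1"]] this[OF UB_lr(2)[of m1 b 1]] this[OF UB_lr(2)[of m1 b "-1"]]
  obtain A1 A2 A3 A4 where A: "A1 \<ge> 0" "\<forall>m z. wdom m1 m z \<longrightarrow> \<bar>lr1 b 1 m z\<bar> \<le> A1" "A2 \<ge> 0" "\<forall>m z. wdom m1 m z \<longrightarrow> \<bar>lr1 b (-1) m z\<bar> \<le> A2"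
    "A3 \<ge> 0" "\<forall>m z. wdom m1 m z \<longrightarrow> \<bar>lr2 b 1 m z\<bar> \<le> A3" "A4 \<ge> 0" "\<forall>m z. wdom m1 m z \<longrightarrow> \<bar>lr2 b (-1) m z\<bar> \<le> A4"
    by metis
  define A where "A = A1 + A2 + A3 + A4"
  have A': "A \<ge> 0" "\<bar>lr1 b sg m z\<bar> \<le> A" "\<bar>lr2 b sg m z\<bar> \<le> A" if "wdom m1 m z" "sg = 1 \<or> sg = -1" for m z sg
  proof -
    show "A \<ge> 0" unfolding A_def using A by simp
    have "\<bar>lr1 b 1 m z\<bar> \<le> A1" "\<bar>lr1 b (-1) m z\<bar> \<le> A2" "\<bar>lr2 b 1 m z\<bar> \<le> A3" "\<bar>lr2 b (-1) m z\<bar> \<le> A4" using A that(1) by auto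
    then show "\<bar>lr1 b sg m z\<bar> \<le> A" "\<bar>lr2 b sg m z\<bar> \<le> A" unfolding A_def using that(2) A(1,3,5,7) by auto
  qed
  have A0: "A \<ge> 0" unfolding A_def using A by simp
  obtain C' where C': "C' \<ge> 0" "\<forall>h y \<alpha> \<gamma> :: real. 0 < h \<and> h \<le> m1^2 \<and> \<bar>\<alpha>\<bar> \<le> A \<and> \<bar>\<gamma>\<bar> \<le> A \<and> \<bar>y - h * \<alpha> - h\<^sup>2 * \<gamma>\<bar> \<le> C1 * h ^ 3 \<longrightarrow>
     \<bar>exp y - (1 + h * \<alpha> + h^2 * (\<gamma> + \<alpha>^2 / 2))\<bar> \<le> C' * h ^ 3"
    using exp_expansion[OF A0 C1(1), of "m1^2"] by auto
  show ?thesis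
  proof (intro exI[of _ C'] conjI allI impI C'(1))
    fix m z h sg :: real
    assume H: "0 < h \<and> (sg = 1 \<or> sg = -1) \<and> wdom m1 m z \<and> wdom m1 m (z - sg * h)"
    have mm: "m^2 \<le> m1^2" using H by (intro power_mono) (auto simp: wdom_def)
    have "h \<le> m^2" using H by (auto simp: wdom_def)
    with mm have h: "h \<le> m1^2" by linarith
    have "\<bar>(lratio b sg m z h - sg * phi m z) - h * lr1 b sg m z - h^2 * lr2 b sg m z\<bar> \<le> C1 * h ^ 3"
      using C1(2)[OF H] by (simp add: algebra_simps)
    with A'(2,3)[of m z sg] H h C'(2)
    show "\<bar>exp (lratio b sg m z h - sg * phi m z) - (1 + h * lr1 b sg m z + h^2 * (lr2 b sg m z + (lr1 b sg m z)^2 / 2))\<bar> \<le> C' * h ^ 3"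
      by auto
  qed
qed

lemma exp_phi:
  assumes "z \<ge> 1" "m \<ge> 1"
  shows "exp (phi m z) = (sqrt z + m) * (m + 1) / (sqrt z + 1)^2"
proof -
  have s: "sqrt z + m > 0" "sqrt z + 1 > 0" "m + 1 > 0" using assms by (auto intro: add_nonneg_pos)
  have "phi m z = ln (sqrt z + m) + ln (m + 1) - 2 * ln (sqrt z + 1)"
    unfolding phi_def logsum_def cphi_def by simp
  then have "exp (phi m z) = (sqrt z + m) * (m + 1) / exp (2 * ln (sqrt z + 1))"
    using s by (simp add: exp_diff exp_add)
  also have "exp (2 * ln (sqrt z + 1)) = (sqrt z + 1)^2"
    using s by (metis exp_double exp_ln)
  finally show ?thesis .
qed

text \<open>Coefficients of the system times the leading ratios \<open>exp (- phi)\<close> and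
  \<open>exp phi\<close>. The products are rational in sqrt z, \<open>wP\<close> vanishes at z =
  m^2, and \<open>wQ\<close> and \<open>wT\<close> vanish at z = 1.\<close>

definition wP :: "real \<Rightarrow> real \<Rightarrow> real" where "wP m z = (m - sqrt z) * (sqrt z + 1)^2 / (m + 1)"
definition wQ :: "real \<Rightarrow> real \<Rightarrow> real" where "wQ m z = (sqrt z - 1)^2 * (sqrt z + m) / (m + 1)"
definition wT :: "real \<Rightarrow> real \<Rightarrow> real \<Rightarrow> real" where
  "wT b m z = b * (sqrt z - 1) * (sqrt z + m) / ((m + 1) * (sqrt z + 1))"

lemma wPQT:
  assumes "z \<ge> 1" "m \<ge> 1"
  shows "(m^2 - z) * exp (- phi m z) = wP m z" "(z - 1)^2 / (m + 1)^2 * exp (phi m z) = wQ m z"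
    "(z - 1) * b / (m + 1)^2 * exp (phi m z) = wT b m z"
proof -
  define n where "n = sqrt z"
  have n: "n \<ge> 1" "z = n^2" unfolding n_def using assms by auto
  have nz: "n + m \<noteq> 0" "n + 1 \<noteq> 0" "m + 1 \<noteq> 0" using n assms by auto
  have e: "exp (phi m z) = (n + m) * (m + 1) / (n + 1)^2" unfolding n_def by (rule exp_phi[OF assms])
  have f: "z - 1 = (n - 1) * (n + 1)" "m^2 - z = (m - n) * (n + m)" unfolding n(2) by (simp_all add: power2_eq_square algebra_simps)
  show "(m^2 - z) * exp (- phi m z) = wP m z"
    unfolding exp_minus e f wP_def n_def[symmetric] using nz by (simp add: divide_simps)
  show "(z - 1)^2 / (m + 1)^2 * exp (phi m z) = wQ m z"
    unfolding e f wQ_def n_def[symmetric] using nz by (simp add: divide_simps power2_eq_square)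
  show "(z - 1) * b / (m + 1)^2 * exp (phi m z) = wT b m z"
    unfolding e f wT_def n_def[symmetric] using nz by (simp add: divide_simps power2_eq_square)
qed

lemma UB_PQT: "UB m1 wP" "UB m1 wQ" "UB m1 (wT b)"
proof -
  have s: "UB m1 (\<lambda>m z. sqrt z)"
  proof (rule UB_I[of _ _ "m1"])
    fix m z assume "wdom m1 m z"
    then have "sqrt z \<le> m" "m \<le> m1" "0 \<le> sqrt z" by (auto simp: wdom_def intro: real_le_lsqrt)
    then show "\<bar>sqrt z\<bar> \<le> m1" by linarith
  qed
  have mm: "UB m1 (\<lambda>m z. m)" by (rule UB_continuous) auto
  have i: "UB m1 (\<lambda>m z. 1 / (m + 1))" by (rule UB_continuous) (intro continuous_intros, auto)
  have w: "wP = (\<lambda>m z. (m - sqrt z) * (sqrt z + 1)^2 * (1 / (m + 1)))" "wQ = (\<lambda>m z. (sqrt z - 1)\<^sup>2 * (sqrt z + m) * (1 / (m + 1)))"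
    "wT b = (\<lambda>m z. b * (sqrt z - 1) * (sqrt z + m) * (1 / (m + 1)) * Qf 1 z)"
    unfolding wP_def wQ_def wT_def Qf_def by (auto simp: fun_eq_iff)
  show "UB m1 wP" "UB m1 wQ" "UB m1 (wT b)"
    unfolding w by (intro UB_intros s mm i)+
qed

text \<open>What the moment system makes of the ansatz, up to the factor in
  \<open>bracket_as_recurrence\<close>: the summands belong to p - 1, to p + 1 and to the
  diagonal.\<close>

definition bracket :: "real \<Rightarrow> real \<Rightarrow> real \<Rightarrow> real \<Rightarrow> real" where
  "bracket b m z h = (m^2 - z) * exp (lratio b (-1) m z h) + (z - 1) * (z - 1 + h * b) / (m + 1)^2 * exp (lratio b 1 m z h)
     - (m^2 - z) * (4 - 2 * m) / (m + 1)"

definition br0 :: "real \<Rightarrow> real \<Rightarrow> real \<Rightarrow> real" where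
  "br0 b m z = wP m z + wQ m z - (m^2 - z) * (4 - 2 * m) / (m + 1)"
definition br1 :: "real \<Rightarrow> real \<Rightarrow> real \<Rightarrow> real" where
  "br1 b m z = wP m z * lr1 b (-1) m z + wQ m z * lr1 b 1 m z + wT b m z"
definition br2 :: "real \<Rightarrow> real \<Rightarrow> real \<Rightarrow> real" where
  "br2 b m z = wP m z * (lr2 b (-1) m z + (lr1 b (-1) m z)^2 / 2) + wQ m z * (lr2 b 1 m z + (lr1 b 1 m z)^2 / 2) + wT b m z * lr1 b 1 m z"

text \<open>At z = m^2 (p = 0) and at z = 1 (p = N) one neighbour lies outside the domain of the
  expansions. Its coefficient vanishes there, so the end points need no separate treatment.\<close>

lemma bracket_expansion:
  "\<exists>C\<ge>0. \<forall>m z h. 0 < h \<and> h \<le> m1^2 \<and> wdom m1 m z \<and> (z = m^2 \<or> wdom m1 m (z + h)) \<and> (z = 1 \<or> wdom m1 m (z - h)) \<longrightarrow>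
    \<bar>bracket b m z h - (br0 b m z + h * br1 b m z + h^2 * br2 b m z)\<bar> \<le> C * h ^ 3"
proof -
  obtain C where C: "C \<ge> 0" "\<And>m z h sg. 0 < h \<and> (sg = 1 \<or> sg = -1) \<and> wdom m1 m z \<and> wdom m1 m (z - sg * h) \<Longrightarrow>
    \<bar>exp (lratio b sg m z h - sg * phi m z) - (1 + h * lr1 b sg m z + h^2 * (lr2 b sg m z + (lr1 b sg m z)^2 / 2))\<bar> \<le> C * h ^ 3"
    using ratio_expansion[of m1 b] by blast
  have UBD: "\<exists>A\<ge>0. \<forall>m z. wdom m1 m z \<longrightarrow> \<bar>f m z\<bar> \<le> A" if "UB m1 f" for f using that unfolding UB_def .
  have "UB m1 (\<lambda>m z. lr2 b 1 m z + (lr1 b 1 m z)^2 / 2)" by (intro UB_intros UB_lr)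
  from UBD[OF UB_PQT(1)] UBD[OF UB_PQT(2)] UBD[OF UB_PQT(3)] UBD[OF this]
  obtain A1 A2 A3 A4 where A: "A1 \<ge> 0" "\<forall>m z. wdom m1 m z \<longrightarrow> \<bar>wP m z\<bar> \<le> A1" "A2 \<ge> 0" "\<forall>m z. wdom m1 m z \<longrightarrow> \<bar>wQ m z\<bar> \<le> A2"
    "A3 \<ge> 0" "\<forall>m z. wdom m1 m z \<longrightarrow> \<bar>wT b m z\<bar> \<le> A3" "A4 \<ge> 0" "\<forall>m z. wdom m1 m z \<longrightarrow> \<bar>lr2 b 1 m z + (lr1 b 1 m z)^2 / 2\<bar> \<le> A4"
    by metis
  define D where "D = A1 * C + A2 * C + A3 * (C * m1^2 + A4)"
  have D: "D \<ge> 0" unfolding D_def using A C by simp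
  show ?thesis
  proof (intro exI[of _ D] conjI allI impI D)
    fix m z h :: real
    assume H: "0 < h \<and> h \<le> m1^2 \<and> wdom m1 m z \<and> (z = m^2 \<or> wdom m1 m (z + h)) \<and> (z = 1 \<or> wdom m1 m (z - h))"
    then have h: "h > 0" "h \<le> m1^2" and d: "wdom m1 m z" and zm: "z \<ge> 1" "m \<ge> 1" by (auto simp: wdom_def)
    define Em where "Em = exp (lratio b (-1) m z h + phi m z) - (1 + h * lr1 b (-1) m z + h^2 * (lr2 b (-1) m z + (lr1 b (-1) m z)^2 / 2))"
    define Ep where "Ep = exp (lratio b 1 m z h - phi m z) - (1 + h * lr1 b 1 m z + h^2 * (lr2 b 1 m z + (lr1 b 1 m z)^2 / 2))"
    note P = wPQT(1,2)[OF zm] wPQT(3)[OF zm, of b]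
    have em: "(m^2 - z) * exp (lratio b (-1) m z h) = wP m z * (1 + h * lr1 b (-1) m z + h^2 * (lr2 b (-1) m z + (lr1 b (-1) m z)^2 / 2)) + wP m z * Em"
    proof -
      have "(m^2 - z) * exp (lratio b (-1) m z h) = ((m^2 - z) * exp (- phi m z)) * exp (lratio b (-1) m z h + phi m z)"
        by (simp add: mult.assoc mult_exp_exp)
      then show ?thesis unfolding P(1) Em_def by (simp add: algebra_simps)
    qed
    have e1: "exp (lratio b 1 m z h) = exp (phi m z) * (1 + h * lr1 b 1 m z + h^2 * (lr2 b 1 m z + (lr1 b 1 m z)^2 / 2) + Ep)"
      unfolding Ep_def by (simp add: mult_exp_exp)
    have ep: "(z - 1) * (z - 1 + h * b) / (m + 1)^2 * exp (lratio b 1 m z h) = (wQ m z + h * wT b m z) * (1 + h * lr1 b 1 m z + h^2 * (lr2 b 1 m z + (lr1 b 1 m z)^2 / 2) + Ep)"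
    proof -
      have "(z - 1) * (z - 1 + h * b) / (m + 1)^2 * exp (lratio b 1 m z h) =
        ((z - 1)^2 / (m + 1)^2 * exp (phi m z) + h * ((z - 1) * b / (m + 1)^2 * exp (phi m z))) * (1 + h * lr1 b 1 m z + h^2 * (lr2 b 1 m z + (lr1 b 1 m z)^2 / 2) + Ep)"
      proof -
        have "(z - 1) * (z - 1 + h * b) / M * (E * X) = ((z - 1)^2 / M * E + h * ((z - 1) * b / M * E)) * X" for M E X :: real
          by (simp add: power2_eq_square algebra_simps add_divide_distrib diff_divide_distrib)
        then show ?thesis unfolding e1 .
      qed
      then show ?thesis unfolding P .
    qed
    have eq: "bracket b m z h - (br0 b m z + h * br1 b m z + h^2 * br2 b m z)
       = wP m z * Em + wQ m z * Ep + wT b m z * h * (h^2 * (lr2 b 1 m z + (lr1 b 1 m z)^2 / 2) + Ep)"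
      unfolding bracket_def em ep br0_def br1_def br2_def by (simp add: algebra_simps power2_eq_square)
    have w0: "z = m^2 \<Longrightarrow> wP m z = 0" "z = 1 \<Longrightarrow> wQ m z = 0" "z = 1 \<Longrightarrow> wT b m z = 0"
      using zm by (auto simp: wP_def wQ_def wT_def)
    have 1: "\<bar>wP m z * Em\<bar> \<le> A1 * C * h ^ 3"
    proof (cases "z = m^2")
      case False
      then have "\<bar>Em\<bar> \<le> C * h ^ 3" using C(2)[of h "-1" m z] H unfolding Em_def by auto
      then have "\<bar>wP m z * Em\<bar> \<le> A1 * (C * h ^ 3)" unfolding abs_mult using A d by (intro mult_mono) auto
      then show ?thesis by (simp add: mult.assoc)
    qed (use w0 A C h in auto)
    have 2: "\<bar>wQ m z * Ep\<bar> \<le> A2 * C * h ^ 3"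
    proof (cases "z = 1")
      case False
      then have "\<bar>Ep\<bar> \<le> C * h ^ 3" using C(2)[of h 1 m z] H unfolding Ep_def by auto
      then have "\<bar>wQ m z * Ep\<bar> \<le> A2 * (C * h ^ 3)" unfolding abs_mult using A d by (intro mult_mono) auto
      then show ?thesis by (simp add: mult.assoc)
    qed (use w0 A C h in auto)
    have 3: "\<bar>wT b m z * h * (h^2 * (lr2 b 1 m z + (lr1 b 1 m z)^2 / 2) + Ep)\<bar> \<le> A3 * (C * m1^2 + A4) * h ^ 3"
    proof (cases "z = 1")
      case False
      then have E: "\<bar>Ep\<bar> \<le> C * h ^ 3" using C(2)[of h 1 m z] H unfolding Ep_def by auto
      have "C * h ^ 3 \<le> h^2 * (C * m1^2)"
      proof -
        have "C * h ^ 3 = h^2 * (C * h)" by (simp add: power_numeral_reduce)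
        also have "\<dots> \<le> h^2 * (C * m1^2)" using h C by (intro mult_left_mono) auto
        finally show ?thesis .
      qed
      moreover have "\<bar>h\<^sup>2 * (lr2 b 1 m z + (lr1 b 1 m z)^2 / 2)\<bar> \<le> h^2 * A4"
        unfolding abs_mult using A d by (intro mult_mono) auto
      ultimately have "\<bar>h\<^sup>2 * (lr2 b 1 m z + (lr1 b 1 m z)^2 / 2) + Ep\<bar> \<le> h^2 * (C * m1^2) + h^2 * A4" using E by linarith
      then have "\<bar>wT b m z * h * (h^2 * (lr2 b 1 m z + (lr1 b 1 m z)^2 / 2) + Ep)\<bar> \<le> A3 * h * (h^2 * (C * m1^2) + h^2 * A4)"
        unfolding abs_mult using A d h C by (intro mult_mono) auto
      also have "\<dots> = A3 * (C * m1^2 + A4) * h ^ 3" by (simp add: algebra_simps power_numeral_reduce)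
      finally show ?thesis .
    qed (use w0 A C h in auto)
    have "D * h ^ 3 = A1 * C * h ^ 3 + A2 * C * h ^ 3 + A3 * (C * m1^2 + A4) * h ^ 3" unfolding D_def by (simp only: distrib_right)
    then show "\<bar>bracket b m z h - (br0 b m z + h * br1 b m z + h^2 * br2 b m z)\<bar> \<le> D * h ^ 3"
      unfolding eq using 1 2 3 by linarith
  qed
qed

section \<open>The residual of the WKB approximation\<close>

text \<open>The first argument \<open>x\<close> stands for \<open>p / N\<close> and is kept fixed in the derivative.\<close>

definition ND :: "real \<Rightarrow> (real \<Rightarrow> real \<Rightarrow> real) \<Rightarrow> bool" where
  "ND m1 f \<longleftrightarrow> (\<exists>f' C. \<forall>x m. 0 \<le> x \<and> x \<le> 1 \<and> 1 < m \<and> m \<le> m1 \<longrightarrow>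
     ((f x) has_real_derivative f' x m) (at m) \<and> \<bar>f x m\<bar> \<le> C \<and> \<bar>f' x m\<bar> \<le> C)"

lemma ND_I:
  assumes "\<And>x m. 0 \<le> x \<Longrightarrow> x \<le> 1 \<Longrightarrow> 1 < m \<Longrightarrow> m \<le> m1 \<Longrightarrow> ((f x) has_real_derivative f' x m) (at m)"
    "\<And>x m. 0 \<le> x \<Longrightarrow> x \<le> 1 \<Longrightarrow> 1 < m \<Longrightarrow> m \<le> m1 \<Longrightarrow> \<bar>f x m\<bar> \<le> C"
    "\<And>x m. 0 \<le> x \<Longrightarrow> x \<le> 1 \<Longrightarrow> 1 < m \<Longrightarrow> m \<le> m1 \<Longrightarrow> \<bar>f' x m\<bar> \<le> D"
  shows "ND m1 f"
  unfolding ND_def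
proof (intro exI[of _ f'] exI[of _ "max C D"] allI impI)
  fix x m :: real assume "0 \<le> x \<and> x \<le> 1 \<and> 1 < m \<and> m \<le> m1"
  then have h: "0 \<le> x" "x \<le> 1" "1 < m" "m \<le> m1" by auto
  show "((f x) has_real_derivative f' x m) (at m) \<and> \<bar>f x m\<bar> \<le> max C D \<and> \<bar>f' x m\<bar> \<le> max C D"
    using assms(1)[OF h] assms(2)[OF h] assms(3)[OF h] by auto
qed

lemma ND_const: "ND m1 (\<lambda>_ _. c)"
  by (rule ND_I[of _ _ "\<lambda>_ _. 0" "\<bar>c\<bar>" 0]) auto

lemma ND_add:
  assumes "ND m1 f" "ND m1 g" shows "ND m1 (\<lambda>x m. f x m + g x m)"
proof -
  from assms obtain f' C g' D where *: "\<forall>x m. 0 \<le> x \<and> x \<le> 1 \<and> 1 < m \<and> m \<le> m1 \<longrightarrow>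
     ((f x) has_real_derivative f' x m) (at m) \<and> \<bar>f x m\<bar> \<le> C \<and> \<bar>f' x m\<bar> \<le> C"
     "\<forall>x m. 0 \<le> x \<and> x \<le> 1 \<and> 1 < m \<and> m \<le> m1 \<longrightarrow>
     ((g x) has_real_derivative g' x m) (at m) \<and> \<bar>g x m\<bar> \<le> D \<and> \<bar>g' x m\<bar> \<le> D" unfolding ND_def by auto
  show ?thesis
  proof (rule ND_I[of _ _ "\<lambda>x m. f' x m + g' x m" "C + D" "C + D"])
    fix x m :: real assume "0 \<le> x" "x \<le> 1" "1 < m" "m \<le> m1"
    with * have h: "((f x) has_real_derivative f' x m) (at m)" "((g x) has_real_derivative g' x m) (at m)"
      "\<bar>f x m\<bar> \<le> C" "\<bar>f' x m\<bar> \<le> C" "\<bar>g x m\<bar> \<le> D" "\<bar>g' x m\<bar> \<le> D" by auto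
    show "((\<lambda>m. f x m + g x m) has_real_derivative f' x m + g' x m) (at m)" by (intro DERIV_add h)
    show "\<bar>f x m + g x m\<bar> \<le> C + D" "\<bar>f' x m + g' x m\<bar> \<le> C + D" using h(3-) by linarith+
  qed
qed

lemma ND_mult:
  assumes "ND m1 f" "ND m1 g" shows "ND m1 (\<lambda>x m. f x m * g x m)"
proof -
  from assms obtain f' C g' D where *: "\<forall>x m. 0 \<le> x \<and> x \<le> 1 \<and> 1 < m \<and> m \<le> m1 \<longrightarrow>
     ((f x) has_real_derivative f' x m) (at m) \<and> \<bar>f x m\<bar> \<le> C \<and> \<bar>f' x m\<bar> \<le> C"
     "\<forall>x m. 0 \<le> x \<and> x \<le> 1 \<and> 1 < m \<and> m \<le> m1 \<longrightarrow>
     ((g x) has_real_derivative g' x m) (at m) \<and> \<bar>g x m\<bar> \<le> D \<and> \<bar>g' x m\<bar> \<le> D" unfolding ND_def by auto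
  show ?thesis
  proof (rule ND_I[of _ _ "\<lambda>x m. f' x m * g x m + g' x m * f x m" "C * D" "C * D + D * C"])
    fix x m :: real assume "0 \<le> x" "x \<le> 1" "1 < m" "m \<le> m1"
    with * have h: "((f x) has_real_derivative f' x m) (at m)" "((g x) has_real_derivative g' x m) (at m)"
      "\<bar>f x m\<bar> \<le> C" "\<bar>f' x m\<bar> \<le> C" "\<bar>g x m\<bar> \<le> D" "\<bar>g' x m\<bar> \<le> D" by auto
    have cd: "C \<ge> 0" "D \<ge> 0" using h(3,5) by linarith+
    show "((\<lambda>m. f x m * g x m) has_real_derivative f' x m * g x m + g' x m * f x m) (at m)" by (intro DERIV_mult h)
    show "\<bar>f x m * g x m\<bar> \<le> C * D" unfolding abs_mult using h cd by (intro mult_mono) auto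
    have "\<bar>f' x m * g x m\<bar> \<le> C * D" "\<bar>g' x m * f x m\<bar> \<le> D * C" unfolding abs_mult using h cd by (auto intro!: mult_mono)
    then show "\<bar>f' x m * g x m + g' x m * f x m\<bar> \<le> C * D + D * C" by linarith
  qed
qed

lemma ND_minus: "ND m1 f \<Longrightarrow> ND m1 (\<lambda>x m. - f x m)"
  using ND_mult[OF ND_const[of m1 "-1"]] by simp

lemma ND_diff: "ND m1 f \<Longrightarrow> ND m1 g \<Longrightarrow> ND m1 (\<lambda>x m. f x m - g x m)"
  using ND_add[OF _ ND_minus] by simp

lemma ND_power: "ND m1 f \<Longrightarrow> ND m1 (\<lambda>x m. f x m ^ k)"
  by (induction k) (auto intro: ND_const ND_mult)

lemma ND_inverse:
  assumes "ND m1 f" "\<And>x m. 0 \<le> x \<Longrightarrow> x \<le> 1 \<Longrightarrow> 1 < m \<Longrightarrow> m \<le> m1 \<Longrightarrow> f x m \<ge> 1"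
  shows "ND m1 (\<lambda>x m. 1 / f x m)"
proof -
  from assms(1) obtain f' C where *: "\<forall>x m. 0 \<le> x \<and> x \<le> 1 \<and> 1 < m \<and> m \<le> m1 \<longrightarrow>
     ((f x) has_real_derivative f' x m) (at m) \<and> \<bar>f x m\<bar> \<le> C \<and> \<bar>f' x m\<bar> \<le> C" unfolding ND_def by auto
  show ?thesis
  proof (rule ND_I[of _ _ "\<lambda>x m. (0 * f x m - 1 * f' x m) / (f x m * f x m)" 1 C])
    fix x m :: real assume "0 \<le> x" "x \<le> 1" "1 < m" "m \<le> m1"
    with * assms(2) have h: "((f x) has_real_derivative f' x m) (at m)" "\<bar>f' x m\<bar> \<le> C" "f x m \<ge> 1" by auto
    show "((\<lambda>m. 1 / f x m) has_real_derivative (0 * f x m - 1 * f' x m) / (f x m * f x m)) (at m)"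
      using h by (intro DERIV_divide DERIV_const) auto
    show "\<bar>1 / f x m\<bar> \<le> 1" using h by (simp add: divide_le_eq)
    have "1 * 1 \<le> f x m * f x m" using h by (intro mult_mono) auto
    then have "\<bar>f' x m\<bar> / (f x m * f x m) \<le> \<bar>f' x m\<bar> / 1" by (intro divide_left_mono) auto
    then show "\<bar>(0 * f x m - 1 * f' x m) / (f x m * f x m)\<bar> \<le> C" using h by (simp add: abs_divide abs_mult)
  qed
qed

text \<open>Linear in x = p / N, from m^2 at x = 0 to 1 at x = 1. Hence sqrt z \<ge> 1, and the
  poles at 0, - 1, \<open>- rho m\<close> and \<open>- m\<close> are never approached.\<close>

definition zz :: "real \<Rightarrow> real \<Rightarrow> real" where "zz x m = m^2 - (m^2 - 1) * x"

lemma zz_ge1: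
  assumes "0 \<le> x" "x \<le> 1" "1 \<le> m"
  shows "1 \<le> zz x m" "zz x m \<le> m^2"
proof -
  have "m^2 \<ge> 1" using assms by simp
  then have "(m^2 - 1) * (1 - x) \<ge> 0" "(m^2 - 1) * x \<ge> 0" using assms by (auto intro!: mult_nonneg_nonneg)
  then show "1 \<le> zz x m" "zz x m \<le> m^2" unfolding zz_def by (auto simp: algebra_simps)
qed

lemma DERIV_sqrt_zz:
  assumes "0 \<le> x" "x \<le> 1" "1 \<le> m"
  shows "((\<lambda>m. sqrt (zz x m)) has_real_derivative (m * (1 - x) / sqrt (zz x m))) (at m)"
proof -
  have z: "zz x m > 0" using zz_ge1(1)[OF assms] by linarith
  have "((\<lambda>m. zz x m) has_real_derivative (2 * m - (2 * m * x))) (at m)"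
    unfolding zz_def by (auto intro!: derivative_eq_intros)
  from DERIV_chain2[OF DERIV_real_sqrt[OF z] this]
  have "((\<lambda>m. sqrt (zz x m)) has_real_derivative inverse (sqrt (zz x m)) / 2 * (2 * m - 2 * m * x)) (at m)" .
  moreover have "inverse s / 2 * (2 * m - 2 * m * x) = m * (1 - x) / s" for s :: real
  proof -
    have "2 * m - 2 * m * x = 2 * (m * (1 - x))" by (simp add: right_diff_distrib)
    then show ?thesis by (simp add: inverse_eq_divide)
  qed
  ultimately show ?thesis by (simp only:)
qed

lemma DERIV_rho:
  assumes "m \<ge> 1"
  shows "(rho has_real_derivative 1 / rho m) (at m)"
proof -
  have "((\<lambda>m. sqrt (2 * m - 1)) has_real_derivative inverse (sqrt (2 * m - 1)) / 2 * (2 * 1 - 0)) (at m)"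
    using assms by (intro DERIV_chain2[OF DERIV_real_sqrt] DERIV_diff DERIV_cmult DERIV_ident DERIV_const) auto
  then show ?thesis unfolding rho_def[abs_def] by (rule DERIV_cong) (simp add: field_simps)
qed

lemma ND_sqrt_zz: "ND m1 (\<lambda>x m. sqrt (zz x m))"
proof (rule ND_I[of _ _ "\<lambda>x m. m * (1 - x) / sqrt (zz x m)" m1 m1])
  fix x m :: real assume h: "0 \<le> x" "x \<le> 1" "1 < m" "m \<le> m1"
  have z: "1 \<le> zz x m" "zz x m \<le> m^2" using zz_ge1[of x m] h by auto
  show "((\<lambda>m. sqrt (zz x m)) has_real_derivative m * (1 - x) / sqrt (zz x m)) (at m)" using h by (intro DERIV_sqrt_zz) auto
  have "sqrt (zz x m) \<le> m" using z h by (intro real_le_lsqrt) auto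
  then show "\<bar>sqrt (zz x m)\<bar> \<le> m1" using z h by auto
  have "m * (1 - x) / sqrt (zz x m) \<le> m * 1 / 1" using z h by (intro frac_le mult_left_mono mult_nonneg_nonneg) auto
  moreover have "0 \<le> m * (1 - x) / sqrt (zz x m)" using z h by auto
  ultimately show "\<bar>m * (1 - x) / sqrt (zz x m)\<bar> \<le> m1" using h by linarith
qed

lemma ND_m: "ND m1 (\<lambda>x m. m)"
  by (rule ND_I[of _ _ "\<lambda>_ _. 1" m1 1]) auto

lemma ND_rho: "ND m1 (\<lambda>x m. rho m)"
proof (rule ND_I[of _ _ "\<lambda>_ m. 1 / rho m" "rho m1" 1])
  fix x m :: real assume h: "1 < m" "m \<le> m1"
  show "(rho has_real_derivative 1 / rho m) (at m)" using h by (intro DERIV_rho) auto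
  show "\<bar>rho m\<bar> \<le> rho m1" using h by (simp add: rho_def)
  show "\<bar>1 / rho m\<bar> \<le> 1" using rho_ge1[of m] h by (simp add: divide_le_eq)
qed

text \<open>The term of size 1 / N of the ansatz is differentiated along with the others in m; this
  makes its derivative contribute only O(1 / N), without computing it.\<close>

lemma ND_sig: "ND m1 (\<lambda>x m. (m^2 - 1) * sig b m (zz x m))"
proof -
  have ir: "ND m1 (\<lambda>x m. 1 / rho m)" by (intro ND_inverse ND_rho) (auto intro: rho_ge1)
  have im: "ND m1 (\<lambda>x m. 1 / m)" by (intro ND_inverse ND_m) auto
  have s1: "sqrt (zz x m) \<ge> 1" if "0 \<le> x" "x \<le> 1" "1 < m" for x m using zz_ge1(1)[of x m] that by auto
  have Q: "ND m1 (\<lambda>x m. Qf 0 (zz x m))" "ND m1 (\<lambda>x m. Qf 1 (zz x m))" "ND m1 (\<lambda>x m. Qf m (zz x m))" "ND m1 (\<lambda>x m. Qf (rho m) (zz x m))"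
    unfolding Qf_def
  proof -
    have S: "ND m1 (\<lambda>x m. 1 / (sqrt (zz x m) + a m))" if "ND m1 (\<lambda>x m. a m)" "\<And>m. 1 < m \<Longrightarrow> a m \<ge> 0" for a
      by (intro ND_inverse ND_add ND_sqrt_zz that add_increasing2 s1)
    show "ND m1 (\<lambda>x m. 1 / (sqrt (zz x m) + 0))" by (rule S) (auto intro: ND_const)
    show "ND m1 (\<lambda>x m. 1 / (sqrt (zz x m) + 1))" by (rule S) (auto intro: ND_const)
    show "ND m1 (\<lambda>x m. 1 / (sqrt (zz x m) + m))" by (rule S[OF ND_m]) simp
    show "ND m1 (\<lambda>x m. 1 / (sqrt (zz x m) + rho m))"
    proof (rule S[OF ND_rho])
      fix m :: real assume "1 < m" then show "rho m \<ge> 0" using rho_ge1[of m] by simp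
    qed
  qed
  have t: "X / (c * Y) = 1 / c * (X * (1 / Y))" "X / (c * Y * Z) = 1 / c * (X * (1 / Y) * (1 / Z))" for X c Y Z :: real by simp_all
  have k: "k4 b m = - (5 / 16 * m * (1 / rho m)^2)"
    "k3 b m = 1 / 4 * (((b + 1) * rho m ^ 3 + b * (rho m)^2 + (b + 2) * rho m + b) * (1 / rho m) ^ 3)"
    "k2 b m = 1 / 192 * (((12 * b^2 + 24 * b + 11) * rho m ^ 6 + 24 * (b^2 + b) * rho m ^ 5 + (36 * b^2 + 72 * b + 45) * rho m ^ 4
     + (48 * b^2 + 72 * b) * rho m ^ 3 + (36 * b^2 + 48 * b + 45) * (rho m)^2 + (24 * b^2 + 48 * b) * rho m + 12 * b^2 + 3) * (1 / rho m) ^ 4 * (1 / m))"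
    "e3 b m = 1 / 16 * (((rho m)^2 - 1)^2 * (b - b^2) * (1 / rho m) ^ 3)"
    "e2 b m = 1 / 32 * (((3 * b^2 + b) * rho m ^ 4 - 4 * b^2 * rho m ^ 3 - 2 * (b^2 + b) * (rho m)^2 + (4 * b^2 + 8 * b) * rho m + 7 * b^2 + b) * (1 / rho m) ^ 4)"
    "g2 b m = 1 / 24 * (1 / m)" for m
    by (unfold k4_def k3_def k2_def e3_def e2_def g2_def power_one_over) (simp, (rule t)+, simp)
  note I = ND_add ND_diff ND_minus ND_mult ND_power ND_const ND_m ND_rho ir im
  have K: "ND m1 (\<lambda>x m. k4 b m)" "ND m1 (\<lambda>x m. k3 b m)" "ND m1 (\<lambda>x m. k2 b m)" "ND m1 (\<lambda>x m. e3 b m)" "ND m1 (\<lambda>x m. e2 b m)"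
    "ND m1 (\<lambda>x m. g2 b m)" "ND m1 (\<lambda>x m. d2 b m)"
    unfolding k d2_def by (intro I)+
  have s: "sig b m z = - (1 / 3 * k4 b m * Qf 0 z ^ 3 + 1 / 2 * k3 b m * (Qf 0 z)^2 - k2 b m * Qf 0 z ^ 1 + d2 b m * Qf 1 z ^ 1
     + 1 / 2 * e3 b m * (Qf (rho m) z)^2 - e2 b m * Qf (rho m) z ^ 1 - g2 b m * Qf m z ^ 1)" for m z
    unfolding sig_def by simp
  show ?thesis unfolding s by (intro I K Q)
qed

text \<open>\<open>wS0\<close>, \<open>wg1\<close> and \<open>wG2\<close> are primitives of the
  parts free of p / N in the three orders, the last two as functions of r = \<open>rho m\<close>.
  All are normalised to vanish at m = 1, where the normalised moments tend to 1.\<close>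

definition wS0 :: "real \<Rightarrow> real \<Rightarrow> real" where
  "wS0 \<beta> m = \<beta> * (2 * ((m - 1) / (m + 1)) + 3 / 4 * ((m - 1) / (m + 1))^2)"

definition wg1 :: "real \<Rightarrow> real" where
  "wg1 r = 1 / 2 - 1 / (r + 1) - 2 * ln (r + 1) + ln (r^2 + 3) + 3 * (r - 1) / (r^2 + 3)"

definition wG2 :: "real \<Rightarrow> real \<Rightarrow> real" where
  "wG2 b r = ln (r^2 + 3) / 6 - ln r / 12 - ln 4 / 6
     + b^2 / (1 + b) * (ln (r + 1) - 11 / 12 * ln r - ln (r^2 + 3) / 6 - ln 2 + ln 4 / 6)"

text \<open>The part of the constant order that is free of z. At p = 0 its logarithms cancel those
  of \<open>logsum\<close>, and only \<open>wG2\<close> remains, see \<open>lnk_0\<close>.\<close>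

definition wK2 :: "real \<Rightarrow> real \<Rightarrow> real" where
  "wK2 b m = - ln (m + 1) - ln 2 / 2 - b * (ln (m + 1) + ln (m + rho m)) + wG2 b (rho m)"

text \<open>The factor 2 m (m - 1)^2 / (m + 1) is the value of the leading order from
  \<open>wkb_order0\<close>; the subtracted \<beta> / (m^2 - 1) is the N^2 part of the derivative of
  the normalising power.\<close>

lemma DERIV_wS0:
  assumes "m > 1"
  shows "(wS0 \<beta> has_real_derivative (2 * \<beta> * (2 * m - 1) / (m - 1)) * (2 * m * (m - 1)^2 / (m + 1)) / (m^2 - 1)^2 - \<beta> / (m^2 - 1)) (at m)"
proof -
  have nz: "m + 1 \<noteq> 0" "m - 1 \<noteq> 0" using assms by auto
  have w: "((\<lambda>m. (m - 1) / (m + 1)) has_real_derivative 2 / (m + 1)^2) (at m)"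
    using nz by (auto intro!: derivative_eq_intros simp: power2_eq_square)
  have "((\<lambda>m. \<beta> * (2 * ((m - 1) / (m + 1)) + 3 / 4 * ((m - 1) / (m + 1))^2)) has_real_derivative
     \<beta> * (2 * (2 / (m + 1)^2) + 3 / 4 * (of_nat 2 * ((2 / (m + 1)^2) * ((m - 1) / (m + 1)) ^ (2 - Suc 0))))) (at m)"
    by (intro DERIV_cmult DERIV_add DERIV_power w)
  moreover have "\<beta> * (2 * (2 / (m + 1)^2) + 3 / 4 * (of_nat 2 * ((2 / (m + 1)^2) * ((m - 1) / (m + 1)) ^ (2 - Suc 0))))
     = (2 * \<beta> * (2 * m - 1) / (m - 1)) * (2 * m * (m - 1)^2 / (m + 1)) / (m^2 - 1)^2 - \<beta> / (m^2 - 1)"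
  proof -
    have e: "m^2 - 1 = (m - 1) * (m + 1)" by (simp add: power2_eq_square algebra_simps)
    \<comment> \<open>With the two inverses as symbols subject to \<open>pm\<close>, the identity of
      rational functions becomes one of polynomials modulo these relations.\<close>
    define P where "P = 1 / (m + 1)"
    define M where "M = 1 / (m - 1)"
    have pm: "P * (m + 1) = 1" "M * (m - 1) = 1" using nz unfolding P_def M_def by auto
    have "\<beta> * (2 * (2 * P^2) + 3 / 4 * (2 * (2 * P^2 * ((m - 1) * P)))) = 2 * \<beta> * (2 * m - 1) * M * (2 * m * (m - 1)^2 * P) * (M^2 * P^2) - \<beta> * (M * P)"
    proof -
      have "\<beta> * (2 * (2 * P^2) + 3 / 4 * (2 * (2 * P^2 * ((m - 1) * P)))) = \<beta> * P ^ 3 * (4 * (m + 1) + 3 * (m - 1))"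
        using pm(1) by algebra
      moreover have "2 * \<beta> * (2 * m - 1) * M * (2 * m * (m - 1)^2 * P) * (M^2 * P^2) - \<beta> * (M * P) = \<beta> * M * P ^ 3 * (4 * m * (2 * m - 1) - (m + 1)^2)"
        using pm by algebra
      moreover have "4 * m * (2 * m - 1) - (m + 1)^2 = (m - 1) * (7 * m + 1)" by (simp add: power2_eq_square algebra_simps)
      ultimately show ?thesis using pm(2) by algebra
    qed
    then show ?thesis unfolding e P_def M_def by (simp add: power_mult_distrib power_one_over divide_simps)
  qed
  ultimately show ?thesis unfolding wS0_def[abs_def] by (simp only:)
qed

lemma DERIV_wg1:
  assumes "m > 1"
  shows "((\<lambda>m. wg1 (rho m)) has_real_derivative (- 4 * (rho m)^2 + 24 * rho m + 12) / ((rho m + 1)^2 * ((rho m)^2 + 3)^2)) (at m)"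
proof -
  define r where "r = rho m"
  have r: "r > 1" unfolding r_def using assms by (rule rho_gt1)
  have s: "r^2 + 3 > 0" by (simp add: add_nonneg_pos)
  have "(wg1 has_real_derivative (1 / (r + 1)^2 - 2 / (r + 1) + 2 * r / (r^2 + 3) + (3 * (r^2 + 3) - 3 * (r - 1) * (2 * r)) / (r^2 + 3)^2)) (at r)"
  proof -
    have nz: "r + 1 > 0" "r^2 + 3 > 0" using r s by auto
    have a: "((\<lambda>r. r + 1) has_real_derivative 1) (at r)" "((\<lambda>r. r\<^sup>2 + 3) has_real_derivative 2 * r) (at r)"
      "((\<lambda>r. 3 * (r - 1)) has_real_derivative 3) (at r)"
      by (auto intro!: derivative_eq_intros)
    have "((\<lambda>r. 1 / 2 - 1 / (r + 1) - 2 * ln (r + 1) + ln (r^2 + 3) + 3 * (r - 1) / (r^2 + 3)) has_real_derivative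
      0 - (0 * (r + 1) - 1 * 1) / ((r + 1) * (r + 1)) - 2 * (1 / (r + 1) * 1) + 1 / (r^2 + 3) * (2 * r)
       + (3 * (r^2 + 3) - 3 * (r - 1) * (2 * r)) / ((r^2 + 3) * (r^2 + 3))) (at r)"
      using nz by (intro DERIV_add DERIV_diff DERIV_divide DERIV_const DERIV_cmult DERIV_chain2[OF DERIV_ln_divide] a) auto
    then show ?thesis unfolding wg1_def[abs_def] by (rule DERIV_cong) (simp add: power2_eq_square)
  qed
  moreover have "1 / (r + 1)^2 - 2 / (r + 1) + 2 * r / (r^2 + 3) + (3 * (r^2 + 3) - 3 * (r - 1) * (2 * r)) / (r^2 + 3)^2
     = r * ((- 4 * r^2 + 24 * r + 12) / ((r + 1)^2 * (r^2 + 3)^2))"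
  proof -
    define s where "s = r^2 + 3"
    have nz: "r + 1 \<noteq> 0" "s \<noteq> 0" using r s unfolding s_def by auto
    have "1 / (r + 1)^2 - 2 / (r + 1) + 2 * r / s + (3 * s - 3 * (r - 1) * (2 * r)) / s^2
      = (s^2 - 2 * (r + 1) * s^2 + 2 * r * s * (r + 1)^2 + (3 * s - 3 * (r - 1) * (2 * r)) * (r + 1)^2) / ((r + 1)^2 * s^2)"
      using nz by (simp add: divide_simps power2_eq_square) (simp add: algebra_simps)
    also have "s^2 - 2 * (r + 1) * s^2 + 2 * r * s * (r + 1)^2 + (3 * s - 3 * (r - 1) * (2 * r)) * (r + 1)^2 = r * (- 4 * r^2 + 24 * r + 12)"
      unfolding s_def by algebra
    finally show ?thesis unfolding s_def by simp
  qed
  ultimately have "(wg1 has_real_derivative r * ((- 4 * r^2 + 24 * r + 12) / ((r + 1)^2 * (r^2 + 3)^2))) (at (rho m))" unfolding r_def by simp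
  from DERIV_chain2[OF this DERIV_rho[of m]] assms r show ?thesis unfolding r_def by simp
qed

lemma has_derivative_transform_gt1:
  fixes f g :: "real \<Rightarrow> real"
  assumes "(g has_real_derivative d) (at m)" "m > 1" "\<And>m. m > 1 \<Longrightarrow> g m = f m"
  shows "(f has_real_derivative d) (at m)"
  using has_field_derivative_transform_within_open[OF assms(1), of "{1<..}" f] assms(2,3) by auto

text \<open>Since m^2 - z and z - 1 are the multiples x and 1 - x of m^2 - 1, the quotient
  simplifies to \<open>?g\<close>, in which only one term keeps the denominator m^2 - 1.\<close>

lemma DERIV_Psi_zz:
  assumes x: "0 \<le> x" "x \<le> 1" and m: "m > 1"
  shows "((\<lambda>m. Psi m (zz x m) / (m^2 - 1)) has_real_derivative
    (m - sqrt (zz x m)) * (3 * m - 2 - sqrt (zz x m)) / (m^2 - 1)^2) (at m)"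
proof -
  let ?g = "\<lambda>m. x * (ln (sqrt (zz x m) + m) + ln (m + 1) + 1 / 2) + (m - 2) * (m - sqrt (zz x m)) / (m^2 - 1)
     + 2 * (1 - x) * ln (sqrt (zz x m) + 1) - 2 * ln (m + 1)"
  define n where "n = sqrt (zz x m)"
  define e where "e = m^2 - 1"
  define d where "d = m * (1 - x) / n"
  have n: "n \<ge> 1" "n^2 = zz x m" using zz_ge1(1)[OF x, of m] m unfolding n_def by auto
  have e: "e > 0" unfolding e_def using m by simp
  have pos: "sqrt (zz x m) + m > 0" "m + 1 > 0" "sqrt (zz x m) + 1 > 0" "m^2 - 1 \<noteq> 0"
    using n(1) m e unfolding n_def e_def by linarith+
  have dn: "((\<lambda>m. sqrt (zz x m)) has_real_derivative d) (at m)"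
    unfolding d_def n_def using x m by (intro DERIV_sqrt_zz) auto
  have dm: "((\<lambda>m. m) has_real_derivative 1) (at m)" "((\<lambda>m. m + 1) has_real_derivative 1) (at m)" "((\<lambda>m. m\<^sup>2 - 1) has_real_derivative 2 * m) (at m)"
     "((\<lambda>m. m - 2) has_real_derivative 1) (at m)"
    by (auto intro!: derivative_eq_intros)
  have dn1: "((\<lambda>m. sqrt (zz x m) + 1) has_real_derivative d) (at m)" using DERIV_add[OF dn DERIV_const[of 1]] by simp
  have "(?g has_real_derivative x * (1 / (n + m) * (d + 1) + 1 / (m + 1) * 1 + 0)
     + ((1 * (m - n) + (1 - d) * (m - 2)) * e - ((m - 2) * (m - n)) * (2 * m)) / (e * e)
     + 2 * (1 - x) * (1 / (n + 1) * d) - 2 * (1 / (m + 1) * 1)) (at m)"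
    unfolding n_def e_def
    by (intro DERIV_add DERIV_diff DERIV_divide DERIV_mult DERIV_const DERIV_cmult DERIV_chain2[OF DERIV_ln_divide] dm dn dn1 pos)
  moreover have "x * (1 / (n + m) * (d + 1) + 1 / (m + 1) * 1 + 0)
     + ((1 * (m - n) + (1 - d) * (m - 2)) * e - ((m - 2) * (m - n)) * (2 * m)) / (e * e)
     + 2 * (1 - x) * (1 / (n + 1) * d) - 2 * (1 / (m + 1) * 1) = (m - n) * (3 * m - 2 - n) / e^2"
  proof -
    have xe: "x = (m^2 - n^2) / e" "1 - x = (n^2 - 1) / e" using e n(2) unfolding e_def zz_def by (simp_all add: field_simps)
    have 1: "x / (n + m) = (m - n) / e" "(1 - x) / (n + 1) = (n - 1) / e"
    proof -
      have "m^2 - n^2 = (m - n) * (n + m)" "n^2 - 1 = (n - 1) * (n + 1)" by (simp_all add: power2_eq_square algebra_simps)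
      with n m have "(m^2 - n^2) / e / (n + m) = (m - n) / e" "(n^2 - 1) / e / (n + 1) = (n - 1) / e" by simp_all
      then show "x / (n + m) = (m - n) / e" "(1 - x) / (n + 1) = (n - 1) / e" by (simp_all only: xe(1)[symmetric] xe(2)[symmetric])
    qed
    have "(m - 1) * (m + 1) = e" unfolding e_def by (simp add: power2_eq_square algebra_simps)
    then have 2: "1 / (m + 1) = (m - 1) / e" using m e by (auto simp: frac_eq_eq)
    have 3: "d * n * e = m * (n^2 - 1)" unfolding d_def using xe(2) n e by simp
    have "x * (1 / (n + m) * (d + 1) + 1 / (m + 1) * 1 + 0) + ((1 * (m - n) + (1 - d) * (m - 2)) * e - ((m - 2) * (m - n)) * (2 * m)) / (e * e)
       + 2 * (1 - x) * (1 / (n + 1) * d) - 2 * (1 / (m + 1) * 1)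
      = x / (n + m) * (d + 1) + x * (1 / (m + 1)) + ((1 * (m - n) + (1 - d) * (m - 2)) * e - ((m - 2) * (m - n)) * (2 * m)) / (e * e)
       + 2 * ((1 - x) / (n + 1)) * d - 2 * (1 / (m + 1))"
    proof -
      have "x * (1 / A * (d + 1) + 1 / B * 1 + 0) + Y + 2 * y * (1 / C * d) - 2 * (1 / B * 1) = x / A * (d + 1) + x * (1 / B) + Y + 2 * (y / C) * d - 2 * (1 / B)"
        for x y d A B C Y :: real by (simp add: algebra_simps)
      then show ?thesis by blast
    qed
    also have "\<dots> = (m - n) / e * (d + 1) + (m^2 - n^2) / e * ((m - 1) / e) + ((1 * (m - n) + (1 - d) * (m - 2)) * e - ((m - 2) * (m - n)) * (2 * m)) / (e * e)
       + 2 * ((n - 1) / e) * d - 2 * ((m - 1) / e)"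
      unfolding 1 2 by (simp only: xe(1))
    also have "\<dots> = ((m - n) * (d + 1) * e + (m^2 - n^2) * (m - 1) + ((1 * (m - n) + (1 - d) * (m - 2)) * e - ((m - 2) * (m - n)) * (2 * m))
       + 2 * (n - 1) * d * e - 2 * (m - 1) * e) / e^2"
    proof -
      have "A / e * q + B / e * (C / e) + D / (e * e) + 2 * (E / e) * d - 2 * (G / e) = (A * q * e + B * C + D + 2 * E * d * e - 2 * G * e) / e^2"
        if "e > 0" for A B C D E G q d e :: real using that by (simp add: field_simps power2_eq_square)
      from this[OF e] show ?thesis by blast
    qed
    also have "(m - n) * (d + 1) * e + (m^2 - n^2) * (m - 1) + ((1 * (m - n) + (1 - d) * (m - 2)) * e - ((m - 2) * (m - n)) * (2 * m))
       + 2 * (n - 1) * d * e - 2 * (m - 1) * e = (m - n) * (3 * m - 2 - n)"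
      using 3 unfolding e_def by algebra
    finally show ?thesis .
  qed
  ultimately have "(?g has_real_derivative (m - n) * (3 * m - 2 - n) / e^2) (at m)" by (simp only:)
  then show ?thesis unfolding n_def e_def
  proof (rule has_derivative_transform_gt1[OF _ m])
    fix m :: real assume m: "m > 1"
    have e: "m^2 - 1 \<noteq> 0" using m by (simp add: power2_eq_1_iff)
    have z: "m^2 - zz x m = (m^2 - 1) * x" "zz x m - 1 = (m^2 - 1) * (1 - x)" unfolding zz_def by (simp_all add: algebra_simps)
    show "?g m = Psi m (zz x m) / (m^2 - 1)"
    proof -
      have "x * A + B / e + 2 * y * C - 2 * D = (e * x * A + B + 2 * (e * y) * C - 2 * e * D) / e" if "e \<noteq> 0" for A B C D x y e :: real
        using that by (simp add: field_simps)
      from this[OF e] show ?thesis unfolding Psi_def z by blast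
    qed
  qed
qed

lemma DERIV_wG2:
  assumes "r > 0"
  shows "(wG2 b has_real_derivative (r / (3 * (r^2 + 3)) - 1 / (12 * r)
     + b^2 / (1 + b) * (1 / (r + 1) - 11 / (12 * r) - r / (3 * (r^2 + 3))))) (at r)"
proof -
  have s: "r^2 + 3 > 0" by (simp add: add_nonneg_pos)
  have d: "((\<lambda>r. r\<^sup>2 + 3) has_real_derivative 2 * r) (at r)" "((\<lambda>r. r + 1) has_real_derivative 1) (at r)"
    by (auto intro!: derivative_eq_intros)
  have "((\<lambda>r. ln (r^2 + 3) / 6 - ln r / 12 - ln 4 / 6
     + b^2 / (1 + b) * (ln (r + 1) - 11 / 12 * ln r - ln (r^2 + 3) / 6 - ln 2 + ln 4 / 6)) has_real_derivative
     (1 / (r^2 + 3) * (2 * r)) / 6 - (1 / r) / 12 - 0 + b^2 / (1 + b) * (1 / (r + 1) * 1 - 11 / 12 * (1 / r) - (1 / (r^2 + 3) * (2 * r)) / 6 - 0 + 0)) (at r)"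
    using assms s by (intro DERIV_add DERIV_diff DERIV_cdivide DERIV_const DERIV_cmult DERIV_chain2[OF DERIV_ln_divide] DERIV_ln_divide d) auto
  then show ?thesis unfolding wG2_def[abs_def]
  proof (rule DERIV_cong)
    have q: "(1 / S * (2 * r)) / 6 = r / (3 * S)" for S by simp
    show "(1 / (r^2 + 3) * (2 * r)) / 6 - (1 / r) / 12 - 0 + b^2 / (1 + b) * (1 / (r + 1) * 1 - 11 / 12 * (1 / r) - (1 / (r^2 + 3) * (2 * r)) / 6 - 0 + 0)
      = r / (3 * (r^2 + 3)) - 1 / (12 * r) + b^2 / (1 + b) * (1 / (r + 1) - 11 / (12 * r) - r / (3 * (r^2 + 3)))"
      unfolding q by (simp add: mult.commute)
  qed
qed

text \<open>The constant order, differentiated at fixed p / N. The group with \<open>s1\<close> on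
  the right of \<open>wkb_order2\<close> is the chain rule through z, because dz/dm = 2 m (1 - x) =
  2 m (n^2 - 1) / (m^2 - 1); the other groups are the explicit m-derivatives of the logarithms, of
  \<open>wK2\<close> and of \<open>wG2\<close>.\<close>

lemma DERIV_wS2:
  assumes x: "0 \<le> x" "x \<le> 1" and m: "m > 1" and b: "1 + b > 0"
  shows "((\<lambda>m. logsum (cs b) m (rho m) (zz x m) + wK2 b m) has_real_derivative
    (2 * (rho m)^2 / ((1 + b) * (m - 1))) * br2 b m (zz x m)) (at m)"
proof -
  define n where "n = sqrt (zz x m)"
  define r where "r = rho m"
  define d where "d = m * (1 - x) / n"
  have n: "n \<ge> 1" "n^2 = zz x m" using zz_ge1(1)[OF x, of m] m unfolding n_def by auto
  have r: "r > 1" "m = (r^2 + 1) / 2" unfolding r_def using rho_gt1[OF m] m by (auto simp: rho_def)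
  have dn: "((\<lambda>m. sqrt (zz x m)) has_real_derivative d) (at m)"
    unfolding d_def n_def using x m by (intro DERIV_sqrt_zz) auto
  have dr: "(rho has_real_derivative 1 / r) (at m)" unfolding r_def using m by (intro DERIV_rho) auto
  have pos: "sqrt (zz x m) + 0 > 0" "sqrt (zz x m) + m > 0" "sqrt (zz x m) + 1 > 0" "sqrt (zz x m) + rho m > 0" "m + rho m > 0" "m + 1 > 0" "rho m > 0"
    using n(1) r(1) m unfolding n_def r_def by linarith+
  note D0 = dn dr DERIV_ident
  have dd: "((\<lambda>m. sqrt (zz x m) + 0) has_real_derivative d + 0) (at m)"
    "((\<lambda>m. sqrt (zz x m) + m) has_real_derivative d + 1) (at m)" "((\<lambda>m. sqrt (zz x m) + 1) has_real_derivative d + 0) (at m)"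
    "((\<lambda>m. sqrt (zz x m) + rho m) has_real_derivative d + 1 / r) (at m)" "((\<lambda>m. m + rho m) has_real_derivative 1 + 1 / r) (at m)"
    "((\<lambda>m. m + 1) has_real_derivative 1 + 0) (at m)"
    by (intro DERIV_add D0 DERIV_const)+
  have "((\<lambda>m. (- 1 / 2 * ln (sqrt (zz x m) + 0) + 1 / 2 * ln (sqrt (zz x m) + m) + (1 + b) * ln (sqrt (zz x m) + 1) + b * ln (sqrt (zz x m) + rho m))
     + (- ln (m + 1) - ln 2 / 2 - b * (ln (m + 1) + ln (m + rho m)) + wG2 b (rho m))) has_real_derivative
     (- 1 / 2 * (1 / (n + 0) * (d + 0)) + 1 / 2 * (1 / (n + m) * (d + 1)) + (1 + b) * (1 / (n + 1) * (d + 0)) + b * (1 / (n + r) * (d + 1 / r)))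
     + (- (1 / (m + 1) * (1 + 0)) - 0 - b * (1 / (m + 1) * (1 + 0) + 1 / (m + r) * (1 + 1 / r))
      + (r / (3 * (r^2 + 3)) - 1 / (12 * r) + b^2 / (1 + b) * (1 / (r + 1) - 11 / (12 * r) - r / (3 * (r^2 + 3)))) * (1 / r))) (at m)"
    unfolding n_def r_def
    by (intro dd[unfolded r_def] dr[unfolded r_def] pos DERIV_add DERIV_diff DERIV_minus DERIV_const DERIV_cmult DERIV_chain2[OF DERIV_ln_divide] DERIV_chain2[OF DERIV_wG2])
  moreover have "(- 1 / 2 * (1 / (n + 0) * (d + 0)) + 1 / 2 * (1 / (n + m) * (d + 1)) + (1 + b) * (1 / (n + 1) * (d + 0)) + b * (1 / (n + r) * (d + 1 / r)))
     + (- (1 / (m + 1) * (1 + 0)) - 0 - b * (1 / (m + 1) * (1 + 0) + 1 / (m + r) * (1 + 1 / r))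
      + (r / (3 * (r^2 + 3)) - 1 / (12 * r) + b^2 / (1 + b) * (1 / (r + 1) - 11 / (12 * r) - r / (3 * (r^2 + 3)))) * (1 / r))
     = 2 * r^2 / ((1 + b) * (m - 1)) * br2 b m (zz x m)"
  proof -
    let ?z = "zz x m"
    define s1 where "s1 = Qf 0 ?z * (- Qf 0 ?z / 2 + Qf m ?z / 2 + (1 + b) * Qf 1 ?z + b * Qf r ?z) / 2"
    have q: "Qf 0 ?z = 1 / n" "Qf 1 ?z = 1 / (n + 1)" "Qf m ?z = 1 / (n + m)" "Qf r ?z = 1 / (n + r)"
      unfolding Qf_def n_def by simp_all
    have f1: "ld1 cphi m (rho m) ?z = Qf 0 ?z * (Qf m ?z - 2 * Qf 1 ?z) / 2"
      unfolding ld1_def qsum_def cphi_def by simp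
    have f2: "ld2 cphi m (rho m) ?z = - (Qf 0 ?z ^ 3 * (Qf m ?z - 2 * Qf 1 ?z) / 4) - (Qf 0 ?z)^2 * ((Qf m ?z)^2 - 2 * (Qf 1 ?z)^2) / 4"
      unfolding ld2_def qsum_def cphi_def by simp
    have s1': "ld1 (cs b) m (rho m) ?z = s1" unfolding s1_def ld1_def qsum_def cs_def r_def by simp
    have s2: "ld2 (cs b) m (rho m) ?z = - (Qf 0 ?z ^ 3 * (- Qf 0 ?z / 2 + Qf m ?z / 2 + (1 + b) * Qf 1 ?z + b * Qf r ?z) / 4)
       - (Qf 0 ?z)\<^sup>2 * (- (Qf 0 ?z)\<^sup>2 / 2 + (Qf m ?z)^2 / 2 + (1 + b) * (Qf 1 ?z)^2 + b * (Qf r ?z)^2) / 4"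
      unfolding ld2_def qsum_def cs_def r_def by simp
    have v1: "sig1 b m ?z = Qf 0 ?z * (- (5 * m / (16 * r^2)) * Qf 0 ?z ^ 4
        + ((b + 1) * r ^ 3 + b * r^2 + (b + 2) * r + b) / (4 * r ^ 3) * Qf 0 ?z ^ 3
        - ((12 * b^2 + 24 * b + 11) * r ^ 6 + 24 * (b^2 + b) * r ^ 5 + (36 * b^2 + 72 * b + 45) * r ^ 4 + (48 * b^2 + 72 * b) * r ^ 3
        + (36 * b^2 + 48 * b + 45) * r^2 + (24 * b^2 + 48 * b) * r + 12 * b^2 + 3) / (192 * r ^ 4 * m) * (Qf 0 ?z)^2
        + (3 * b^2 + 3 * b + 1) / 12 * (Qf 1 ?z)^2 + (r^2 - 1)^2 * (b - b^2) / (16 * r ^ 3) * Qf r ?z ^ 3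
        - ((3 * b^2 + b) * r ^ 4 - 4 * b^2 * r ^ 3 - 2 * (b^2 + b) * r^2 + (4 * b^2 + 8 * b) * r + 7 * b^2 + b) / (32 * r ^ 4) * (Qf r ?z)^2
        - 1 / (24 * m) * (Qf m ?z)^2) / 2"
      unfolding sig1_def k4_def k3_def k2_def d2_def e3_def e2_def g2_def r_def ..
    note W = wkb_order2[OF n(1) r(1) b r(2) q f1 f2 s1_def s2 refl refl refl v1]
    \<comment> \<open>The contributions of the neighbours p - 1 and p + 1 are regrouped into their
      parts even and odd under reversing the step, which is the form treated by
      \<open>wkb_order2\<close>.\<close>
    have comb: "P * (- f2 / 6 + s2 / 2 + v1 + (- f1 / 2 + s1)^2 / 2) + Q * (f2 / 6 + s2 / 2 - v1 + (- f1 / 2 - s1)^2 / 2) + T * (- f1 / 2 - s1)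
       = (P + Q) * (s2 / 2 + (f1^2 / 4 + s1^2) / 2) + (Q - P) * (f2 / 6 - v1 + f1 * s1 / 2) + T * (- f1 / 2 - s1)"
      for P Q T f1 f2 s1 s2 v1 :: real by (simp add: field_simps power2_eq_square)
    have "br2 b m (zz x m) = wP m (zz x m) * (- ld2 cphi m (rho m) (zz x m) / 6 + ld2 (cs b) m (rho m) (zz x m) / 2 + sig1 b m (zz x m) + (- ld1 cphi m (rho m) (zz x m) / 2 + s1)^2 / 2)
      + wQ m (zz x m) * (ld2 cphi m (rho m) (zz x m) / 6 + ld2 (cs b) m (rho m) (zz x m) / 2 - sig1 b m (zz x m) + (- ld1 cphi m (rho m) (zz x m) / 2 - s1)^2 / 2)
      + wT b m (zz x m) * (- ld1 cphi m (rho m) (zz x m) / 2 - s1)"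
      unfolding br2_def lr2_def lr1_def s1' by simp
    note this[unfolded comb wP_def wQ_def wT_def n_def[symmetric]]
    from arg_cong[OF this, of "\<lambda>y. 2 * r^2 / ((1 + b) * (m - 1)) * y", unfolded W]
    have "2 * r^2 / ((1 + b) * (m - 1)) * br2 b m (zz x m) = s1 * (2 * m * (n^2 - 1)) / (m^2 - 1) + (- 1 / (m + 1) + 1 / (2 * (n + m)))
       + b * (- 1 / (m + 1) + 1 / (r * (n + r)) - 2 / (r * (r + 1)))
       + (1 / (3 * (r^2 + 3)) - 1 / (12 * r^2) + b^2 / (1 + b) * (1 / (r * (r + 1)) - 11 / (12 * r^2) - 1 / (3 * (r^2 + 3))))" .
    moreover have "s1 * (2 * m * (n^2 - 1)) / (m^2 - 1) = d * (- 1 / 2 * (1 / n) + 1 / 2 * (1 / (n + m)) + (1 + b) * (1 / (n + 1)) + b * (1 / (n + r)))"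
    proof -
      have e: "m^2 - 1 \<noteq> 0" using m by (simp add: power2_eq_1_iff)
      have "(1 - x) * (m^2 - 1) = n^2 - 1" unfolding n(2) zz_def by (simp add: algebra_simps)
      then have "1 - x = (n^2 - 1) / (m^2 - 1)" using e by (simp add: eq_divide_eq)
      then have "d = 1 / n * (m * (n^2 - 1) / (m^2 - 1))" unfolding d_def by simp
      moreover have "Q * S / 2 * (2 * m * Y) / E = Q * (m * Y / E) * S" for Q S Y E :: real by simp
      moreover have "- A / 2 + B / 2 + C + D = - 1 / 2 * A + 1 / 2 * B + C + D" for A B C D :: real by simp
      ultimately show ?thesis unfolding s1_def q by (simp only:)
    qed
    moreover have "1 / (m + r) * (1 + 1 / r) = 2 / (r * (r + 1))"
    proof -
      have "m + r = (r + 1)^2 / 2" unfolding r(2) by (simp add: power2_eq_square field_simps)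
      moreover have "1 + 1 / r = (r + 1) / r" using r(1) by (simp add: add_divide_distrib)
      moreover have "1 / (q^2 / 2) * (q / r) = 2 / (r * q)" if "q > 0" for q using that r(1) by (simp add: power2_eq_square)
      from this[of "r + 1"] r(1) have "1 / ((r + 1)^2 / 2) * ((r + 1) / r) = 2 / (r * (r + 1))" by linarith
      ultimately show ?thesis by (simp only:)
    qed
    moreover have "(r / (3 * (r^2 + 3)) - 1 / (12 * r) + b^2 / (1 + b) * (1 / (r + 1) - 11 / (12 * r) - r / (3 * (r^2 + 3)))) * (1 / r)
      = 1 / (3 * (r^2 + 3)) - 1 / (12 * r^2) + b^2 / (1 + b) * (1 / (r * (r + 1)) - 11 / (12 * r^2) - 1 / (3 * (r^2 + 3)))"
    proof -
      have "r \<noteq> 0" using r(1) by simp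
      then have "r / (3 * (r^2 + 3)) * (1 / r) = 1 / (3 * (r^2 + 3))" "1 / (12 * r) * (1 / r) = 1 / (12 * r^2)"
        "1 / (r + 1) * (1 / r) = 1 / (r * (r + 1))" "11 / (12 * r) * (1 / r) = 11 / (12 * r^2)" by (simp_all add: power2_eq_square mult.commute)
      then show ?thesis by (simp only: left_diff_distrib distrib_right mult.assoc)
    qed
    moreover have "1 / (r * (n + r)) = 1 / (n + r) * (1 / r)" "1 / (2 * (n + m)) = 1 / 2 * (1 / (n + m))" "- 1 / (m + 1) = - (1 / (m + 1))" "n + 0 = n" by simp_all
    moreover have "(- 1 / 2 * (A * (d + 0)) + 1 / 2 * (B * (d + 1)) + (1 + b) * (C * (d + 0)) + b * (D * (d + R))) + (- (M * (1 + 0)) - 0 - b * (M * (1 + 0) + U) + G)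
      = d * (- 1 / 2 * A + 1 / 2 * B + (1 + b) * C + b * D) + (- M + 1 / 2 * B) + b * (- M + D * R - U) + G" for A B C D M U G R by (simp add: algebra_simps)
    ultimately show ?thesis by (simp only:)
  qed
  ultimately show ?thesis unfolding logsum_def cs_def wK2_def r_def by (simp only: prod.case)
qed

lemma wkb_order1':
  assumes x: "0 \<le> x" "x \<le> 1" and m: "m > 1" and b: "1 + b > 0"
  shows "(2 * (rho m)^2 / ((1 + b) * (m - 1))) * br1 b m (zz x m) =
     b / (1 + b) * ((m^2 - 1) * ((- 4 * (rho m)^2 + 24 * rho m + 12) / ((rho m + 1)^2 * ((rho m)^2 + 3)^2)) + 1)
       + (m - sqrt (zz x m)) * (3 * m - 2 - sqrt (zz x m)) / (m^2 - 1) + x"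
proof -
  define n where "n = sqrt (zz x m)"
  define r where "r = rho m"
  have n: "n \<ge> 1" "n^2 = zz x m" using zz_ge1(1)[OF x, of m] m unfolding n_def by auto
  have r: "r > 1" "m = (r^2 + 1) / 2" unfolding r_def using rho_gt1[OF m] m by (auto simp: rho_def)
  define s1 where "s1 = Qf 0 (zz x m) * (- Qf 0 (zz x m) / 2 + Qf m (zz x m) / 2 + (1 + b) * Qf 1 (zz x m) + b * Qf r (zz x m)) / 2"
  have q: "Qf 0 (zz x m) = 1 / n" "Qf 1 (zz x m) = 1 / (n + 1)" "Qf m (zz x m) = 1 / (n + m)" "Qf r (zz x m) = 1 / (n + r)"
    unfolding Qf_def n_def by simp_all
  have f1: "ld1 cphi m (rho m) (zz x m) = Qf 0 (zz x m) * (Qf m (zz x m) - 2 * Qf 1 (zz x m)) / 2"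
    unfolding ld1_def qsum_def cphi_def by simp
  have s1': "ld1 (cs b) m (rho m) (zz x m) = s1" unfolding s1_def ld1_def qsum_def cs_def r_def by simp
  note W = wkb_order1[OF n(1) r(1) b r(2) q f1 s1_def]
  have e: "m^2 - 1 \<noteq> 0" using m by (simp add: power2_eq_1_iff)
  have "(m^2 - n^2) / (m^2 - 1) = x" unfolding n(2) zz_def using e by (simp add: field_simps)
  note W[unfolded this]
  moreover have "br1 b m (zz x m) = wP m (zz x m) * (- ld1 cphi m (rho m) (zz x m) / 2 + s1) + wQ m (zz x m) * (- ld1 cphi m (rho m) (zz x m) / 2 - s1) + wT b m (zz x m)"
    unfolding br1_def lr1_def s1' by simp
  ultimately show ?thesis unfolding wP_def wQ_def wT_def n_def[symmetric] r_def[symmetric] by simp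
qed

lemma wkb_order0':
  assumes "0 \<le> x" "x \<le> 1" "m > 1"
  shows "br0 b m (zz x m) = 2 * m * (m - 1)^2 / (m + 1)"
proof -
  have "(sqrt (zz x m))^2 = zz x m" using zz_ge1(1)[of x m] assms by simp
  then show ?thesis using wkb_order0[OF assms(3), of "sqrt (zz x m)"] unfolding br0_def wP_def wQ_def by simp
qed

text \<open>The WKB approximation, to relative order \<open>1 / N\<close>, of the logarithm of the normalised moment \<open>kap\<close>
  below; \<open>sqrt (zz (p / N) m)\<close> is the variable \<open>n\<close> of the orders computed above.\<close>

definition lnk :: "real \<Rightarrow> nat \<Rightarrow> real \<Rightarrow> real \<Rightarrow> real" where
  "lnk \<beta> N p m = (real N)^2 * wS0 \<beta> m + real N * ((1 - \<beta>) * wg1 (rho m) + Psi m (zz (p / real N) m) / (m^2 - 1))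
     + (logsum (cs (1 / \<beta> - 1)) m (rho m) (zz (p / real N) m) + wK2 (1 / \<beta> - 1) m)
     + (m^2 - 1) * sig (1 / \<beta> - 1) m (zz (p / real N) m) / real N"

text \<open>The argument p of \<open>lnk\<close> is real, so both neighbours are covered by one
  formula. A step in p is a step of - sg h in z with h = (m^2 - 1) / N; the terms free of p cancel,
  and N / (m^2 - 1) becomes 1 / h.\<close>

lemma lnk_shift:
  assumes "m > 1" "N > 0"
  shows "lnk \<beta> N (p + sg) m - lnk \<beta> N p m = lratio (1 / \<beta> - 1) sg m (zz (p / real N) m) ((m^2 - 1) / real N)"
proof -
  have e: "m^2 - 1 \<noteq> 0" using assms by (simp add: power2_eq_1_iff)
  have "zz ((p + sg) / real N) m = zz (p / real N) m - sg * ((m^2 - 1) / real N)"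
    unfolding zz_def using assms by (simp add: field_simps)
  moreover have "M^2 * W + M * (g + A / E) + (B + K) + E * S / M - (M^2 * W + M * (g + A' / E) + (B' + K) + E * S' / M)
    = (A - A') / (E / M) + (B - B') + E / M * (S - S')" if "E \<noteq> 0" "M > 0" for M W g A A' B B' E K S S' :: real
    using that by (simp add: field_simps)
  note this[OF e, of "real N"]
  ultimately show ?thesis unfolding lnk_def lratio_def using assms by simp
qed

text \<open>The prefactor of \<open>bracket\<close> is of order 1 / h^2. Its expansion terms of
  order 0, 1 and 2 are matched exactly by the three order equations, and the remainder h^3 leaves
  O(h) = O(1 / N).\<close>

lemma lnk_deriv:
  assumes "\<beta> > 0"
  shows "\<exists>C\<ge>0. \<forall>N p m. N > 0 \<and> p \<le> N \<and> 1 < m \<and> m \<le> m1 \<longrightarrow>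
    (\<exists>d. (lnk \<beta> N (real p) has_real_derivative d) (at m) \<and>
       \<bar>d - ((2 * \<beta> * (2 * m - 1) / (m - 1)) / ((m^2 - 1) / real N)^2 * bracket (1 / \<beta> - 1) m (zz (real p / real N) m) ((m^2 - 1) / real N)
          - ((real N)^2 * \<beta> + real N * (1 - \<beta>) + real p) / (m^2 - 1))\<bar> \<le> C / real N)"
proof -
  define b where "b = 1 / \<beta> - 1"
  have b: "1 + b > 0" "1 / (1 + b) = \<beta>" "b / (1 + b) = 1 - \<beta>" unfolding b_def using assms by (auto simp: field_simps)
  obtain C where C: "C \<ge> 0" "\<And>m z h. 0 < h \<and> h \<le> m1^2 \<and> wdom m1 m z \<and> (z = m^2 \<or> wdom m1 m (z + h)) \<and> (z = 1 \<or> wdom m1 m (z - h)) \<Longrightarrow>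
    \<bar>bracket b m z h - (br0 b m z + h * br1 b m z + h^2 * br2 b m z)\<bar> \<le> C * h ^ 3" using bracket_expansion[of m1 b] by auto
  obtain s' D where s': "\<forall>x m. 0 \<le> x \<and> x \<le> 1 \<and> 1 < m \<and> m \<le> m1 \<longrightarrow>
     ((\<lambda>m. (m^2 - 1) * sig b m (zz x m)) has_real_derivative s' x m) (at m) \<and> \<bar>(m^2 - 1) * sig b m (zz x m)\<bar> \<le> D \<and> \<bar>s' x m\<bar> \<le> D"
    using ND_sig[of m1 b] unfolding ND_def by blast
  define E where "E = C * (2 * \<beta> * (2 * \<bar>m1\<bar>) * (\<bar>m1\<bar> + 1)) + \<bar>D\<bar>"
  show ?thesis
  proof (rule exI[of _ E], intro conjI allI impI)
    show "E \<ge> 0" unfolding E_def using C assms by (intro add_nonneg_nonneg mult_nonneg_nonneg) auto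
    fix N p :: nat and m :: real assume h: "N > 0 \<and> p \<le> N \<and> 1 < m \<and> m \<le> m1"
    then have m: "m > 1" "m \<le> m1" and N: "N > 0" "p \<le> N" by auto
    define M where "M = real N"
    define x where "x = real p / M"
    define e where "e = m^2 - 1"
    define F where "F = 2 * \<beta> * (2 * m - 1) / (m - 1)"
    define z where "z = zz x m"
    define g' where "g' = (- 4 * (rho m)^2 + 24 * rho m + 12) / ((rho m + 1)^2 * ((rho m)^2 + 3)^2)"
    define P' where "P' = (m - sqrt (zz x m)) * (3 * m - 2 - sqrt (zz x m))"
    have M: "M > 0" "real p \<le> M" unfolding M_def using N by auto
    have x: "0 \<le> x" "x \<le> 1" "M * x = real p" using M unfolding x_def M_def by auto
    have e: "e > 0" unfolding e_def using m by simp
    have e': "e = (m - 1) * (m + 1)" unfolding e_def by (simp add: power2_eq_square algebra_simps)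
    have F: "2 * (rho m)^2 / ((1 + b) * (m - 1)) = F"
    proof -
      have "2 * (rho m)^2 / ((1 + b) * (m - 1)) = 2 * (1 / (1 + b)) * (rho m)^2 / (m - 1)" by simp
      also have "\<dots> = F" unfolding b F_def rho_def using m by simp
      finally show ?thesis .
    qed
    have wd: "wdom m1 m z" unfolding wdom_def z_def using zz_ge1[OF x(1,2), of m] m by auto
    have zp: "z + e / M = zz ((real p - 1) / M) m" "z - e / M = zz ((real p + 1) / M) m"
      unfolding z_def zz_def e_def x_def using M unfolding M_def by (simp_all add: field_simps)
    have c1: "z = m^2 \<or> wdom m1 m (z + e / M)"
    proof (cases "p = 0")
      case True then show ?thesis by (simp add: z_def zz_def x_def)
    next
      case False
      then have "0 \<le> (real p - 1) / M" "(real p - 1) / M \<le> 1" using M by auto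
      from zz_ge1[OF this, of m] m show ?thesis unfolding zp wdom_def by auto
    qed
    have c2: "z = 1 \<or> wdom m1 m (z - e / M)"
    proof (cases "p = N")
      case True then show ?thesis using N by (simp add: z_def zz_def x_def M_def)
    next
      case False
      then have "0 \<le> (real p + 1) / M" "(real p + 1) / M \<le> 1" using N unfolding M_def by auto
      from zz_ge1[OF this, of m] m show ?thesis unfolding zp wdom_def by auto
    qed
    have "e / M \<le> e / 1" using M e N unfolding M_def by (intro divide_left_mono) auto
    also have "\<dots> \<le> m^2" unfolding e_def by simp
    also have "\<dots> \<le> m1^2" using m by (intro power_mono) auto
    finally have hb: "e / M \<le> m1^2" .
    have Br: "\<bar>bracket b m z (e / M) - (br0 b m z + e / M * br1 b m z + (e / M)^2 * br2 b m z)\<bar> \<le> C * (e / M) ^ 3"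
      using e M hb wd c1 c2 by (intro C(2)) auto
    have s: "((\<lambda>m. (m^2 - 1) * sig b m (zz x m)) has_real_derivative s' x m) (at m)" "\<bar>s' x m\<bar> \<le> D" using s' x m by auto
    let ?d = "M^2 * (F * br0 b m z / e^2 - \<beta> / e) + M * ((1 - \<beta>) * g' + P' / e^2) + F * br2 b m z + s' x m / M"
    have dA: "(lnk \<beta> N (real p) has_real_derivative ?d) (at m)"
    proof -
      have 0: "(wS0 \<beta> has_real_derivative (F * br0 b m z / e^2 - \<beta> / e)) (at m)"
        using DERIV_wS0[OF m(1), of \<beta>] unfolding z_def wkb_order0'[OF x(1,2) m(1)] F_def e_def .
      show ?thesis unfolding lnk_def[abs_def] b_def[symmetric] M_def[symmetric] x_def[symmetric]
        using DERIV_wg1[OF m(1)] DERIV_Psi_zz[OF x(1,2) m(1)] DERIV_wS2[OF x(1,2) m(1) b(1)] s(1) unfolding F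
        unfolding z_def[symmetric] e_def g'_def P'_def
        by (intro DERIV_add DERIV_cmult DERIV_cdivide 0[unfolded e_def]) (simp_all add: z_def)
    qed
    have dB: "\<bar>?d - (F / (e / M)^2 * bracket b m z (e / M) - (M^2 * \<beta> + M * (1 - \<beta>) + real p) / e)\<bar> \<le> E / M"
    proof -
      have o1: "F * br1 b m z = (1 - \<beta>) * (e * g' + 1) + P' / e + x"
        using wkb_order1'[OF x(1,2) m(1) b(1)] unfolding F b e_def g'_def P'_def z_def .
      have "F / (e / M)^2 * (br0 b m z + e / M * br1 b m z + (e / M)^2 * br2 b m z) = M^2 * (F * br0 b m z / e^2) + M * (F * br1 b m z) / e + F * br2 b m z"
        using e M by (simp add: field_simps power2_eq_square)
      also have "M * (F * br1 b m z) / e = M * ((1 - \<beta>) * g' + P' / e^2) + (M * (1 - \<beta>) + real p) / e"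
        unfolding o1 x(3)[symmetric] using e by (simp add: field_simps power2_eq_square)
      finally have "?d - (F / (e / M)^2 * bracket b m z (e / M) - (M^2 * \<beta> + M * (1 - \<beta>) + real p) / e)
        = F / (e / M)^2 * ((br0 b m z + e / M * br1 b m z + (e / M)^2 * br2 b m z) - bracket b m z (e / M)) + s' x m / M"
        by (simp add: right_diff_distrib add_divide_distrib)
      also have "\<bar>\<dots>\<bar> \<le> \<bar>F / (e / M)^2\<bar> * (C * (e / M) ^ 3) + \<bar>D\<bar> / M"
      proof -
        have "\<bar>s' x m / M\<bar> \<le> \<bar>D\<bar> / M" unfolding abs_divide using s(2) M by (auto intro!: divide_right_mono)
        moreover have "\<bar>F / (e / M)^2 * ((br0 b m z + e / M * br1 b m z + (e / M)^2 * br2 b m z) - bracket b m z (e / M))\<bar> \<le> \<bar>F / (e / M)^2\<bar> * (C * (e / M) ^ 3)"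
          unfolding abs_mult using Br by (intro mult_left_mono) (simp_all only: abs_minus_commute abs_ge_zero)
        ultimately show ?thesis by linarith
      qed
      \<comment> \<open>F has a pole at m = 1, but the remainder supplies a factor h that contains
        m^2 - 1: the product F (m^2 - 1) = 2 \<beta> (2 m - 1) (m + 1) stays bounded.\<close>
      also have "\<bar>F / (e / M)^2\<bar> * (C * (e / M) ^ 3) = C * (2 * \<beta> * (2 * m - 1) * (m + 1)) / M"
      proof -
        have F0: "F \<ge> 0" unfolding F_def using assms m by auto
        have "F / h^2 * (C * h ^ 3) = C * (F * h)" if "h > 0" for h using that by (simp add: power2_eq_square power3_eq_cube)
        from this[of "e / M"] have "F / (e / M)^2 * (C * (e / M) ^ 3) = C * (F * e) / M" using e M by simp
        moreover have "F * e = 2 * \<beta> * (2 * m - 1) * (m + 1)" unfolding F_def e' using m by simp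
        ultimately show ?thesis using F0 by simp
      qed
      also have "\<dots> \<le> C * (2 * \<beta> * (2 * \<bar>m1\<bar>) * (\<bar>m1\<bar> + 1)) / M"
        using m M assms C(1) by (intro divide_right_mono mult_left_mono mult_mono) auto
      finally show ?thesis unfolding E_def by (simp add: add_divide_distrib)
    qed
    show "\<exists>d. (lnk \<beta> N (real p) has_real_derivative d) (at m) \<and>
       \<bar>d - ((2 * \<beta> * (2 * m - 1) / (m - 1)) / ((m^2 - 1) / real N)^2 * bracket (1 / \<beta> - 1) m (zz (real p / real N) m) ((m^2 - 1) / real N)
          - ((real N)^2 * \<beta> + real N * (1 - \<beta>) + real p) / (m^2 - 1))\<bar> \<le> E / real N"
      unfolding F_def[symmetric] b_def[symmetric] M_def[symmetric] x_def[symmetric] z_def[symmetric] e_def[symmetric]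
      by (rule exI[of _ ?d], rule conjI[OF dA dB])
  qed
qed

text \<open>The speed of the Laplace variable along m: with l = \<open>cl c m\<close> and u =
  \<open>cu m\<close>, this is - (dl/dm) / (c u), see \<open>kap_deriv\<close>.\<close>

definition cK :: "real \<Rightarrow> real" where "cK m = 2 * (2 * m - 1) / ((m - 1) * (m^2 - 1))"
definition cw :: "real \<Rightarrow> real" where "cw m = (m - 1) / (m + 1)"

text \<open>Translation from z and h back to p and N. For b = 1 / \<beta> - 1 the factor z - 1 + h b
  is h / \<beta> times the factor 1 + \<beta> (N - 1 - p) of Aomoto's recursion, so the coefficients
  of \<open>kap_deriv\<close> appear.\<close>

lemma bracket_as_recurrence:
  assumes m: "m > 1" and N: "N > 0" and b: "\<beta> > 0"
  shows "(2 * \<beta> * (2 * m - 1) / (m - 1)) / ((m^2 - 1) / real N)^2 * bracket (1 / \<beta> - 1) m (zz (p / real N) m) ((m^2 - 1) / real N)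
     = cK m * (p * (real N * \<beta>) * exp (lnk \<beta> N (p - 1) m - lnk \<beta> N p m)
         + cw m * (real N - p) * (1 + \<beta> * (real N - 1 - p)) * exp (lnk \<beta> N (p + 1) m - lnk \<beta> N p m)
         - p * (real N * \<beta>) * (1 - 3 * cw m))"
proof -
  define M where "M = real N"
  define e where "e = m^2 - 1"
  define x where "x = p / M"
  define h where "h = e / M"
  have M: "M > 0" unfolding M_def using N by simp
  have e: "e > 0" unfolding e_def using m by simp
  have e': "e = (m - 1) * (m + 1)" unfolding e_def by (simp add: power2_eq_square algebra_simps)
  have h: "h > 0" unfolding h_def using e M by simp
  have z: "m^2 - zz (p / real N) m = h * p" "zz (p / real N) m - 1 = h * (M - p)"
    unfolding zz_def h_def e_def M_def using N by (simp_all add: field_simps)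
  have z3: "h * (M - p) + h * (1 / \<beta> - 1) = h / \<beta> * (1 + \<beta> * (M - 1 - p))" using b by (simp add: field_simps)
  have s: "lratio (1 / \<beta> - 1) (-1) m (zz (p / real N) m) h = lnk \<beta> N (p - 1) m - lnk \<beta> N p m"
    "lratio (1 / \<beta> - 1) 1 m (zz (p / real N) m) h = lnk \<beta> N (p + 1) m - lnk \<beta> N p m"
    using lnk_shift[OF m N, of \<beta> p "-1"] lnk_shift[OF m N, of \<beta> p 1] unfolding h_def e_def M_def by simp_all
  define X where "X = exp (lnk \<beta> N (p - 1) m - lnk \<beta> N p m)"
  define Y where "Y = exp (lnk \<beta> N (p + 1) m - lnk \<beta> N p m)"
  have m1: "m - 1 \<noteq> 0" "m + 1 \<noteq> 0" using m by auto
  have w: "1 - 3 * cw m = (4 - 2 * m) / (m + 1)" unfolding cw_def using m1 by (simp add: field_simps)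
  have K: "(2 * \<beta> * (2 * m - 1) / (m - 1)) / h = cK m * (M * \<beta>)"
    unfolding cK_def e_def[symmetric] h_def using m1 e M by simp
  have K2: "(2 * \<beta> * (2 * m - 1) / (m - 1)) / (\<beta> * (m + 1)^2) = cK m * cw m"
  proof -
    have "(2 * \<beta> * A / U) / (\<beta> * V^2) = 2 * A / (U * (U * V)) * (U / V)" if "U \<noteq> 0" "V \<noteq> 0" for A U V :: real
      using that b by (simp add: power2_eq_square)
    from this[OF m1] show ?thesis unfolding cK_def e_def[symmetric] cw_def e' .
  qed
  have br: "bracket (1 / \<beta> - 1) m (zz (p / real N) m) h = h * p * X + h * (M - p) * (h / \<beta> * (1 + \<beta> * (M - 1 - p))) / (m + 1)^2 * Y - h * p * (1 - 3 * cw m)"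
    unfolding bracket_def s X_def Y_def z w z3 by simp
  have "(2 * \<beta> * (2 * m - 1) / (m - 1)) / h^2 * bracket (1 / \<beta> - 1) m (zz (p / real N) m) h
     = (2 * \<beta> * (2 * m - 1) / (m - 1)) / h * (p * X) + (2 * \<beta> * (2 * m - 1) / (m - 1)) / (\<beta> * (m + 1)^2) * ((M - p) * (1 + \<beta> * (M - 1 - p)) * Y)
       - (2 * \<beta> * (2 * m - 1) / (m - 1)) / h * (p * (1 - 3 * cw m))"
  proof -
    have gen: "A / h^2 * (h * p * X + h * (M - p) * (h / \<beta> * V) / G * Y - h * p * W) = A / h * (p * X) + A / (\<beta> * G) * ((M - p) * V * Y) - A / h * (p * W)"
      for A V G W
    proof -
      have 1: "A / h^2 * (h * S * T) = A / h * (S * T)" for S T using h by (simp add: power2_eq_square)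
      have 2: "A / h^2 * (h * S * (h / \<beta> * V) / G * Y) = A / (\<beta> * G) * (S * V * Y)" for S using h by (simp add: power2_eq_square)
      show ?thesis unfolding right_diff_distrib[of "A / h^2"] distrib_left[of "A / h^2"] 1 2 ..
    qed
    show ?thesis unfolding br by (rule gen)
  qed
  also have "\<dots> = cK m * (p * (M * \<beta>) * X + cw m * (M - p) * (1 + \<beta> * (M - 1 - p)) * Y - p * (M * \<beta>) * (1 - 3 * cw m))"
    unfolding K K2
  proof -
    have "k * c * (p * X) + k * w * (S * V * Y) - k * c * (p * W) = k * (p * c * X + w * S * V * Y - p * c * W)" for k c w S V W
      by (simp add: algebra_simps)
    then show "cK m * (M * \<beta>) * (p * X) + cK m * cw m * ((M - p) * (1 + \<beta> * (M - 1 - p)) * Y) - cK m * (M * \<beta>) * (p * (1 - 3 * cw m))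
      = cK m * (p * (M * \<beta>) * X + cw m * (M - p) * (1 + \<beta> * (M - 1 - p)) * Y - p * (M * \<beta>) * (1 - 3 * cw m))" .
  qed
  finally show ?thesis unfolding X_def Y_def h_def e_def M_def .
qed

text \<open>If some value were positive, consider the maximum over all p and over [a, m0], with a so
  close to 1 that it is not attained at a. There the derivative in m is negative, so q is larger
  slightly to the left, a contradiction.\<close>

lemma max_principle:
  fixes q q' :: "nat \<Rightarrow> real \<Rightarrow> real"
  assumes d: "\<And>p m. p \<le> N \<Longrightarrow> 1 < m \<Longrightarrow> m \<le> m1 \<Longrightarrow> (q p has_real_derivative q' p m) (at m)"
    and neg: "\<And>p m. p \<le> N \<Longrightarrow> 1 < m \<Longrightarrow> m \<le> m1 \<Longrightarrow> (\<And>j. j \<le> N \<Longrightarrow> q j m \<le> q p m) \<Longrightarrow> q' p m < 0"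
    and lim: "\<And>p. p \<le> N \<Longrightarrow> (q p \<longlongrightarrow> 0) (at_right 1)"
    and p0: "p0 \<le> N" "1 < m0" "m0 \<le> m1"
  shows "q p0 m0 \<le> 0"
proof (rule ccontr)
  assume "\<not> q p0 m0 \<le> 0"
  then have pos: "q p0 m0 > 0" by simp
  have "\<forall>p\<in>{..N}. eventually (\<lambda>m. q p m < q p0 m0) (at_right 1)"
    using lim pos by (auto intro: order_tendstoD(2))
  then have "eventually (\<lambda>m. \<forall>p\<in>{..N}. q p m < q p0 m0) (at_right 1)"
    by (subst eventually_ball_finite_distrib) auto
  then obtain a0 where a0: "a0 > 1" "\<And>m p. 1 < m \<Longrightarrow> m < a0 \<Longrightarrow> p \<le> N \<Longrightarrow> q p m < q p0 m0"
    unfolding eventually_at_right_field by auto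
  define a where "a = (1 + min a0 m0) / 2"
  have a: "1 < a" "a < a0" "a < m0" using a0 p0 unfolding a_def by (auto simp: min_def)
  have cont: "continuous_on {a..m0} (q p)" if "p \<le> N" for p
  proof (rule continuous_at_imp_continuous_on, rule ballI)
    fix x assume "x \<in> {a..m0}"
    then show "isCont (q p) x" using DERIV_isCont[OF d[OF that, of x]] a p0 by auto
  qed
  have "\<exists>m\<in>{a..m0}. \<forall>y\<in>{a..m0}. q p y \<le> q p m" if "p \<le> N" for p
    using continuous_attains_sup[OF compact_Icc _ cont[OF that]] a by auto
  then obtain M where M: "\<And>p. p \<le> N \<Longrightarrow> M p \<in> {a..m0}" "\<And>p y. p \<le> N \<Longrightarrow> y \<in> {a..m0} \<Longrightarrow> q p y \<le> q p (M p)"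
    by metis
  have fin: "finite ((\<lambda>p. q p (M p)) ` {..N})" "(\<lambda>p. q p (M p)) ` {..N} \<noteq> {}" by auto
  obtain ps where ps: "ps \<in> {..N}" "Max ((\<lambda>p. q p (M p)) ` {..N}) = q ps (M ps)" using Max_in[OF fin] by (elim imageE) (rule that)
  then have ps2: "q p (M p) \<le> q ps (M ps)" if "p \<in> {..N}" for p
    using Max_ge[OF fin(1), of "q p (M p)"] that by auto
  define ms where "ms = M ps"
  have ms: "ms \<in> {a..m0}" "\<And>p y. p \<le> N \<Longrightarrow> y \<in> {a..m0} \<Longrightarrow> q p y \<le> q ps ms"

  proof -
    show "ms \<in> {a..m0}" unfolding ms_def using M(1) ps by auto
    fix p y assume "p \<le> N" "y \<in> {a..m0}"
    then show "q p y \<le> q ps ms" unfolding ms_def using M(2)[of p y] ps2[of p] by auto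
  qed
  have "q p0 m0 \<le> q ps ms" using ms(2)[OF p0(1)] a by auto
  then have "ms > a" using a0(2)[of a ps] a ps ms(1) by (cases "ms = a") auto
  have "q' ps ms < 0" using ms ps a p0 by (intro neg) auto
  moreover have "(q ps has_real_derivative q' ps ms) (at ms)" using ms ps a p0 by (intro d) auto
  ultimately obtain dd where dd: "dd > 0" "\<And>h. h > 0 \<Longrightarrow> h < dd \<Longrightarrow> q ps (ms - h) > q ps ms"
    using DERIV_neg_dec_left by blast
  define hh where "hh = min (dd / 2) (ms - a)"
  have "hh > 0" "hh < dd" "ms - hh \<in> {a..m0}" using dd \<open>ms > a\<close> ms(1) unfolding hh_def by (auto simp: min_def)
  from dd(2)[OF this(1,2)] ms(2)[OF _ this(3), of ps] ps show False by auto
qed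

text \<open>The off-diagonal coefficients of the system are nonnegative, so that the largest ratio of the solution to
  the approximation cannot grow faster than the residual permits; the same holds for the smallest one.\<close>

lemma comparison_principle:
  fixes \<kappa> L A B D :: "nat \<Rightarrow> real \<Rightarrow> real"
  assumes \<kappa>: "\<And>p m. p \<le> N \<Longrightarrow> 1 < m \<Longrightarrow> m \<le> m1 \<Longrightarrow>
      (\<kappa> p has_real_derivative A p m * \<kappa> (p - 1) m + B p m * \<kappa> (Suc p) m + D p m * \<kappa> p m) (at m)"
    and pos: "\<And>p m. p \<le> N \<Longrightarrow> 1 < m \<Longrightarrow> m \<le> m1 \<Longrightarrow> \<kappa> p m > 0"
    and AB: "\<And>p m. p \<le> N \<Longrightarrow> 1 < m \<Longrightarrow> m \<le> m1 \<Longrightarrow> A p m \<ge> 0"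
      "\<And>p m. p \<le> N \<Longrightarrow> 1 < m \<Longrightarrow> m \<le> m1 \<Longrightarrow> B p m \<ge> 0 \<and> (p = N \<longrightarrow> B p m = 0)"
    and L: "\<And>p m. p \<le> N \<Longrightarrow> 1 < m \<Longrightarrow> m \<le> m1 \<Longrightarrow> \<exists>d. (L p has_real_derivative d) (at m) \<and>
      \<bar>d - (A p m * exp (L (p - 1) m - L p m) + B p m * exp (L (Suc p) m - L p m) + D p m)\<bar> \<le> \<delta>"
    and lim: "\<And>p. p \<le> N \<Longrightarrow> ((\<lambda>m. ln (\<kappa> p m) - L p m) \<longlongrightarrow> 0) (at_right 1)"
    and p0: "p0 \<le> N" "1 < m0" "m0 \<le> m1"
  shows "\<bar>ln (\<kappa> p0 m0) - L p0 m0\<bar> \<le> \<delta> * (m0 - 1)"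
proof -
  obtain L' where L': "\<And>p m. p \<le> N \<Longrightarrow> 1 < m \<Longrightarrow> m \<le> m1 \<Longrightarrow> (L p has_real_derivative L' p m) (at m) \<and>
      \<bar>L' p m - (A p m * exp (L (p - 1) m - L p m) + B p m * exp (L (Suc p) m - L p m) + D p m)\<bar> \<le> \<delta>"
    using L by metis
  define r where "r p m = ln (\<kappa> p m) - L p m" for p m
  define r' where "r' p m = (A p m * \<kappa> (p - 1) m + B p m * \<kappa> (Suc p) m + D p m * \<kappa> p m) / \<kappa> p m - L' p m" for p m
  have r: "(r p has_real_derivative r' p m) (at m)" if "p \<le> N" "1 < m" "m \<le> m1" for p m
  proof -
    have "((\<lambda>m. ln (\<kappa> p m) - L p m) has_real_derivative
       1 / \<kappa> p m * (A p m * \<kappa> (p - 1) m + B p m * \<kappa> (Suc p) m + D p m * \<kappa> p m) - L' p m) (at m)"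
      using L'[OF that] pos[OF that] \<kappa>[OF that] by (intro DERIV_diff DERIV_chain2[OF DERIV_ln_divide]) auto
    then show ?thesis unfolding r_def[abs_def] r'_def by simp
  qed
  \<comment> \<open>The diagonal coefficient cancels, and every off-diagonal term has the sign of a
    difference of neighbouring values of \<open>r\<close>. At a maximum over p both are nonpositive,
    at a minimum nonnegative, and only the residual is left.\<close>
  have split: "r' p m = A p m * exp (L (p - 1) m - L p m) * (exp (r (p - 1) m - r p m) - 1)
      + B p m * exp (L (Suc p) m - L p m) * (exp (r (Suc p) m - r p m) - 1)
      - (L' p m - (A p m * exp (L (p - 1) m - L p m) + B p m * exp (L (Suc p) m - L p m) + D p m))"
    if pm: "p \<le> N" "1 < m" "m \<le> m1" for p m
  proof -
    have k: "\<kappa> j m / \<kappa> p m = exp (L j m - L p m) * exp (r j m - r p m)" if "j \<le> N" for j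
    proof -
      have "exp (L j m - L p m) * exp (r j m - r p m) = exp (ln (\<kappa> j m) - ln (\<kappa> p m))"
        unfolding exp_add[symmetric] r_def by simp
      also have "\<dots> = \<kappa> j m / \<kappa> p m" using pos[OF that pm(2,3)] pos[OF pm] by (simp add: exp_diff)
      finally show ?thesis by simp
    qed
    have kp: "\<kappa> p m > 0" using pos[OF pm] .
    have 1: "A p m * (\<kappa> (p - 1) m / \<kappa> p m) = A p m * (exp (L (p - 1) m - L p m) * exp (r (p - 1) m - r p m))"
      using k[of "p - 1"] pm by simp
    have 2: "B p m * (\<kappa> (Suc p) m / \<kappa> p m) = B p m * (exp (L (Suc p) m - L p m) * exp (r (Suc p) m - r p m))"
    proof (cases "p = N")
      case True then show ?thesis using AB(2)[OF pm] by simp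
    next
      case False then show ?thesis using k[of "Suc p"] pm by simp
    qed
    have "r' p m = A p m * (\<kappa> (p - 1) m / \<kappa> p m) + B p m * (\<kappa> (Suc p) m / \<kappa> p m) + D p m - L' p m"
      unfolding r'_def using kp by (simp add: add_divide_distrib)
    then show ?thesis unfolding 1 2 by (simp add: algebra_simps)
  qed
  have res: "\<bar>L' p m - (A p m * exp (L (p - 1) m - L p m) + B p m * exp (L (Suc p) m - L p m) + D p m)\<bar> \<le> \<delta>"
    if "p \<le> N" "1 < m" "m \<le> m1" for p m using L'[OF that] by simp
  have lim': "((\<lambda>m. c * r p m - \<epsilon> * (m - 1)) \<longlongrightarrow> 0) (at_right 1)" if "p \<le> N" for p c \<epsilon>
  proof -
    have "((\<lambda>m. c * r p m - \<epsilon> * (m - 1)) \<longlongrightarrow> c * 0 - \<epsilon> * (1 - 1)) (at_right 1)"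
      unfolding r_def by (intro tendsto_intros lim that)
    then show ?thesis by simp
  qed
  \<comment> \<open>The strict inequality \<epsilon> > \<delta> supplies the strict sign demanded by
    \<open>max_principle\<close>; \<delta> itself is recovered at the end by density.\<close>
  have up: "r p0 m0 - \<epsilon> * (m0 - 1) \<le> 0" "- r p0 m0 - \<epsilon> * (m0 - 1) \<le> 0" if e: "\<epsilon> > \<delta>" for \<epsilon>
  proof -
    have "1 * r p0 m0 - \<epsilon> * (m0 - 1) \<le> 0"
    proof (rule max_principle[where q = "\<lambda>p m. 1 * r p m - \<epsilon> * (m - 1)" and q' = "\<lambda>p m. r' p m - \<epsilon>" and N = N, OF _ _ lim' p0])
      fix p m assume h: "p \<le> N" "(1::real) < m" "m \<le> m1"
      show "((\<lambda>m. 1 * r p m - \<epsilon> * (m - 1)) has_real_derivative r' p m - \<epsilon>) (at m)"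
        using r[OF h] by (auto intro!: derivative_eq_intros)
      assume mx: "\<And>j. j \<le> N \<Longrightarrow> 1 * r j m - \<epsilon> * (m - 1) \<le> 1 * r p m - \<epsilon> * (m - 1)"
      have a: "A p m * exp (L (p - 1) m - L p m) * (exp (r (p - 1) m - r p m) - 1) \<le> 0"
        using mx[of "p - 1"] h AB(1)[OF h] by (intro mult_nonneg_nonpos) auto
      have b: "B p m * exp (L (Suc p) m - L p m) * (exp (r (Suc p) m - r p m) - 1) \<le> 0"
        using mx[of "Suc p"] h AB(2)[OF h] by (cases "p = N") (auto intro!: mult_nonneg_nonpos)
      from split[OF h] a b res[OF h] e show "r' p m - \<epsilon> < 0" by linarith
    qed
    then show "r p0 m0 - \<epsilon> * (m0 - 1) \<le> 0" by simp
    have "(-1) * r p0 m0 - \<epsilon> * (m0 - 1) \<le> 0"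
    proof (rule max_principle[where q = "\<lambda>p m. (-1) * r p m - \<epsilon> * (m - 1)" and q' = "\<lambda>p m. - r' p m - \<epsilon>" and N = N, OF _ _ lim' p0])
      fix p m assume h: "p \<le> N" "(1::real) < m" "m \<le> m1"
      show "((\<lambda>m. (-1) * r p m - \<epsilon> * (m - 1)) has_real_derivative - r' p m - \<epsilon>) (at m)"
        using r[OF h] by (auto intro!: derivative_eq_intros)
      assume mx: "\<And>j. j \<le> N \<Longrightarrow> (-1) * r j m - \<epsilon> * (m - 1) \<le> (-1) * r p m - \<epsilon> * (m - 1)"
      have a: "A p m * exp (L (p - 1) m - L p m) * (exp (r (p - 1) m - r p m) - 1) \<ge> 0"
        using mx[of "p - 1"] h AB(1)[OF h] by (intro mult_nonneg_nonneg) auto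
      have b: "B p m * exp (L (Suc p) m - L p m) * (exp (r (Suc p) m - r p m) - 1) \<ge> 0"
        using mx[of "Suc p"] h AB(2)[OF h] by (cases "p = N") (auto intro!: mult_nonneg_nonneg)
      from split[OF h] a b res[OF h] e show "- r' p m - \<epsilon> < 0" by linarith
    qed
    then show "- r p0 m0 - \<epsilon> * (m0 - 1) \<le> 0" by simp
  qed
  have "\<bar>r p0 m0\<bar> \<le> \<epsilon> * (m0 - 1)" if "\<epsilon> > \<delta>" for \<epsilon> using up[OF that] by linarith
  then have "\<bar>r p0 m0\<bar> / (m0 - 1) \<le> \<epsilon>" if "\<epsilon> > \<delta>" for \<epsilon> using that p0 by (simp add: pos_divide_le_eq)
  then have "\<bar>r p0 m0\<bar> / (m0 - 1) \<le> \<delta>" by (rule dense_ge)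
  then show ?thesis unfolding r_def using p0 by (simp add: pos_divide_le_eq)
qed

section \<open>Asymptotics of the Laplace moments\<close>

text \<open>The parameter \<open>m > 1\<close> is tied to the cut-off by \<open>a / sqrt t = 3 * u - 1 / u\<close>, \<open>u = cu m\<close>; the limit \<open>m \<rightarrow> 1\<close>
  is \<open>a \<rightarrow> - \<infinity>\<close>, where the moments become Laguerre integrals, and \<open>m \<rightarrow> \<infinity>\<close> is the edge \<open>a = 2 * sqrt t\<close>.\<close>

definition cu :: "real \<Rightarrow> real" where "cu m = sqrt (cw m)"
definition cl :: "real \<Rightarrow> real \<Rightarrow> real" where "cl c m = c * (1 / cu m - 3 * cu m)"

lemma cu:
  assumes "m > 1"
  shows "cw m > 0" "cu m > 0" "(cu m)^2 = cw m" "cu m < 1"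
proof -
  show w: "cw m > 0" unfolding cw_def using assms by simp
  then show "cu m > 0" "(cu m)^2 = cw m" unfolding cu_def by auto
  show "cu m < 1" unfolding cu_def cw_def using assms by (simp add: divide_less_eq)
qed

lemma DERIV_cu:
  assumes "m > 1"
  shows "(cu has_real_derivative cu m / (m^2 - 1)) (at m)"
proof -
  have w: "(cw has_real_derivative 2 / (m + 1)^2) (at m)"
    unfolding cw_def[abs_def] using assms by (auto intro!: derivative_eq_intros simp: power2_eq_square)
  have "(cu has_real_derivative inverse (sqrt (cw m)) / 2 * (2 / (m + 1)^2)) (at m)"
    unfolding cu_def[abs_def] by (rule DERIV_chain2[OF DERIV_real_sqrt[OF cu(1)[OF assms]] w])
  moreover have "inverse (sqrt (cw m)) / 2 * (2 / (m + 1)^2) = cu m / (m^2 - 1)"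
  proof -
    have e: "m^2 - 1 = (m - 1) * (m + 1)" by (simp add: power2_eq_square algebra_simps)
    have "inverse (cu m) = cu m / cw m" using cu[OF assms] by (simp add: power2_eq_square field_simps)
    also have "\<dots> = cu m * ((m + 1) / (m - 1))" unfolding cw_def by simp
    finally have "inverse (cu m) / 2 * (2 / (m + 1)^2) = cu m * ((m + 1) / (m - 1)) / 2 * (2 / (m + 1)^2)" by simp
    also have "\<dots> = cu m / (m^2 - 1)"
    proof -
      have "c * (V / U) / 2 * (2 / V^2) = c / (U * V)" if "V \<noteq> 0" for c U V :: real using that by (simp add: power2_eq_square)
      moreover have "m + 1 \<noteq> 0" using assms by simp
      ultimately show ?thesis unfolding e by blast
    qed
    finally show ?thesis unfolding cu_def .
  qed
  ultimately show ?thesis by simp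
qed

lemma DERIV_cl:
  assumes "m > 1"
  shows "(cl c has_real_derivative - (c * (1 / cu m + 3 * cu m) / (m^2 - 1))) (at m)"
proof -
  have u: "cu m \<noteq> 0" using cu(2)[OF assms] by simp
  have "((\<lambda>m. c * (1 / cu m - 3 * cu m)) has_real_derivative
    c * ((0 * cu m - 1 * (cu m / (m^2 - 1))) / (cu m * cu m) - 3 * (cu m / (m^2 - 1)))) (at m)"
    using u by (intro DERIV_cmult DERIV_diff DERIV_divide DERIV_const DERIV_cu assms) auto
  moreover have "c * ((0 * U - 1 * (U / E)) / (U * U) - 3 * (U / E)) = - (c * (1 / U + 3 * U) / E)" if "U \<noteq> 0" for U E :: real
  proof -
    have "(0 * U - 1 * (U / E)) / (U * U) = - (1 / U / E)" using that by simp
    then show ?thesis by (simp add: add_divide_distrib algebra_simps)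
  qed
  ultimately show ?thesis unfolding cl_def[abs_def] using u by simp
qed

definition lag_prod :: "real \<Rightarrow> nat \<Rightarrow> nat \<Rightarrow> real" where
  "lag_prod \<beta> N p = (\<Prod>j<p. 1 + \<beta> * real (N - 1 - j))"

text \<open>The exponent is \<open>N + p\<close> plus twice \<open>\<beta>\<close> times the number of pairs: the degree of homogeneity of the moment.\<close>

definition lag_deg :: "real \<Rightarrow> nat \<Rightarrow> nat \<Rightarrow> real" where
  "lag_deg \<beta> N p = real p + real N + \<beta> * real N * (real N - 1)"

text \<open>The normalising power uses c / \<open>cu m\<close> instead of l. Both are asymptotically
  equal as m tends to 1, but l = c (1 / u - 3 u) changes sign on the way to the edge, while c / u
  stays positive.\<close>

definition kap :: "real \<Rightarrow> nat \<Rightarrow> nat \<Rightarrow> real \<Rightarrow> real" where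
  "kap \<beta> N p m = mom \<beta> N (real N * \<beta>) (cl (real N * \<beta>) m) p * exp (lag_deg \<beta> N p * ln (real N * \<beta> / cu m))
     / (lag_prod \<beta> N p * laguerre \<beta> N 0)"

lemma lag_prod_pos: "\<beta> > 0 \<Longrightarrow> lag_prod \<beta> N p > 0"
  unfolding lag_prod_def by (intro prod_pos) (auto intro: add_pos_nonneg)

lemma kap_pos:
  assumes "\<beta> > 0" "N > 0" "p \<le> N"
  shows "kap \<beta> N p m > 0"
  unfolding kap_def using mom_pos[of \<beta> "real N * \<beta>" _ p N] lag_prod_pos[of \<beta> N p] laguerre_pos[of \<beta> N 0] assms by simp

text \<open>In \<open>mom_deriv\<close> the neighbours p - 1 and p + 1 have nonpositive
  coefficients. As l decreases in m, the chain rule reverses their sign, which makes the comparison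
  principle applicable.\<close>

lemma kap_deriv:
  assumes \<beta>: "\<beta> > 0" and N: "N > 0" and p: "p \<le> N" and m: "m > 1"
  shows "(kap \<beta> N p has_real_derivative
     (cK m * (real p * (real N * \<beta>))) * kap \<beta> N (p - 1) m
     + (cK m * (cw m * (real N - real p) * (1 + \<beta> * (real N - 1 - real p)))) * kap \<beta> N (Suc p) m
     + (- (cK m * (real p * (real N * \<beta>) * (1 - 3 * cw m))) - lag_deg \<beta> N p / (m^2 - 1)) * kap \<beta> N p m) (at m)"
proof -
  define c where "c = real N * \<beta>"
  define u where "u = cu m"
  define e where "e = m^2 - 1"
  define l where "l = cl c m"
  define M where "M p = mom \<beta> N c l p" for p
  define E where "E p = exp (lag_deg \<beta> N p * ln (c / u))" for p
  define Z where "Z p = lag_prod \<beta> N p" for p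
  define L where "L = laguerre \<beta> N 0"
  have c: "c > 0" unfolding c_def using \<beta> N by simp
  have u: "u > 0" "u^2 = cw m" unfolding u_def using cu[OF m] by auto
  have e: "e > 0" unfolding e_def using m by simp
  have Z: "Z p > 0" "L > 0" for p unfolding Z_def L_def using lag_prod_pos laguerre_pos \<beta> by auto
  have k: "kap \<beta> N q m = M q * E q / (Z q * L)" for q
    unfolding kap_def M_def E_def Z_def L_def c_def l_def u_def ..
  have d1: "((\<lambda>m. mom \<beta> N c (cl c m) p) has_real_derivative
      (- (real p * (1 + \<beta> * real (N - p)) * M (p - 1)) + real p * l * M p - c * real (N - p) * M (Suc p)) / c * (- (c * (1 / u + 3 * u) / e))) (at m)"
    unfolding M_def l_def u_def e_def by (rule DERIV_chain2[OF mom_deriv[OF \<beta> c p] DERIV_cl[OF m]])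
  have d2: "((\<lambda>m. exp (lag_deg \<beta> N p * ln (c / cu m))) has_real_derivative E p * (- (lag_deg \<beta> N p / e))) (at m)"
  proof -
    have "((\<lambda>m. ln c - ln (cu m)) has_real_derivative (0 - 1 / u * (u / e))) (at m)"
      unfolding u_def e_def using u u_def by (intro DERIV_diff DERIV_const DERIV_chain2[OF DERIV_ln_divide] DERIV_cu m) auto
    then have "((\<lambda>m. ln (c / cu m)) has_real_derivative (0 - 1 / u * (u / e))) (at m)"
    proof (rule has_derivative_transform_gt1[OF _ m])
      fix m :: real assume "m > 1"
      from cu(2)[OF this] c show "ln c - ln (cu m) = ln (c / cu m)" by (simp add: ln_div)
    qed
    moreover have "0 - 1 / u * (u / e) = - 1 / e" using u by simp
    ultimately have "((\<lambda>m. ln (c / cu m)) has_real_derivative - 1 / e) (at m)" by (simp only:)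
    from DERIV_chain2[OF DERIV_exp DERIV_cmult[OF this, of "lag_deg \<beta> N p"]]
    show ?thesis unfolding E_def u_def by simp
  qed
  have "(kap \<beta> N p has_real_derivative
     ((- (real p * (1 + \<beta> * real (N - p)) * M (p - 1)) + real p * l * M p - c * real (N - p) * M (Suc p)) / c * (- (c * (1 / u + 3 * u) / e)) * E p
      + E p * (- (lag_deg \<beta> N p / e)) * M p) / (Z p * L)) (at m)"
    using DERIV_cdivide[OF DERIV_mult[OF d1 d2], of "Z p * L"]
    unfolding kap_def[abs_def] c_def[symmetric] Z_def L_def M_def E_def l_def u_def by simp
  moreover have "((- (real p * (1 + \<beta> * real (N - p)) * M (p - 1)) + real p * l * M p - c * real (N - p) * M (Suc p)) / c * (- (c * (1 / u + 3 * u) / e)) * E p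
      + E p * (- (lag_deg \<beta> N p / e)) * M p) / (Z p * L)
    = cK m * (real p * c) * kap \<beta> N (p - 1) m + cK m * (cw m * (real N - real p) * (1 + \<beta> * (real N - 1 - real p))) * kap \<beta> N (Suc p) m
     + (- (cK m * (real p * c * (1 - 3 * cw m))) - lag_deg \<beta> N p / e) * kap \<beta> N p m"
  proof -
    have K: "(1 / u + 3 * u) / e = cK m * u"
    proof -
      have m0: "m - 1 \<noteq> 0" "m + 1 \<noteq> 0" using m by auto
      have "1 + 3 * cw m = (2 * (2 * m - 1)) / (m + 1)" unfolding cw_def using m0 by (simp add: field_simps)
      moreover have "1 / cw m = (m + 1) / (m - 1)" unfolding cw_def by simp
      ultimately have "(1 + 3 * cw m) * (1 / cw m) = 2 * (2 * m - 1) / (m - 1)" using m0 by simp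
      then have q: "(1 + 3 * cw m) / cw m / e = cK m" unfolding cK_def e_def by simp
      have "1 / u + 3 * u = (1 + 3 * u^2) / u^2 * u" using u(1) by (simp add: field_simps power2_eq_square)
      then have "(1 / u + 3 * u) / e = (1 + 3 * cw m) / cw m / e * u" unfolding u(2) by simp
      then show ?thesis unfolding q .
    qed
    have ul: "u * l = c * (1 - 3 * cw m)" unfolding l_def cl_def u(2)[symmetric] u_def[symmetric] using u(1) by (simp add: field_simps power2_eq_square)
    have Es: "E (Suc q) = E q * (c / u)" for q
    proof -
      have "lag_deg \<beta> N (Suc q) * ln (c / u) = lag_deg \<beta> N q * ln (c / u) + ln (c / u)" unfolding lag_deg_def by (simp add: algebra_simps)
      then show ?thesis unfolding E_def using c u by (simp add: exp_add)
    qed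
    have Zs: "Z (Suc q) = Z q * (1 + \<beta> * real (N - 1 - q))" for q unfolding Z_def lag_prod_def by simp
    have 1: "real p * (1 + \<beta> * real (N - p)) * M (p - 1) * u * E p / (Z p * L) = real p * c * kap \<beta> N (p - 1) m"
    proof (cases p)
      case (Suc q)
      have nz: "1 + \<beta> * real (N - 1 - q) > 0" using \<beta> by (intro add_pos_nonneg) auto
      have r: "N - p = N - 1 - q" using Suc by simp
      show ?thesis unfolding k unfolding r unfolding Suc Es Zs using nz u(1) Z(1)[of q] Z(2) by simp
    qed simp
    have 2: "real (N - p) * M (Suc p) * u * E p / (Z p * L) * c = cw m * (real N - real p) * (1 + \<beta> * (real N - 1 - real p)) * kap \<beta> N (Suc p) m"
    proof (cases "p = N")
      case False
      then have q: "real N - 1 - real p = real (N - 1 - p)" "real N - real p = real (N - p)" using p by auto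
      have nz: "1 + \<beta> * real (N - 1 - p) > 0" using \<beta> by (intro add_pos_nonneg) auto
      show ?thesis unfolding k Es Zs q u(2)[symmetric] using nz u(1) Z(1)[of p] Z(2) by (simp add: power2_eq_square)
    qed simp
    have 3: "real p * l * M p * u * E p / (Z p * L) = real p * c * (1 - 3 * cw m) * kap \<beta> N p m"
    proof -
      have "real p * l * M p * u * E p / (Z p * L) = real p * (u * l) * (M p * E p / (Z p * L))" by simp
      then show ?thesis unfolding ul k by simp
    qed
    have "((- A + B - c * C) / c * (- (c * X / e)) * Ep + Ep * (- (d / e)) * Mp) / ZL
       = X / e * (A * Ep / ZL) - X / e * (B * Ep / ZL) + X / e * (C * Ep / ZL * c) - d / e * (Mp * Ep / ZL)" for A B C X Ep d Mp ZL
    proof -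
      have "(- A + B - c * C) / c * (- (c * X / e)) = X / e * (A - B + C * c)"
      proof -
        have "S / c * (- (c * X / e)) = X / e * (- S)" for S using c by simp
        then show ?thesis by (simp only:) (simp add: mult.commute)
      qed
      then have "(- A + B - c * C) / c * (- (c * X / e)) * Ep + Ep * (- (d / e)) * Mp = X / e * (A * Ep) - X / e * (B * Ep) + X / e * (C * Ep * c) - d / e * (Mp * Ep)"
        by (simp only:) (simp only: algebra_simps)
      then show ?thesis by (simp only: add_divide_distrib diff_divide_distrib) (simp only: times_divide_eq_right times_divide_eq_left)
    qed
    note this[of "real p * (1 + \<beta> * real (N - p)) * M (p - 1)" "real p * l * M p" "real (N - p) * M (Suc p)" "1 / u + 3 * u" "E p" "lag_deg \<beta> N p" "M p" "Z p * L"]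
    also have "(1 / u + 3 * u) / e * (real p * (1 + \<beta> * real (N - p)) * M (p - 1) * E p / (Z p * L)) - (1 / u + 3 * u) / e * (real p * l * M p * E p / (Z p * L))
       + (1 / u + 3 * u) / e * (real (N - p) * M (Suc p) * E p / (Z p * L) * c) - lag_deg \<beta> N p / e * (M p * E p / (Z p * L))
      = cK m * (real p * (1 + \<beta> * real (N - p)) * M (p - 1) * u * E p / (Z p * L)) - cK m * (real p * l * M p * u * E p / (Z p * L))
       + cK m * (real (N - p) * M (Suc p) * u * E p / (Z p * L) * c) - lag_deg \<beta> N p / e * (M p * E p / (Z p * L))"
      unfolding K by (simp add: mult_ac)
    finally show ?thesis unfolding 1 2 3 k[symmetric] by (simp add: algebra_simps)
  qed
  ultimately show ?thesis unfolding c_def e_def by simp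
qed

text \<open>\<open>mom_laguerre_limit\<close> is normalised by a power of l and \<open>kap\<close>
  by the same power of c / u. The quotient of the bases is 1 - 3 \<open>cw m\<close>, which tends to
  1.\<close>

lemma kap_tendsto:
  assumes \<beta>: "\<beta> > 0" and N: "N > 0" and p: "p \<le> N"
  shows "(kap \<beta> N p \<longlongrightarrow> 1) (at_right 1)"
proof -
  define c where "c = real N * \<beta>"
  have c: "c > 0" unfolding c_def using \<beta> N by simp
  have Z: "lag_prod \<beta> N p > 0" "laguerre \<beta> N 0 > 0" using lag_prod_pos laguerre_pos \<beta> by auto
  have gt: "\<forall>\<^sub>F m::real in at_right 1. m > 1" by (simp add: eventually_at_right_less)
  have w0: "(cw \<longlongrightarrow> 0) (at_right 1)"
  proof -
    have "((\<lambda>m::real. (m - 1) / (m + 1)) \<longlongrightarrow> (1 - 1) / (1 + 1)) (at_right 1)" by (intro tendsto_intros) auto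
    then show ?thesis unfolding cw_def[abs_def] by simp
  qed
  have u0: "(cu \<longlongrightarrow> 0) (at_right 1)" using tendsto_real_sqrt[OF w0] unfolding cu_def[abs_def] by simp
  have fu: "filterlim cu (at_right 0) (at_right 1)"
    by (rule tendsto_imp_filterlim_at_right[OF u0 eventually_mono[OF gt cu(2)]])
  have l1: "filterlim (cl c) at_top (at_right 1)"
  proof -
    have "filterlim (\<lambda>m. inverse (cu m)) at_top (at_right 1)"
      by (rule filterlim_compose[OF filterlim_inverse_at_top_right fu])
    moreover have "((\<lambda>m. - (3 * cu m)) \<longlongrightarrow> - (3 * 0)) (at_right 1)" by (intro tendsto_intros u0)
    ultimately have "filterlim (\<lambda>m. - (3 * cu m) + inverse (cu m)) at_top (at_right 1)" by (intro filterlim_tendsto_add_at_top)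
    from filterlim_tendsto_pos_mult_at_top[OF tendsto_const c this]
    show ?thesis unfolding cl_def[abs_def] by (simp add: inverse_eq_divide)
  qed
  have ul: "((\<lambda>m. 1 - 3 * cw m) \<longlongrightarrow> 1 - 3 * 0) (at_right 1)" by (intro tendsto_intros w0)
  have "((\<lambda>m. mom \<beta> N c (cl c m) p * (cl c m ^ (N + p) * (cl c m powr (2 * \<beta>)) ^ card (pairs N))
     * (1 - 3 * cw m) powr (- lag_deg \<beta> N p)) \<longlongrightarrow> mom \<beta> N 0 1 p * (1 - 3 * 0) powr (- lag_deg \<beta> N p)) (at_right 1)"
    by (intro tendsto_mult filterlim_compose[OF mom_laguerre_limit[OF \<beta> c p] l1] tendsto_powr ul tendsto_const) simp
  then have "((\<lambda>m. mom \<beta> N c (cl c m) p * (cl c m ^ (N + p) * (cl c m powr (2 * \<beta>)) ^ card (pairs N))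
     * (1 - 3 * cw m) powr (- lag_deg \<beta> N p) / (lag_prod \<beta> N p * laguerre \<beta> N 0)) \<longlongrightarrow> mom \<beta> N 0 1 p / (lag_prod \<beta> N p * laguerre \<beta> N 0)) (at_right 1)"
    using Z by (intro tendsto_divide) auto
  moreover have "mom \<beta> N 0 1 p = lag_prod \<beta> N p * laguerre \<beta> N 0"
    using laguerre_mom[OF \<beta> p] unfolding lag_prod_def laguerre_def mom_def by simp
  ultimately have "((\<lambda>m. mom \<beta> N c (cl c m) p * (cl c m ^ (N + p) * (cl c m powr (2 * \<beta>)) ^ card (pairs N))
     * (1 - 3 * cw m) powr (- lag_deg \<beta> N p) / (lag_prod \<beta> N p * laguerre \<beta> N 0)) \<longlongrightarrow> 1) (at_right 1)"
    using Z by simp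
  then show ?thesis
  proof (rule Lim_transform_eventually)
    have "\<forall>\<^sub>F m in at_right 1. cl c m > 0" using l1 by (auto simp: filterlim_at_top_dense)
    then show "\<forall>\<^sub>F m in at_right 1. mom \<beta> N c (cl c m) p * (cl c m ^ (N + p) * (cl c m powr (2 * \<beta>)) ^ card (pairs N))
     * (1 - 3 * cw m) powr (- lag_deg \<beta> N p) / (lag_prod \<beta> N p * laguerre \<beta> N 0) = kap \<beta> N p m" using gt
    proof eventually_elim
      case (elim m)
      define l where "l = cl c m"
      have u: "cu m > 0" using cu[OF elim(2)] by simp
      have ul: "1 - 3 * cw m = l / (c / cu m)" unfolding l_def cl_def cu(3)[OF elim(2), symmetric] using u c by (simp add: field_simps power2_eq_square)
      have l: "l > 0" using elim(1) unfolding l_def .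
      have cup: "c / cu m > 0" using c u by simp
      have "l ^ (N + p) * (l powr (2 * \<beta>)) ^ card (pairs N) = l powr lag_deg \<beta> N p"
      proof -
        have "l ^ (N + p) * (l powr (2 * \<beta>)) ^ card (pairs N) = l powr real (N + p) * l powr (2 * \<beta> * real (card (pairs N)))"
          using l by (simp add: powr_realpow powr_powr flip: powr_realpow)
        also have "\<dots> = l powr (real (N + p) + 2 * \<beta> * real (card (pairs N)))" using l by (simp add: powr_add)
        also have "real (N + p) + 2 * \<beta> * real (card (pairs N)) = lag_deg \<beta> N p" unfolding card_pairs lag_deg_def by simp
        finally show ?thesis .
      qed
      moreover have "(l / (c / cu m)) powr (- lag_deg \<beta> N p) = exp (lag_deg \<beta> N p * ln (c / cu m)) * l powr (- lag_deg \<beta> N p)"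
      proof -
        have "ln (l / y) = ln l - ln y" "(l / y) powr (- a) = exp (a * ln y) * l powr (- a)" if "y > 0" for y a
          using that l by (simp_all add: powr_def ln_div exp_add[symmetric] algebra_simps)
        from this(2)[OF cup] show ?thesis .
      qed
      moreover have "l powr lag_deg \<beta> N p * l powr (- lag_deg \<beta> N p) = 1" using l by (simp add: powr_minus)
      ultimately have "l ^ (N + p) * (l powr (2 * \<beta>)) ^ card (pairs N) * (1 - 3 * cw m) powr (- lag_deg \<beta> N p) = exp (lag_deg \<beta> N p * ln (c / cu m))"
        unfolding ul by simp
      then show ?case unfolding kap_def c_def[symmetric] l_def[symmetric] by (simp add: mult.assoc)
    qed
  qed
qed

lemma lnk_tendsto:
  assumes p: "p \<le> N" and N: "N > 0"
  shows "(lnk \<beta> N (real p) \<longlongrightarrow> 0) (at_right 1)"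
proof -
  define x where "x = real p / real N"
  define b where "b = 1 / \<beta> - 1"
  have x: "0 \<le> x" "x \<le> 1" unfolding x_def using assms by auto
  have gt: "\<forall>\<^sub>F m::real in at_right 1. m > 1" by (simp add: eventually_at_right_less)
  have id: "((\<lambda>m. m) \<longlongrightarrow> (1::real)) (at_right 1)" by (rule tendsto_ident_at)
  have r: "(rho \<longlongrightarrow> 1) (at_right 1)"
  proof -
    have "((\<lambda>m. sqrt (2 * m - 1)) \<longlongrightarrow> sqrt (2 * 1 - 1)) (at_right 1)" by (intro tendsto_intros)
    then show ?thesis unfolding rho_def[abs_def] by simp
  qed
  have n: "((\<lambda>m. sqrt (zz x m)) \<longlongrightarrow> 1) (at_right 1)"
  proof -
    have "((\<lambda>m. sqrt (m^2 - (m^2 - 1) * x)) \<longlongrightarrow> sqrt (1^2 - (1^2 - 1) * x)) (at_right 1)" by (intro tendsto_intros)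
    then show ?thesis unfolding zz_def by simp
  qed
  have l4: "ln 4 = 2 * ln (2::real)" using ln_realpow[of 2 2] by simp
  have S0: "(wS0 \<beta> \<longlongrightarrow> 0) (at_right 1)"
  proof -
    have "((\<lambda>m. \<beta> * (2 * ((m - 1) / (m + 1)) + 3 / 4 * ((m - 1) / (m + 1))^2)) \<longlongrightarrow>
      \<beta> * (2 * ((1 - 1) / (1 + 1)) + 3 / 4 * ((1 - 1) / (1 + 1))^2)) (at_right 1)" by (intro tendsto_intros) auto
    then show ?thesis unfolding wS0_def[abs_def] by simp
  qed
  have g1: "((\<lambda>m. wg1 (rho m)) \<longlongrightarrow> 0) (at_right 1)"
  proof -
    have "((\<lambda>m. 1 / 2 - 1 / (rho m + 1) - 2 * ln (rho m + 1) + ln ((rho m)^2 + 3) + 3 * (rho m - 1) / ((rho m)^2 + 3)) \<longlongrightarrow>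
       1 / 2 - 1 / (1 + 1) - 2 * ln (1 + 1) + ln (1^2 + 3) + 3 * (1 - 1) / (1^2 + 3)) (at_right 1)" by (intro tendsto_intros r) auto
    then show ?thesis unfolding wg1_def using l4 by simp
  qed
  have G2: "((\<lambda>m. wG2 b (rho m)) \<longlongrightarrow> 0) (at_right 1)"
  proof -
    have "((\<lambda>m. ln ((rho m)^2 + 3) / 6 - ln (rho m) / 12 - ln 4 / 6
     + b^2 / (1 + b) * (ln (rho m + 1) - 11 / 12 * ln (rho m) - ln ((rho m)^2 + 3) / 6 - ln 2 + ln 4 / 6)) \<longlongrightarrow>
      ln (1^2 + 3) / 6 - ln 1 / 12 - ln 4 / 6
     + b^2 / (1 + b) * (ln (1 + 1) - 11 / 12 * ln 1 - ln (1^2 + 3) / 6 - ln 2 + ln 4 / 6)) (at_right 1)" by (intro tendsto_intros r) auto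
    then show ?thesis unfolding wG2_def by simp
  qed
  have Ps: "((\<lambda>m. Psi m (zz x m) / (m^2 - 1)) \<longlongrightarrow> 0) (at_right 1)"
  proof -
    \<comment> \<open>\<open>Psi\<close> / (m^2 - 1) has the form 0 / 0 at m = 1. After dividing out
      m^2 - z = (m^2 - 1) x and z - 1 = (m^2 - 1) (1 - x), and with m - sqrt z = (m^2 - 1) x / (m +
      sqrt z), the limit can be taken term by term.\<close>
    have "((\<lambda>m. x * (ln (sqrt (zz x m) + m) + ln (m + 1) + 1 / 2) + (m - 2) * (x / (m + sqrt (zz x m)))
     + 2 * (1 - x) * ln (sqrt (zz x m) + 1) - 2 * ln (m + 1)) \<longlongrightarrow>
      x * (ln (1 + 1) + ln (1 + 1) + 1 / 2) + (1 - 2) * (x / (1 + 1)) + 2 * (1 - x) * ln (1 + 1) - 2 * ln (1 + 1)) (at_right 1)"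
      by (intro tendsto_intros n) auto
    then have "((\<lambda>m. x * (ln (sqrt (zz x m) + m) + ln (m + 1) + 1 / 2) + (m - 2) * (x / (m + sqrt (zz x m)))
     + 2 * (1 - x) * ln (sqrt (zz x m) + 1) - 2 * ln (m + 1)) \<longlongrightarrow> 0) (at_right 1)" by (simp add: algebra_simps)
    then show ?thesis
    proof (rule Lim_transform_eventually)
      show "\<forall>\<^sub>F m in at_right 1. x * (ln (sqrt (zz x m) + m) + ln (m + 1) + 1 / 2) + (m - 2) * (x / (m + sqrt (zz x m)))
         + 2 * (1 - x) * ln (sqrt (zz x m) + 1) - 2 * ln (m + 1) = Psi m (zz x m) / (m^2 - 1)" using gt
      proof eventually_elim
        fix m :: real assume m: "m > 1"
        have e: "m^2 - 1 \<noteq> 0" using m by (simp add: power2_eq_1_iff)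
        have z: "m^2 - zz x m = (m^2 - 1) * x" "zz x m - 1 = (m^2 - 1) * (1 - x)" unfolding zz_def by (simp_all add: algebra_simps)
        have s: "sqrt (zz x m) \<ge> 1" "(sqrt (zz x m))^2 = zz x m" using zz_ge1(1)[OF x, of m] m by auto
        have "(m - sqrt (zz x m)) * (m + sqrt (zz x m)) = (m^2 - 1) * x" unfolding z(1)[symmetric] using s(2) by (simp add: power2_eq_square algebra_simps)
        moreover have "m + sqrt (zz x m) \<noteq> 0" using m s(1) by linarith
        ultimately have q: "x / (m + sqrt (zz x m)) = (m - sqrt (zz x m)) / (m^2 - 1)" using e by (metis frac_eq_eq mult.commute)
        have "x * A + C0 * (B / e) + 2 * y * C - 2 * D = (e * x * A + C0 * B + 2 * (e * y) * C - 2 * e * D) / e" if "e \<noteq> 0" for A B C D C0 x y e :: real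
          using that by (simp add: field_simps)
        from this[OF e] show "x * (ln (sqrt (zz x m) + m) + ln (m + 1) + 1 / 2) + (m - 2) * (x / (m + sqrt (zz x m)))
           + 2 * (1 - x) * ln (sqrt (zz x m) + 1) - 2 * ln (m + 1) = Psi m (zz x m) / (m^2 - 1)" unfolding Psi_def z q by blast
      qed
    qed
  qed
  have ls: "((\<lambda>m. logsum (cs b) m (rho m) (zz x m) + wK2 b m) \<longlongrightarrow> 0) (at_right 1)"
  proof -
    have "((\<lambda>m. (- 1 / 2 * ln (sqrt (zz x m) + 0) + 1 / 2 * ln (sqrt (zz x m) + m) + (1 + b) * ln (sqrt (zz x m) + 1) + b * ln (sqrt (zz x m) + rho m))
      + (- ln (m + 1) - ln 2 / 2 - b * (ln (m + 1) + ln (m + rho m)) + wG2 b (rho m))) \<longlongrightarrow>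
       (- 1 / 2 * ln (1 + 0) + 1 / 2 * ln (1 + 1) + (1 + b) * ln (1 + 1) + b * ln (1 + 1))
      + (- ln (1 + 1) - ln 2 / 2 - b * (ln (1 + 1) + ln (1 + 1)) + 0)) (at_right 1)"
      by (intro tendsto_intros n r G2) auto
    then show ?thesis unfolding logsum_def cs_def wK2_def by (simp add: algebra_simps)
  qed
  have sg: "((\<lambda>m. (m^2 - 1) * sig b m (zz x m)) \<longlongrightarrow> 0) (at_right 1)"
  proof -
    obtain C where C: "C \<ge> 0" "\<And>m z. wdom 2 m z \<Longrightarrow> \<bar>sig b m z\<bar> \<le> C" using UB_sig(1)[of 2 b] unfolding UB_def by blast
    have "((\<lambda>m. (m^2 - 1) * C) \<longlongrightarrow> (1^2 - 1) * C) (at_right (1::real))" by (intro tendsto_intros)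
    then have t: "((\<lambda>m. (m^2 - 1) * C) \<longlongrightarrow> 0) (at_right (1::real))" by simp
    have "\<forall>\<^sub>F m in at_right 1. norm ((m^2 - 1) * sig b m (zz x m)) \<le> (m^2 - 1) * C"
      unfolding eventually_at_right_field
    proof (rule exI[of _ 2], intro conjI allI impI)
      fix m :: real assume m: "m > 1" "m < 2"
      have "wdom 2 m (zz x m)" unfolding wdom_def using zz_ge1[OF x, of m] m by auto
      from C(2)[OF this] m show "norm ((m^2 - 1) * sig b m (zz x m)) \<le> (m^2 - 1) * C"
        unfolding real_norm_def abs_mult by (intro mult_mono) auto
    qed simp
    from Lim_null_comparison[OF this t] show ?thesis .
  qed
  have "(lnk \<beta> N (real p) \<longlongrightarrow> (real N)\<^sup>2 * 0 + real N * ((1 - \<beta>) * 0 + 0) + 0 + 0 / real N) (at_right 1)"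
    unfolding lnk_def[abs_def] x_def[symmetric] b_def[symmetric] using N
    by (intro tendsto_add tendsto_mult tendsto_divide tendsto_const S0 g1 Ps ls sg) auto
  then show ?thesis by simp
qed

lemma lnk_0:
  assumes "m > 1"
  shows "lnk \<beta> N 0 m = (real N)^2 * wS0 \<beta> m + real N * ((1 - \<beta>) * wg1 (rho m)) + wG2 (1 / \<beta> - 1) (rho m)
    + (m^2 - 1) * sig (1 / \<beta> - 1) m (m^2) / real N"
proof -
  have z: "zz (0 / real N) m = m^2" unfolding zz_def by simp
  have s: "sqrt (m^2) = m" using assms by simp
  have P: "Psi m (m^2) = 0" unfolding Psi_def s by simp
  have "ln (m + m) = ln 2 + ln m" using assms ln_mult_pos[of 2 m] by simp
  then have "logsum (cs b) m (rho m) (m^2) + wK2 b m = wG2 b (rho m)" for b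
    unfolding logsum_def cs_def wK2_def prod.case s by (simp add: algebra_simps)
  then show ?thesis unfolding lnk_def z P by simp
qed

text \<open>The comparison principle, run from m = 1 with the residual of \<open>lnk_deriv\<close>,
  read off at p = 0. The constant depends on m1 but neither on N nor on m; the \<open>sig\<close>
  term is itself O(1 / N) and is moved into the error.\<close>

theorem laplace_moment_asymptotics:
  assumes \<beta>: "\<beta> > 0"
  shows "\<exists>C. \<forall>N m. N > 0 \<and> 1 < m \<and> m \<le> m1 \<longrightarrow>
    \<bar>ln (mom \<beta> N (real N * \<beta>) (cl (real N * \<beta>) m) 0) + lag_deg \<beta> N 0 * ln (real N * \<beta> / cu m) - ln (laguerre \<beta> N 0)
      - ((real N)^2 * wS0 \<beta> m + real N * ((1 - \<beta>) * wg1 (rho m)) + wG2 (1 / \<beta> - 1) (rho m))\<bar> \<le> C / real N"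
proof -
  obtain C where C: "C \<ge> 0" "\<And>N p m. N > 0 \<and> p \<le> N \<and> 1 < m \<and> m \<le> m1 \<Longrightarrow>
    (\<exists>d. (lnk \<beta> N (real p) has_real_derivative d) (at m) \<and>
       \<bar>d - ((2 * \<beta> * (2 * m - 1) / (m - 1)) / ((m^2 - 1) / real N)^2 * bracket (1 / \<beta> - 1) m (zz (real p / real N) m) ((m^2 - 1) / real N)
          - ((real N)^2 * \<beta> + real N * (1 - \<beta>) + real p) / (m^2 - 1))\<bar> \<le> C / real N)"
    using lnk_deriv[OF \<beta>, of m1] by auto
  obtain S where S: "S \<ge> 0" "\<And>m z. wdom m1 m z \<Longrightarrow> \<bar>sig (1 / \<beta> - 1) m z\<bar> \<le> S" using UB_sig(1)[of m1 "1 / \<beta> - 1"] unfolding UB_def by blast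
  show ?thesis
  proof (rule exI[of _ "C * (m1 - 1) + m1^2 * S"], intro allI impI)
    fix N :: nat and m :: real assume h: "N > 0 \<and> 1 < m \<and> m \<le> m1"
    then have N: "N > 0" and m: "1 < m" "m \<le> m1" by auto
    define A where "A p m = cK m * (real p * (real N * \<beta>))" for p m
    define B where "B p m = cK m * (cw m * (real N - real p) * (1 + \<beta> * (real N - 1 - real p)))" for p m
    define D where "D p m = - (cK m * (real p * (real N * \<beta>) * (1 - 3 * cw m))) - lag_deg \<beta> N p / (m^2 - 1)" for p m
    have K: "cK m > 0" if "m > 1" for m unfolding cK_def using that by simp
    have "\<bar>ln (kap \<beta> N 0 m) - lnk \<beta> N (real 0) m\<bar> \<le> C / real N * (m - 1)"
    proof (rule comparison_principle[where \<kappa> = "kap \<beta> N" and L = "\<lambda>p. lnk \<beta> N (real p)" and A = A and B = B and D = D and N = N, OF _ _ _ _ _ _ _ m])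
      fix p and m :: real assume p: "p \<le> N" and m: "1 < m" "m \<le> m1"
      show "(kap \<beta> N p has_real_derivative A p m * kap \<beta> N (p - 1) m + B p m * kap \<beta> N (Suc p) m + D p m * kap \<beta> N p m) (at m)"
        unfolding A_def B_def D_def by (rule kap_deriv[OF \<beta> N p m(1)])
      show "kap \<beta> N p m > 0" by (rule kap_pos[OF \<beta> N p])
      show "A p m \<ge> 0" unfolding A_def using K[OF m(1)] \<beta> by simp
      show "B p m \<ge> 0 \<and> (p = N \<longrightarrow> B p m = 0)"
      proof (cases "p = N")
        case False
        then have "real N - 1 - real p \<ge> 0" using p by simp
        then have "1 + \<beta> * (real N - 1 - real p) \<ge> 0" using \<beta> by simp
        then show ?thesis unfolding B_def using K[OF m(1)] cu(1)[OF m(1)] p False by simp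
      qed (simp add: B_def)
      obtain d where d: "(lnk \<beta> N (real p) has_real_derivative d) (at m)"
       "\<bar>d - ((2 * \<beta> * (2 * m - 1) / (m - 1)) / ((m^2 - 1) / real N)^2 * bracket (1 / \<beta> - 1) m (zz (real p / real N) m) ((m^2 - 1) / real N)
          - ((real N)^2 * \<beta> + real N * (1 - \<beta>) + real p) / (m^2 - 1))\<bar> \<le> C / real N"
        using C(2)[of N p m] N p m by auto
      \<comment> \<open>Natural subtraction gives p - 1 = 0 at p = 0, whereas the ansatz is
        evaluated at - 1; the coefficient \<open>A\<close> vanishes there.\<close>
      have p1: "A p m * exp (lnk \<beta> N (real (p - 1)) m - lnk \<beta> N (real p) m) = A p m * exp (lnk \<beta> N (real p - 1) m - lnk \<beta> N (real p) m)"
        by (cases p) (simp_all add: A_def)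
      have e: "(real N)^2 * \<beta> + real N * (1 - \<beta>) + real p = lag_deg \<beta> N p"
        unfolding lag_deg_def by (simp add: power2_eq_square algebra_simps)
      have sp: "real (Suc p) = real p + 1" by simp
      have "(2 * \<beta> * (2 * m - 1) / (m - 1)) / ((m^2 - 1) / real N)^2 * bracket (1 / \<beta> - 1) m (zz (real p / real N) m) ((m^2 - 1) / real N)
          - ((real N)^2 * \<beta> + real N * (1 - \<beta>) + real p) / (m^2 - 1)
         = A p m * exp (lnk \<beta> N (real (p - 1)) m - lnk \<beta> N (real p) m) + B p m * exp (lnk \<beta> N (real (Suc p)) m - lnk \<beta> N (real p) m) + D p m"
        unfolding bracket_as_recurrence[OF m(1) N \<beta>] e p1 sp unfolding A_def B_def D_def by (simp add: algebra_simps)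
      then show "\<exists>d. (lnk \<beta> N (real p) has_real_derivative d) (at m) \<and>
         \<bar>d - (A p m * exp (lnk \<beta> N (real (p - 1)) m - lnk \<beta> N (real p) m) + B p m * exp (lnk \<beta> N (real (Suc p)) m - lnk \<beta> N (real p) m) + D p m)\<bar> \<le> C / real N"
        using d by auto
    next
      fix p assume p: "p \<le> N"
      have "((\<lambda>m. ln (kap \<beta> N p m) - lnk \<beta> N (real p) m) \<longlongrightarrow> ln 1 - 0) (at_right 1)"
        by (intro tendsto_diff tendsto_ln kap_tendsto lnk_tendsto \<beta> N p) simp
      then show "((\<lambda>m. ln (kap \<beta> N p m) - lnk \<beta> N (real p) m) \<longlongrightarrow> 0) (at_right 1)" by simp
    qed simp
    also have "C / real N * (m - 1) \<le> C * (m1 - 1) / real N" using C(1) m N by (simp add: divide_right_mono mult_left_mono)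
    finally have 1: "\<bar>ln (kap \<beta> N 0 m) - lnk \<beta> N 0 m\<bar> \<le> C * (m1 - 1) / real N" by simp
    have 2: "\<bar>(m^2 - 1) * sig (1 / \<beta> - 1) m (m^2) / real N\<bar> \<le> m1^2 * S / real N"
    proof -
      have "wdom m1 m (m^2)" unfolding wdom_def using m by auto
      from S(2)[OF this] have s: "\<bar>sig (1 / \<beta> - 1) m (m^2)\<bar> \<le> S" .
      have "m^2 \<le> m1^2" "m^2 \<ge> 1" using m by (auto intro: power_mono)
      then have "\<bar>m\<^sup>2 - 1\<bar> * \<bar>sig (1 / \<beta> - 1) m (m^2)\<bar> \<le> m1^2 * S" using s by (intro mult_mono) auto
      then show ?thesis unfolding abs_divide abs_mult using N by (simp add: divide_right_mono)
    qed
    have u: "cu m > 0" using cu(2)[OF m(1)] .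
    have M: "mom \<beta> N (real N * \<beta>) (cl (real N * \<beta>) m) 0 > 0" using \<beta> N by (intro mom_pos) auto
    have k: "ln (kap \<beta> N 0 m) = ln (mom \<beta> N (real N * \<beta>) (cl (real N * \<beta>) m) 0) + lag_deg \<beta> N 0 * ln (real N * \<beta> / cu m) - ln (laguerre \<beta> N 0)"
      unfolding kap_def using M laguerre_pos[OF \<beta>, of N 0] by (simp add: lag_prod_def ln_div ln_mult)
    show "\<bar>ln (mom \<beta> N (real N * \<beta>) (cl (real N * \<beta>) m) 0) + lag_deg \<beta> N 0 * ln (real N * \<beta> / cu m) - ln (laguerre \<beta> N 0)
      - ((real N)^2 * wS0 \<beta> m + real N * ((1 - \<beta>) * wg1 (rho m)) + wG2 (1 / \<beta> - 1) (rho m))\<bar> \<le> (C * (m1 - 1) + m1^2 * S) / real N"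
      using 1 2 unfolding k lnk_0[OF m(1), of \<beta> N] add_divide_distrib by linarith
  qed
qed

section \<open>The zeta function\<close>

text \<open>\<open>zpow n s u\<close> is \<open>(n + 1 + u) powr (- s)\<close>; each Dirichlet-type series below is a sum of integrals of it
  over \<open>[0, 1]\<close>, so that integration by parts gains one power of \<open>n\<close>.\<close>

definition zpow :: "nat \<Rightarrow> complex \<Rightarrow> real \<Rightarrow> complex" where
  "zpow n s u = exp (- (s * of_real (ln (real (Suc n) + u))))"

definition zterm :: "(real \<Rightarrow> complex) \<Rightarrow> nat \<Rightarrow> complex \<Rightarrow> complex" where
  "zterm g n s = integral {0..1} (\<lambda>u. g u * zpow n s u)"

definition zseries :: "(real \<Rightarrow> complex) \<Rightarrow> complex \<Rightarrow> complex" where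
  "zseries g s = (\<Sum>n. zterm g n s)"

lemma zpow_deriv:
  assumes "u \<ge> 0"
  shows "(zpow n s has_vector_derivative (- s * zpow n (s + 1) u)) (at u within S)"
proof -
  define x where "x = real (Suc n) + u"
  have x: "x > 0" unfolding x_def using assms by simp
  have "((\<lambda>u. ln (real (Suc n) + u)) has_real_derivative 1 / x) (at u within S)"
    using x unfolding x_def by (auto intro!: derivative_eq_intros)
  then have "((\<lambda>u. complex_of_real (ln (real (Suc n) + u))) has_vector_derivative of_real (1 / x)) (at u within S)"
    by (rule has_vector_derivative_of_real)
  then have "((\<lambda>u. - (s * complex_of_real (ln (real (Suc n) + u)))) has_vector_derivative - (s * of_real (1 / x))) (at u within S)"
    by (intro has_vector_derivative_minus has_vector_derivative_mult_right)
  from field_vector_diff_chain_within[OF this, of exp "exp (- (s * of_real (ln x)))"]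
  have "(zpow n s has_vector_derivative (- (s * of_real (1 / x)) * exp (- (s * of_real (ln x))))) (at u within S)"
    unfolding zpow_def[abs_def] x_def by (simp add: o_def DERIV_exp has_field_derivative_at_within)
  moreover have "- (s * of_real (1 / x)) * exp (- (s * of_real (ln x))) = - s * zpow n (s + 1) u"
  proof -
    have "exp (- complex_of_real (ln x)) = of_real (1 / x)" using x by (simp add: exp_minus exp_of_real inverse_eq_divide)
    then show ?thesis unfolding zpow_def x_def[symmetric] by (simp add: distrib_right exp_add[symmetric] exp_diff exp_minus field_simps)
  qed
  ultimately show ?thesis by simp
qed

lemma zpow_cont: "continuous_on {0..1} (zpow n s)"
  unfolding zpow_def[abs_def] by (intro continuous_intros) auto

lemma norm_zpow:
  assumes "u \<ge> 0" "Re s \<ge> 0"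
  shows "norm (zpow n s u) \<le> real (Suc n) powr (- Re s)"
proof -
  have "norm (zpow n s u) = exp (- (Re s * ln (real (Suc n) + u)))" unfolding zpow_def by simp
  also have "\<dots> \<le> exp (- (Re s * ln (real (Suc n))))" using assms by (simp add: mult_left_mono)
  finally show ?thesis by (simp add: powr_def)
qed

lemma norm_zterm:
  assumes g: "continuous_on {0..1} g" "\<And>u. u \<in> {0..1} \<Longrightarrow> norm (g u) \<le> B" and s: "Re s \<ge> a" "a \<ge> 0"
  shows "norm (zterm g n s) \<le> B * real (Suc n) powr (- a)"
proof -
  have B: "B \<ge> 0" using g(2)[of 0] by (auto intro: order_trans[OF norm_ge_zero])
  have "norm (zterm g n s) \<le> integral {0..1} (\<lambda>u::real. B * real (Suc n) powr (- a))"
    unfolding zterm_def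
  proof (rule integral_norm_bound_integral)
    show "(\<lambda>u. g u * zpow n s u) integrable_on {0..1}" by (intro integrable_continuous_real continuous_on_mult g zpow_cont)
    fix u :: real assume u: "u \<in> {0..1}"
    have "norm (zpow n s u) \<le> real (Suc n) powr (- Re s)" using norm_zpow[of u s n] u s by auto
    also have "\<dots> \<le> real (Suc n) powr (- a)" using s by (intro powr_mono) auto
    finally show "norm (g u * zpow n s u) \<le> B * real (Suc n) powr (- a)" unfolding norm_mult using g(2)[OF u] B by (intro mult_mono) auto
  qed auto
  then show ?thesis by simp
qed

lemma zterm_bounded:
  assumes "continuous_on {0..1} g"
  obtains B where "\<And>a n s. Re s \<ge> a \<Longrightarrow> a \<ge> 0 \<Longrightarrow> norm (zterm g n s) \<le> B * real (Suc n) powr (- a)"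
proof -
  have "bounded (g ` {0..1})" by (intro compact_imp_bounded compact_continuous_image assms) auto
  then obtain B where "\<And>u. u \<in> {0..1} \<Longrightarrow> norm (g u) \<le> B" unfolding bounded_iff by blast
  from norm_zterm[OF assms this] that show ?thesis by blast
qed

lemma summable_Suc_powr: "a > 1 \<Longrightarrow> summable (\<lambda>n. B * real (Suc n) powr (- a))"
  using summable_real_powr_iff[of "- a"] by (intro summable_mult) (simp add: summable_Suc_iff[of "\<lambda>n. real n powr (- a)"] del: of_nat_Suc)

lemma zseries_sums:
  assumes g: "continuous_on {0..1} g" and s: "Re s > 1"
  shows "(\<lambda>n. zterm g n s) sums zseries g s"
proof -
  obtain B where B: "\<And>a n s. Re s \<ge> a \<Longrightarrow> a \<ge> 0 \<Longrightarrow> norm (zterm g n s) \<le> B * real (Suc n) powr (- a)"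
    using zterm_bounded[OF g] by blast
  have "summable (\<lambda>n. zterm g n s)"
    by (rule summable_comparison_test'[OF summable_Suc_powr[OF s, of B], of 0]) (use B[of "Re s" s] s in auto)
  then show ?thesis unfolding zseries_def by (rule summable_sums)
qed

lemma zterm_holomorphic:
  assumes g: "continuous_on {0..1} g"
  shows "zterm g n holomorphic_on UNIV"
proof -
  have g2: "continuous_on (UNIV \<times> {0..1}) (\<lambda>x :: complex \<times> real. g (snd x))"
    by (rule continuous_on_compose2[OF g]) (auto intro: continuous_intros)
  have "(\<lambda>s. integral (cbox 0 1) (\<lambda>u. g u * zpow n s u)) holomorphic_on UNIV"
  proof (rule leibniz_rule_holomorphic)
    fix s :: complex and u :: real assume "u \<in> cbox 0 1"
    show "((\<lambda>s. g u * zpow n s u) has_field_derivative g u * (- (of_real (ln (real (Suc n) + u)) * zpow n s u))) (at s within UNIV)"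
      unfolding zpow_def by (auto intro!: derivative_eq_intros)
  next
    fix s :: complex
    show "(\<lambda>u. g u * zpow n s u) integrable_on cbox 0 1"
      using integrable_continuous_real[OF continuous_on_mult[OF g zpow_cont]] by simp
  next
    show "continuous_on (UNIV \<times> cbox 0 1) (\<lambda>(s, u). g u * (- (of_real (ln (real (Suc n) + u)) * zpow n s u)))"
      unfolding zpow_def case_prod_beta by (intro continuous_intros) (use g2 in auto)
  qed auto
  then show ?thesis unfolding zterm_def[abs_def] by simp
qed

lemma zseries_holomorphic:
  assumes g: "continuous_on {0..1} g"
  shows "zseries g holomorphic_on {s. Re s > 1}"
proof (rule holomorphic_uniform_sequence[where f = "\<lambda>k s. \<Sum>n<k. zterm g n s"])
  show "open {s. Re s > 1}" by (rule open_halfspace_Re_gt)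
  show "(\<lambda>s. \<Sum>n<k. zterm g n s) holomorphic_on {s. Re s > 1}" for k
    by (intro holomorphic_on_sum holomorphic_on_subset[OF zterm_holomorphic[OF g]]) auto
  fix s assume "s \<in> {s. Re s > 1}"
  then have s: "Re s > 1" by simp
  define d where "d = (Re s - 1) / 2"
  have d: "d > 0" "Re s - d > 1" unfolding d_def using s by (simp_all add: field_simps)
  have cb: "Re z \<ge> Re s - d" if "z \<in> cball s d" for z
    using that abs_Re_le_cmod[of "s - z"] by (auto simp: dist_norm)
  obtain B where B: "\<And>a n s. Re s \<ge> a \<Longrightarrow> a \<ge> 0 \<Longrightarrow> norm (zterm g n s) \<le> B * real (Suc n) powr (- a)"
    using zterm_bounded[OF g] by blast
  have "uniform_limit (cball s d) (\<lambda>k s. \<Sum>n<k. zterm g n s) (\<lambda>s. suminf (\<lambda>n. zterm g n s)) sequentially"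
    by (rule Weierstrass_m_test[OF B summable_Suc_powr[OF d(2), of B]]) (use cb d in auto)
  then show "\<exists>d>0. cball s d \<subseteq> {s. 1 < Re s} \<and> uniform_limit (cball s d) (\<lambda>k s. \<Sum>n<k. zterm g n s) (zseries g) sequentially"
    using d cb by (intro exI[of _ d]) (fastforce simp: zseries_def[abs_def])
qed

text \<open>\<open>G\<close> is a primitive of g minus a constant c. If c is the mean of g and G
  starts at 0, the boundary terms vanish and one power of n is gained.\<close>

lemma zterm_by_parts:
  assumes g: "continuous_on {0..1} g"
    and G: "\<And>u. u \<in> {0..1} \<Longrightarrow> (G has_vector_derivative (g u - c)) (at u within {0..1})"
  shows "zterm g n s = c * zterm (\<lambda>_. 1) n s + s * zterm G n (s + 1) + (G 1 * zpow n s 1 - G 0 * zpow n s 0)"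
proof -
  have cG: "continuous_on {0..1} G" using G by (rule continuous_on_vector_derivative)
  have i: "(\<lambda>u. g u * zpow n s u) integrable_on {0..1}" "(\<lambda>u. 1 * zpow n s u) integrable_on {0..1}" "(\<lambda>u. G u * zpow n (s + 1) u) integrable_on {0..1}"
    by (intro integrable_continuous_real continuous_on_mult g cG continuous_on_const zpow_cont)+
  have h1: "((\<lambda>u. G u * (- s * zpow n (s + 1) u) + (g u - c) * zpow n s u) has_integral (G 1 * zpow n s 1 - G 0 * zpow n s 0)) {0..1}"
    by (rule fundamental_theorem_of_calculus, simp, intro has_vector_derivative_mult G zpow_deriv) auto
  have h2: "((\<lambda>u. - s * (G u * zpow n (s + 1) u) + (g u * zpow n s u - c * (1 * zpow n s u))) has_integral
      (- s * zterm G n (s + 1) + (zterm g n s - c * zterm (\<lambda>_. 1) n s))) {0..1}"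
    unfolding zterm_def by (intro has_integral_add has_integral_diff has_integral_mult_right integrable_integral i)
  have eq: "(\<lambda>u. - s * (G u * zpow n (s + 1) u) + (g u * zpow n s u - c * (1 * zpow n s u))) = (\<lambda>u. G u * (- s * zpow n (s + 1) u) + (g u - c) * zpow n s u)"
    by (auto simp: algebra_simps)
  have "G 1 * zpow n s 1 - G 0 * zpow n s 0 = - s * zterm G n (s + 1) + (zterm g n s - c * zterm (\<lambda>_. 1) n s)"
    by (rule has_integral_unique[OF h1 h2[unfolded eq]])
  then show ?thesis by (simp add: algebra_simps)
qed

text \<open>The summands are the integrals of x^(- s) over consecutive unit intervals, so the series
  telescopes to the integral from 1 to infinity.\<close>

lemma zterm_1_sums:
  assumes s: "Re s > 1"
  shows "(\<lambda>n. zterm (\<lambda>_. 1) n s) sums (1 / (s - 1))"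
proof -
  have s1: "s - 1 \<noteq> 0" using s by auto
  have t: "zterm (\<lambda>_. 1) n s = (zpow n (s - 1) 0 - zpow (Suc n) (s - 1) 0) / (s - 1)" for n
  proof -
    have "((\<lambda>u. - (s - 1) * zpow n (s - 1 + 1) u) has_integral (zpow n (s - 1) 1 - zpow n (s - 1) 0)) {0..1}"
      by (rule fundamental_theorem_of_calculus, simp, intro zpow_deriv) auto
    from has_integral_mult_right[OF this, of "- 1 / (s - 1)"]
    have "((\<lambda>u. 1 * zpow n s u) has_integral (zpow n (s - 1) 0 - zpow n (s - 1) 1) / (s - 1)) {0..1}"
    proof -
      have "- 1 / a * (- a * y) = 1 * y" if "a \<noteq> 0" for a y :: complex using that by simp
      note this[OF s1]
      then have "- 1 / (s - 1) * (- (s - 1) * zpow n (s - 1 + 1) u) = 1 * zpow n s u" for u by simp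
      moreover have "- 1 / (s - 1) * (zpow n (s - 1) 1 - zpow n (s - 1) 0) = (zpow n (s - 1) 0 - zpow n (s - 1) 1) / (s - 1)"
      proof -
        have "- 1 / a * (x - y) = (y - x) / a" for a x y :: complex by (simp add: diff_divide_distrib left_diff_distrib)
        then show ?thesis .
      qed
      ultimately show ?thesis using \<open>((\<lambda>u. - 1 / (s - 1) * _ u) has_integral _) _\<close> by (simp only:)
    qed
    moreover have "zpow n (s - 1) 1 = zpow (Suc n) (s - 1) 0" unfolding zpow_def by (simp add: add_ac)
    ultimately show ?thesis unfolding zterm_def by (simp add: integral_unique)
  qed
  have "(\<lambda>n. zpow n (s - 1) 0) \<longlonglongrightarrow> 0"
  proof (rule tendsto_norm_zero_cancel)
    have "(\<lambda>n. real (Suc n) powr (- (Re s - 1))) \<longlonglongrightarrow> 0"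
      using s by (intro LIMSEQ_Suc tendsto_neg_powr filterlim_real_sequentially) auto
    moreover have "norm (zpow n (s - 1) 0) = real (Suc n) powr (- (Re s - 1))" for n
      unfolding zpow_def by (simp add: powr_def algebra_simps)
    ultimately show "(\<lambda>n. norm (zpow n (s - 1) 0)) \<longlonglongrightarrow> 0" by simp
  qed
  from sums_divide[OF telescope_sums'[OF this], of "s - 1"]
  show ?thesis unfolding t by (simp add: zpow_def)
qed

lemma zseries_recursion:
  assumes g: "continuous_on {0..1} g"
    and G: "\<And>u. u \<in> {0..1} \<Longrightarrow> (G has_vector_derivative (g u - c)) (at u within {0..1})" "G 0 = 0" "G 1 = 0"
    and s: "Re s > 1"
  shows "zseries g s = c / (s - 1) + s * zseries G (s + 1)"
proof -
  have cG: "continuous_on {0..1} G" using G(1) by (rule continuous_on_vector_derivative)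
  have "(\<lambda>n. c * zterm (\<lambda>_. 1) n s + s * zterm G n (s + 1)) sums (c * (1 / (s - 1)) + s * zseries G (s + 1))"
    using s by (intro sums_add sums_mult zterm_1_sums zseries_sums cG) auto
  moreover have "zterm g n s = c * zterm (\<lambda>_. 1) n s + s * zterm G n (s + 1)" for n
    using zterm_by_parts[where g = g and G = G and c = c and n = n and s = s, OF g G(1)] by (simp add: G)
  ultimately have "(\<lambda>n. zterm g n s) sums (c * (1 / (s - 1)) + s * zseries G (s + 1))" by simp
  with zseries_sums[OF g s] show ?thesis by (metis sums_unique2 times_divide_eq_right mult_1_right)
qed

text \<open>Each use of the recursion moves the half-plane by one to the left. The factor s - 1
  removes the only pole, and the factor s in front of the shifted series is (s + 1) - 1, just what
  the induction hypothesis at s + 1 needs.\<close>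

lemma zseries_continuation:
  assumes "continuous_on {0..1} g"
  shows "\<exists>h. h holomorphic_on {s. Re s > 1 - real m} \<and> (\<forall>s. Re s > 1 \<longrightarrow> h s = (s - 1) * zseries g s)"
  using assms
proof (induction m arbitrary: g)
  case 0
  have "(\<lambda>s. (s - 1) * zseries g s) holomorphic_on {s. Re s > 1}"
    by (intro holomorphic_intros zseries_holomorphic 0)
  then show ?case by (intro exI[of _ "\<lambda>s. (s - 1) * zseries g s"]) auto
next
  case (Suc m)
  define c where "c = integral {0..1} g"
  define G where "G u = integral {0..u} (\<lambda>v. g v - c)" for u
  have gc: "continuous_on {0..1} (\<lambda>v. g v - c)" by (intro continuous_intros Suc.prems)
  have G: "(G has_vector_derivative (g u - c)) (at u within {0..1})" if "u \<in> {0..1}" for u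
    unfolding G_def using integral_has_vector_derivative[OF gc that] .
  have "G 1 = integral {0..1} g - integral {0..1} (\<lambda>v::real. c)"
    unfolding G_def by (intro integral_diff integrable_continuous_real Suc.prems continuous_on_const)
  then have G01: "G 0 = 0" "G 1 = 0" unfolding G_def c_def by simp_all
  have cG: "continuous_on {0..1} G" using G by (rule continuous_on_vector_derivative)
  from Suc.IH[OF cG] obtain h where h: "h holomorphic_on {s. Re s > 1 - real m}" "\<And>s. Re s > 1 \<Longrightarrow> h s = (s - 1) * zseries G s" by blast
  have "(h \<circ> (\<lambda>s. s + 1)) holomorphic_on {s. Re s > 1 - real (Suc m)}"
    by (rule holomorphic_on_compose_gen[OF _ h(1)]) (auto intro!: holomorphic_intros)
  then have "(\<lambda>s. c + (s - 1) * (h \<circ> (\<lambda>s. s + 1)) s) holomorphic_on {s. Re s > 1 - real (Suc m)}"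
    by (intro holomorphic_intros)
  moreover have "c + (s - 1) * (h \<circ> (\<lambda>s. s + 1)) s = (s - 1) * zseries g s" if s: "Re s > 1" for s
  proof -
    have "s - 1 \<noteq> 0" using s by auto
    moreover have "h (s + 1) = s * zseries G (s + 1)" using h(2)[of "s + 1"] s by simp
    moreover have "zseries g s = c / (s - 1) + s * zseries G (s + 1)"
      by (rule zseries_recursion[where g = g and G = G, OF Suc.prems G G01 s])
    ultimately show ?thesis unfolding o_def by (simp add: distrib_left)
  qed
  ultimately show ?case by blast
qed

text \<open>Integration by parts for g = 0, c = 1 and G(u) = 1 - u: the left side vanishes, and the
  boundary term at u = 0 is the Dirichlet summand.\<close>

lemma dirichlet_sums:
  assumes s: "Re s > 1"
  shows "(\<lambda>n. 1 / of_nat (Suc n) powr s) sums (1 / (s - 1) + s * zseries (\<lambda>u. 1 - of_real u) (s + 1))"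
proof -
  have c: "continuous_on {0..1} (\<lambda>u::real. 1 - complex_of_real u)" by (intro continuous_intros)
  have "1 / of_nat (Suc n) powr s = zterm (\<lambda>_. 1) n s + s * zterm (\<lambda>u. 1 - of_real u) n (s + 1)" for n
  proof -
    have "((\<lambda>u. 1 - complex_of_real u) has_vector_derivative (0 - 1)) (at u within {0..1})" for u
      by (auto intro!: derivative_eq_intros)
    then have "zterm (\<lambda>_. 0) n s = 1 * zterm (\<lambda>_. 1) n s + s * zterm (\<lambda>u. 1 - of_real u) n (s + 1) + ((1 - of_real 1) * zpow n s 1 - (1 - of_real 0) * zpow n s 0)"
      by (intro zterm_by_parts continuous_on_const)
    moreover have "zterm (\<lambda>_. 0) n s = 0" unfolding zterm_def by simp
    moreover have "zpow n s 0 = 1 / of_nat (Suc n) powr s"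
    proof -
      have "Ln (of_nat (Suc n)) = of_real (ln (real (Suc n)))" using Ln_of_real[of "real (Suc n)"] by simp
      then show ?thesis unfolding zpow_def powr_def by (simp add: exp_minus inverse_eq_divide del: of_nat_Suc)
    qed
    ultimately show ?thesis by simp
  qed
  moreover have "(\<lambda>n. zterm (\<lambda>_. 1) n s + s * zterm (\<lambda>u. 1 - of_real u) n (s + 1)) sums (1 / (s - 1) + s * zseries (\<lambda>u. 1 - of_real u) (s + 1))"
    using s by (intro sums_add sums_mult zterm_1_sums zseries_sums c) auto
  ultimately show ?thesis by simp
qed

lemma riemann_zeta_unique:
  fixes f h :: "complex \<Rightarrow> complex"
  assumes f: "f holomorphic_on S - {1}" and h: "h holomorphic_on S - {1}"
    and S: "open S" "connected S" "{s. Re s > 1} \<subseteq> S"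
    and eq: "\<And>s. Re s > 1 \<Longrightarrow> f s = h s" and s: "s \<in> S - {1}"
  shows "f s = h s"
proof (rule analytic_continuation_open[of "{s. Re s > 1}" "S - {1}" f h s])
  show "open {s. Re s > 1}" by (rule open_halfspace_Re_gt)
  show "open (S - {1})" using S by auto
  have "complex_of_real 2 \<in> {s. Re s > 1}" by simp
  then show "{s. Re s > 1} \<noteq> {}" by blast
  show "connected (S - {1})" using S by (intro connected_open_delete) auto
  show "{s. Re s > 1} \<subseteq> S - {1}" using S by auto
qed (use eq f h s in auto)

text \<open>The continuations of (s - 1) times the Dirichlet series to growing half-planes agree on
  overlaps and glue to an entire function \<open>W\<close>. Dividing by s - 1 gives existence, and
  the identity theorem on the punctured plane gives uniqueness, as the definite description
  requires.\<close>

lemma riemann_zeta: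
  shows riemann_zeta_holomorphic: "riemann_zeta holomorphic_on - {1}"
    and riemann_zeta_sums: "Re s > 1 \<Longrightarrow> (\<lambda>n. 1 / of_nat (Suc n) powr s) sums riemann_zeta s"
proof -
  let ?P = "\<lambda>f. f holomorphic_on (- {1}) \<and> f 1 = 0 \<and> (\<forall>s. Re s > 1 \<longrightarrow> (\<lambda>n. 1 / of_nat (Suc n) powr s) sums f s)"
  define D where "D s = 1 / (s - 1) + s * zseries (\<lambda>u. 1 - of_real u) (s + 1)" for s
  have c: "continuous_on {0..1} (\<lambda>u::real. 1 - complex_of_real u)" by (intro continuous_intros)
  have "\<exists>f. f holomorphic_on {s. Re s > - real m} \<and> (\<forall>s. Re s > 1 \<longrightarrow> f s = (s - 1) * D s)" for m
  proof -
    obtain h where h: "h holomorphic_on {s. Re s > 1 - real m}" "\<And>s. Re s > 1 \<Longrightarrow> h s = (s - 1) * zseries (\<lambda>u. 1 - of_real u) s"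
      using zseries_continuation[OF c, of m] by blast
    have "(h \<circ> (\<lambda>s. s + 1)) holomorphic_on {s. Re s > - real m}"
      by (rule holomorphic_on_compose_gen[OF _ h(1)]) (auto intro!: holomorphic_intros)
    then have "(\<lambda>s. 1 + (s - 1) * (h \<circ> (\<lambda>s. s + 1)) s) holomorphic_on {s. Re s > - real m}"
      by (intro holomorphic_intros)
    moreover have "1 + (s - 1) * (h \<circ> (\<lambda>s. s + 1)) s = (s - 1) * D s" if s: "Re s > 1" for s
    proof -
      have "s - 1 \<noteq> 0" using s by auto
      moreover have "h (s + 1) = s * zseries (\<lambda>u. 1 - of_real u) (s + 1)" using h(2)[of "s + 1"] s by simp
      ultimately show ?thesis unfolding D_def o_def by (simp add: distrib_left)
    qed
    ultimately show ?thesis by blast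
  qed
  then obtain Z where Z: "\<And>m. Z m holomorphic_on {s. Re s > - real m}" "\<And>m s. Re s > 1 \<Longrightarrow> Z m s = (s - 1) * D s" by metis
  have Zeq: "Z m s = Z k s" if "Re s > - real m" "m \<le> k" for m k s
  proof (rule analytic_continuation_open[of "{s. Re s > 1}" "{s. Re s > - real m}" "Z m" "Z k" s])
    have "complex_of_real 2 \<in> {s. Re s > 1}" by simp
    then show "{s. Re s > 1} \<noteq> {}" by blast
    show "connected {s. - real m < Re s}" by (intro convex_connected convex_halfspace_Re_gt)
    show "Z m holomorphic_on {s. Re s > - real m}" "Z k holomorphic_on {s. Re s > - real m}"
      using that by (auto intro: holomorphic_on_subset[OF Z(1)])
  qed (use that Z(2) in \<open>auto simp: open_halfspace_Re_gt\<close>)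
  \<comment> \<open>Any index m with Re s > - m would do; \<open>WZ\<close> shows that the value
    does not depend on the choice.\<close>
  define W where "W s = Z (nat \<lceil>\<bar>Re s\<bar>\<rceil> + 1) s" for s
  have WZ: "W s = Z m s" if "Re s > - real m" for m s
  proof (cases "m \<le> nat \<lceil>\<bar>Re s\<bar>\<rceil> + 1")
    case True then show ?thesis unfolding W_def using Zeq[OF that True] by simp
  next
    case False
    have "Re s > - real (nat \<lceil>\<bar>Re s\<bar>\<rceil> + 1)" by linarith
    then show ?thesis unfolding W_def using Zeq[of "nat \<lceil>\<bar>Re s\<bar>\<rceil> + 1" s m] False by simp
  qed
  have W: "W holomorphic_on UNIV"
  proof -
    have "W holomorphic_on (\<Union>m. {s. Re s > - real m})"
    proof (rule holomorphic_on_UN_open)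
      fix m show "W holomorphic_on {s. Re s > - real m}"
        using Z(1)[of m] by (rule holomorphic_transform) (auto simp: WZ)
    qed (auto simp: open_halfspace_Re_gt)
    moreover have "(\<Union>m. {s. Re s > - real m}) = UNIV"
    proof -
      have "\<exists>m. Re s > - real m" for s using reals_Archimedean2[of "- Re s"] by (auto simp: minus_less_iff)
      then show ?thesis by auto
    qed
    ultimately show ?thesis by simp
  qed
  define f where "f s = (if s = 1 then 0 else W s / (s - 1))" for s
  have Pf: "?P f"
  proof (intro conjI allI impI)
    have "(\<lambda>s. W s / (s - 1)) holomorphic_on - {1}"
      by (intro holomorphic_intros holomorphic_on_subset[OF W]) auto
    then show "f holomorphic_on - {1}" by (rule holomorphic_transform) (auto simp: f_def)
    show "f 1 = 0" by (simp add: f_def)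
    fix s assume s: "Re s > 1"
    then have "s \<noteq> 1" by auto
    then have "f s = D s" unfolding f_def using WZ[of 0 s] Z(2)[OF s, of 0] s by simp
    then show "(\<lambda>n. 1 / of_nat (Suc n) powr s) sums f s" using dirichlet_sums[OF s] unfolding D_def by simp
  qed
  have un: "h = k" if hk: "?P h" "?P k" for h k
  proof
    fix s show "h s = k s"
    proof (cases "s = 1")
      case False
      show ?thesis
      proof (rule riemann_zeta_unique[of h UNIV k])
        show "h holomorphic_on UNIV - {1}" "k holomorphic_on UNIV - {1}" using hk by (auto simp: Compl_eq_Diff_UNIV)
        fix s assume "Re s > 1" then show "h s = k s" using hk sums_unique2 by blast
      qed (use False in auto)
    qed (use hk in auto)
  qed
  have "\<exists>!f. ?P f" by (rule ex1I[of ?P, OF Pf un[OF _ Pf]])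
  then have "?P riemann_zeta" unfolding riemann_zeta_def by (rule theI')
  then show "riemann_zeta holomorphic_on - {1}" "Re s > 1 \<Longrightarrow> (\<lambda>n. 1 / of_nat (Suc n) powr s) sums riemann_zeta s" by auto
qed

text \<open>This is - B_3(u) / 6 for the Bernoulli polynomial B_3. It arises from 1 - u by twice
  subtracting the mean, first 1/2 and then 1/12, and integrating from 0.\<close>

definition bern2 :: "real \<Rightarrow> real" where "bern2 u = u^2 / 4 - u ^ 3 / 6 - u / 12"

text \<open>Two steps of the recursion are just enough to reach s = - 1: the series at s + 3
  converges for Re s > - 2.\<close>

lemma riemann_zeta_eq:
  assumes s: "Re s > -2" "s \<noteq> 1"
  shows "riemann_zeta s = 1 / (s - 1) + 1 / 2 + s / 12 + s * (s + 1) * (s + 2) * zseries (\<lambda>u. of_real (bern2 u)) (s + 3)"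
proof (rule riemann_zeta_unique[of riemann_zeta "{s. Re s > -2}"])
  have c: "continuous_on {0..1} (\<lambda>u. complex_of_real (bern2 u))" unfolding bern2_def by (intro continuous_intros) auto
  show "riemann_zeta holomorphic_on {s. Re s > -2} - {1}" by (rule holomorphic_on_subset[OF riemann_zeta_holomorphic]) auto
  have "(zseries (\<lambda>u. of_real (bern2 u)) \<circ> (\<lambda>s. s + 3)) holomorphic_on {s. Re s > -2} - {1}"
    by (rule holomorphic_on_compose_gen[OF _ zseries_holomorphic[OF c]]) (auto intro!: holomorphic_intros)
  then have "(\<lambda>s. zseries (\<lambda>u. of_real (bern2 u)) (s + 3)) holomorphic_on {s. Re s > -2} - {1}" by (simp add: o_def)
  then show "(\<lambda>s. 1 / (s - 1) + 1 / 2 + s / 12 + s * (s + 1) * (s + 2) * zseries (\<lambda>u. of_real (bern2 u)) (s + 3)) holomorphic_on {s. Re s > -2} - {1}"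
    by (intro holomorphic_intros) auto
  show "s \<in> {s. Re s > -2} - {1}" using s by simp
  show "open {s. Re s > -2}" by (rule open_halfspace_Re_gt)
  show "connected {s. Re s > -2}" by (intro convex_connected convex_halfspace_Re_gt)
  fix s assume s: "Re s > 1"
  have c0: "continuous_on {0..1} (\<lambda>u::real. 1 - complex_of_real u)" by (intro continuous_intros)
  have c1: "continuous_on {0..1} (\<lambda>u::real. complex_of_real (u / 2 - u^2 / 2))" by (intro continuous_intros) auto
  have d1: "((\<lambda>u::real. complex_of_real (u / 2 - u^2 / 2)) has_vector_derivative (1 - of_real u - 1 / 2)) (at u within {0..1})" for u :: real
  proof -
    have "((\<lambda>u::real. u / 2 - u^2 / 2) has_real_derivative (1 - u - 1 / 2)) (at u within {0..1})" by (auto intro!: derivative_eq_intros)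
    then have "((\<lambda>u. complex_of_real (u / 2 - u^2 / 2)) has_vector_derivative of_real (1 - u - 1 / 2)) (at u within {0..1})"
      by (rule has_vector_derivative_of_real)
    then show ?thesis by simp
  qed
  have d2: "((\<lambda>u. complex_of_real (bern2 u)) has_vector_derivative (complex_of_real (u / 2 - u^2 / 2) - 1 / 12)) (at u within {0..1})" for u :: real
  proof -
    have "(bern2 has_real_derivative (u / 2 - u^2 / 2 - 1 / 12)) (at u within {0..1})" unfolding bern2_def by (auto intro!: derivative_eq_intros)
    then have "((\<lambda>u. complex_of_real (bern2 u)) has_vector_derivative of_real (u / 2 - u^2 / 2 - 1 / 12)) (at u within {0..1})"
      by (rule has_vector_derivative_of_real)
    then show ?thesis by simp
  qed
  have nz: "s \<noteq> 0" "s + 1 \<noteq> 0" using s by (auto simp: complex_eq_iff)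
  have r1: "zseries (\<lambda>u. 1 - of_real u) (s + 1) = (1 / 2) / (s + 1 - 1) + (s + 1) * zseries (\<lambda>u. of_real (u / 2 - u^2 / 2)) (s + 1 + 1)"
    using s by (intro zseries_recursion c0 d1) (auto simp: power2_eq_square)
  have r2: "zseries (\<lambda>u. of_real (u / 2 - u^2 / 2)) (s + 1 + 1) = (1 / 12) / (s + 1 + 1 - 1) + (s + 1 + 1) * zseries (\<lambda>u. of_real (bern2 u)) (s + 1 + 1 + 1)"
    using s by (intro zseries_recursion c1 d2) (auto simp: bern2_def)
  have "riemann_zeta s = 1 / (s - 1) + s * zseries (\<lambda>u. 1 - of_real u) (s + 1)"
    using sums_unique2[OF riemann_zeta_sums[OF s] dirichlet_sums[OF s]] .
  also have "s * zseries (\<lambda>u. 1 - of_real u) (s + 1) = 1 / 2 + s / 12 + s * (s + 1) * (s + 2) * zseries (\<lambda>u. of_real (bern2 u)) (s + 3)"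
  proof -
    have "s + 1 + 1 = s + 2" "s + 1 + 1 + 1 = s + 3" "s + 1 - 1 = s" "s + 1 + 1 - 1 = s + 1" by simp_all
    then have "s * zseries (\<lambda>u. 1 - of_real u) (s + 1) = s * ((1 / 2) / s + (s + 1) * ((1 / 12) / (s + 1) + (s + 2) * zseries (\<lambda>u. of_real (bern2 u)) (s + 3)))"
      unfolding r1 r2 by (simp only:)
    also have "\<dots> = s * ((1 / 2) / s) + s * ((s + 1) * ((1 / 12) / (s + 1))) + s * (s + 1) * (s + 2) * zseries (\<lambda>u. of_real (bern2 u)) (s + 3)"
    proof -
      have "a * (x + b * (y + c * z)) = a * x + a * (b * y) + a * b * c * z" for a b c x y z :: complex by (simp add: algebra_simps)
      then show ?thesis .
    qed
    also have "(s + 1) * ((1 / 12) / (s + 1)) = 1 / 12"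
    proof -
      have "b * ((1 / 12) / b) = 1 / 12" if "b \<noteq> 0" for b :: complex using that by simp
      from this[OF nz(2)] show ?thesis .
    qed
    finally show ?thesis using nz(1) by simp
  qed
  finally show "riemann_zeta s = 1 / (s - 1) + 1 / 2 + s / 12 + s * (s + 1) * (s + 2) * zseries (\<lambda>u. of_real (bern2 u)) (s + 3)"
    by (simp add: add.assoc)
qed auto

text \<open>The factor s + 1 vanishes at - 1, so the derivative of the last term is s (s + 2) = - 1
  times the series at 2, without derivatives of the series. The elementary terms give - 1/4 + 1/12 =
  - 1/6.\<close>

lemma deriv_riemann_zeta: "deriv riemann_zeta (-1) = - 1 / 6 - zseries (\<lambda>u. of_real (bern2 u)) 2"
proof -
  let ?Z = "zseries (\<lambda>u. of_real (bern2 u))"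
  have c: "continuous_on {0..1} (\<lambda>u. complex_of_real (bern2 u))" unfolding bern2_def by (intro continuous_intros) auto
  have "?Z field_differentiable at 2"
    by (rule holomorphic_on_imp_differentiable_at[OF zseries_holomorphic[OF c] open_halfspace_Re_gt]) auto
  then obtain d where "(?Z has_field_derivative d) (at 2)" unfolding field_differentiable_def by blast
  then have "(?Z has_field_derivative d) (at (-1 + 3))" by simp
  then have Zd: "((\<lambda>s. ?Z (s + 3)) has_field_derivative d * (1 + 0)) (at (-1))"
    by (rule DERIV_chain2) (intro DERIV_add DERIV_ident DERIV_const)
  have D: "((\<lambda>s. 1 / (s - 1) + 1 / 2 + s / 12 + s * (s + 1) * (s + 2) * ?Z (s + 3)) has_field_derivative
      (- 1 / 6 - ?Z 2)) (at (-1))"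
    using Zd by (auto intro!: derivative_eq_intros simp: field_simps)
  have "\<forall>\<^sub>F s in nhds (-1). riemann_zeta s = 1 / (s - 1) + 1 / 2 + s / 12 + s * (s + 1) * (s + 2) * ?Z (s + 3)"
  proof -
    have "open {s. Re s > -2 \<and> Re s < 1}" by (intro open_Collect_conj open_halfspace_Re_gt open_halfspace_Re_lt)
    then have "\<forall>\<^sub>F s in nhds (-1). s \<in> {s. Re s > -2 \<and> Re s < 1}" by (rule eventually_nhds_in_open) auto
    then show ?thesis by eventually_elim (rule riemann_zeta_eq, auto)
  qed
  from deriv_cong_ev[OF this refl] DERIV_imp_deriv[OF D] show ?thesis by (rule trans)
qed

text \<open>The limit is the logarithm of the Glaisher-Kinkelin constant. The summands of the series
  for the derivative of zeta at - 1 have the closed form \<open>d\<close>, and \<open>d\<close> is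
  the increment of the expression on the left, so the series telescopes.\<close>

lemma glaisher:
  "(\<lambda>N. (\<Sum>n=1..N. real n * ln (real n)) - ((real N)^2 / 2 + real N / 2 + 1 / 12) * ln (real N) + (real N)^2 / 4)
    \<longlonglongrightarrow> 1 / 12 - Re (deriv riemann_zeta (-1))"
proof -
  define e where "e N = (\<Sum>n=1..N. real n * ln (real n)) - ((real N)^2 / 2 + real N / 2 + 1 / 12) * ln (real N) + (real N)^2 / 4" for N
  define d where "d a = (1 / 12 + a * (a + 1) / 2) * (ln a - ln (a + 1)) + a / 2 + 1 / 4" for a :: real
  have cb: "continuous_on {0..1} (\<lambda>u. complex_of_real (bern2 u))" unfolding bern2_def by (intro continuous_intros) auto
  have z: "zterm (\<lambda>u. of_real (bern2 u)) n 2 = of_real (d (real (Suc n)))" for n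
  proof -
    define a where "a = real (Suc n)"
    have a: "a > 0" unfolding a_def by simp
    \<comment> \<open>A primitive of \<open>bern2 u\<close> / (a + u)^2, found by integrating by
      parts twice; the second derivative 1/2 - u of \<open>bern2\<close> is written as (a + 1/2) -
      (a + u).\<close>
    let ?H = "\<lambda>u. - (bern2 u / (a + u)) + (u / 2 - u^2 / 2 - 1 / 12) * ln (a + u) - ((a + 1 / 2) * ((a + u) * ln (a + u) - (a + u)) - ((a + u)^2 / 2 * ln (a + u) - (a + u)^2 / 4))"
    have "(?H has_vector_derivative bern2 u / (a + u)^2) (at u within {0..1})" if u: "u \<in> {0..1}" for u
    proof -
      have x: "a + u > 0" using a u by simp
      have b: "(bern2 has_real_derivative (u / 2 - u^2 / 2 - 1 / 12)) (at u within {0..1})"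
        unfolding bern2_def by (auto intro!: derivative_eq_intros)
      have au: "((\<lambda>u. a + u) has_real_derivative 1) (at u within {0..1})" by (auto intro!: derivative_eq_intros)
      have l: "((\<lambda>u. ln (a + u)) has_real_derivative 1 / (a + u)) (at u within {0..1})"
        using x by (auto intro!: derivative_eq_intros)
      have p: "((\<lambda>u. u / 2 - u^2 / 2 - 1 / 12) has_real_derivative 1 / 2 - u) (at u within {0..1})"
        "((\<lambda>u. (a + u)\<^sup>2 / 2) has_real_derivative a + u) (at u within {0..1})" "((\<lambda>u. (a + u)\<^sup>2 / 4) has_real_derivative (a + u) / 2) (at u within {0..1})"
        by (auto intro!: derivative_eq_intros simp: field_simps)
      have "(?H has_real_derivative - (((u / 2 - u^2 / 2 - 1 / 12) * (a + u) - bern2 u * 1) / ((a + u) * (a + u)))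
        + ((1 / 2 - u) * ln (a + u) + 1 / (a + u) * (u / 2 - u^2 / 2 - 1 / 12))
        - ((a + 1 / 2) * ((1 * ln (a + u) + 1 / (a + u) * (a + u)) - 1) - (((a + u) * ln (a + u) + 1 / (a + u) * ((a + u)^2 / 2)) - (a + u) / 2))) (at u within {0..1})"
        using x by (intro DERIV_add DERIV_diff DERIV_minus DERIV_divide DERIV_mult DERIV_cmult b au l p) auto
      moreover have "- (((u / 2 - u^2 / 2 - 1 / 12) * X - B * 1) / (X * X))
        + ((1 / 2 - u) * L + 1 / X * (u / 2 - u^2 / 2 - 1 / 12))
        - ((a + 1 / 2) * ((1 * L + 1 / X * X) - 1) - ((X * L + 1 / X * (X^2 / 2)) - X / 2)) = B / X^2"
        if "X > 0" "X = a + u" for X B L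
      proof -
        have "- (((u / 2 - u^2 / 2 - 1 / 12) * X - B * 1) / (X * X)) = B / X^2 - 1 / X * (u / 2 - u^2 / 2 - 1 / 12)"
          using that by (simp add: diff_divide_distrib power2_eq_square)
        moreover have "1 / X * X = 1" "1 / X * (X^2 / 2) = X / 2" using that by (simp_all add: power2_eq_square)
        moreover have "(1 / 2 - u) * L - (a + 1 / 2) * L + X * L = 0" unfolding that(2) by (simp add: algebra_simps)
        ultimately show ?thesis by (simp add: algebra_simps)
      qed
      note this[OF x refl]
      ultimately have "(?H has_real_derivative bern2 u / (a + u)^2) (at u within {0..1})" by (simp only:)
      then show ?thesis by (simp add: has_real_derivative_iff_has_vector_derivative)
    qed
    then have "((\<lambda>u. bern2 u / (a + u)^2) has_integral (?H 1 - ?H 0)) {0..1}" by (intro fundamental_theorem_of_calculus) auto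
    also have "?H 1 - ?H 0 = d a" unfolding d_def bern2_def by (simp add: power2_eq_square power3_eq_cube field_simps)
    finally have "((\<lambda>u. complex_of_real (bern2 u / (a + u)^2)) has_integral of_real (d a)) {0..1}" by (rule has_integral_of_real)
    then have "((\<lambda>u. of_real (bern2 u) * zpow n 2 u) has_integral of_real (d a)) {0..1}"
    proof (rule has_integral_eq[rotated])
      fix u :: real assume "u \<in> {0..1}"
      then have x: "a + u > 0" using a by simp
      have "zpow n 2 u = of_real (exp (- (2 * ln (a + u))))" unfolding zpow_def a_def by (simp add: exp_of_real[symmetric])
      also have "exp (- (2 * ln (a + u))) = 1 / (a + u)^2"
        using x by (simp add: exp_minus inverse_eq_divide exp_double power2_eq_square)
      finally show "complex_of_real (bern2 u / (a + u)^2) = of_real (bern2 u) * zpow n 2 u" by simp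
    qed
    then show ?thesis unfolding zterm_def a_def by (rule integral_unique)
  qed
  let ?Z = "zseries (\<lambda>u. of_real (bern2 u)) 2"
  have "(\<lambda>n. zterm (\<lambda>u. of_real (bern2 u)) n 2) sums ?Z" by (rule zseries_sums[OF cb]) simp
  then have "(\<lambda>n. Re (of_real (d (real (Suc n))))) sums Re ?Z" unfolding z by (rule sums_Re)
  then have s: "(\<lambda>n. d (real (Suc n))) sums Re ?Z" by simp
  have step: "e (Suc (Suc k)) - e (Suc k) = d (real (Suc k))" for k
    unfolding e_def d_def by (simp add: power2_eq_square field_simps)
  have "(\<Sum>i<k. d (real (Suc i))) = e (Suc k) - e (Suc 0)" for k
  proof (induction k)
    case (Suc k) then show ?case using step[of k] by simp
  qed simp
  then have "(\<lambda>k. e (Suc k) - e (Suc 0)) \<longlonglongrightarrow> Re ?Z" using s unfolding sums_def by simp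
  from tendsto_add[OF this tendsto_const[of "e (Suc 0)"]] have "(\<lambda>k. e (Suc k)) \<longlonglongrightarrow> Re ?Z + e (Suc 0)" by simp
  moreover have "Re ?Z + e (Suc 0) = 1 / 12 - Re (deriv riemann_zeta (-1))" unfolding deriv_riemann_zeta e_def by simp
  ultimately have "e \<longlonglongrightarrow> 1 / 12 - Re (deriv riemann_zeta (-1))" by (metis LIMSEQ_imp_Suc)
  then show ?thesis unfolding e_def .
qed

section \<open>Binet's formula\<close>

text \<open>The remainder of \<sigma> / (exp \<sigma> - 1) after its Taylor polynomial of degree 2,
  so that division by \<sigma>^2 is harmless at 0.\<close>

definition binet :: "real \<Rightarrow> real" where
  "binet \<sigma> = \<sigma> / (exp \<sigma> - 1) - 1 + \<sigma> / 2 - \<sigma>^2 / 12"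

lemma nonneg_deriv_nonneg:
  fixes f f' :: "real \<Rightarrow> real"
  assumes "\<And>x. (f has_real_derivative f' x) (at x)" "\<And>x. x \<ge> 0 \<Longrightarrow> f' x \<ge> 0" "f 0 = 0" "x \<ge> 0"
  shows "f x \<ge> 0"
  using DERIV_nonneg_imp_nondecreasing[of 0 x f] assms by force

text \<open>Multiplied by exp \<sigma> - 1, both inequalities concern functions that vanish at 0
  together with their first two derivatives and have a nonnegative third derivative on the
  half-line.\<close>

lemma binet_bounds:
  assumes "\<sigma> > 0"
  shows "binet \<sigma> \<le> 0" "- binet \<sigma> \<le> \<sigma> ^ 3 / 12"
proof -
  have E: "exp \<sigma> - 1 > 0" using assms by simp
  let ?f = "\<lambda>x::real. (1 - x / 2 + x^2 / 12) * (exp x - 1) - x" and ?f1 = "\<lambda>x::real. exp x * (1 / 2 - x / 3 + x^2 / 12) - 1 / 2 - x / 6"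
    and ?f2 = "\<lambda>x::real. exp x * (1 / 6 - x / 6 + x^2 / 12) - 1 / 6"
  have d: "(?f has_real_derivative ?f1 x) (at x)" "(?f1 has_real_derivative ?f2 x) (at x)" "(?f2 has_real_derivative exp x * x^2 / 12) (at x)" for x
    by (auto intro!: derivative_eq_intros simp: field_simps)
  have f2: "?f2 x \<ge> 0" if "x \<ge> 0" for x by (rule nonneg_deriv_nonneg[where f = ?f2 and f' = "\<lambda>x::real. exp x * x^2 / 12"], rule d(3), simp, simp, rule that)
  have f1: "?f1 x \<ge> 0" if "x \<ge> 0" for x by (rule nonneg_deriv_nonneg[where f = ?f1 and f' = ?f2], rule d(2), rule f2, assumption, simp, rule that)
  have f: "?f x \<ge> 0" if "x \<ge> 0" for x by (rule nonneg_deriv_nonneg[where f = ?f and f' = ?f1], rule d(1), rule f1, assumption, simp, rule that)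
  let ?g = "\<lambda>x::real. x ^ 3 / 12 * (exp x - 1) - ?f x" and ?g1 = "\<lambda>x::real. x\<^sup>2 / 4 * (exp x - 1) + x ^ 3 / 12 * exp x - ?f1 x"
    and ?g2 = "\<lambda>x::real. x / 2 * (exp x - 1) + x^2 / 2 * exp x + x ^ 3 / 12 * exp x - ?f2 x"
    and ?g3 = "\<lambda>x::real. (exp x - 1) / 2 + 3 / 2 * x * exp x + 2 / 3 * x^2 * exp x + x ^ 3 / 12 * exp x"
  have dp: "((\<lambda>x::real. x ^ 3 / 12) has_real_derivative x\<^sup>2 / 4) (at x)" "((\<lambda>x::real. x\<^sup>2 / 4) has_real_derivative x / 2) (at x)"
    "((\<lambda>x::real. x / 2) has_real_derivative 1 / 2) (at x)" "((\<lambda>x::real. x\<^sup>2 / 2) has_real_derivative x) (at x)"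
    "((\<lambda>x::real. exp x - 1) has_real_derivative exp x) (at x)" for x
    by (auto intro!: derivative_eq_intros)
  have dg1: "(?g has_real_derivative ?g1 x) (at x)" for x
  proof -
    have "(?g has_real_derivative x\<^sup>2 / 4 * (exp x - 1) + exp x * (x ^ 3 / 12) - ?f1 x) (at x)" by (intro DERIV_diff DERIV_mult dp d(1))
    then show ?thesis by (rule DERIV_cong) simp
  qed
  have dg2: "(?g1 has_real_derivative ?g2 x) (at x)" for x
  proof -
    have "(?g1 has_real_derivative (x / 2 * (exp x - 1) + exp x * (x^2 / 4)) + (x^2 / 4 * exp x + exp x * (x ^ 3 / 12)) - ?f2 x) (at x)"
      by (intro DERIV_add DERIV_diff DERIV_mult dp d(2) DERIV_exp)
    then show ?thesis by (rule DERIV_cong) (simp add: algebra_simps)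
  qed
  have dg3: "(?g2 has_real_derivative ?g3 x) (at x)" for x
  proof -
    have "(?g2 has_real_derivative (1 / 2 * (exp x - 1) + exp x * (x / 2)) + (x * exp x + exp x * (x^2 / 2)) + (x^2 / 4 * exp x + exp x * (x ^ 3 / 12)) - exp x * x^2 / 12) (at x)"
      by (intro DERIV_add DERIV_diff DERIV_mult dp d(3) DERIV_exp)
    then show ?thesis by (rule DERIV_cong) (simp add: algebra_simps)
  qed
  have g2: "?g2 x \<ge> 0" if "x \<ge> 0" for x by (rule nonneg_deriv_nonneg[where f = ?g2 and f' = ?g3], rule dg3, simp, simp, rule that)
  have g1: "?g1 x \<ge> 0" if "x \<ge> 0" for x by (rule nonneg_deriv_nonneg[where f = ?g1 and f' = ?g2], rule dg2, rule g2, assumption, simp, rule that)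
  have g: "?g x \<ge> 0" if "x \<ge> 0" for x by (rule nonneg_deriv_nonneg[where f = ?g and f' = ?g1], rule dg1, rule g1, assumption, simp, rule that)
  have b: "- binet \<sigma> * (exp \<sigma> - 1) = ?f \<sigma>"
  proof -
    have "- (\<sigma> / e - 1 + \<sigma> / 2 - \<sigma>^2 / 12) * e = (1 - \<sigma> / 2 + \<sigma>^2 / 12) * e - \<sigma>" if "e > 0" for e
      using that by (simp add: algebra_simps)
    from this[OF E] show ?thesis unfolding binet_def .
  qed
  have "- binet \<sigma> * (exp \<sigma> - 1) \<ge> 0" "- binet \<sigma> * (exp \<sigma> - 1) \<le> \<sigma> ^ 3 / 12 * (exp \<sigma> - 1)"
    unfolding b using f[of \<sigma>] g[of \<sigma>] assms by auto
  then have "0 * (exp \<sigma> - 1) \<le> - binet \<sigma> * (exp \<sigma> - 1)" "- binet \<sigma> * (exp \<sigma> - 1) \<le> \<sigma> ^ 3 / 12 * (exp \<sigma> - 1)" by simp_all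
  from mult_right_le_imp_le[OF this(1) E] mult_right_le_imp_le[OF this(2) E]
  show "binet \<sigma> \<le> 0" "- binet \<sigma> \<le> \<sigma> ^ 3 / 12" by simp_all
qed

lemma binet_abs: "\<sigma> > 0 \<Longrightarrow> \<bar>binet \<sigma>\<bar> \<le> \<sigma> ^ 3 / 12"
  using binet_bounds[of \<sigma>] by linarith

lemma binet_measurable [measurable]: "binet \<in> borel_measurable borel"
  unfolding binet_def[abs_def] by measurable

text \<open>An unnormalised Erlang density; \<open>pos_exp_integral\<close> takes its total mass
  from the known moments of that distribution.\<close>

definition pos_exp :: "nat \<Rightarrow> real \<Rightarrow> real \<Rightarrow> real" where
  "pos_exp k a \<sigma> = indicator {0<..} \<sigma> * (\<sigma> ^ k * exp (- a * \<sigma>))"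

lemma pos_exp_nonneg: "pos_exp k a \<sigma> \<ge> 0"
  unfolding pos_exp_def by (auto simp: indicator_def)

lemma pos_exp_integral:
  assumes "a > 0"
  shows "has_bochner_integral lborel (pos_exp k a) (fact k / a ^ Suc k)"
proof (rule has_bochner_integral_nn_integral)
  show "pos_exp k a \<in> borel_measurable lborel" unfolding pos_exp_def[abs_def] by measurable
  have "(\<integral>\<^sup>+ x. ennreal (pos_exp k a x) \<partial>lborel) = (\<integral>\<^sup>+ x. ennreal (fact k / a ^ Suc k) * ennreal (erlang_density k a x) \<partial>lborel)"
  proof (rule nn_integral_cong_AE)
    show "AE x in lborel. ennreal (pos_exp k a x) = ennreal (fact k / a ^ Suc k) * ennreal (erlang_density k a x)"
      using AE_lborel_singleton[of 0]
    proof eventually_elim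
      case (elim x)
      then show ?case using assms by (simp add: pos_exp_def erlang_density_def indicator_def ennreal_mult[symmetric])
    qed
  qed
  also have "\<dots> = ennreal (fact k / a ^ Suc k) * (\<integral>\<^sup>+ x. ennreal (erlang_density k a x * x ^ 0) \<partial>lborel)"
    by (subst nn_integral_cmult) auto
  also have "\<dots> = ennreal (fact k / a ^ Suc k)" unfolding nn_integral_erlang_ith_moment[OF assms] by simp
  finally show "(\<integral>\<^sup>+ x. ennreal (pos_exp k a x) \<partial>lborel) = ennreal (fact k / a ^ Suc k)" .
qed (use assms in \<open>auto simp: pos_exp_nonneg\<close>)

text \<open>For k = 0 the remainder in Binet's formula, a Laplace transform; each derivative in x
  raises k by one and changes the sign.\<close>

definition binet_J :: "nat \<Rightarrow> real \<Rightarrow> real" where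
  "binet_J k x = (LINT \<sigma>|lborel. binet \<sigma> / \<sigma>^2 * pos_exp k x \<sigma>)"

lemma binet_integrand_bound: "\<bar>binet \<sigma> / \<sigma>^2 * pos_exp k x \<sigma>\<bar> \<le> pos_exp (Suc k) x \<sigma> / 12"
proof (cases "\<sigma> > 0")
  case True
  then have "\<bar>binet \<sigma> / \<sigma>^2\<bar> \<le> \<sigma> ^ 3 / 12 / \<sigma>^2" unfolding abs_divide abs_power2 by (intro divide_right_mono binet_abs[OF True]) simp
  also have "\<dots> = \<sigma> / 12" using True by (simp add: power2_eq_square power3_eq_cube)
  finally have "\<bar>binet \<sigma> / \<sigma>^2\<bar> * pos_exp k x \<sigma> \<le> \<sigma> / 12 * pos_exp k x \<sigma>" by (intro mult_right_mono pos_exp_nonneg)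
  then show ?thesis unfolding abs_mult using pos_exp_nonneg[of k x \<sigma>] by (simp add: pos_exp_def mult_ac)
qed (simp add: pos_exp_def)

lemma pos_exp_measurable [measurable]: "pos_exp k x \<in> borel_measurable borel"
  unfolding pos_exp_def[abs_def] by measurable

lemma binet_integrable:
  assumes "x > 0"
  shows "integrable lborel (\<lambda>\<sigma>. binet \<sigma> / \<sigma>^2 * pos_exp k x \<sigma>)"
proof (rule Bochner_Integration.integrable_bound)
  show "integrable lborel (\<lambda>\<sigma>. pos_exp (Suc k) x \<sigma> / 12)"
    using pos_exp_integral[OF assms, of "Suc k"] by (auto simp: has_bochner_integral_iff)
  show "AE \<sigma> in lborel. norm (binet \<sigma> / \<sigma>^2 * pos_exp k x \<sigma>) \<le> norm (pos_exp (Suc k) x \<sigma> / 12)"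
    using binet_integrand_bound by (intro AE_I2) (simp add: order_trans[OF _ abs_ge_self])
qed measurable

lemma binet_J_bound:
  assumes "x > 0"
  shows "\<bar>binet_J 0 x\<bar> \<le> 1 / (12 * x^2)"
    and "(LINT \<sigma>|lborel. norm (binet \<sigma> / \<sigma>^2 * pos_exp 0 x \<sigma>)) \<le> 1 / (12 * x^2)"
proof -
  have i: "integrable lborel (\<lambda>\<sigma>. pos_exp 1 x \<sigma> / 12)" "(LINT \<sigma>|lborel. pos_exp 1 x \<sigma> / 12) = 1 / (12 * x^2)"
    using pos_exp_integral[OF assms, of 1] by (auto simp: has_bochner_integral_iff power2_eq_square)
  show "(LINT \<sigma>|lborel. norm (binet \<sigma> / \<sigma>^2 * pos_exp 0 x \<sigma>)) \<le> 1 / (12 * x^2)"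
    unfolding i(2)[symmetric]
    by (rule integral_mono[OF integrable_norm[OF binet_integrable[OF assms]] i(1)])
      (simp only: real_norm_def binet_integrand_bound One_nat_def)
  moreover have "\<bar>binet_J 0 x\<bar> \<le> (LINT \<sigma>|lborel. norm (binet \<sigma> / \<sigma>^2 * pos_exp 0 x \<sigma>))"
    unfolding binet_J_def using integral_norm_bound[of lborel "\<lambda>\<sigma>. binet \<sigma> / \<sigma>^2 * pos_exp 0 x \<sigma>"] by simp
  ultimately show "\<bar>binet_J 0 x\<bar> \<le> 1 / (12 * x^2)" by linarith
qed

lemma DERIV_binet_J:
  assumes x: "x > 0"
  shows "(binet_J k has_real_derivative - binet_J (Suc k) x) (at x)"
proof -
  have "((\<lambda>x. LINT \<sigma>|lborel. binet \<sigma> / \<sigma>^2 * pos_exp k x \<sigma>) has_real_derivative (LINT \<sigma>|lborel. - (binet \<sigma> / \<sigma>^2 * pos_exp (Suc k) x \<sigma>))) (at x)"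
  proof (rule has_real_derivative_integral[where d = "x / 2" and w = "\<lambda>\<sigma>. pos_exp (Suc (Suc k)) (x / 2) \<sigma> / 12"])
    fix y assume y: "\<bar>y - x\<bar> < x / 2"
    then have y2: "y > x / 2" by linarith
    then show "integrable lborel (\<lambda>\<sigma>. binet \<sigma> / \<sigma>^2 * pos_exp k y \<sigma>)" using x by (intro binet_integrable) auto
    fix \<sigma> :: real
    show "((\<lambda>y. binet \<sigma> / \<sigma>^2 * pos_exp k y \<sigma>) has_real_derivative - (binet \<sigma> / \<sigma>^2 * pos_exp (Suc k) y \<sigma>)) (at y)"
    proof -
      have "((\<lambda>y. pos_exp k y \<sigma>) has_real_derivative - pos_exp (Suc k) y \<sigma>) (at y)"
        unfolding pos_exp_def by (auto intro!: derivative_eq_intros)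
      from DERIV_cmult[OF this, of "binet \<sigma> / \<sigma>^2"] show ?thesis by (simp only: mult_minus_right)
    qed
    have "pos_exp (Suc (Suc k)) y \<sigma> \<le> pos_exp (Suc (Suc k)) (x / 2) \<sigma>"
      unfolding pos_exp_def using y2 by (auto simp: indicator_def intro!: mult_left_mono)
    with binet_integrand_bound[of \<sigma> "Suc k" y]
    show "\<bar>- (binet \<sigma> / \<sigma>^2 * pos_exp (Suc k) y \<sigma>)\<bar> \<le> pos_exp (Suc (Suc k)) (x / 2) \<sigma> / 12" by simp
  next
    show "integrable lborel (\<lambda>\<sigma>. pos_exp (Suc (Suc k)) (x / 2) \<sigma> / 12)"
      using pos_exp_integral[of "x / 2" "Suc (Suc k)"] x by (auto simp: has_bochner_integral_iff)
    show "(\<lambda>\<sigma>. - (binet \<sigma> / \<sigma>^2 * pos_exp (Suc k) x \<sigma>)) \<in> borel_measurable lborel" by measurable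
  qed (use x in auto)
  then show ?thesis unfolding binet_J_def[abs_def] by simp
qed

lemma exp_geometric_sums:
  assumes "\<tau> > 0"
  shows "(\<lambda>n. exp (- (real (Suc n) * \<tau>))) sums (1 / (exp \<tau> - 1))"
proof -
  define q where "q = exp (- \<tau>)"
  have q: "q < 1" "q > 0" unfolding q_def using assms by auto
  have "(\<lambda>n. q * q ^ n) sums (q * (1 / (1 - q)))" using q by (intro sums_mult geometric_sums) auto
  moreover have "q * q ^ n = exp (- (real (Suc n) * \<tau>))" for n
    unfolding q_def by (simp add: exp_of_nat_mult[symmetric] exp_add[symmetric] algebra_simps)
  moreover have "q * (1 / (1 - q)) = 1 / (exp \<tau> - 1)"
    unfolding q_def using assms by (simp add: exp_minus field_simps)
  ultimately show ?thesis by simp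
qed

text \<open>The geometric series of 1 / (exp \<sigma> - 1), integrated term by term, gives the
  series of the trigamma function; the three other terms of \<open>binet\<close> have elementary
  integrals.\<close>

lemma Polygamma_integral:
  assumes x: "x > 0"
  shows "binet_J 2 x = Polygamma 1 (1 + x) - 1 / x + 1 / (2 * x^2) - 1 / (6 * x ^ 3)"
proof -
  let ?f = "\<lambda>n. pos_exp 1 (x + real (Suc n))"
  have hb: "has_bochner_integral lborel (?f n) (1 / (x + real (Suc n))^2)" for n
    using pos_exp_integral[of "x + real (Suc n)" 1] x by (simp add: power2_eq_square)
  have int: "integrable lborel (?f n)" "(LINT \<sigma>|lborel. ?f n \<sigma>) = 1 / (x + real (Suc n))^2" for n
    using hb[of n] by (auto simp: has_bochner_integral_iff)
  have P: "(\<lambda>n. 1 / (x + real (Suc n))^2) sums Polygamma 1 (1 + x)"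
    using Polygamma_LIMSEQ[of "1 + x" 1] x by (simp add: inverse_eq_divide numeral_2_eq_2 add_ac)
  have pt: "(\<lambda>n. ?f n \<sigma>) sums (\<sigma> / (exp \<sigma> - 1) * pos_exp 0 x \<sigma>)" for \<sigma>
  proof (cases "\<sigma> > 0")
    case True
    from sums_mult[OF exp_geometric_sums[OF True], of "\<sigma> * exp (- x * \<sigma>)"] True
    show ?thesis unfolding pos_exp_def by (simp add: exp_add[symmetric] algebra_simps)
  qed (simp add: pos_exp_def)
  have "(\<lambda>n. LINT \<sigma>|lborel. ?f n \<sigma>) sums (LINT \<sigma>|lborel. (\<Sum>n. ?f n \<sigma>))"
    and i0: "integrable lborel (\<lambda>\<sigma>. \<Sum>n. ?f n \<sigma>)"
  proof -
    have *: "AE \<sigma> in lborel. summable (\<lambda>n. norm (?f n \<sigma>))" "summable (\<lambda>n. LINT \<sigma>|lborel. norm (?f n \<sigma>))"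
      unfolding real_norm_def abs_of_nonneg[OF pos_exp_nonneg] int(2) by (intro AE_I2 sums_summable[OF pt]) (rule sums_summable[OF P])
    show "(\<lambda>n. LINT \<sigma>|lborel. ?f n \<sigma>) sums (LINT \<sigma>|lborel. (\<Sum>n. ?f n \<sigma>))" "integrable lborel (\<lambda>\<sigma>. \<Sum>n. ?f n \<sigma>)"
      by (rule sums_integral[OF int(1) *] integrable_suminf[OF int(1) *])+
  qed
  then have 1: "(LINT \<sigma>|lborel. \<sigma> / (exp \<sigma> - 1) * pos_exp 0 x \<sigma>) = Polygamma 1 (1 + x)"
    and i1: "integrable lborel (\<lambda>\<sigma>. \<sigma> / (exp \<sigma> - 1) * pos_exp 0 x \<sigma>)"
    using sums_unique2[OF _ P] unfolding int(2) sums_unique[OF pt, symmetric] by auto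
  note h = pos_exp_integral[OF x, unfolded has_bochner_integral_iff]
  have eq: "binet \<sigma> / \<sigma>^2 * pos_exp 2 x \<sigma> = \<sigma> / (exp \<sigma> - 1) * pos_exp 0 x \<sigma> - pos_exp 0 x \<sigma> + pos_exp 1 x \<sigma> / 2 - pos_exp 2 x \<sigma> / 12" for \<sigma>
  proof (cases "\<sigma> > 0")
    case True
    then have "binet \<sigma> / \<sigma>^2 * pos_exp 2 x \<sigma> = binet \<sigma> * exp (- x * \<sigma>)" by (simp add: pos_exp_def)
    also have "\<dots> = \<sigma> / (exp \<sigma> - 1) * pos_exp 0 x \<sigma> - pos_exp 0 x \<sigma> + pos_exp 1 x \<sigma> / 2 - pos_exp 2 x \<sigma> / 12"
      using True unfolding binet_def by (simp add: pos_exp_def algebra_simps)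
    finally show ?thesis .
  qed (simp add: pos_exp_def)
  have "binet_J 2 x = Polygamma 1 (1 + x) - fact 0 / x ^ Suc 0 + fact 1 / x ^ Suc 1 / 2 - fact 2 / x ^ Suc 2 / 12"
    unfolding binet_J_def eq using h[of 0] h[of 1] h[of 2] i1 1 by simp
  then show ?thesis by (simp add: power2_eq_square power3_eq_cube)
qed

lemma ln_stirling: "(\<lambda>n. ln (fact n) - (real n * ln (real n) - real n + ln (real n) / 2)) \<longlonglongrightarrow> ln (2 * pi) / 2"
proof -
  have "(\<lambda>n. ln (fact n / laplace_scale n)) \<longlonglongrightarrow> ln (sqrt (2 * pi))"
    by (intro tendsto_ln stirling) simp
  moreover have "ln (sqrt (2 * pi)) = ln (2 * pi) / 2" by (simp add: ln_sqrt)
  ultimately have "(\<lambda>n. ln (fact n / laplace_scale n)) \<longlonglongrightarrow> ln (2 * pi) / 2" by (simp only:)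
  then show ?thesis
  proof (rule Lim_transform_eventually)
    show "\<forall>\<^sub>F n in sequentially. ln (fact n / laplace_scale n) = ln (fact n) - (real n * ln (real n) - real n + ln (real n) / 2)"
      using eventually_gt_at_top[of 0]
    proof eventually_elim
      case (elim n)
      then have "ln (laplace_scale n) = real n * ln (real n) - real n + ln (real n) / 2"
        unfolding laplace_scale_def by (simp add: ln_mult ln_realpow ln_sqrt)
      moreover have "laplace_scale n > 0" unfolding laplace_scale_def using elim by simp
      ultimately show ?case by (simp add: ln_div)
    qed
  qed
qed

text \<open>Both sides have the same second derivative, by \<open>Polygamma_integral\<close>, so
  they differ by an affine function. Stirling's formula along the integers forces this function to
  tend to 0, hence to be 0.\<close>

theorem binet_formula:
  assumes x: "x > 0"
  shows "ln (Gamma (1 + x)) = x * ln x - x + ln (2 * pi * x) / 2 + 1 / (12 * x) + binet_J 0 x"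
proof -
  define H where "H x = ln_Gamma (1 + x) - (x * ln x - x + (ln (2 * pi) + ln x) / 2 + 1 / 12 * inverse x) - binet_J 0 x" for x :: real
  define H1 where "H1 x = Digamma (1 + x) - (ln x + 1 / 2 * inverse x - 1 / 12 * (inverse x)^2) + binet_J 1 x" for x :: real
  have d1: "(H has_real_derivative H1 x) (at x)" if "x > 0" for x
    unfolding H_def[abs_def] H1_def using that DERIV_binet_J[OF that, of 0]
    by (auto intro!: derivative_eq_intros simp: power2_eq_square inverse_eq_divide field_simps)
  have d2: "(H1 has_real_derivative 0) (at x)" if "x > 0" for x
  proof -
    have n: "1 + x \<notin> \<int>\<^sub>\<le>\<^sub>0" using that by (auto elim!: nonpos_Ints_cases)
    have "(H1 has_real_derivative Polygamma 1 (1 + x) * 1 - (inverse x - 1 / 2 * (inverse x)^2 + 1 / 6 * inverse x ^ 3) - binet_J 2 x) (at x)"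
      unfolding H1_def[abs_def]
      using that n DERIV_binet_J[OF that, of 1]
      by (auto intro!: derivative_eq_intros DERIV_chain2[OF has_field_derivative_Polygamma] simp: power2_eq_square power3_eq_cube numeral_2_eq_2 inverse_eq_divide)
    then show ?thesis unfolding Polygamma_integral[OF that] by (rule DERIV_cong) (simp add: inverse_eq_divide power_one_over)
  qed
  obtain c1 where c1: "\<And>x. x > 0 \<Longrightarrow> H1 x = c1"
    using has_field_derivative_zero_constant[of "{0<..}" H1] d2 by (auto intro: has_field_derivative_at_within)
  have "((\<lambda>x. H x - c1 * x) has_real_derivative 0) (at x)" if "x > 0" for x
    using d1[OF that] c1[OF that] by (auto intro!: derivative_eq_intros)
  then obtain c0 where c0: "\<And>x. x > 0 \<Longrightarrow> H x - c1 * x = c0"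
    using has_field_derivative_zero_constant[of "{0<..}" "\<lambda>x. H x - c1 * x"] by (auto intro: has_field_derivative_at_within)
  have J0: "(\<lambda>n. binet_J 0 (real n)) \<longlonglongrightarrow> 0"
  proof (rule Lim_null_comparison)
    show "\<forall>\<^sub>F n in sequentially. norm (binet_J 0 (real n)) \<le> 1 / (12 * (real n)^2)"
      using eventually_gt_at_top[of 0] by eventually_elim (use binet_J_bound(1) in auto)
    show "(\<lambda>n. 1 / (12 * (real n)^2)) \<longlonglongrightarrow> 0" by real_asymp
  qed
  have "(\<lambda>n. ln (fact n) - (real n * ln (real n) - real n + ln (real n) / 2) - ln (2 * pi) / 2 - 1 / (12 * real n) - binet_J 0 (real n)) \<longlonglongrightarrow> ln (2 * pi) / 2 - ln (2 * pi) / 2 - 0 - 0"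
    by (intro tendsto_diff ln_stirling J0 tendsto_const) real_asymp
  then have "(\<lambda>n. ln (fact n) - (real n * ln (real n) - real n + ln (real n) / 2) - ln (2 * pi) / 2 - 1 / (12 * real n) - binet_J 0 (real n)) \<longlonglongrightarrow> 0" by simp
  then have H0: "(\<lambda>n. H (real n)) \<longlonglongrightarrow> 0"
  proof (rule Lim_transform_eventually)
    show "\<forall>\<^sub>F n in sequentially. ln (fact n) - (real n * ln (real n) - real n + ln (real n) / 2) - ln (2 * pi) / 2 - 1 / (12 * real n) - binet_J 0 (real n) = H (real n)"
      using eventually_gt_at_top[of 0]
    proof eventually_elim
      case (elim n)
      have "ln_Gamma (1 + real n) = ln (fact n)" using ln_Gamma_real_conv_fact[of "Suc n"] by (simp add: add.commute)
      then show ?case unfolding H_def using elim by (simp add: add_divide_distrib inverse_eq_divide)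
    qed
  qed
  have Hn: "H (real n) = c1 * real n + c0" if "n > 0" for n using c0[of "real n"] that by simp
  have "c1 = 0"
  proof (rule LIMSEQ_unique)
    have "(\<lambda>n. H (real n) * (1 / real n) - c0 * (1 / real n)) \<longlonglongrightarrow> 0 * 0 - c0 * 0"
      by (intro tendsto_diff tendsto_mult H0 tendsto_const) real_asymp+
    then have "(\<lambda>n. H (real n) * (1 / real n) - c0 * (1 / real n)) \<longlonglongrightarrow> 0" by simp
    then show "(\<lambda>n. c1) \<longlonglongrightarrow> 0"
    proof (rule Lim_transform_eventually)
      show "\<forall>\<^sub>F n in sequentially. H (real n) * (1 / real n) - c0 * (1 / real n) = c1"
        using eventually_gt_at_top[of 0] by eventually_elim (simp add: Hn field_simps)
    qed
  qed simp
  moreover have "c0 = 0"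
  proof (rule LIMSEQ_unique[OF _ H0])
    show "(\<lambda>n. H (real n)) \<longlonglongrightarrow> c0"
    proof (rule Lim_transform_eventually[OF tendsto_const])
      show "\<forall>\<^sub>F n in sequentially. c0 = H (real n)" using eventually_gt_at_top[of 0] by eventually_elim (simp add: Hn \<open>c1 = 0\<close>)
    qed
  qed
  ultimately have "H x = 0" using c0[OF x] by simp
  moreover have "ln (2 * pi * x) = ln (2 * pi) + ln x" using x by (simp add: ln_mult)
  ultimately show ?thesis unfolding H_def using ln_Gamma_real_pos[of "1 + x"] x by (simp add: inverse_eq_divide)
qed

section \<open>The constant \<open>kappa\<close>\<close>

text \<open>The geometric series of 1 / (exp(\<beta> \<sigma>) - 1) turns the integral into the sum
  of the Binet remainders at j \<beta>, j \<ge> 1; their bound by a multiple of 1 / j^2 justifies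
  the exchange of sum and integral.\<close>

lemma kappa_integrable:
  assumes \<beta>: "\<beta> > 0"
  shows "set_integrable lborel {0<..} (kappa_integrand \<beta>)"
    and "(\<lambda>n. binet_J 0 (real (Suc n) * \<beta>)) sums (LINT \<sigma> : {0<..} | lborel. kappa_integrand \<beta> \<sigma>)"
proof -
  let ?f = "\<lambda>n \<sigma>. binet \<sigma> / \<sigma>^2 * pos_exp 0 (real (Suc n) * \<beta>) \<sigma>"
  have p: "real (Suc n) * \<beta> > 0" for n using \<beta> by simp
  have pt: "(\<lambda>n. ?f n \<sigma>) sums (indicator {0<..} \<sigma> *\<^sub>R kappa_integrand \<beta> \<sigma>)" for \<sigma>
  proof (cases "\<sigma> > 0")
    case True
    then have "\<beta> * \<sigma> > 0" using \<beta> by simp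
    from sums_mult[OF exp_geometric_sums[OF this], of "binet \<sigma> / \<sigma>^2"] True
    show ?thesis unfolding pos_exp_def kappa_integrand_def binet_def by (simp add: mult_ac)
  qed (simp add: pos_exp_def)
  have *: "AE \<sigma> in lborel. summable (\<lambda>n. norm (?f n \<sigma>))"
  proof (intro AE_I2)
    fix \<sigma> :: real
    show "summable (\<lambda>n. norm (?f n \<sigma>))"
    proof (cases "\<sigma> > 0")
      case True
      then have "\<beta> * \<sigma> > 0" using \<beta> by simp
      from sums_mult[OF exp_geometric_sums[OF this], of "\<bar>binet \<sigma> / \<sigma>^2\<bar>"] True
      show ?thesis unfolding pos_exp_def by (intro sums_summable) (auto simp: abs_mult mult_ac)
    qed (simp add: pos_exp_def)
  qed
  have **: "summable (\<lambda>n. LINT \<sigma>|lborel. norm (?f n \<sigma>))"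
  proof (rule summable_comparison_test')
    have "summable (\<lambda>n. 1 / (12 * \<beta>^2) * inverse ((real (Suc n))^2))"
      using inverse_power_summable[of 2, where 'a = real] by (intro summable_mult) (simp add: summable_Suc_iff[of "\<lambda>n. inverse ((real n)^2)"] del: of_nat_Suc)
    then show "summable (\<lambda>n. 1 / (12 * (real (Suc n) * \<beta>)^2))" by (simp add: power_mult_distrib inverse_eq_divide mult_ac)
    show "norm (LINT \<sigma>|lborel. norm (?f n \<sigma>)) \<le> 1 / (12 * (real (Suc n) * \<beta>)^2)" for n
      using binet_J_bound(2)[OF p, of n] by (subst real_norm_def, subst abs_of_nonneg) (auto intro!: integral_nonneg_AE)
  qed
  from integrable_suminf[OF binet_integrable[OF p] * **]
  show "set_integrable lborel {0<..} (kappa_integrand \<beta>)" unfolding set_integrable_def sums_unique[OF pt, symmetric] .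
  from sums_integral[OF binet_integrable[OF p] * **]
  show "(\<lambda>n. binet_J 0 (real (Suc n) * \<beta>)) sums (LINT \<sigma> : {0<..} | lborel. kappa_integrand \<beta> \<sigma>)"
    unfolding set_lebesgue_integral_def sums_unique[OF pt, symmetric] binet_J_def .
qed

definition kappa_poly :: "real \<Rightarrow> nat \<Rightarrow> real" where
  "kappa_poly \<beta> N = \<beta> * (((real N)^2 / 2 + real N / 2 + 1 / 12) * ln (real N) - (real N)^2 / 4) + \<beta> * (ln \<beta> - 1) * ((real N)^2 + real N) / 2
     + real N * ln (2 * pi * \<beta>) / 2 + (real N * ln (real N) - real N + ln (real N) / 2) / 2 + ln (real N) / (12 * \<beta>)"

text \<open>Binet's formula for every factor leaves the sums of j ln j, ln j, 1 / j and of the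
  remainders. Their constant terms are given by \<open>glaisher\<close>, Stirling's formula, Euler's
  constant and the integral, the four parts of \<open>kappa\<close>.\<close>

theorem ln_Gamma_product_asymptotics:
  assumes \<beta>: "\<beta> > 0"
  shows "(\<lambda>N. (\<Sum>j=1..N. ln (Gamma (1 + real j * \<beta>))) - kappa_poly \<beta> N) \<longlonglongrightarrow> kappa \<beta>"
proof -
  let ?G = "\<lambda>N. (\<Sum>n=1..N. real n * ln (real n)) - ((real N)^2 / 2 + real N / 2 + 1 / 12) * ln (real N) + (real N)^2 / 4"
  have J: "(\<lambda>N. \<Sum>j=1..N. binet_J 0 (real j * \<beta>)) \<longlonglongrightarrow> (LINT \<sigma> : {0<..} | lborel. kappa_integrand \<beta> \<sigma>)"
  proof -
    have "(\<Sum>j=1..N. binet_J 0 (real j * \<beta>)) = (\<Sum>n<N. binet_J 0 (real (Suc n) * \<beta>))" for N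
      by (induction N) auto
    then show ?thesis using kappa_integrable(2)[OF \<beta>] unfolding sums_def by simp
  qed
  have "(\<lambda>N. \<beta> * ?G N + (ln (fact N) - (real N * ln (real N) - real N + ln (real N) / 2)) / 2 + (harm N - ln (of_nat N)) / (12 * \<beta>)
      + (\<Sum>j=1..N. binet_J 0 (real j * \<beta>))) \<longlonglongrightarrow>
    \<beta> * (1 / 12 - Re (deriv riemann_zeta (-1))) + (ln (2 * pi) / 2) / 2 + euler_mascheroni / (12 * \<beta>) + (LINT \<sigma> : {0<..} | lborel. kappa_integrand \<beta> \<sigma>)"
    using \<beta> by (intro tendsto_add tendsto_mult tendsto_divide tendsto_const glaisher ln_stirling euler_mascheroni_LIMSEQ J) auto
  moreover have "\<beta> * (1 / 12 - Re (deriv riemann_zeta (-1))) + (ln (2 * pi) / 2) / 2 + euler_mascheroni / (12 * \<beta>) + (LINT \<sigma> : {0<..} | lborel. kappa_integrand \<beta> \<sigma>) = kappa \<beta>"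
    unfolding kappa_def by simp
  moreover have "\<beta> * ?G N + (ln (fact N) - (real N * ln (real N) - real N + ln (real N) / 2)) / 2 + (harm N - ln (of_nat N)) / (12 * \<beta>)
      + (\<Sum>j=1..N. binet_J 0 (real j * \<beta>)) = (\<Sum>j=1..N. ln (Gamma (1 + real j * \<beta>))) - kappa_poly \<beta> N" for N
  proof -
    have "ln (Gamma (1 + real j * \<beta>)) = \<beta> * (real j * ln (real j)) + \<beta> * (ln \<beta> - 1) * real j + ln (2 * pi * \<beta>) / 2 + ln (real j) / 2 + inverse (real j) / (12 * \<beta>)
        + binet_J 0 (real j * \<beta>)" if "j \<in> {1..N}" for j
    proof -
      have j: "real j > 0" using that by simp
      then have l: "ln (real j * \<beta>) = ln (real j) + ln \<beta>" using \<beta> by (simp add: ln_mult)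
      have "2 * pi * (real j * \<beta>) = (2 * pi * \<beta>) * real j" by simp
      then have l2: "ln (2 * pi * (real j * \<beta>)) = ln (2 * pi * \<beta>) + ln (real j)" using \<beta> j by (simp only: ln_mult_pos pi_gt_zero mult_pos_pos zero_less_numeral)
      have "ln (Gamma (1 + real j * \<beta>)) = real j * \<beta> * ln (real j * \<beta>) - real j * \<beta> + ln (2 * pi * (real j * \<beta>)) / 2 + 1 / (12 * (real j * \<beta>)) + binet_J 0 (real j * \<beta>)"
        using \<beta> j by (intro binet_formula) simp
      then show ?thesis unfolding l l2 by (simp add: algebra_simps add_divide_distrib inverse_eq_divide)
    qed
    then have "(\<Sum>j=1..N. ln (Gamma (1 + real j * \<beta>))) = (\<Sum>j=1..N. \<beta> * (real j * ln (real j)) + \<beta> * (ln \<beta> - 1) * real j + ln (2 * pi * \<beta>) / 2 + ln (real j) / 2 + inverse (real j) / (12 * \<beta>)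
        + binet_J 0 (real j * \<beta>))" by (intro sum.cong) auto
    also have "\<dots> = \<beta> * (\<Sum>j=1..N. real j * ln (real j)) + \<beta> * (ln \<beta> - 1) * (\<Sum>j=1..N. real j) + real N * (ln (2 * pi * \<beta>) / 2) + (\<Sum>j=1..N. ln (real j)) / 2
        + (\<Sum>j=1..N. inverse (real j)) / (12 * \<beta>) + (\<Sum>j=1..N. binet_J 0 (real j * \<beta>))"
      by (simp add: sum.distrib sum_distrib_left sum_divide_distrib)
    also have "(\<Sum>j=1..N. real j) = ((real N)^2 + real N) / 2" by (induction N) (auto simp: power2_eq_square field_simps)
    also have "(\<Sum>j=1..N. ln (real j)) = ln (fact N)" by (induction N) (auto simp: ln_mult)
    also have "(\<Sum>j=1..N. inverse (real j)) = harm N" unfolding harm_def by simp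
    finally show ?thesis unfolding kappa_poly_def by (simp add: algebra_simps add_divide_distrib diff_divide_distrib)
  qed
  ultimately show ?thesis by simp
qed

lemma has_finite_part_kappa:
  assumes \<beta>: "\<beta> > 0"
  shows "has_finite_part (\<lambda>N. \<Sum>j=1..N. ln (Gamma (1 + real j * \<beta>))) (kappa \<beta>)"
proof -
  define c :: "nat \<Rightarrow> nat \<Rightarrow> real" where "c i j =
     (if (i, j) = (2, 1) then \<beta> / 2 else if (i, j) = (1, 1) then \<beta> / 2 + 1 / 2 else if (i, j) = (0, 1) then \<beta> / 12 + 1 / 4 + 1 / (12 * \<beta>)
      else if (i, j) = (2, 0) then - \<beta> / 4 + \<beta> * (ln \<beta> - 1) / 2 else if (i, j) = (1, 0) then \<beta> * (ln \<beta> - 1) / 2 + ln (2 * pi * \<beta>) / 2 - 1 / 2 else 0)" for i j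
  have S: "{..2} \<times> {..2} - {(0, 0)} = {(0, 1), (0, 2), (1, 0), (1, 1), (1, 2), (2, 0), (2, 1), (2 :: nat, 2 :: nat)}"
  proof -
    have "{..2::nat} = {0, 1, 2}" by (auto simp: numeral_2_eq_2)
    then show ?thesis by auto
  qed
  have "(\<Sum>(i, j)\<in>{..2} \<times> {..2} - {(0, 0)}. c i j * real N ^ i * ln (real N) ^ j) = kappa_poly \<beta> N" for N
    unfolding S kappa_poly_def by (simp add: c_def field_simps)
  then show ?thesis unfolding has_finite_part_def using ln_Gamma_product_asymptotics[OF \<beta>]
    by (intro exI[of _ 2] exI[of _ c]) simp
qed

section \<open>The one-cut expansion and the edge limit\<close>

text \<open>\<open>gE0\<close>, \<open>gE1\<close> and \<open>gE2\<close> are the coefficients of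
  N^2, N and 1 in ln P_N, and \<open>qE\<close> is that of ln N; 3 u - 1 / u with u =
  \<open>cu m\<close> is the cut-off over sqrt t. The constants - 3/4 and - 1/2 come from the
  Stirling parts of the Gamma factors.\<close>

definition gE0 :: "real \<Rightarrow> real \<Rightarrow> real" where
  "gE0 \<beta> m = wS0 \<beta> m + \<beta> * (ln (cu m) - (3 * cu m - 1 / cu m)^2 / 2 - 3 / 4)"

definition gE1 :: "real \<Rightarrow> real \<Rightarrow> real" where
  "gE1 \<beta> m = (1 - \<beta>) * (wg1 (rho m) + ln (cu m) - 1 / 2)"

definition gE2 :: "real \<Rightarrow> real \<Rightarrow> real" where
  "gE2 \<beta> m = wG2 (1 / \<beta> - 1) (rho m) + kappa \<beta> - ln (2 * pi * \<beta>) / 2"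

definition qE :: "real \<Rightarrow> real" where "qE \<beta> = \<beta> / 12 + 1 / (12 * \<beta>) - 1 / 4"

lemma ln_mehta:
  assumes \<beta>: "\<beta> > 0" and N: "N > 0"
  shows "ln (mehta \<beta> N) = real N * ln (2 * pi) / 2 + ln (laguerre \<beta> N 0) - (\<Sum>j=1..N. ln (Gamma (1 + real j * \<beta>))) + ln (Gamma (1 + real N * \<beta>))"
proof -
  have G: "Gamma (1 + \<beta> * real j) > 0" for j using \<beta> by (intro Gamma_real_pos add_pos_nonneg) auto
  have "ln (\<Prod>j<N. Gamma (1 + \<beta> * real j)) = (\<Sum>j<N. ln (Gamma (1 + \<beta> * real j)))"
    by (rule ln_prod) (simp_all add: G G[THEN less_imp_neq, THEN not_sym])
  also have "\<dots> = (\<Sum>j=1..N. ln (Gamma (1 + real j * \<beta>))) - ln (Gamma (1 + real N * \<beta>))"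
    by (induction N) (auto simp: mult.commute)
  finally have P: "ln (\<Prod>j<N. Gamma (1 + \<beta> * real j)) = (\<Sum>j=1..N. ln (Gamma (1 + real j * \<beta>))) - ln (Gamma (1 + real N * \<beta>))" .
  have Pp: "(\<Prod>j<N. Gamma (1 + \<beta> * real j)) > 0" by (intro prod_pos) (use G in auto)
  have L: "laguerre \<beta> N 0 > 0" by (rule laguerre_pos[OF \<beta>])
  have "ln (mehta \<beta> N) = ln (sqrt (2 * pi) ^ N) + (ln (laguerre \<beta> N 0) - ln (\<Prod>j<N. Gamma (1 + \<beta> * real j)))"
  proof -
    have "ln (A * (L / P)) = ln A + (ln L - ln P)" if "A > 0" "L > 0" "P > 0" for A L P :: real
      using that by (simp add: ln_mult ln_div)
    from this[OF _ L Pp] show ?thesis unfolding mehta_eq[OF \<beta>] by simp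
  qed
  also have "ln (sqrt (2 * pi) ^ N) = real N * ln (2 * pi) / 2" by (simp add: ln_realpow ln_sqrt)
  finally show ?thesis unfolding P by simp
qed

lemma ln_powers:
  assumes "s > 0"
  shows "ln (s ^ N * (s powr (2 * \<beta>)) ^ card (pairs N)) = (real N + \<beta> * real N * (real N - 1)) * ln s"
proof -
  have "ln (s ^ N * (s powr (2 * \<beta>)) ^ card (pairs N)) = real N * ln s + real (card (pairs N)) * (2 * \<beta> * ln s)"
    using assms by (subst ln_mult_pos) (auto simp: ln_realpow)
  then show ?thesis unfolding card_pairs by (simp add: field_simps)
qed

text \<open>An exact identity for every N: the powers of t and the Laguerre integral cancel. It
  isolates three errors, those of the moment asymptotics, of the product of Gamma functions and of
  Binet's formula for its last factor.\<close>

lemma ln_partition_ratio: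
  assumes t: "t > 0" and \<beta>: "\<beta> > 0" and m: "m > 1" and N: "N > 0"
  defines "c \<equiv> real N * \<beta>"
  shows "ln (partition_fn t \<beta> N (ereal (sqrt t * (3 * cu m - 1 / cu m)))) - ln (partition_fn t \<beta> N \<infinity>)
      - ((real N)^2 * gE0 \<beta> m + real N * gE1 \<beta> m + gE2 \<beta> m + qE \<beta> * ln (real N))
    = (ln (mom \<beta> N c (cl c m) 0) + lag_deg \<beta> N 0 * ln (c / cu m) - ln (laguerre \<beta> N 0)
      - ((real N)^2 * wS0 \<beta> m + real N * ((1 - \<beta>) * wg1 (rho m)) + wG2 (1 / \<beta> - 1) (rho m)))
     + ((\<Sum>j=1..N. ln (Gamma (1 + real j * \<beta>))) - kappa_poly \<beta> N - kappa \<beta>)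
     - (1 / (12 * c) + binet_J 0 c)"
proof -
  define a where "a = 3 * cu m - 1 / cu m"
  define e where "e = real N + \<beta> * real N * (real N - 1)"
  define s where "s = sqrt (t / c)"
  have c: "c > 0" unfolding c_def using \<beta> N by simp
  have u: "cu m > 0" using cu(2)[OF m] .
  have st: "sqrt t > 0" "s > 0" unfolding s_def using t c by auto
  have la: "- c * a = cl c m" unfolding cl_def a_def by (simp add: algebra_simps)
  have M: "mom \<beta> N c (cl c m) 0 > 0" using \<beta> c by (intro mom_pos) auto
  have "ln (partition_fn t \<beta> N (ereal (sqrt t * a))) = ln (sqrt t ^ N * (sqrt t powr (2 * \<beta>)) ^ card (pairs N)) + (- (real N * c * a^2 / 2)) + ln (mom \<beta> N c (cl c m) 0)"
    unfolding partition_fn_finite[OF t \<beta> N] c_def[symmetric] la using st M by (simp add: ln_mult_pos)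
  then have 1: "ln (partition_fn t \<beta> N (ereal (sqrt t * a))) = e * ln (sqrt t) - real N * c * a^2 / 2 + ln (mom \<beta> N c (cl c m) 0)"
    unfolding ln_powers[OF st(1)] e_def by simp
  have "ln (partition_fn t \<beta> N \<infinity>) = ln (s ^ N * (s powr (2 * \<beta>)) ^ card (pairs N)) + ln (mehta \<beta> N)"
  proof -
    have "partition_fn t \<beta> N \<infinity> = s ^ N * (s powr (2 * \<beta>)) ^ card (pairs N) * mehta \<beta> N"
      unfolding s_def c_def by (rule partition_fn_infinity[OF t \<beta> N])
    then show ?thesis using st mehta_pos[OF \<beta>, of N] by (simp add: ln_mult_pos)
  qed
  then have 2: "ln (partition_fn t \<beta> N \<infinity>) = e * ln s + ln (mehta \<beta> N)" unfolding ln_powers[OF st(2)] e_def .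
  have ls: "ln s = ln (sqrt t) - ln c / 2" unfolding s_def using t c by (simp add: ln_sqrt ln_div diff_divide_distrib real_sqrt_divide)
  have lc: "ln c = ln (real N) + ln \<beta>" unfolding c_def using N \<beta> by (simp add: ln_mult)
  have l2: "ln (2 * pi * c) = ln (2 * pi) + (ln (real N) + ln \<beta>)" "ln (2 * pi * \<beta>) = ln (2 * pi) + ln \<beta>"
    unfolding lc[symmetric] using c \<beta> by (simp_all add: ln_mult_pos[of "2 * pi"])
  have lcu: "ln (c / cu m) = ln (real N) + ln \<beta> - ln (cu m)" unfolding lc[symmetric] using c u by (simp add: ln_div)
  have G: "ln (Gamma (1 + c)) = c * ln c - c + ln (2 * pi * c) / 2 + 1 / (12 * c) + binet_J 0 c" by (rule binet_formula[OF c])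
  have ld: "lag_deg \<beta> N 0 = e" unfolding lag_deg_def e_def by simp
  define S where "S = (\<Sum>j=1..N. ln (Gamma (1 + real j * \<beta>)))"
  define X where "X = ln (mom \<beta> N c (cl c m) 0)"
  define L where "L = ln (laguerre \<beta> N 0)"
  define J where "J = binet_J 0 c"
  define K where "K = 1 / (12 * c)"
  define W1 where "W1 = wg1 (rho m)"
  define W2 where "W2 = wG2 (1 / \<beta> - 1) (rho m)"
  define lN where "lN = ln (real N)"
  define lb where "lb = ln \<beta>"
  define lp where "lp = ln (2 * pi)"
  define lu where "lu = ln (cu m)"
  define ib where "ib = 1 / (12 * \<beta>)"
  have ib2: "ln (real N) / (12 * \<beta>) = lN * ib" unfolding ib_def lN_def by simp
  have "e * ln (sqrt t) - real N * c * a^2 / 2 + X - (e * (ln (sqrt t) - (lN + lb) / 2)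
        + (real N * lp / 2 + L - S + (c * (lN + lb) - c + (lp + (lN + lb)) / 2 + K + J)))
      - ((real N)^2 * (wS0 \<beta> m + \<beta> * (lu - a^2 / 2 - 3 / 4)) + real N * ((1 - \<beta>) * (W1 + lu - 1 / 2)) + (W2 + kappa \<beta> - (lp + lb) / 2) + (\<beta> / 12 + ib - 1 / 4) * lN)
    = (X + e * (lN + lb - lu) - L - ((real N)^2 * wS0 \<beta> m + real N * ((1 - \<beta>) * W1) + W2))
     + (S - (\<beta> * (((real N)^2 / 2 + real N / 2 + 1 / 12) * lN - (real N)^2 / 4) + \<beta> * (lb - 1) * ((real N)^2 + real N) / 2
     + real N * (lp + lb) / 2 + (real N * lN - real N + lN / 2) / 2 + lN * ib) - kappa \<beta>) - (K + J)"
    unfolding e_def c_def by (simp add: field_simps power2_eq_square)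
  then show ?thesis
    unfolding a_def[symmetric] 1 2 ls lcu ld ln_mehta[OF \<beta> N] c_def[symmetric] G gE0_def gE1_def gE2_def qE_def kappa_poly_def l2 ib2
    unfolding lc X_def L_def J_def K_def W1_def W2_def lN_def lb_def lp_def lu_def ib_def S_def .
qed

lemma ln_partition_ratio_tendsto:
  assumes t: "t > 0" and \<beta>: "\<beta> > 0" and m: "m > 1"
  shows "(\<lambda>N. ln (partition_fn t \<beta> N (ereal (sqrt t * (3 * cu m - 1 / cu m)))) - ln (partition_fn t \<beta> N \<infinity>)
      - ((real N)^2 * gE0 \<beta> m + real N * gE1 \<beta> m + gE2 \<beta> m + qE \<beta> * ln (real N))) \<longlonglongrightarrow> 0"
proof -
  let ?A = "\<lambda>N. ln (mom \<beta> N (real N * \<beta>) (cl (real N * \<beta>) m) 0) + lag_deg \<beta> N 0 * ln (real N * \<beta> / cu m) - ln (laguerre \<beta> N 0)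
      - ((real N)^2 * wS0 \<beta> m + real N * ((1 - \<beta>) * wg1 (rho m)) + wG2 (1 / \<beta> - 1) (rho m))"
  obtain C where C: "\<And>N. N > 0 \<Longrightarrow> \<bar>?A N\<bar> \<le> C / real N"
    using laplace_moment_asymptotics[OF \<beta>, of m] m by auto
  have A: "?A \<longlonglongrightarrow> 0"
  proof (rule Lim_null_comparison)
    show "\<forall>\<^sub>F N in sequentially. norm (?A N) \<le> C / real N"
      using eventually_gt_at_top[of 0] by eventually_elim (use C in auto)
    show "(\<lambda>N. C / real N) \<longlonglongrightarrow> 0" by real_asymp
  qed
  have B: "(\<lambda>N. (\<Sum>j=1..N. ln (Gamma (1 + real j * \<beta>))) - kappa_poly \<beta> N - kappa \<beta>) \<longlonglongrightarrow> kappa \<beta> - kappa \<beta>"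
    by (intro tendsto_diff ln_Gamma_product_asymptotics[OF \<beta>] tendsto_const)
  have Cc: "(\<lambda>N. 1 / (12 * (real N * \<beta>)) + binet_J 0 (real N * \<beta>)) \<longlonglongrightarrow> 0 + 0"
  proof (rule tendsto_add)
    show "(\<lambda>N. 1 / (12 * (real N * \<beta>))) \<longlonglongrightarrow> 0" using \<beta> by real_asymp
    show "(\<lambda>N. binet_J 0 (real N * \<beta>)) \<longlonglongrightarrow> 0"
    proof (rule Lim_null_comparison)
      show "\<forall>\<^sub>F N in sequentially. norm (binet_J 0 (real N * \<beta>)) \<le> 1 / (12 * (real N * \<beta>)^2)"
        using eventually_gt_at_top[of 0] by eventually_elim (use binet_J_bound(1) \<beta> in auto)
      show "(\<lambda>N. 1 / (12 * (real N * \<beta>)^2)) \<longlonglongrightarrow> 0" using \<beta> by real_asymp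
    qed
  qed
  from tendsto_diff[OF tendsto_add[OF A B] Cc]
  have "(\<lambda>N. ?A N + ((\<Sum>j=1..N. ln (Gamma (1 + real j * \<beta>))) - kappa_poly \<beta> N - kappa \<beta>) - (1 / (12 * (real N * \<beta>)) + binet_J 0 (real N * \<beta>))) \<longlonglongrightarrow> 0"
    by simp
  then show ?thesis
  proof (rule Lim_transform_eventually)
    show "\<forall>\<^sub>F N in sequentially. ?A N + ((\<Sum>j=1..N. ln (Gamma (1 + real j * \<beta>))) - kappa_poly \<beta> N - kappa \<beta>) - (1 / (12 * (real N * \<beta>)) + binet_J 0 (real N * \<beta>))
      = ln (partition_fn t \<beta> N (ereal (sqrt t * (3 * cu m - 1 / cu m)))) - ln (partition_fn t \<beta> N \<infinity>)
      - ((real N)^2 * gE0 \<beta> m + real N * gE1 \<beta> m + gE2 \<beta> m + qE \<beta> * ln (real N))"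
      using eventually_gt_at_top[of 0] by eventually_elim (use ln_partition_ratio[OF t \<beta> m] in auto)
  qed
qed

section \<open>Identification of the coefficients in the assumed expansion\<close>

lemma expansion_coeffs_zero:
  fixes a0 a1 a2 b0 b1 b2 :: real
  assumes "(\<lambda>N::nat. (real N)\<^sup>2 * (a0 + b0 * ln (real N)) + real N * (a1 + b1 * ln (real N)) + (a2 + b2 * ln (real N))) \<longlonglongrightarrow> 0"
  shows "a0 = 0" "b0 = 0" "a1 = 0" "b1 = 0" "a2 = 0" "b2 = 0"
proof -
  let ?X = "\<lambda>N::nat. (real N)\<^sup>2 * (a0 + b0 * ln (real N)) + real N * (a1 + b1 * ln (real N)) + (a2 + b2 * ln (real N))"
  have div: "(\<lambda>N. ?X N * g N) \<longlonglongrightarrow> 0" if "g \<longlonglongrightarrow> 0" for g using tendsto_mult[OF assms that] by simp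
  have "(\<lambda>N. ?X N * (1 / ((real N)^2 * ln (real N)))) \<longlonglongrightarrow> b0" by real_asymp
  moreover have "(\<lambda>N. ?X N * (1 / ((real N)^2 * ln (real N)))) \<longlonglongrightarrow> 0" by (rule div) real_asymp
  ultimately show b0: "b0 = 0" by (rule LIMSEQ_unique)
  have "(\<lambda>N. ?X N * (1 / (real N)^2)) \<longlonglongrightarrow> a0" unfolding b0 by real_asymp
  moreover have "(\<lambda>N. ?X N * (1 / (real N)^2)) \<longlonglongrightarrow> 0" by (rule div) real_asymp
  ultimately show a0: "a0 = 0" by (rule LIMSEQ_unique)
  have "(\<lambda>N. ?X N * (1 / (real N * ln (real N)))) \<longlonglongrightarrow> b1" unfolding a0 b0 by real_asymp
  moreover have "(\<lambda>N. ?X N * (1 / (real N * ln (real N)))) \<longlonglongrightarrow> 0" by (rule div) real_asymp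
  ultimately show b1: "b1 = 0" by (rule LIMSEQ_unique)
  have "(\<lambda>N. ?X N * (1 / real N)) \<longlonglongrightarrow> a1" unfolding a0 b0 b1 by real_asymp
  moreover have "(\<lambda>N. ?X N * (1 / real N)) \<longlonglongrightarrow> 0" by (rule div) real_asymp
  ultimately show a1: "a1 = 0" by (rule LIMSEQ_unique)
  have "(\<lambda>N. ?X N * (1 / ln (real N))) \<longlonglongrightarrow> b2" unfolding a0 b0 a1 b1 by real_asymp
  moreover have "(\<lambda>N. ?X N * (1 / ln (real N))) \<longlonglongrightarrow> 0" by (rule div) real_asymp
  ultimately show b2: "b2 = 0" by (rule LIMSEQ_unique)
  have "?X \<longlonglongrightarrow> a2" unfolding a0 b0 a1 b1 b2 by real_asymp
  from LIMSEQ_unique[OF this assms] show "a2 = 0" .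
qed

definition exp_coeff :: "(nat \<Rightarrow> nat \<Rightarrow> real \<Rightarrow> real \<Rightarrow> real) \<Rightarrow> real \<Rightarrow> real \<Rightarrow> nat \<Rightarrow> real \<Rightarrow> real" where
  "exp_coeff F t \<beta> n a = (\<Sum>(g, k)\<in>{(g, k). 2 * g + k = n}. (sqrt \<beta> / t) powi (2 - int n) * (sqrt \<beta> - 1 / sqrt \<beta>) ^ k * F g k t a)"

lemma expansion_term_eq: "expansion_term F t \<beta> n N a = real N powi (2 - int n) * exp_coeff F t \<beta> n a"
  unfolding expansion_term_def exp_coeff_def sum_distrib_left
proof (intro sum.cong refl, clarify)
  fix g k :: nat
  have "2 - 2 * int g - int k = 2 - int (2 * g + k)" by simp
  moreover have "real N * sqrt \<beta> / t = real N * (sqrt \<beta> / t)" by simp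
  ultimately show "(real N * sqrt \<beta> / t) powi (2 - 2 * int g - int k) * (sqrt \<beta> - 1 / sqrt \<beta>) ^ k * F g k t a
    = real N powi (2 - int (2 * g + k)) * ((sqrt \<beta> / t) powi (2 - int (2 * g + k)) * (sqrt \<beta> - 1 / sqrt \<beta>) ^ k * F g k t a)"
    by (simp only: power_int_mult_distrib mult.assoc)
qed

lemma asymp_expansion_2:
  assumes "asymp_expansion sequentially f T (\<lambda>n N. real N powi (2 - int n))"
  shows "(\<lambda>N. f N - (T 0 N + T 1 N + T 2 N)) \<longlonglongrightarrow> 0"
proof -
  have "(\<lambda>N. f N - (\<Sum>n\<le>2. T n N)) \<in> o[sequentially](\<lambda>N. real N powi (2 - int 2))"
    using assms unfolding asymp_expansion_def by blast
  then have "(\<lambda>N. (f N - (\<Sum>n\<le>2. T n N)) / 1) \<longlonglongrightarrow> 0" by (intro smalloD_tendsto) simp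
  then show ?thesis by (simp add: numeral_2_eq_2)
qed

text \<open>The split between \<open>D\<close> and \<open>F\<close> is not unique, so only the sums
  with \<open>p n\<close> are determined. No logarithm occurs at orders N^2 and N, which forces q 0
  = q 1 = 0.\<close>

lemma expansion_coeffs:
  assumes t: "t > 0" and \<beta>: "\<beta> > 0" and F: "has_one_over_N_expansion D F" and m: "m > 1"
    and D: "asymp_expansion sequentially (\<lambda>N. D N \<beta> - ln (partition_fn t \<beta> N \<infinity>))
          (\<lambda>n N. real N powi (2 - int n) * (p n + q n * ln (real N))) (\<lambda>n N. real N powi (2 - int n))"
    and a: "a = sqrt t * (3 * cu m - 1 / cu m)" "a < 2 * sqrt t"
  shows "exp_coeff F t \<beta> 0 a + p 0 = gE0 \<beta> m" "q 0 = 0" "exp_coeff F t \<beta> 1 a + p 1 = gE1 \<beta> m" "q 1 = 0"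
    "exp_coeff F t \<beta> 2 a + p 2 = gE2 \<beta> m" "q 2 = qE \<beta>"
proof -
  let ?e = "exp_coeff F t \<beta>"
  have "asymp_expansion sequentially (\<lambda>N. ln (partition_fn t \<beta> N (ereal a)) - D N \<beta>) (\<lambda>n N. expansion_term F t \<beta> n N a) (\<lambda>n N. real N powi (2 - int n))"
    using F t \<beta> a unfolding has_one_over_N_expansion_def by blast
  from tendsto_diff[OF ln_partition_ratio_tendsto[OF t \<beta> m] tendsto_add[OF asymp_expansion_2[OF this] asymp_expansion_2[OF D]]]
  have "(\<lambda>N. (real N)\<^sup>2 * ((?e 0 a + p 0 - gE0 \<beta> m) + q 0 * ln (real N)) + real N * ((?e 1 a + p 1 - gE1 \<beta> m) + q 1 * ln (real N))
      + ((?e 2 a + p 2 - gE2 \<beta> m) + (q 2 - qE \<beta>) * ln (real N))) \<longlonglongrightarrow> 0"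
    unfolding a(1)[symmetric] expansion_term_eq by (simp add: algebra_simps)
  from expansion_coeffs_zero[OF this] show "?e 0 a + p 0 = gE0 \<beta> m" "q 0 = 0" "?e 1 a + p 1 = gE1 \<beta> m" "q 1 = 0"
    "?e 2 a + p 2 = gE2 \<beta> m" "q 2 = qE \<beta>" by simp_all
qed

text \<open>\<open>edge_r y\<close> is the value of \<open>rho\<close> at the point \<open>a / sqrt t = 2 * (1 - y)\<close>.\<close>

definition edge_r :: "real \<Rightarrow> real" where
  "edge_r y = sqrt ((1 + 3 * (((2 - 2 * y) + sqrt ((2 - 2 * y)^2 + 12)) / 6)^2) / (1 - (((2 - 2 * y) + sqrt ((2 - 2 * y)^2 + 12)) / 6)^2))"

definition edge_m :: "real \<Rightarrow> real" where "edge_m y = ((edge_r y)^2 + 1) / 2"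

lemma edge_r:
  assumes "y > 0"
  shows "edge_r y > 1" "edge_m y > 1" "rho (edge_m y) = edge_r y" "cw (edge_m y) = ((edge_r y)^2 - 1) / ((edge_r y)^2 + 3)"
    "3 * cu (edge_m y) - 1 / cu (edge_m y) = 2 * (1 - y)"
proof -
  define A where "A = 2 - 2 * y"
  define S where "S = sqrt (A^2 + 12)"
  \<comment> \<open>The positive root of 3 u^2 - A u - 1 = 0, which inverts A = 3 u - 1 / u.\<close>
  define u where "u = (A + S) / 6"
  define r where "r = edge_r y"
  have S: "S^2 = A^2 + 12" "S > 0" unfolding S_def by (auto simp: add_nonneg_pos)
  have A: "A < 2" unfolding A_def using assms by simp
  have "A^2 < S^2" unfolding S by simp
  then have "\<bar>A\<bar> < S" using S(2) by (metis abs_le_square_iff abs_of_pos linorder_not_le)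
  then have u0: "u > 0" unfolding u_def by simp
  have "S^2 < (6 - A)^2" unfolding S using A by (simp add: power2_eq_square algebra_simps)
  then have "S < 6 - A" by (rule power2_less_imp_less) (use A in simp)
  then have u1: "u < 1" unfolding u_def by simp
  have "3 * u^2 - A * u - 1 = (S^2 - A^2 - 12) / 12" unfolding u_def by (simp add: power2_eq_square field_simps)
  then have q: "3 * u^2 - A * u - 1 = 0" unfolding S by simp
  have uu: "u^2 < 1" "u^2 > 0" using u0 u1 by (auto simp: power_less_one_iff)
  have r2: "r^2 = (1 + 3 * u^2) / (1 - u^2)"
    unfolding r_def edge_r_def A_def[symmetric] S_def[symmetric] u_def[symmetric] using uu by (subst real_sqrt_pow2) (auto intro!: divide_nonneg_pos)
  have r0: "r \<ge> 0" unfolding r_def edge_r_def A_def[symmetric] S_def[symmetric] u_def[symmetric] using uu by auto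
  have r13: "r^2 - 1 = 4 * u^2 / (1 - u^2)" "r^2 + 3 = 4 / (1 - u^2)" unfolding r2 using uu by (simp_all add: field_simps)
  have "4 * u^2 / (1 - u^2) > 0" using uu by simp
  then have "r^2 > 1\<^sup>2" unfolding r13(1)[symmetric] by simp
  then have r1: "r > 1" using r0 by (rule power2_less_imp_less)
  then show "edge_r y > 1" unfolding r_def .
  have m: "edge_m y = (r^2 + 1) / 2" unfolding edge_m_def r_def ..
  show "edge_m y > 1" unfolding m using \<open>r\<^sup>2 > 1\<^sup>2\<close> by simp
  show "rho (edge_m y) = edge_r y"
  proof -
    have "2 * ((r^2 + 1) / 2) - 1 = r^2" by (simp add: field_simps)
    then show ?thesis unfolding rho_def m r_def[symmetric] using r0 by (simp only: real_sqrt_abs abs_of_nonneg)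
  qed
  have "cw (edge_m y) = (r^2 - 1) / (r^2 + 3)"
  proof -
    have "(r^2 + 1) / 2 - 1 = (r^2 - 1) / 2" "(r^2 + 1) / 2 + 1 = (r^2 + 3) / 2" by (simp_all add: field_simps)
    moreover have "(p / 2) / (q / 2) = p / q" for p q :: real by simp
    ultimately show ?thesis unfolding cw_def m by (simp only:)
  qed
  then show w: "cw (edge_m y) = ((edge_r y)^2 - 1) / ((edge_r y)^2 + 3)" unfolding r_def .
  have "cw (edge_m y) = u^2" unfolding w r_def[symmetric] r13 using uu by simp
  then have "cu (edge_m y) = u" unfolding cu_def using u0 by simp
  moreover have "3 * u - 1 / u = A" using q u0 by (simp add: field_simps power2_eq_square)
  ultimately show "3 * cu (edge_m y) - 1 / cu (edge_m y) = 2 * (1 - y)" unfolding A_def by simp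
qed

text \<open>Near the edge 3 u - 1 / u has slope 4 at u = 1, so 1 - u behaves like y / 2, and r^2 =
  (1 + 3 u^2) / (1 - u^2) behaves like 4 / y.\<close>

lemma edge_r_limits:
  "filterlim edge_r at_top (at_right 0)" "((\<lambda>y. (edge_r y)\<^sup>2 * y) \<longlongrightarrow> 4) (at_right 0)"
proof -
  show "filterlim edge_r at_top (at_right 0)" unfolding edge_r_def[abs_def] by real_asymp
  have "((\<lambda>y. ((1 + 3 * (((2 - 2 * y) + sqrt ((2 - 2 * y)^2 + 12)) / 6)^2) / (1 - (((2 - 2 * y) + sqrt ((2 - 2 * y)^2 + 12)) / 6)^2)) * y) \<longlongrightarrow> 4) (at_right (0::real))"
    by real_asymp
  then show "((\<lambda>y. (edge_r y)\<^sup>2 * y) \<longlongrightarrow> 4) (at_right 0)"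
  proof (rule Lim_transform_eventually)
    show "\<forall>\<^sub>F y in at_right 0. ((1 + 3 * (((2 - 2 * y) + sqrt ((2 - 2 * y)^2 + 12)) / 6)^2) / (1 - (((2 - 2 * y) + sqrt ((2 - 2 * y)^2 + 12)) / 6)^2)) * y = (edge_r y)^2 * y"
      using eventually_at_right_less[of 0]
    proof eventually_elim
      case (elim y)
      have "edge_r y > 0" using edge_r(1)[OF elim] by simp
      then have "(1 + 3 * (((2 - 2 * y) + sqrt ((2 - 2 * y)^2 + 12)) / 6)^2) / (1 - (((2 - 2 * y) + sqrt ((2 - 2 * y)^2 + 12)) / 6)^2) > 0"
        unfolding edge_r_def by (rule real_sqrt_gt_0_iff[THEN iffD1])
      then show ?case unfolding edge_r_def by (subst real_sqrt_pow2) auto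
    qed
  qed
qed

lemma gE0_eq:
  assumes "m > 1"
  shows "gE0 \<beta> m = \<beta> * (2 * cw m + 3 / 4 * (cw m)^2 + ln (cw m) / 2 - (9 * cw m - 6 + 1 / cw m) / 2 - 3 / 4)"
proof -
  note u = cu[OF assms]
  have "(3 * cu m - 1 / cu m)^2 = 9 * cw m - 6 + 1 / cw m"
    unfolding u(3)[symmetric] using u(2) by (simp add: power2_eq_square field_simps)
  moreover have "ln (cu m) = ln (cw m) / 2" unfolding cu_def using u(1) by (simp add: ln_sqrt)
  moreover have "\<beta> * x + \<beta> * (p - Q / 2 - z) = \<beta> * (x + p - Q / 2 - z)" for x p Q z by (simp add: algebra_simps)
  ultimately show ?thesis unfolding gE0_def wS0_def cw_def[symmetric] by (simp only:)
qed

lemma edge_limits: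
  assumes \<eta>: "\<eta> > 0" and \<beta>: "\<beta> > 0"
  defines "y \<equiv> \<lambda>N. real N powr (- 2 / 3) * \<eta>"
  shows "(\<lambda>N. (real N)\<^sup>2 * gE0 \<beta> (edge_m (y N))) \<longlonglongrightarrow> - (2 / 3 * \<beta> * \<eta> ^ 3)"
    and "(\<lambda>N. real N * gE1 \<beta> (edge_m (y N))) \<longlonglongrightarrow> 4 / 3 * (\<beta> - 1) * \<eta> powr (3 / 2)"
    and "(\<lambda>N. gE2 \<beta> (edge_m (y N)) + qE \<beta> * ln (real N)) \<longlonglongrightarrow> ln (tau \<beta>) + (\<beta> + 1 / \<beta> - 3) / 8 * ln (2 * \<eta>)"
proof -
  let ?H = "\<lambda>r::real. 2 * ((r^2 - 1) / (r^2 + 3)) + 3 / 4 * ((r^2 - 1) / (r^2 + 3))^2 + ln ((r^2 - 1) / (r^2 + 3)) / 2 - (9 * ((r^2 - 1) / (r^2 + 3)) - 6 + 1 / ((r^2 - 1) / (r^2 + 3))) / 2 - 3 / 4"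
    and ?G = "\<lambda>r::real. 1 / 2 - 1 / (r + 1) - 2 * ln (r + 1) + ln (r^2 + 3) + 3 * (r - 1) / (r^2 + 3) + (ln (r^2 - 1) - ln (r^2 + 3)) / 2 - 1 / 2"
  define r where "r N = edge_r (y N)" for N
  have ypos: "y N > 0" if "N > 0" for N unfolding y_def using \<eta> that by simp
  have y0: "filterlim y (at_right 0) sequentially"
  proof (rule tendsto_imp_filterlim_at_right)
    show "y \<longlonglongrightarrow> 0" unfolding y_def by real_asymp
    show "\<forall>\<^sub>F N in sequentially. y N > 0" using eventually_gt_at_top[of 0] by eventually_elim (rule ypos)
  qed
  have r: "filterlim r at_top sequentially" unfolding r_def by (rule filterlim_compose[OF edge_r_limits(1) y0])
  have ry: "(\<lambda>N. (r N)\<^sup>2 * y N) \<longlonglongrightarrow> 4" unfolding r_def by (rule filterlim_compose[OF edge_r_limits(2) y0])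
  have ev: "\<forall>\<^sub>F N in sequentially. N > (0::nat)" by (rule eventually_gt_at_top)
  have y3: "(real N)^2 * y N ^ 3 = \<eta> ^ 3" if "N > 0" for N
  proof -
    have "(real N powr (- 2 / 3)) ^ 3 = real N powr (- 2)" using that by (simp add: powr_power)
    also have "\<dots> = 1 / (real N)^2" using that by (simp add: powr_minus powr_numeral inverse_eq_divide)
    finally show ?thesis unfolding y_def using that by (simp add: power_mult_distrib)
  qed
  note E = edge_r[OF ypos]
  \<comment> \<open>The terms down to r^(-4) cancel: \<open>gE0\<close> vanishes to third order in
    y, as N^2 y^3 = \<eta>^3 requires. With r^2 y near 4 the limit is (- 128/3) / 4^3 = -
    2/3.\<close>
  have L0: "((\<lambda>r::real. ?H r * r ^ 6) \<longlongrightarrow> - 128 / 3) at_top"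
    by real_asymp
  have "(\<lambda>N. \<beta> * \<eta> ^ 3 * (?H (r N) * r N ^ 6) / ((r N)^2 * y N) ^ 3)
     \<longlonglongrightarrow> \<beta> * \<eta> ^ 3 * (- 128 / 3) / 4 ^ 3"
    by (intro tendsto_divide tendsto_mult tendsto_power tendsto_const ry filterlim_compose[OF L0 r]) simp
  then have "(\<lambda>N. (real N)\<^sup>2 * gE0 \<beta> (edge_m (y N))) \<longlonglongrightarrow> \<beta> * \<eta> ^ 3 * (- 128 / 3) / 4 ^ 3"
  proof (rule Lim_transform_eventually)
    show "\<forall>\<^sub>F N in sequentially. \<beta> * \<eta> ^ 3 * (?H (r N) * r N ^ 6) / ((r N)^2 * y N) ^ 3
      = (real N)^2 * gE0 \<beta> (edge_m (y N))" using ev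
    proof eventually_elim
      case (elim N)
      have "r N > 1" "y N > 0" using E(1)[OF elim] ypos[OF elim] unfolding r_def by auto
      then have "\<beta> * (n * Y ^ 3) * (H * r N ^ 6) / ((r N)^2 * Y) ^ 3 = n * (\<beta> * H)" if "Y > 0" for n H Y
        using that by (simp add: power_mult_distrib flip: power_mult)
      from this[of "y N" "(real N)^2"] ypos[OF elim]
      show ?case unfolding y3[OF elim] gE0_eq[OF E(2)[OF elim]] E(4)[OF elim] r_def[symmetric] by blast
    qed
  qed
  then show "(\<lambda>N. (real N)\<^sup>2 * gE0 \<beta> (edge_m (y N))) \<longlonglongrightarrow> - (2 / 3 * \<beta> * \<eta> ^ 3)" by (simp add: mult.assoc)
  have u2: "ln (cu (edge_m (y N))) = (ln ((r N)^2 - 1) - ln ((r N)^2 + 3)) / 2" if "N > 0" for N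
  proof -
    have "(r N)^2 > 1" unfolding r_def using E(1)[OF that] by (simp add: one_less_power)
    then show ?thesis unfolding cu_def E(4)[OF that] r_def[symmetric] by (simp add: ln_sqrt ln_div)
  qed
  \<comment> \<open>Here the order is r^(-3), matching N y^(3/2) = \<eta>^(3/2), and (- 32/3) / 2^3
    = - 4/3.\<close>
  have L1: "((\<lambda>r::real. ?G r * r ^ 3) \<longlongrightarrow> - 32 / 3) at_top"
    by real_asymp
  have "(\<lambda>N. sqrt ((r N)^2 * y N)) \<longlonglongrightarrow> sqrt 4" by (intro tendsto_real_sqrt ry)
  then have "(\<lambda>N. sqrt ((r N)^2 * y N)) \<longlonglongrightarrow> 2" by simp
  then have "(\<lambda>N. (1 - \<beta>) * \<eta> powr (3 / 2) * (?G (r N) * r N ^ 3) / sqrt ((r N)^2 * y N) ^ 3)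
     \<longlonglongrightarrow> (1 - \<beta>) * \<eta> powr (3 / 2) * (- 32 / 3) / 2 ^ 3"
    by (intro tendsto_divide tendsto_mult tendsto_power tendsto_const filterlim_compose[OF L1 r]) simp_all
  then have "(\<lambda>N. real N * gE1 \<beta> (edge_m (y N))) \<longlonglongrightarrow> (1 - \<beta>) * \<eta> powr (3 / 2) * (- 32 / 3) / 2 ^ 3"
  proof (rule Lim_transform_eventually)
    show "\<forall>\<^sub>F N in sequentially. (1 - \<beta>) * \<eta> powr (3 / 2) * (?G (r N) * r N ^ 3) / sqrt ((r N)^2 * y N) ^ 3
      = real N * gE1 \<beta> (edge_m (y N))" using ev
    proof eventually_elim
      case (elim N)
      have rN: "r N > 1" "y N > 0" using E(1)[OF elim] ypos[OF elim] unfolding r_def by auto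
      define Y where "Y = sqrt (y N)"
      have Y: "Y > 0" "Y^2 = y N" unfolding Y_def using rN by auto
      have "(real N * Y ^ 3)^2 = (real N)^2 * (Y^2) ^ 3" by (simp add: power_mult_distrib flip: power_mult)
      also have "\<dots> = \<eta> ^ 3" unfolding Y y3[OF elim] ..
      also have "\<dots> = (\<eta> powr (3 / 2))^2" using \<eta> by (simp add: powr_power powr_numeral)
      finally have NY: "real N * Y ^ 3 = \<eta> powr (3 / 2)" using Y by (simp add: power2_eq_iff_nonneg)
      have s: "sqrt ((r N)^2 * y N) = r N * Y" unfolding Y_def using rN by (simp add: real_sqrt_mult)
      have "(1 - \<beta>) * (n * Y ^ 3) * (H * r N ^ 3) / (r N * Y) ^ 3 = n * ((1 - \<beta>) * H)" for n H
        using Y rN by (simp add: power_mult_distrib)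
      then show ?case unfolding NY[symmetric] s gE1_def u2[OF elim] E(3)[OF elim] r_def[symmetric] wg1_def by blast
    qed
  qed
  moreover have "(1 - \<beta>) * \<eta> powr (3 / 2) * (- 32 / 3) / 2 ^ 3 = 4 / 3 * (\<beta> - 1) * \<eta> powr (3 / 2)" by (simp add: field_simps)
  ultimately show "(\<lambda>N. real N * gE1 \<beta> (edge_m (y N))) \<longlonglongrightarrow> 4 / 3 * (\<beta> - 1) * \<eta> powr (3 / 2)" by (simp only:)
  define b where "b = 1 / \<beta> - 1"
  define B where "B = \<beta> + 1 / \<beta> - 2"
  have B: "b^2 / (1 + b) = B" unfolding b_def B_def using \<beta> by (simp add: power2_eq_square field_simps)
  have q: "qE \<beta> = (B - 1) / 12" unfolding qE_def B_def by simp
  \<comment> \<open>With ln N = (3/2) (ln \<eta> - ln y) and ln y = ln (r^2 y) - 2 ln r, the term qE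
    ln N supplies (B - 1) / 4 times ln r. This cancels the logarithmic divergence of
    \<open>gE2\<close> at the edge, and only ln (r^2 y) and convergent differences of logarithms
    remain.\<close>
  let ?Q = "\<lambda>N. (ln ((r N)^2 + 3) / 6 - ln (r N) / 12 - ln (r N) / 4 - ln 4 / 6) + B * ((ln (r N + 1) - 11 / 12 * ln (r N) - ln ((r N)^2 + 3) / 6 + ln (r N) / 4) - ln 2 + ln 4 / 6) + (kappa \<beta> - ln (2 * pi * \<beta>) / 2) + (B - 1) / 8 * (ln \<eta> - ln ((r N)^2 * y N))"
    and ?L = "- ln 4 / 6 + B * (0 - ln 2 + ln 4 / 6) + (kappa \<beta> - ln (2 * pi * \<beta>) / 2) + (B - 1) / 8 * (ln \<eta> - ln 4)"
  have L2: "((\<lambda>r::real. ln (r^2 + 3) / 6 - ln r / 12 - ln r / 4 - ln 4 / 6) \<longlongrightarrow> - ln 4 / 6) at_top" by real_asymp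
  have L3: "((\<lambda>r::real. ln (r + 1) - 11 / 12 * ln r - ln (r^2 + 3) / 6 + ln r / 4) \<longlongrightarrow> 0) at_top" by real_asymp
  have "(\<lambda>N. ?Q N)
     \<longlonglongrightarrow> ?L"
    by (intro tendsto_add tendsto_diff tendsto_mult tendsto_const tendsto_ln ry filterlim_compose[OF L2 r] filterlim_compose[OF L3 r]) simp
  then have "(\<lambda>N. gE2 \<beta> (edge_m (y N)) + qE \<beta> * ln (real N))
     \<longlonglongrightarrow> ?L"
  proof (rule Lim_transform_eventually)
    show "\<forall>\<^sub>F N in sequentially. ?Q N = gE2 \<beta> (edge_m (y N)) + qE \<beta> * ln (real N)"
      using ev
    proof eventually_elim
      case (elim N)
      have rN: "r N > 1" "y N > 0" "real N > 0" using E(1)[OF elim] ypos[OF elim] elim unfolding r_def by auto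
      have "2 * ln (real N) + 3 * ln (y N) = ln ((real N)^2 * y N ^ 3)" using rN by (simp add: ln_mult_pos ln_realpow)
      also have "\<dots> = 3 * ln \<eta>" unfolding y3[OF elim] using \<eta> by (simp add: ln_realpow)
      finally have lN: "ln (real N) = 3 / 2 * (ln \<eta> - ln (y N))" by simp
      have l: "ln ((r N)^2 * y N) = 2 * ln (r N) + ln (y N)" using rN by (simp add: ln_mult_pos ln_realpow)
      show ?case unfolding l lN q gE2_def E(3)[OF elim] r_def[symmetric] wG2_def b_def[symmetric] B by (simp add: field_simps)
    qed
  qed
  moreover have "?L = ln (tau \<beta>) + (\<beta> + 1 / \<beta> - 3) / 8 * ln (2 * \<eta>)"
  proof -
    have l: "ln 4 = 2 * ln (2::real)" using ln_realpow[of 2 2] by simp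
    have l2: "ln (2 * pi * \<beta>) = ln (2 * pi) + ln \<beta>" "ln (2 * \<eta>) = ln 2 + ln \<eta>" using \<beta> \<eta> by (simp_all add: ln_mult_pos[of "2 * pi"] ln_mult_pos)
    have s: "\<beta> + 1 / \<beta> = B + 2" unfolding B_def by simp
    show ?thesis unfolding tau_def ln_exp l l2 s by (simp add: field_simps)
  qed
  ultimately show "(\<lambda>N. gE2 \<beta> (edge_m (y N)) + qE \<beta> * ln (real N)) \<longlonglongrightarrow> ln (tau \<beta>) + (\<beta> + 1 / \<beta> - 3) / 8 * ln (2 * \<eta>)" by (simp only:)
qed

section \<open>Monotonicity of the limit distribution and scaling of the next term\<close>

lemma partition_fn_nonneg: "partition_fn t \<beta> N a \<ge> 0"
  unfolding partition_fn_alt by (intro integral_nonneg_AE AE_I2 mult_nonneg_nonneg prod_nonneg vand_nonneg) auto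

lemma partition_fn_mono:
  assumes t: "t > 0" and \<beta>: "\<beta> > 0" and N: "N > 0" and a: "a \<le> b"
  shows "partition_fn t \<beta> N (ereal a) \<le> partition_fn t \<beta> N (ereal b)"
proof -
  define k where "k = real N * \<beta> / (2 * t)"
  have k: "k > 0" unfolding k_def using assms by simp
  have "rapid (\<lambda>x::real. exp (- k * x^2))"
  proof (rule rapid_exp_bound[of _ 1 "exp (1 / (4 * k))" 0])
    fix x :: real
    have "(sqrt k * \<bar>x\<bar> - 1 / (2 * sqrt k))^2 \<ge> 0" by simp
    also have "(sqrt k * \<bar>x\<bar> - 1 / (2 * sqrt k))^2 = k * x^2 - \<bar>x\<bar> + 1 / (4 * k)"
      using k by (simp add: power2_diff power_mult_distrib power_divide)
    finally have "- k * x^2 \<le> 1 / (4 * k) + - 1 * \<bar>x\<bar>" by simp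
    then show "\<bar>exp (- k * x^2)\<bar> \<le> exp (1 / (4 * k)) * (1 + \<bar>x\<bar>) ^ 0 * exp (- 1 * \<bar>x\<bar>)"
      by (simp add: exp_add[symmetric])
  qed (use k in auto)
  from rapid_prod_integrable[OF polyb_vand[of \<beta> 0 N] this] \<beta>
  have int: "integrable (Leb N) (\<lambda>x. vand \<beta> 0 N x * (\<Prod>i<N. exp (- k * (x i)^2)))" by simp
  have S: "(\<Pi>\<^sub>E i\<in>{..<N}. {y. ereal y \<le> ereal c}) \<in> sets (Leb N)" for c by (intro sets_PiM_I_finite) auto
  have i: "integrable (Leb N) (\<lambda>x. indicator (\<Pi>\<^sub>E i\<in>{..<N}. {y. ereal y \<le> ereal c}) x * vand \<beta> 0 N x * (\<Prod>i<N. exp (- k * (x i)^2)))" for c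
    using integrable_mult_indicator[OF S int, of c] by (simp add: mult.assoc)
  show ?thesis unfolding partition_fn_alt k_def[symmetric]
  proof (rule integral_mono[OF i i])
    fix x :: "nat \<Rightarrow> real"
    have "(\<Pi>\<^sub>E i\<in>{..<N}. {y. ereal y \<le> ereal a}) \<subseteq> (\<Pi>\<^sub>E i\<in>{..<N}. {y. ereal y \<le> ereal b})" using a by (intro PiE_mono) auto
    then have "indicator (\<Pi>\<^sub>E i\<in>{..<N}. {y. ereal y \<le> ereal a}) x \<le> (indicator (\<Pi>\<^sub>E i\<in>{..<N}. {y. ereal y \<le> ereal b}) x :: real)"
      by (auto simp: indicator_def)
    then show "indicator (\<Pi>\<^sub>E i\<in>{..<N}. {y. ereal y \<le> ereal a}) x * vand \<beta> 0 N x * (\<Prod>i<N. exp (- k * (x i)^2))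
      \<le> indicator (\<Pi>\<^sub>E i\<in>{..<N}. {y. ereal y \<le> ereal b}) x * vand \<beta> 0 N x * (\<Prod>i<N. exp (- k * (x i)^2))"
      using vand_nonneg by (intro mult_right_mono prod_nonneg) auto
  qed
qed

lemma limit_cdf_antimono:
  assumes t: "t > 0" and \<beta>: "\<beta> > 0"
    and P: "\<And>\<eta>. (\<lambda>N. max_eigenvalue_cdf t \<beta> N (edge_scaled t N \<eta>)) \<longlonglongrightarrow> P \<eta>"
  shows "P \<eta> \<ge> 0" "\<eta> \<le> \<eta>' \<Longrightarrow> P \<eta>' \<le> P \<eta>"
proof -
  show "P \<eta> \<ge> 0"
    by (rule LIMSEQ_le_const[OF P]) (auto simp: max_eigenvalue_cdf_def intro!: divide_nonneg_nonneg partition_fn_nonneg)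
  assume le: "\<eta> \<le> \<eta>'"
  have "max_eigenvalue_cdf t \<beta> N (edge_scaled t N \<eta>') \<le> max_eigenvalue_cdf t \<beta> N (edge_scaled t N \<eta>)" if "N \<ge> 1" for N
  proof -
    have "edge_scaled t N \<eta>' \<le> edge_scaled t N \<eta>"
      unfolding edge_scaled_def using t le by (intro mult_left_mono diff_left_mono) auto
    then show ?thesis unfolding max_eigenvalue_cdf_def
      using t \<beta> that by (intro divide_right_mono partition_fn_mono partition_fn_nonneg) auto
  qed
  then show "P \<eta>' \<le> P \<eta>" by (intro LIMSEQ_le[OF P P]) auto
qed

text \<open>Along \<open>N = k M\<close> the point \<open>k powr (2 / 3) * \<eta>\<close> has the same spectral edge as \<open>\<eta>\<close> along \<open>M\<close>.\<close>

lemma edge_term_3_scaling: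
  assumes T: "\<And>\<eta>. \<eta> > 0 \<Longrightarrow> (\<lambda>N. expansion_term F t \<beta> 3 N (edge_scaled t N \<eta>) + real N powi (2 - int 3) * (p + q * ln (real N))) \<longlonglongrightarrow> T3 \<eta>"
    and \<eta>: "\<eta> > 0" and k: "k > 0"
  shows "T3 (real k powr (2 / 3) * \<eta>) = T3 \<eta> / real k"
proof -
  let ?S = "\<lambda>N \<eta>. expansion_term F t \<beta> 3 N (edge_scaled t N \<eta>) + real N powi (2 - int 3) * (p + q * ln (real N))"
  have S: "?S N \<eta> = (exp_coeff F t \<beta> 3 (edge_scaled t N \<eta>) + p + q * ln (real N)) / real N" for N \<eta>
    unfolding expansion_term_eq by (simp add: power_int_minus add_divide_distrib inverse_eq_divide algebra_simps)
  have kp: "real k powr (2 / 3) * \<eta> > 0" using k \<eta> by simp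
  have sm: "strict_mono (\<lambda>M. k * M)" using k by (simp add: strict_mono_def)
  have "(\<lambda>M. ?S (k * M) (real k powr (2 / 3) * \<eta>)) \<longlonglongrightarrow> T3 (real k powr (2 / 3) * \<eta>)"
    using LIMSEQ_subseq_LIMSEQ[OF T[OF kp] sm] by (simp add: o_def)
  moreover have "(\<lambda>M. ?S M \<eta> / real k + q * ln (real k) / real k * (1 / real M)) \<longlonglongrightarrow> T3 \<eta> / real k + q * ln (real k) / real k * 0"
    using k by (intro tendsto_add tendsto_divide tendsto_mult tendsto_const T[OF \<eta>]) (auto, real_asymp)
  then have "(\<lambda>M. ?S (k * M) (real k powr (2 / 3) * \<eta>)) \<longlonglongrightarrow> T3 \<eta> / real k + q * ln (real k) / real k * 0"
  proof (rule Lim_transform_eventually)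
    show "\<forall>\<^sub>F M in sequentially. ?S M \<eta> / real k + q * ln (real k) / real k * (1 / real M) = ?S (k * M) (real k powr (2 / 3) * \<eta>)"
      using eventually_gt_at_top[of 0]
    proof eventually_elim
      case (elim M)
      have "real (k * M) powr (- 2 / 3) * (real k powr (2 / 3) * \<eta>) = (real k powr (- 2 / 3) * real k powr (2 / 3)) * real M powr (- 2 / 3) * \<eta>"
        by (simp add: powr_mult)
      also have "real k powr (- 2 / 3) * real k powr (2 / 3) = 1" using k by (simp add: powr_add[symmetric])
      finally have e: "edge_scaled t (k * M) (real k powr (2 / 3) * \<eta>) = edge_scaled t M \<eta>" unfolding edge_scaled_def by simp
      have l: "ln (real (k * M)) = ln (real k) + ln (real M)" using k elim by (simp add: ln_mult)
      show ?case unfolding S unfolding e l using k elim by (simp add: field_simps)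
    qed
  qed
  ultimately show ?thesis using LIMSEQ_unique by fastforce
qed

theorem mainTheorem3:
  fixes t \<beta> :: real
    and D :: "nat \<Rightarrow> real \<Rightarrow> real"
    and F :: "nat \<Rightarrow> nat \<Rightarrow> real \<Rightarrow> real \<Rightarrow> real"
  assumes "t > 0" and "\<beta> > 0"
    and "has_one_over_N_expansion D F"
    and "double_scaling_limit D F t \<beta>"
  shows "(\<exists>P :: real \<Rightarrow> real.
           (\<forall>\<eta>. (\<lambda>N. max_eigenvalue_cdf t \<beta> N (edge_scaled t N \<eta>)) \<longlonglongrightarrow> P \<eta>) \<and>
           (\<exists>R \<in> O[at_top](\<lambda>\<eta>. \<bar>- 2 * \<eta>\<bar> powr (- 3 / 2)).
              \<forall>\<^sub>F \<eta> in at_top. let \<xi> = - 2 * \<eta> in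
                P \<eta> = tau \<beta> * exp (- (\<beta> * \<bar>\<xi>\<bar> ^ 3 / 12)
                  + sqrt 2 * (\<beta> - 1) / 3 * \<bar>\<xi>\<bar> powr (3 / 2)
                  + (\<beta> + 1 / \<beta> - 3) / 8 * ln \<bar>\<xi>\<bar> + R \<eta>)))
         \<and> set_integrable lborel {0<..} (kappa_integrand \<beta>)
         \<and> has_finite_part (\<lambda>N. \<Sum>j=1..N. ln (Gamma (1 + real j * \<beta>))) (kappa \<beta>)"
proof -
  note t = assms(1) and \<beta> = assms(2)
  obtain p q P T where
    D: "asymp_expansion sequentially (\<lambda>N. D N \<beta> - ln (partition_fn t \<beta> N \<infinity>))
          (\<lambda>n N. real N powi (2 - int n) * (p n + q n * ln (real N))) (\<lambda>n N. real N powi (2 - int n))"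
    and T: "\<And>\<eta> n. \<eta> > 0 \<Longrightarrow> (\<lambda>N. expansion_term F t \<beta> n N (edge_scaled t N \<eta>) + real N powi (2 - int n) * (p n + q n * ln (real N))) \<longlonglongrightarrow> T n \<eta>"
    and P: "\<And>\<eta>. (\<lambda>N. max_eigenvalue_cdf t \<beta> N (edge_scaled t N \<eta>)) \<longlonglongrightarrow> P \<eta>"
    and A: "asymp_expansion at_top (\<lambda>\<eta>. ln (P \<eta>)) T (\<lambda>n \<eta>. \<eta> powr (3 * (2 - real n) / 2))"
    using assms(4) unfolding double_scaling_limit_def by blast
  define E where "E \<eta> = - (2 / 3 * \<beta> * \<eta> ^ 3) + 4 / 3 * (\<beta> - 1) * \<eta> powr (3 / 2) + (ln (tau \<beta>) + (\<beta> + 1 / \<beta> - 3) / 8 * ln (2 * \<eta>))" for \<eta>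
  have T012: "T 0 \<eta> = - (2 / 3 * \<beta> * \<eta> ^ 3)" "T 0 \<eta> + T 1 \<eta> + T 2 \<eta> = E \<eta>" if \<eta>: "\<eta> > 0" for \<eta>
  proof -
    let ?y = "\<lambda>N. real N powr (- 2 / 3) * \<eta>"
    \<comment> \<open>The identities of \<open>expansion_coeffs\<close> hold at every single cut-off
      below the edge, hence may be used at a cut-off that varies with N.\<close>
    have c: "exp_coeff F t \<beta> 0 (edge_scaled t N \<eta>) + p 0 = gE0 \<beta> (edge_m (?y N))" "q 0 = 0"
      "exp_coeff F t \<beta> 1 (edge_scaled t N \<eta>) + p 1 = gE1 \<beta> (edge_m (?y N))" "q 1 = 0"
      "exp_coeff F t \<beta> 2 (edge_scaled t N \<eta>) + p 2 = gE2 \<beta> (edge_m (?y N))" "q 2 = qE \<beta>" if N: "N > 0" for N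
    proof -
      have y: "?y N > 0" using \<eta> N by simp
      have a: "edge_scaled t N \<eta> = sqrt t * (3 * cu (edge_m (?y N)) - 1 / cu (edge_m (?y N)))"
        unfolding edge_r(5)[OF y] edge_scaled_def by simp
      have lt: "edge_scaled t N \<eta> < 2 * sqrt t" unfolding edge_scaled_def using y t by simp
      note C = expansion_coeffs[OF t \<beta> assms(3) edge_r(2)[OF y] D a lt]
      show "exp_coeff F t \<beta> 0 (edge_scaled t N \<eta>) + p 0 = gE0 \<beta> (edge_m (?y N))" "q 0 = 0"
        "exp_coeff F t \<beta> 1 (edge_scaled t N \<eta>) + p 1 = gE1 \<beta> (edge_m (?y N))" "q 1 = 0"
        "exp_coeff F t \<beta> 2 (edge_scaled t N \<eta>) + p 2 = gE2 \<beta> (edge_m (?y N))" "q 2 = qE \<beta>" by (rule C)+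
    qed
    have q: "q 0 = 0" "q 1 = 0" "q 2 = qE \<beta>" using c[of 1] by auto
    note el = edge_limits[OF \<eta> \<beta>]
    have ev: "\<forall>\<^sub>F N in sequentially. N > (0::nat)" by (rule eventually_gt_at_top)
    have s: "expansion_term F t \<beta> n N a + real N powi (2 - int n) * (p n + q n * ln (real N))
       = real N powi (2 - int n) * (exp_coeff F t \<beta> n a + p n + q n * ln (real N))" for n N a
      unfolding expansion_term_eq by (simp add: algebra_simps)
    show 0: "T 0 \<eta> = - (2 / 3 * \<beta> * \<eta> ^ 3)"
    proof (rule LIMSEQ_unique[OF T[OF \<eta>]], rule Lim_transform_eventually[OF el(1)])
      show "\<forall>\<^sub>F N in sequentially. (real N)\<^sup>2 * gE0 \<beta> (edge_m (?y N)) = expansion_term F t \<beta> 0 N (edge_scaled t N \<eta>) + real N powi (2 - int 0) * (p 0 + q 0 * ln (real N))"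
        using ev by eventually_elim (subst s, subst c(1), assumption, simp add: q)
    qed
    have 1: "T 1 \<eta> = 4 / 3 * (\<beta> - 1) * \<eta> powr (3 / 2)"
    proof (rule LIMSEQ_unique[OF T[OF \<eta>]], rule Lim_transform_eventually[OF el(2)])
      show "\<forall>\<^sub>F N in sequentially. real N * gE1 \<beta> (edge_m (?y N)) = expansion_term F t \<beta> 1 N (edge_scaled t N \<eta>) + real N powi (2 - int 1) * (p 1 + q 1 * ln (real N))"
        using ev by eventually_elim (subst s, subst c(3), assumption, simp add: q[unfolded One_nat_def])
    qed
    have 2: "T 2 \<eta> = ln (tau \<beta>) + (\<beta> + 1 / \<beta> - 3) / 8 * ln (2 * \<eta>)"
    proof (rule LIMSEQ_unique[OF T[OF \<eta>]], rule Lim_transform_eventually[OF el(3)])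
      show "\<forall>\<^sub>F N in sequentially. gE2 \<beta> (edge_m (?y N)) + qE \<beta> * ln (real N) = expansion_term F t \<beta> 2 N (edge_scaled t N \<eta>) + real N powi (2 - int 2) * (p 2 + q 2 * ln (real N))"
        using ev by eventually_elim (subst s, subst c(5), assumption, simp add: q)
    qed
    show "T 0 \<eta> + T 1 \<eta> + T 2 \<eta> = E \<eta>" unfolding 0 1 2 E_def ..
  qed
  have P_mono: "\<And>\<eta>. P \<eta> \<ge> 0" "\<And>\<eta> \<eta>'. \<eta> \<le> \<eta>' \<Longrightarrow> P \<eta>' \<le> P \<eta>" using limit_cdf_antimono[OF t \<beta> P] by auto
  have "(\<lambda>\<eta>. ln (P \<eta>) - (\<Sum>n\<le>0. T n \<eta>)) \<in> o[at_top](\<lambda>\<eta>. \<eta> powr (3 * (2 - real 0) / 2))"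
    using A unfolding asymp_expansion_def by blast
  \<comment> \<open>With half of the leading coefficient 2 \<beta> / 3 as tolerance, ln (P \<eta>)
    is negative for large \<eta>. As \<open>ln 0 = 0\<close>, this excludes the value P \<eta> =
    0.\<close>
  from landau_o.smallD[OF this, of "\<beta> / 3"] \<beta>
  have "\<forall>\<^sub>F \<eta> in at_top. \<bar>ln (P \<eta>) - T 0 \<eta>\<bar> \<le> \<beta> / 3 * \<eta> powr 3" by simp
  then have Ppos: "\<forall>\<^sub>F \<eta> in at_top. P \<eta> > 0" using eventually_gt_at_top[of 0]
  proof eventually_elim
    case (elim \<eta>)
    then have "\<bar>ln (P \<eta>) + 2 / 3 * \<beta> * \<eta> ^ 3\<bar> \<le> \<beta> / 3 * \<eta> ^ 3" by (simp add: T012 powr_numeral)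
    moreover have "\<beta> * \<eta> ^ 3 > 0" using \<beta> elim by simp
    ultimately have "ln (P \<eta>) < 0" by (simp add: field_simps abs_le_iff)
    then have "P \<eta> \<noteq> 0" by auto
    then show ?case using P_mono(1)[of \<eta>] by simp
  qed
  have "(\<lambda>\<eta>. ln (P \<eta>) - (\<Sum>n\<le>3. T n \<eta>)) \<in> o[at_top](\<lambda>\<eta>. \<eta> powr (3 * (2 - real 3) / 2))"
    using A unfolding asymp_expansion_def by blast
  from landau_o.smallD[OF this, of 1]
  have "\<forall>\<^sub>F \<eta> in at_top. \<bar>ln (P \<eta>) - (T 0 \<eta> + T 1 \<eta> + T 2 \<eta> + T 3 \<eta>)\<bar> \<le> \<eta> powr (- 3 / 2)" by (simp add: numeral_3_eq_3 numeral_2_eq_2)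
  then have "\<forall>\<^sub>F \<eta> in at_top. \<bar>ln (P \<eta>) - E \<eta> - T 3 \<eta>\<bar> \<le> \<eta> powr (- 3 / 2)" using eventually_gt_at_top[of 0]
  proof eventually_elim
    case (elim \<eta>) then show ?case using T012(2)[of \<eta>] by (simp add: algebra_simps)
  qed
  from eventually_conj[OF Ppos this] obtain h0 where h0: "\<And>\<eta>. \<eta> \<ge> h0 \<Longrightarrow> P \<eta> > 0 \<and> \<bar>ln (P \<eta>) - E \<eta> - T 3 \<eta>\<bar> \<le> \<eta> powr (- 3 / 2)"
    unfolding eventually_at_top_linorder by blast
  define h where "h = max h0 1"
  have h: "h \<ge> 1" "h \<ge> h0" unfolding h_def by auto
  have Pp: "P \<eta> > 0" "\<bar>ln (P \<eta>) - E \<eta> - T 3 \<eta>\<bar> \<le> \<eta> powr (- 3 / 2)" if "\<eta> \<ge> h" for \<eta> using h0[of \<eta>] h that by auto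
  \<comment> \<open>Nothing is known about the regularity of \<open>T 3\<close>, but monotonicity of \<open>P\<close> bounds it on a compact interval,
    and the scaling of \<open>T 3\<close> transports this bound to infinity.\<close>
  obtain K where K: "\<And>\<eta>. \<eta> \<in> {h..2 * h} \<Longrightarrow> \<bar>T 3 \<eta>\<bar> \<le> K"
  proof -
    have "continuous_on {h..2 * h} E" unfolding E_def[abs_def] using h by (intro continuous_intros) auto
    then have "bounded (E ` {h..2 * h})" by (intro compact_imp_bounded compact_continuous_image) auto
    then obtain B where B: "\<And>\<eta>. \<eta> \<in> {h..2 * h} \<Longrightarrow> \<bar>E \<eta>\<bar> \<le> B" unfolding bounded_iff real_norm_def by blast
    show thesis
    proof (rule that[of "\<bar>ln (P h)\<bar> + \<bar>ln (P (2 * h))\<bar> + B + 1"])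
      fix \<eta> assume \<eta>: "\<eta> \<in> {h..2 * h}"
      have "ln (P (2 * h)) \<le> ln (P \<eta>)" "ln (P \<eta>) \<le> ln (P h)"
        using \<eta> Pp(1) P_mono(2) h by (auto intro!: ln_mono)
      moreover have "\<eta> powr (- 3 / 2) \<le> 1 powr (- 3 / 2)" using \<eta> h by (intro powr_mono2') auto
      ultimately show "\<bar>T 3 \<eta>\<bar> \<le> \<bar>ln (P h)\<bar> + \<bar>ln (P (2 * h))\<bar> + B + 1"
        using Pp(2)[of \<eta>] B[OF \<eta>] \<eta> by simp
    qed
  qed
  have K0: "K \<ge> 0" using K[of h] h by auto
  have T3: "\<bar>T 3 \<eta>\<bar> \<le> 2 * K * h powr (3 / 2) * \<eta> powr (- 3 / 2)" if \<eta>: "\<eta> \<ge> 2 * h" for \<eta>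
  proof -
    \<comment> \<open>The integer k is the floor of s, so that 1 \<le> s / k < 2 and \<eta> /
      k^(2/3) = h (s / k)^(2/3) falls into [h, 2 h], where \<open>T 3\<close> is bounded by
      K.\<close>
    define s where "s = (\<eta> / h) powr (3 / 2)"
    define k where "k = nat \<lfloor>s\<rfloor>"
    have "\<eta> / h \<ge> 2" using \<eta> h by (simp add: le_divide_eq)
    then have "s \<ge> (\<eta> / h) powr 1" unfolding s_def by (intro powr_mono) auto
    moreover have "(\<eta> / h) powr 1 = \<eta> / h" using \<open>\<eta> / h \<ge> 2\<close> by (intro powr_one) simp
    ultimately have s2: "s \<ge> 2" using \<open>\<eta> / h \<ge> 2\<close> by linarith
    have k: "k > 0" "real k \<le> s" "s < 2 * real k" unfolding k_def using s2 by linarith+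
    define x where "x = (s / real k) powr (2 / 3)"
    have "s powr (2 / 3) = \<eta> / h"
    proof -
      have "(w powr (3 / 2)) powr (2 / 3) = w" if "w > 0" for w :: real using that by (simp add: powr_powr)
      then show ?thesis unfolding s_def using \<open>\<eta> / h \<ge> 2\<close> by simp
    qed
    then have "real k powr (2 / 3) * (h * x) = \<eta>" unfolding x_def using k s2 h by (simp add: powr_divide)
    moreover have "1 powr (2 / 3) \<le> x" unfolding x_def using k by (intro powr_mono2) auto
    then have x1: "1 \<le> x" by simp
    moreover have "x \<le> 2 powr (2 / 3)" unfolding x_def using k s2 by (intro powr_mono2) (auto simp: divide_le_eq)
    then have "x \<le> 2 powr 1" by (rule order_trans) (intro powr_mono, auto)
    then have x2: "x \<le> 2" by simp
    have hx: "h * x > 0" "h * x \<in> {h..2 * h}" using h x1 x2 by (auto simp: mult.commute[of 2])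
    ultimately have "T 3 \<eta> = T 3 (h * x) / real k"
      using edge_term_3_scaling[OF T hx(1) k(1)] by simp
    also have "\<bar>\<dots>\<bar> \<le> K / real k" unfolding abs_divide using K[OF hx(2)] by (simp add: divide_right_mono)
    also have "\<dots> \<le> K * (2 / s)" using k s2 K0 by (simp add: field_simps mult_left_mono)
    also have "2 / s = 2 * (h powr (3 / 2) * \<eta> powr (- 3 / 2))"
      unfolding s_def using h \<eta> by (simp add: powr_divide powr_minus_divide)
    finally show ?thesis by (simp add: mult_ac)
  qed
  define X where "X \<eta> = - (\<beta> * \<bar>- 2 * \<eta>\<bar> ^ 3 / 12) + sqrt 2 * (\<beta> - 1) / 3 * \<bar>- 2 * \<eta>\<bar> powr (3 / 2) + (\<beta> + 1 / \<beta> - 3) / 8 * ln \<bar>- 2 * \<eta>\<bar>" for \<eta>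
  define R where "R \<eta> = ln (P \<eta>) - ln (tau \<beta>) - X \<eta>" for \<eta>
  have E: "E \<eta> = ln (tau \<beta>) + X \<eta>" if \<eta>: "\<eta> > 0" for \<eta>
  proof -
    have "(2 * \<eta>) powr (3 / 2) = 2 powr (3 / 2) * \<eta> powr (3 / 2)" using \<eta> by (simp add: powr_mult)
    moreover have "(2::real) powr (3 / 2) = 2 * sqrt 2"
      using powr_add[of "2::real" 1 "1 / 2"] by (simp add: powr_half_sqrt)
    ultimately have "sqrt 2 * (\<beta> - 1) / 3 * (2 * \<eta>) powr (3 / 2) = 4 / 3 * (\<beta> - 1) * \<eta> powr (3 / 2)" by simp
    moreover have "\<bar>- 2 * \<eta>\<bar> = 2 * \<eta>" using \<eta> by simp
    ultimately show ?thesis unfolding E_def X_def by (simp add: power_mult_distrib)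
  qed
  have "R \<in> O[at_top](\<lambda>\<eta>. \<bar>- 2 * \<eta>\<bar> powr (- 3 / 2))"
  proof (rule bigoI[where c = "(1 + 2 * K * h powr (3 / 2)) * 2 powr (3 / 2)"])
    show "\<forall>\<^sub>F \<eta> in at_top. norm (R \<eta>) \<le> (1 + 2 * K * h powr (3 / 2)) * 2 powr (3 / 2) * norm (\<bar>- 2 * \<eta>\<bar> powr (- 3 / 2))"
      using eventually_ge_at_top[of "2 * h"]
    proof eventually_elim
      case (elim \<eta>)
      have \<eta>: "\<eta> > 0" "\<eta> \<ge> h" using elim h by auto
      have "\<bar>R \<eta>\<bar> \<le> \<eta> powr (- 3 / 2) + 2 * K * h powr (3 / 2) * \<eta> powr (- 3 / 2)"
        using Pp(2)[OF \<eta>(2)] T3[OF elim] E[OF \<eta>(1)] unfolding R_def by linarith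
      also have "\<dots> = (1 + 2 * K * h powr (3 / 2)) * \<eta> powr (- 3 / 2)" by (simp add: distrib_right)
      also have "\<eta> powr (- 3 / 2) = 2 powr (3 / 2) * \<bar>- 2 * \<eta>\<bar> powr (- 3 / 2)"
        using \<eta> by (simp add: powr_mult powr_minus)
      finally show ?case by (simp add: mult_ac)
    qed
  qed
  moreover have "\<forall>\<^sub>F \<eta> in at_top. P \<eta> = tau \<beta> * exp (X \<eta> + R \<eta>)"
    using Ppos
  proof eventually_elim
    case (elim \<eta>)
    have "tau \<beta> > 0" unfolding tau_def by simp
    then have "tau \<beta> * exp (X \<eta> + R \<eta>) = exp (ln (tau \<beta>) + (X \<eta> + R \<eta>))" by (simp add: exp_add)
    also have "\<dots> = P \<eta>" unfolding R_def using elim by simp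
    finally show ?case by simp
  qed
  ultimately have "\<exists>R \<in> O[at_top](\<lambda>\<eta>. \<bar>- 2 * \<eta>\<bar> powr (- 3 / 2)).
      \<forall>\<^sub>F \<eta> in at_top. let \<xi> = - 2 * \<eta> in
        P \<eta> = tau \<beta> * exp (- (\<beta> * \<bar>\<xi>\<bar> ^ 3 / 12) + sqrt 2 * (\<beta> - 1) / 3 * \<bar>\<xi>\<bar> powr (3 / 2)
          + (\<beta> + 1 / \<beta> - 3) / 8 * ln \<bar>\<xi>\<bar> + R \<eta>)"
    unfolding X_def Let_def by blast
  with P kappa_integrable(1)[OF \<beta>] has_finite_part_kappa[OF \<beta>] show ?thesis by blast
qed

end
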